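(* Let $a\ge0$, $\sigma\ge1$, $\alpha>\frac12$, $\beta>\frac12$, let $s\in[-1,0]$ satisfy $$s>\max\Big\{1-2\alpha,\ \tfrac{\alpha(1-2\beta)}{\beta},\ \tfrac{\beta(1-2\alpha)}{\alpha}\Big\},$$ and let $(u_0,\theta_0)\in\mathcal{X}_{a,\sigma}^s(\mathbb{R}^3)$ with $\operatorname{div}u_0=0$. Let $(u,\theta)\in C([0,T^* ),\mathcal{X}_{a,\sigma}^s(\mathbb{R}^3))$ be the maximal (mild) solution of the fractional Boussinesq equations with initial data $(u_0,\theta_0)$. If $T^*<\infty$, then there is a constant $C>0$ such that, for all $t\in[0,T^* )$: (i) $\displaystyle\limsup_{t\nearrow T^*}\|(u,\theta)(t)\|_{\mathcal{X}_{a,\sigma}^s}=\infty$; (ii) $\displaystyle\int_t^{T^*}\Big[\|u(\tau)\|_{\mathcal{X}_{a,\sigma}^{s}}^{\frac{2\alpha}{2\alpha+s-1}}+\|u(\tau)\|_{\mathcal{X}_{a,\sigma}^{s}}^{\frac{\beta(s+2\alpha)}{\beta(s+2\alpha)-\alpha}}\|\theta(\tau)\|_{\mathcal{X}_{a,\sigma}^{s}}^{\frac{-s\beta}{\beta(s+2\alpha)-\alpha}}+\|u(\tau)\|_{\mathcal{X}_{a,\sigma}^{s}}^{\frac{-s\alpha}{\alpha(s+2\beta)-\beta}}\|\theta(\tau)\|_{\mathcal{X}_{a,\sigma}^{s}}^{\frac{\alpha(s+2\beta)}{\alpha(s+2\beta)-\beta}}\Big]\,d\tau=\infty$; (iii)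 $\displaystyle\|(u,\theta)(t)\|_{\mathcal{X}_{a,\sigma}^{s}}^{\frac{2\alpha}{2\alpha+s-1}}+\|(u,\theta)(t)\|_{\mathcal{X}_{a,\sigma}^{s}}^{\frac{2\alpha\beta}{2\alpha\beta+s\beta-\alpha}}+\|(u,\theta)(t)\|_{\mathcal{X}_{a,\sigma}^{s}}^{\frac{2\alpha\beta}{2\alpha\beta+s\alpha-\beta}}\ge\big[e^{C(T^*-t)}-1\big]^{-1}$.
   Context: Equations. The fractional Boussinesq equations on $\mathbb{R}^3$ are $$u_t+(-\Delta)^\alpha u+u\cdot\nabla u+\nabla p=\theta e_3,\quad \theta_t+(-\Delta)^\beta\theta+u\cdot\nabla\theta=0,\quad \operatorname{div}u=0\quad (x\in\mathbb{R}^3,\ t>0),$$ with $u(x,0)=u_0(x)$, $\theta(x,0)=\theta_0(x)$, where $u(x,t)\in\mathbb{R}^3$, $p(x,t),\theta(x,t)\in\mathbb{R}$, $e_3=(0,0,1)$, and $\operatorname{div}u_0=0$. The Fourier transform is $\widehat f(\xi)=\int_{\mathbb{R}^3}e^{-i\xi\cdot x}f(x)\,dx$, and $\mathcal{F}[(-\Delta)^\gamma f](\xi)=|\xi|^{2\gamma}\widehat f(\xi)$. Spaces. For $a\ge0$, $\sigma\ge1$, $s\in\mathbb{R}$, $$\mathcal{X}_{a,\sigma}^s(\mathbb{R}^3)=\Big\{f\in S'(\mathbb{R}^3):\widehat f\in L^1_{\mathrm{loc}}(\mathbb{R}^3),\ \|f\|_{\mathcal{X}_{a,\sigma}^s}:=\int_{\mathbb{R}^3}|\xi|^s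 e^{a|\xi|^{1/\sigma}}|\widehat f(\xi)|\,d\xi<\infty\Big\},$$ with $S'$ the tempered distributions; for vector-valued $f$, $|\widehat f(\xi)|$ is the Euclidean norm. For a pair, $(f,g)\in\mathcal{X}_{a,\sigma}^s$ means that both entries belong to the space, and $\|(f,g)\|_{\mathcal{X}_{a,\sigma}^s}=\|f\|_{\mathcal{X}_{a,\sigma}^s}+\|g\|_{\mathcal{X}_{a,\sigma}^s}$. Powers with exponent $0$ (which occur when $s=0$) are read as $1$. Mild solutions. With $\mathbb{P}$ the Leray projector onto divergence-free fields and $e^{-t(-\Delta)^\gamma}$ the Fourier multiplier $e^{-t|\xi|^{2\gamma}}$, $(u,\theta)$ satisfies $\operatorname{div}u=0$ and $$u(t)=e^{-t(-\Delta)^\alpha}u_0-\int_0^t e^{-(t-\tau)(-\Delta)^\alpha}\mathbb{P}(u\cdot\nabla u)\,d\tau+\int_0^t e^{-(t-\tau)(-\Delta)^\alpha}\mathbb{P}(\theta e_3)\,d\tau,$$ $$\theta(t)=e^{-t(-\Delta)^\beta}\theta_0-\int_0^t e^{-(t-\tau)(-\Delta)^\beta}(u\cdot\nabla\theta)\,d\tau .$$ Maximal solution. Under the stated hypotheses, local existence and uniqueness give, for some $T>0$, a mild solution with $u\in C([0,T];\mathcal{X}_{a,\sigma}^s)\cap L^1([0,T];\mathcal{X}_{a,\sigma}^{s+2\alpha})$ and $\theta\in C([0,T];\mathcal{X}_{a,\sigma}^s)\cap L^1([0,T];\mathcal{X}_{a,\sigma}^{s+2\beta})$. The maximal solution is the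 extension of this solution to the maximal interval $[0,T^* )$, $0<T^*\le\infty$: it is a mild solution with $u\in C([0,T];\mathcal{X}_{a,\sigma}^s)\cap L^1([0,T];\mathcal{X}_{a,\sigma}^{s+2\alpha})$ and $\theta\in C([0,T];\mathcal{X}_{a,\sigma}^s)\cap L^1([0,T];\mathcal{X}_{a,\sigma}^{s+2\beta})$ for every $T<T^*$, and it cannot be extended to such a solution on a larger time interval. *)

theory Defs
  imports "HOL-Analysis.Analysis"
begin

text \<open>Test functions. A multi-index derivative is written as an iterated partial derivative along
  a list of coordinate directions.\<close>

type_synonym test_fun = "real^3 \<Rightarrow> complex"

definition pd :: "3 \<Rightarrow> test_fun \<Rightarrow> test_fun" where
  "pd j \<phi> = (\<lambda>x. frechet_derivative \<phi> (at x) (axis j 1))"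

definition pds :: "3 list \<Rightarrow> test_fun \<Rightarrow> test_fun" where
  "pds js \<phi> = foldr pd js \<phi>"

definition schwartz :: "test_fun set" where
  "schwartz = {\<phi>. \<forall>js. (\<forall>x. pds js \<phi> differentiable (at x)) \<and>
                   (\<forall>k::nat. bounded (range (\<lambda>x. norm x ^ k *\<^sub>R pds js \<phi> x)))}"

definition schwartz_norm :: "nat \<Rightarrow> test_fun \<Rightarrow> real" where
  "schwartz_norm N \<phi> =
     (\<Sum>k\<le>N. \<Sum>js\<in>{js. length js \<le> N}. SUP x. norm x ^ k * norm (pds js \<phi> x))"

definition fourier :: "test_fun \<Rightarrow> test_fun" where
  "fourier \<phi> = (\<lambda>\<xi>. \<integral>x. exp (- \<i> * of_real (\<xi> \<bullet> x)) * \<phi> x \<partial>lborel)"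

definition inv_fourier :: "test_fun \<Rightarrow> test_fun" where
  "inv_fourier \<phi> =
     (\<lambda>x. of_real (1 / (2 * pi) ^ 3) * (\<integral>\<xi>. exp (\<i> * of_real (\<xi> \<bullet> x)) * \<phi> \<xi> \<partial>lborel))"

text \<open>A tempered distribution is a continuous linear functional on the Schwartz space. Functionals
  are total functions here and are normalised to vanish off the Schwartz space, so that equality of
  tempered distributions is equality in HOL.\<close>

type_synonym distr = "test_fun \<Rightarrow> complex"

definition tempered :: "distr \<Rightarrow> bool" where
  "tempered T \<longleftrightarrow>
     (\<forall>\<phi>. \<phi> \<notin> schwartz \<longrightarrow> T \<phi> = 0) \<and>
     (\<forall>\<phi>\<in>schwartz. \<forall>\<psi>\<in>schwartz. \<forall>b c. T (\<lambda>x. b * \<phi> x + c * \<psi> x) = b * T \<phi> + c * T \<psi>) \<and>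
     (\<exists>C N. \<forall>\<phi>\<in>schwartz. norm (T \<phi>) \<le> C * schwartz_norm N \<phi>)"

text \<open>Real-valued distributions.\<close>

definition real_distr :: "distr \<Rightarrow> bool" where
  "real_distr T \<longleftrightarrow> (\<forall>\<phi>\<in>schwartz. T (\<lambda>x. cnj (\<phi> x)) = cnj (T \<phi>))"

definition locally_integrable :: "test_fun \<Rightarrow> bool" where
  "locally_integrable g \<longleftrightarrow> (\<forall>K. compact K \<longrightarrow> set_integrable lborel K g)"

definition regular :: "test_fun \<Rightarrow> distr" where
  "regular g = (\<lambda>\<phi>. if \<phi> \<in> schwartz then \<integral>x. g x * \<phi> x \<partial>lborel else 0)"

definition represents :: "test_fun \<Rightarrow> distr \<Rightarrow> bool" where
  "represents g T \<longleftrightarrow> locally_integrable g \<and>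
     (\<forall>\<phi>\<in>schwartz. integrable lborel (\<lambda>x. g x * \<phi> x) \<and> T \<phi> = (\<integral>x. g x * \<phi> x \<partial>lborel))"

text \<open>The locally integrable function underlying a regular distribution, unique up to null sets;
  meaningful only if such a function exists.\<close>

definition fun_of :: "distr \<Rightarrow> test_fun" where
  "fun_of T = (SOME g. represents g T)"

definition fourier_distr :: "distr \<Rightarrow> distr" where
  "fourier_distr T = (\<lambda>\<phi>. if \<phi> \<in> schwartz then T (fourier \<phi>) else 0)"

definition inv_fourier_distr :: "distr \<Rightarrow> distr" where
  "inv_fourier_distr T = (\<lambda>\<phi>. if \<phi> \<in> schwartz then T (inv_fourier \<phi>) else 0)"

definition hat :: "distr \<Rightarrow> test_fun" where
  "hat f = fun_of (fourier_distr f)"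

definition hat_vec :: "distr^3 \<Rightarrow> real^3 \<Rightarrow> complex^3" where
  "hat_vec f = (\<lambda>\<xi>. \<chi> i. hat (f $ i) \<xi>)"

text \<open>Real powers with the convention that exponent 0 gives 1 (\<open>0 powr 0 = 0\<close> in the library).\<close>

definition rpow :: "real \<Rightarrow> real \<Rightarrow> real" where
  "rpow x y = (if y = 0 then 1 else x powr y)"

definition weighted_L1 ::
  "real \<Rightarrow> real \<Rightarrow> real \<Rightarrow> (real^3 \<Rightarrow> 'b::real_normed_vector) \<Rightarrow> ennreal" where
  "weighted_L1 a \<sigma> s F =
     (\<integral>\<^sup>+\<xi>. ennreal (rpow (norm \<xi>) s * exp (a * norm \<xi> powr (1 / \<sigma>)) * norm (F \<xi>)) \<partial>lborel)"

definition X_space :: "real \<Rightarrow> real \<Rightarrow> real \<Rightarrow> distr set" where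
  "X_space a \<sigma> s = {f. tempered f \<and> (\<exists>g. represents g (fourier_distr f)) \<and>
                       weighted_L1 a \<sigma> s (hat f) < \<infinity>}"

definition X_norm :: "real \<Rightarrow> real \<Rightarrow> real \<Rightarrow> distr \<Rightarrow> real" where
  "X_norm a \<sigma> s f = enn2real (weighted_L1 a \<sigma> s (hat f))"

definition X_space_vec :: "real \<Rightarrow> real \<Rightarrow> real \<Rightarrow> (distr^3) set" where
  "X_space_vec a \<sigma> s = {f. (\<forall>i. tempered (f $ i) \<and> (\<exists>g. represents g (fourier_distr (f $ i)))) \<and>
                           weighted_L1 a \<sigma> s (hat_vec f) < \<infinity>}"

definition X_norm_vec :: "real \<Rightarrow> real \<Rightarrow> real \<Rightarrow> distr^3 \<Rightarrow> real" where
  "X_norm_vec a \<sigma> s f = enn2real (weighted_L1 a \<sigma> s (hat_vec f))"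

text \<open>\<open>C(I; V)\<close> and the Bochner space \<open>L\<^sup>1(I; V)\<close> for a space \<open>V\<close> with norm \<open>N\<close>. Membership in
  the latter is strong measurability (a.e. limit of simple functions) and integrability of the
  norm.\<close>

definition C_into :: "'v::minus set \<Rightarrow> ('v \<Rightarrow> real) \<Rightarrow> real set \<Rightarrow> (real \<Rightarrow> 'v) \<Rightarrow> bool" where
  "C_into V N I f \<longleftrightarrow> (\<forall>t\<in>I. f t \<in> V) \<and>
     (\<forall>t\<in>I. ((\<lambda>r. N (f r - f t)) \<longlongrightarrow> 0) (at t within I))"

definition L1_into :: "'v::minus set \<Rightarrow> ('v \<Rightarrow> real) \<Rightarrow> real set \<Rightarrow> (real \<Rightarrow> 'v) \<Rightarrow> bool" where
  "L1_into V N I f \<longleftrightarrow>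
     (AE t in lebesgue. t \<in> I \<longrightarrow> f t \<in> V) \<and>
     (\<exists>g. (\<forall>n. simple_function lebesgue (g n) \<and> (\<forall>t. g n t \<in> V)) \<and>
          (AE t in lebesgue. t \<in> I \<longrightarrow> (\<lambda>n. N (g n t - f t)) \<longlonglongrightarrow> 0)) \<and>
     set_integrable lebesgue I (\<lambda>t. N (f t))"

definition distr_pd :: "3 \<Rightarrow> distr \<Rightarrow> distr" where
  "distr_pd j T = (\<lambda>\<phi>. if \<phi> \<in> schwartz then - T (pd j \<phi>) else 0)"

definition divergence :: "distr^3 \<Rightarrow> distr" where
  "divergence v = (\<lambda>\<phi>. \<Sum>j\<in>UNIV. distr_pd j (v $ j) \<phi>)"

definition distr_mult :: "distr \<Rightarrow> distr \<Rightarrow> distr" where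
  "distr_mult f g = regular (\<lambda>x. fun_of f x * fun_of g x)"

text \<open>The transport term \<open>v \<cdot> \<nabla>f\<close> of a divergence-free \<open>v\<close>, read in the sense of distributions as
  \<open>div (f v)\<close>. The products are pointwise: at almost every time the solutions below lie in
  \<open>\<X>\<^sup>0\<close>, hence are bounded functions, whereas \<open>\<nabla>\<theta>\<close> need not be a function if \<open>\<beta> < \<alpha>\<close>.\<close>

definition advect :: "distr^3 \<Rightarrow> distr \<Rightarrow> distr" where
  "advect v f = divergence (\<chi> j. distr_mult (v $ j) f)"

definition advect_vec :: "distr^3 \<Rightarrow> distr^3 \<Rightarrow> distr^3" where
  "advect_vec v w = (\<chi> i. advect v (w $ i))"

definition multiplier :: "(real^3 \<Rightarrow> real) \<Rightarrow> distr \<Rightarrow> distr" where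
  "multiplier m f = inv_fourier_distr (regular (\<lambda>\<xi>. of_real (m \<xi>) * hat f \<xi>))"

definition heat :: "real \<Rightarrow> real \<Rightarrow> distr \<Rightarrow> distr" where
  "heat \<gamma> t = multiplier (\<lambda>\<xi>. exp (- t * norm \<xi> powr (2 * \<gamma>)))"

definition leray :: "distr^3 \<Rightarrow> distr^3" where
  "leray f = (\<chi> i. (\<lambda>\<phi>. \<Sum>j\<in>UNIV.
     multiplier (\<lambda>\<xi>. (if i = j then 1 else 0) - \<xi> $ i * \<xi> $ j / (norm \<xi>)\<^sup>2) (f $ j) \<phi>))"

definition buoyancy :: "distr \<Rightarrow> distr^3" where
  "buoyancy \<theta> = (\<chi> i. if i = 3 then \<theta> else (\<lambda>_. 0))"

text \<open>\<open>S(t) = \<integral>\<^sub>0\<^sup>t F(\<tau>) d\<tau>\<close> for distribution-valued \<open>F\<close>, taken weakly, i.e. after pairing with each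
  test function.\<close>

definition has_time_integral :: "(real \<Rightarrow> distr) \<Rightarrow> distr \<Rightarrow> real \<Rightarrow> bool" where
  "has_time_integral F S t \<longleftrightarrow> (\<forall>\<phi>\<in>schwartz.
     set_integrable lebesgue {0..t} (\<lambda>\<tau>. F \<tau> \<phi>) \<and>
     S \<phi> = set_lebesgue_integral lebesgue {0..t} (\<lambda>\<tau>. F \<tau> \<phi>))"

definition duhamel_u ::
  "real \<Rightarrow> distr^3 \<Rightarrow> (real \<Rightarrow> distr^3) \<Rightarrow> (real \<Rightarrow> distr) \<Rightarrow> real \<Rightarrow> bool" where
  "duhamel_u \<alpha> u0 u \<theta> t \<longleftrightarrow> (\<forall>i. \<exists>A B.
     has_time_integral (\<lambda>\<tau>. heat \<alpha> (t - \<tau>) (leray (advect_vec (u \<tau>) (u \<tau>)) $ i)) A t \<and>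
     has_time_integral (\<lambda>\<tau>. heat \<alpha> (t - \<tau>) (leray (buoyancy (\<theta> \<tau>)) $ i)) B t \<and>
     (\<forall>\<phi>\<in>schwartz. (u t $ i) \<phi> = heat \<alpha> t (u0 $ i) \<phi> - A \<phi> + B \<phi>))"

definition duhamel_\<theta> ::
  "real \<Rightarrow> distr \<Rightarrow> (real \<Rightarrow> distr^3) \<Rightarrow> (real \<Rightarrow> distr) \<Rightarrow> real \<Rightarrow> bool" where
  "duhamel_\<theta> \<beta> \<theta>0 u \<theta> t \<longleftrightarrow> (\<exists>A.
     has_time_integral (\<lambda>\<tau>. heat \<beta> (t - \<tau>) (advect (u \<tau>) (\<theta> \<tau>))) A t \<and>
     (\<forall>\<phi>\<in>schwartz. \<theta> t \<phi> = heat \<beta> t \<theta>0 \<phi> - A \<phi>))"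

definition mild_solution ::
  "real \<Rightarrow> real \<Rightarrow> real \<Rightarrow> real \<Rightarrow> real \<Rightarrow> distr^3 \<Rightarrow> distr \<Rightarrow> real set \<Rightarrow>
   (real \<Rightarrow> distr^3) \<Rightarrow> (real \<Rightarrow> distr) \<Rightarrow> bool" where
  "mild_solution a \<sigma> \<alpha> \<beta> s u0 \<theta>0 I u \<theta> \<longleftrightarrow>
     (\<forall>T\<in>I.
        C_into (X_space_vec a \<sigma> s) (X_norm_vec a \<sigma> s) {0..T} u \<and>
        L1_into (X_space_vec a \<sigma> (s + 2 * \<alpha>)) (X_norm_vec a \<sigma> (s + 2 * \<alpha>)) {0..T} u \<and>
        C_into (X_space a \<sigma> s) (X_norm a \<sigma> s) {0..T} \<theta> \<and>
        L1_into (X_space a \<sigma> (s + 2 * \<beta>)) (X_norm a \<sigma> (s + 2 * \<beta>)) {0..T} \<theta>) \<and>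
     (\<forall>t\<in>I.
        (\<forall>i. real_distr (u t $ i)) \<and> real_distr (\<theta> t) \<and>
        divergence (u t) = (\<lambda>_. 0) \<and> duhamel_u \<alpha> u0 u \<theta> t \<and> duhamel_\<theta> \<beta> \<theta>0 u \<theta> t)"

definition maximal_mild_solution ::
  "real \<Rightarrow> real \<Rightarrow> real \<Rightarrow> real \<Rightarrow> real \<Rightarrow> distr^3 \<Rightarrow> distr \<Rightarrow> ereal \<Rightarrow>
   (real \<Rightarrow> distr^3) \<Rightarrow> (real \<Rightarrow> distr) \<Rightarrow> bool" where
  "maximal_mild_solution a \<sigma> \<alpha> \<beta> s u0 \<theta>0 Tstar u \<theta> \<longleftrightarrow>
     0 < Tstar \<and>
     (let I = {t. 0 \<le> t \<and> ereal t < Tstar} in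
        mild_solution a \<sigma> \<alpha> \<beta> s u0 \<theta>0 I u \<theta> \<and>
        (\<nexists>J v \<eta>. is_interval J \<and> J \<subseteq> {0..} \<and> I \<subset> J \<and>
                 mild_solution a \<sigma> \<alpha> \<beta> s u0 \<theta>0 J v \<eta> \<and> (\<forall>t\<in>I. v t = u t \<and> \<eta> t = \<theta> t)))"

definition pair_norm :: "real \<Rightarrow> real \<Rightarrow> real \<Rightarrow> distr^3 \<Rightarrow> distr \<Rightarrow> real" where
  "pair_norm a \<sigma> s f g = X_norm_vec a \<sigma> s f + X_norm a \<sigma> s g"

end

theory Submission
  imports Defs "HOL-Probability.Probability"
begin

text \<open>The solution is studied through functions \<open>U i t \<xi>\<close> and \<open>\<Theta> t \<xi>\<close> that represent the Fourier
  transforms of the components of \<open>u(t)\<close> and of \<open>\<theta>(t)\<close> and are measurable in time and frequency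
  jointly (\<open>jointly_measurable_version\<close>). Pairing the mild equation with test functions, exchanging the
  time and frequency integrals (\<open>time_integral_duh\<close>) and using that a function is determined almost
  everywhere by its pairings with Schwartz functions (\<open>AE_zero_if_schwartz_pairings_zero\<close>), one obtains
  the scalar Duhamel formula at almost every frequency (\<open>solution_frep\<close>). All norms are weighted
  integrals of \<open>|U|\<close> and \<open>|\<Theta>|\<close>, so that from here on only nonnegative integrals are estimated.

  Let \<open>N(t)\<close> be the norm of \<open>(u,\<theta>)(t)\<close>, let \<open>high(t)\<close> be the sum of the norms with \<open>2\<alpha>\<close> and \<open>2\<beta>\<close> more
  derivatives, and let \<open>\<Phi>\<close> be the integrand in (ii). The heat kernel gives
  \<open>N(t) + \<integral> high \<lesssim> N(t\<^sub>0) + \<integral> |forcing|\<close> on \<open>[t\<^sub>0, t]\<close> (\<open>parabolic_estimate\<close>). The products are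
  convolutions in frequency; interpolation between the low and the high norms and Young's inequality
  bound the forcing by \<open>\<epsilon> high + C (1 + \<Phi>) N\<close> (\<open>bilinear_estimate\<close>, \<open>parts_bound\<close>). The exponents in \<open>\<Phi>\<close>
  are those that Young's inequality produces, and the three conditions on \<open>s\<close> say that the
  interpolation exponents of the high norms add up to less than one. Absorbing \<open>\<epsilon> high\<close> leads to
  \<open>N(t) + \<integral> high \<le> C N(t\<^sub>0) + K \<integral> (1 + \<Phi>) N\<close> (\<open>energy\<close>).

  For (ii), suppose that \<open>\<Phi>\<close> is integrable up to \<open>T\<^sup>*\<close>. Then Gronwall's inequality bounds \<open>N\<close>, and the high
  norms and the forcing are integrable up to \<open>T\<^sup>*\<close> (\<open>bounds_if_Phi_integrable\<close>). The Duhamel formula at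
  \<open>t = T\<^sup>*\<close> therefore defines a final value, to which the solution converges in norm, and the curve
  completed by this value is a mild solution on the closed interval \<open>[0, T\<^sup>*]\<close> (\<open>extension\<close>). This
  contradicts maximality.

  For (i), \<open>\<Phi>\<close> is at most \<open>F(N)\<close> for the sum \<open>F\<close> of the three powers in (iii). A bounded \<open>N\<close> would
  make \<open>\<Phi>\<close> integrable, so \<open>N\<close> is unbounded near \<open>T\<^sup>*\<close>.

  For (iii), the energy inequality with \<open>\<Phi> \<le> F(N)\<close> shows that \<open>ln (F / (1 + F))\<close>, evaluated along a
  majorant of \<open>N\<close>, grows at most linearly in time (\<open>gronwall_powers\<close>). As \<open>N\<close> is unbounded, this quantity
  reaches values arbitrarily close to \<open>0\<close> before \<open>T\<^sup>*\<close>, which bounds \<open>F(6 N(t))\<close> from below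
  (\<open>blowup_rate\<close>); the factor 6 is moved into the constant \<open>C\<close>.\<close>

section \<open>Schwartz functions\<close>

lemma pd_eqI: "(\<phi> has_derivative D) (at x) \<Longrightarrow> pd j \<phi> x = D (axis j 1)"
  unfolding pd_def by (metis frechet_derivative_at)

lemma pds_Cons: "pds (j # js) \<phi> = pd j (pds js \<phi>)"
  by (simp add: pds_def)

lemma schwartz_differentiable: "\<phi> \<in> schwartz \<Longrightarrow> \<phi> differentiable (at x)"
  unfolding schwartz_def by (auto dest!: spec[of _ "[]"] simp: pds_def)

lemma schwartz_has_derivative:
  "\<phi> \<in> schwartz \<Longrightarrow> (\<phi> has_derivative frechet_derivative \<phi> (at x)) (at x)"
  using schwartz_differentiable frechet_derivative_works by blast

lemma schwartz_bounded: "\<phi> \<in> schwartz \<Longrightarrow> bounded (range (\<lambda>x. norm x ^ k *\<^sub>R \<phi> x))"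
  unfolding schwartz_def by (auto dest!: spec[of _ "[]"] simp: pds_def)

lemma schwartz_pd: "\<phi> \<in> schwartz \<Longrightarrow> pd j \<phi> \<in> schwartz"
proof -
  assume *: "\<phi> \<in> schwartz"
  have "pds js (pd j \<phi>) = pds (js @ [j]) \<phi>" for js
    by (simp add: pds_def)
  with * show ?thesis unfolding schwartz_def by auto
qed

text \<open>The Schwartz space is the largest set of differentiable, rapidly decreasing functions that is
  closed under partial derivatives. Membership of \<open>\<phi>\<close> is therefore shown by
  exhibiting one set with these closure properties that contains \<open>\<phi>\<close>, where only single partial
  derivatives have to be computed.\<close>

lemma schwartz_coinduct:
  assumes "\<phi> \<in> S"
    and "\<And>\<psi> x. \<psi> \<in> S \<Longrightarrow> \<psi> differentiable (at x)"
    and "\<And>\<psi> k. \<psi> \<in> S \<Longrightarrow> bounded (range (\<lambda>x. norm x ^ k *\<^sub>R \<psi> x))"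
    and "\<And>\<psi> j. \<psi> \<in> S \<Longrightarrow> pd j \<psi> \<in> S"
  shows "\<phi> \<in> schwartz"
proof -
  have "pds js \<phi> \<in> S" for js
    by (induction js) (auto simp: pds_Cons assms, simp add: pds_def assms)
  with assms show ?thesis unfolding schwartz_def by auto
qed

lemma bounded_lincomb:
  fixes \<phi> \<psi> :: test_fun
  assumes "bounded (range (\<lambda>x. norm x ^ k *\<^sub>R \<phi> x))" "bounded (range (\<lambda>x. norm x ^ k *\<^sub>R \<psi> x))"
  shows "bounded (range (\<lambda>x. norm x ^ k *\<^sub>R (b * \<phi> x + c * \<psi> x)))"
proof -
  obtain M N where MN: "\<And>x. norm (norm x ^ k *\<^sub>R \<phi> x) \<le> M" "\<And>x. norm (norm x ^ k *\<^sub>R \<psi> x) \<le> N"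
    using assms unfolding bounded_iff by auto
  have "norm (norm x ^ k *\<^sub>R (b * \<phi> x + c * \<psi> x)) \<le> norm b * M + norm c * N" for x
  proof -
    have "norm x ^ k *\<^sub>R (b * \<phi> x + c * \<psi> x) =
       b * (norm x ^ k *\<^sub>R \<phi> x) + c * (norm x ^ k *\<^sub>R \<psi> x)"
      by (simp add: scaleR_conv_of_real algebra_simps)
    also have "norm \<dots> \<le> norm b * norm (norm x ^ k *\<^sub>R \<phi> x) + norm c * norm (norm x ^ k *\<^sub>R \<psi> x)"
      by (metis norm_triangle_ineq norm_mult)
    also have "\<dots> \<le> norm b * M + norm c * N"
      using MN by (intro add_mono mult_left_mono) auto
    finally show ?thesis .
  qed
  then show ?thesis unfolding bounded_iff by blast
qed

lemma pd_lincomb: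
  assumes "\<phi> differentiable (at x)" "\<psi> differentiable (at x)"
  shows "pd j (\<lambda>x. b * \<phi> x + c * \<psi> x) x = b * pd j \<phi> x + c * pd j \<psi> x"
proof -
  have "((\<lambda>x. b * \<phi> x + c * \<psi> x) has_derivative
      (\<lambda>h. b * frechet_derivative \<phi> (at x) h + c * frechet_derivative \<psi> (at x) h)) (at x)"
    using assms frechet_derivative_works
    by (intro derivative_intros) auto
  then show ?thesis by (subst pd_eqI, assumption) (simp add: pd_def)
qed

lemma schwartz_lincomb:
  assumes "\<phi> \<in> schwartz" "\<psi> \<in> schwartz"
  shows "(\<lambda>x. b * \<phi> x + c * \<psi> x) \<in> schwartz"
proof (rule schwartz_coinduct)
  let ?S = "{(\<lambda>x. b * \<phi> x + c * \<psi> x) |\<phi> \<psi>. \<phi> \<in> schwartz \<and> \<psi> \<in> schwartz}"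
  show "(\<lambda>x. b * \<phi> x + c * \<psi> x) \<in> ?S" using assms by auto
  show "\<rho> differentiable (at x)" if "\<rho> \<in> ?S" for \<rho> x
  proof -
    from that obtain \<phi> \<psi> where *: "\<phi> \<in> schwartz" "\<psi> \<in> schwartz" "\<rho> = (\<lambda>x. b * \<phi> x + c * \<psi> x)"
      by auto
    show ?thesis unfolding *(3)
      using *(1,2)[THEN schwartz_differentiable]
      by (intro differentiable_add differentiable_mult differentiable_const)
  qed
  show "bounded (range (\<lambda>x. norm x ^ k *\<^sub>R \<rho> x))" if "\<rho> \<in> ?S" for \<rho> k
  proof -
    from that obtain \<phi> \<psi> where *: "\<phi> \<in> schwartz" "\<psi> \<in> schwartz" "\<rho> = (\<lambda>x. b * \<phi> x + c * \<psi> x)"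
      by auto
    show ?thesis
      unfolding *(3) by (rule bounded_lincomb[OF *(1,2)[THEN schwartz_bounded]])
  qed
  show "pd j \<rho> \<in> ?S" if "\<rho> \<in> ?S" for \<rho> j
  proof -
    from that obtain \<phi> \<psi> where *: "\<phi> \<in> schwartz" "\<psi> \<in> schwartz" "\<rho> = (\<lambda>x. b * \<phi> x + c * \<psi> x)"
      by auto
    then have "pd j \<rho> = (\<lambda>x. b * pd j \<phi> x + c * pd j \<psi> x)"
      by (simp only: *(3)) (intro ext pd_lincomb schwartz_differentiable *(1,2))
    with * schwartz_pd show ?thesis by blast
  qed
qed

lemma schwartz_cmult: "\<phi> \<in> schwartz \<Longrightarrow> (\<lambda>x. c * \<phi> x) \<in> schwartz"
  using schwartz_lincomb[of \<phi> \<phi> c 0] by simp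

lemma zero_schwartz: "(\<lambda>x. 0) \<in> schwartz"
proof (rule schwartz_coinduct)
  show "(\<lambda>x. 0) \<in> {\<lambda>x::real^3. 0::complex}" by simp
  show "pd j \<psi> \<in> {\<lambda>x. 0}" if "\<psi> \<in> {\<lambda>x. 0}" for j \<psi>
  proof -
    have "pd j (\<lambda>x. 0) x = 0" for x
      by (subst pd_eqI[OF has_derivative_const]) simp
    with that show ?thesis by auto
  qed
qed auto

lemma abs_component_le_norm: "\<bar>x $ j\<bar> \<le> norm (x :: real^3)"
  by (rule component_le_norm_cart)

lemma bounded_coordinate:
  fixes \<phi> :: test_fun
  assumes "bounded (range (\<lambda>x. norm x ^ Suc k *\<^sub>R \<phi> x))"
  shows "bounded (range (\<lambda>x. norm x ^ k *\<^sub>R (of_real (x $ j) * \<phi> x)))"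
proof -
  obtain M where M: "\<And>x. norm (norm x ^ Suc k *\<^sub>R \<phi> x) \<le> M"
    using assms unfolding bounded_iff by auto
  have "norm (norm x ^ k *\<^sub>R (of_real (x $ j) * \<phi> x)) \<le> M" for x
  proof -
    have "norm (norm x ^ k *\<^sub>R (of_real (x $ j) * \<phi> x)) = norm x ^ k * \<bar>x $ j\<bar> * norm (\<phi> x)"
      by (simp add: norm_mult)
    also have "\<dots> \<le> norm x ^ k * norm x * norm (\<phi> x)"
      by (intro mult_right_mono mult_left_mono abs_component_le_norm) auto
    also have "\<dots> \<le> M" using M[of x] by (simp add: mult_ac)
    finally show ?thesis .
  qed
  then show ?thesis unfolding bounded_iff by blast
qed

lemma pd_coordinate:
  assumes "\<phi> differentiable (at x)"
  shows "pd i (\<lambda>x. of_real (x $ j) * \<phi> x) x =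
    (if i = j then 1 else 0) * \<phi> x + of_real (x $ j) * pd i \<phi> x"
proof -
  have "((\<lambda>x. of_real (x $ j) :: complex) has_derivative (\<lambda>h. of_real (h $ j))) (at x)"
    by (intro derivative_intros)
      (simp_all add: bounded_linear_imp_has_derivative bounded_linear_vec_nth)
  then have "((\<lambda>x. of_real (x $ j) * \<phi> x) has_derivative
      (\<lambda>h. of_real (x $ j) * frechet_derivative \<phi> (at x) h + of_real (h $ j) * \<phi> x)) (at x)"
    using assms frechet_derivative_works by (intro has_derivative_mult) auto
  then show ?thesis by (subst pd_eqI, assumption) (auto simp: pd_def axis_def)
qed

lemma schwartz_coordinate:
  assumes "\<phi> \<in> schwartz"
  shows "(\<lambda>x. of_real (x $ j) * \<phi> x) \<in> schwartz"
proof (rule schwartz_coinduct)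
  let ?f = "\<lambda>\<phi> \<psi> x. 1 * (of_real (x $ j) * \<phi> x) + 1 * \<psi> x"
  let ?S = "{?f \<phi> \<psi> |\<phi> \<psi>. \<phi> \<in> schwartz \<and> \<psi> \<in> schwartz}"
  show "(\<lambda>x. of_real (x $ j) * \<phi> x) \<in> ?S"
    by (intro CollectI exI[of _ \<phi>] exI[of _ "\<lambda>x. 0"] conjI assms zero_schwartz) simp
  have coord: "(\<lambda>x. of_real (x $ j) * \<phi> x) differentiable (at x)" if "\<phi> \<in> schwartz" for \<phi> x
  proof -
    have "((\<lambda>x. of_real (x $ j) :: complex) has_derivative (\<lambda>h. of_real (h $ j))) (at x)"
      by (intro derivative_intros)
        (simp_all add: bounded_linear_imp_has_derivative bounded_linear_vec_nth)
    from has_derivative_mult[OF this schwartz_has_derivative[OF that]] show ?thesis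
      by (rule differentiableI)
  qed
  show "\<rho> differentiable (at x)" if "\<rho> \<in> ?S" for \<rho> x
  proof -
    from that obtain \<phi> \<psi> where *: "\<phi> \<in> schwartz" "\<psi> \<in> schwartz" "\<rho> = ?f \<phi> \<psi>"
      by auto
    show ?thesis unfolding *(3) mult_1_left
      by (rule differentiable_add[OF coord[OF *(1)] schwartz_differentiable[OF *(2)]])
  qed
  show "bounded (range (\<lambda>x. norm x ^ k *\<^sub>R \<rho> x))" if "\<rho> \<in> ?S" for \<rho> k
  proof -
    from that obtain \<phi> \<psi> where *: "\<phi> \<in> schwartz" "\<psi> \<in> schwartz" "\<rho> = ?f \<phi> \<psi>"
      by auto
    show ?thesis
      unfolding *(3)
      by (rule bounded_lincomb[OF bounded_coordinate[OF schwartz_bounded[OF *(1)]] schwartz_bounded[OF *(2)]])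
  qed
  show "pd i \<rho> \<in> ?S" if "\<rho> \<in> ?S" for \<rho> i
  proof -
    from that obtain \<phi> \<psi> where *: "\<phi> \<in> schwartz" "\<psi> \<in> schwartz" "\<rho> = ?f \<phi> \<psi>"
      by auto
    then have "pd i \<rho> = ?f (pd i \<phi>) (\<lambda>x. (if i = j then 1 else 0) * \<phi> x + 1 * pd i \<psi> x)"
      by (simp only: *(3), intro ext,
          subst pd_lincomb[OF coord[OF *(1)] schwartz_differentiable[OF *(2)]])
         (simp add: pd_coordinate[OF schwartz_differentiable[OF *(1)]])
    moreover have "(\<lambda>x. (if i = j then 1 else 0) * \<phi> x + 1 * pd i \<psi> x) \<in> schwartz"
      by (rule schwartz_lincomb[OF *(1) schwartz_pd[OF *(2)]])
    ultimately show ?thesis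
      by (intro CollectI exI conjI) (assumption, rule schwartz_pd[OF *(1)], assumption)
  qed
qed

text \<open>An integrable majorant of every Schwartz function, up to a constant given by two of its
  seminorms. As a product of functions of one coordinate it is integrable by Fubini's theorem.\<close>

definition lorentz :: "real^3 \<Rightarrow> real" where
  "lorentz x = (\<Prod>b\<in>Basis. inverse (1 + (x \<bullet> b)\<^sup>2))"

lemma lorentz_pos: "lorentz x > 0"
  unfolding lorentz_def by (intro prod_pos) (auto intro!: add_pos_nonneg)

lemma inverse_1_plus_square_nn_integral_finite:
  "(\<integral>\<^sup>+(x::real). ennreal (inverse (1 + x\<^sup>2)) \<partial>lborel) < \<infinity>"
proof -
  have "integrable lborel (\<lambda>x::real. inverse (1 + x\<^sup>2))"
    using integrable_inverse_1_plus_square by (simp add: set_integrable_def einterval_def)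
  from integrableD(2)[OF this] show ?thesis
    by (simp add: less_top[symmetric] abs_of_nonneg add_nonneg_nonneg)
qed

lemma borel_measurable_lorentz [measurable]: "lorentz \<in> borel_measurable borel"
  unfolding lorentz_def by measurable

lemma integrable_lorentz: "integrable lborel lorentz"
proof (rule integrableI_bounded)
  have "(\<integral>\<^sup>+x. ennreal (norm (lorentz x)) \<partial>lborel) =
      (\<integral>\<^sup>+(x::real^3). (\<Prod>b\<in>Basis. ennreal (inverse (1 + (x \<bullet> b)\<^sup>2))) \<partial>lborel)"
    by (intro nn_integral_cong, subst real_norm_def, subst abs_of_nonneg[OF less_imp_le[OF lorentz_pos]])
       (simp add: lorentz_def prod_ennreal)
  also have "\<dots> = (\<Prod>b\<in>(Basis::(real^3) set). \<integral>\<^sup>+x. ennreal (inverse (1 + x\<^sup>2)) \<partial>lborel)"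
    by (rule nn_integral_lborel_prod) auto
  also have "\<dots> < \<infinity>"
    using inverse_1_plus_square_nn_integral_finite by (simp add: power_less_top_ennreal)
  finally show "(\<integral>\<^sup>+x. ennreal (norm (lorentz x)) \<partial>lborel) < \<infinity>" .
qed measurable

lemma lorentz_ge: "inverse ((1 + (norm x)\<^sup>2) ^ 3) \<le> lorentz x"
proof -
  have "inverse (1 + (norm x)\<^sup>2) \<le> inverse (1 + (x \<bullet> b)\<^sup>2)" if "b \<in> Basis" for b
  proof (rule le_imp_inverse_le)
    have "\<bar>x \<bullet> b\<bar> \<le> norm x" using Basis_le_norm[OF that] .
    then have "(x \<bullet> b)\<^sup>2 \<le> (norm x)\<^sup>2" using abs_le_square_iff[of "x \<bullet> b" "norm x"] by simp
    then show "1 + (x \<bullet> b)\<^sup>2 \<le> 1 + (norm x)\<^sup>2" by simp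
    show "0 < 1 + (x \<bullet> b)\<^sup>2" by (simp add: add_pos_nonneg)
  qed
  then have "(\<Prod>b\<in>(Basis::(real^3) set). inverse (1 + (norm x)\<^sup>2)) \<le> lorentz x"
    unfolding lorentz_def by (intro prod_mono) (auto simp: add_nonneg_nonneg)
  then show ?thesis by (simp add: power_inverse)
qed

text \<open>Translating by a vector of length at most one changes the majorant only by a constant; this
  is what dominates difference quotients.\<close>

lemma decay_bound:
  assumes "norm (y - x) \<le> 1" and "norm (f y) \<le> A" and "norm y ^ 6 * norm (f y) \<le> B"
  shows "norm (f y :: complex) \<le> 216 * (A + B) * lorentz x"
proof -
  have aux: "a \<le> 2 * b + 2 \<Longrightarrow> 0 \<le> b \<Longrightarrow> 1 + a \<le> 3 * (1 + b)" for a b :: real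
    by simp
  have max3: "max 1 b ^ 3 = max 1 (b ^ 3)" if "0 \<le> b" for b :: real
    using that one_le_power[of b 3] power_le_one[of b 3] by (auto simp: max_def)
  have n: "norm x \<le> norm y + 1"
    using assms(1) norm_triangle_ineq2[of x y] by (simp add: norm_minus_commute)
  have "(norm x)\<^sup>2 \<le> (norm y + 1)\<^sup>2" using n by (intro power_mono) auto
  also have "\<dots> \<le> 2 * (norm y)\<^sup>2 + 2"
    using sum_squares_ge_zero[of "norm y - 1" 0] by (simp add: power2_eq_square algebra_simps)
  finally have "1 + (norm x)\<^sup>2 \<le> 3 * (1 + (norm y)\<^sup>2)"
    using aux zero_le_power2[of "norm y"] by blast
  also have "\<dots> \<le> 6 * max 1 ((norm y)\<^sup>2)" by (auto simp: max_def)
  finally have "(1 + (norm x)\<^sup>2) ^ 3 \<le> (6 * max 1 ((norm y)\<^sup>2)) ^ 3"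
    by (intro power_mono) (auto simp: add_nonneg_nonneg)
  also have "\<dots> = 216 * max 1 (((norm y)\<^sup>2) ^ 3)"
    by (simp add: power_mult_distrib max3)
  also have "\<dots> \<le> 216 * (1 + norm y ^ 6)" by (auto simp: max_def power_mult[symmetric])
  finally have "(1 + (norm x)\<^sup>2) ^ 3 * norm (f y) \<le> 216 * (1 + norm y ^ 6) * norm (f y)"
    by (intro mult_right_mono) auto
  also have "\<dots> \<le> 216 * (A + B)" using assms(2,3) by (simp add: algebra_simps)
  finally have *: "(1 + (norm x)\<^sup>2) ^ 3 * norm (f y) \<le> 216 * (A + B)" .
  have p: "(1 + (norm x)\<^sup>2) ^ 3 > 0" by (simp add: add_pos_nonneg)
  have AB: "0 \<le> A + B"
    using assms(2,3) by (meson add_nonneg_nonneg norm_ge_zero order_trans zero_le_power mult_nonneg_nonneg)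
  have "norm (f y) \<le> 216 * (A + B) * inverse ((1 + (norm x)\<^sup>2) ^ 3)"
    using * p by (simp add: field_simps)
  also have "\<dots> \<le> 216 * (A + B) * lorentz x"
    using lorentz_ge AB by (intro mult_left_mono) auto
  finally show ?thesis .
qed

definition seminorm :: "nat \<Rightarrow> test_fun \<Rightarrow> real" where
  "seminorm k \<phi> = (SUP x. norm x ^ k * norm (\<phi> x))"

lemma seminorm_bdd: "\<phi> \<in> schwartz \<Longrightarrow> bdd_above (range (\<lambda>x. norm x ^ k * norm (\<phi> x)))"
  using schwartz_bounded[of \<phi> k] unfolding bounded_iff bdd_above_def by auto

lemma seminorm_ge: "\<phi> \<in> schwartz \<Longrightarrow> norm x ^ k * norm (\<phi> x) \<le> seminorm k \<phi>"
  unfolding seminorm_def by (rule cSUP_upper[OF _ seminorm_bdd]) auto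

lemma seminorm_nonneg: "\<phi> \<in> schwartz \<Longrightarrow> 0 \<le> seminorm k \<phi>"
  using seminorm_ge[of \<phi> 0 k] by (meson mult_nonneg_nonneg norm_ge_zero order_trans zero_le_power)

lemma schwartz_shift_bound:
  assumes "\<phi> \<in> schwartz" and "norm (y - x) \<le> 1"
  shows "norm (\<phi> y) \<le> 216 * (seminorm 0 \<phi> + seminorm 6 \<phi>) * lorentz x"
  using assms(2) by (rule decay_bound) (use seminorm_ge[OF assms(1), of y 0] seminorm_ge[OF assms(1), of y 6] in auto)

lemmas schwartz_lorentz_bound = schwartz_shift_bound[of _ x x for x, simplified]

lemma schwartz_measurable: "\<phi> \<in> schwartz \<Longrightarrow> \<phi> \<in> borel_measurable borel"
  by (intro borel_measurable_continuous_onI continuous_at_imp_continuous_on)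
     (auto intro!: differentiable_imp_continuous_within schwartz_differentiable)

lemma schwartz_integrable:
  assumes "\<phi> \<in> schwartz"
  shows "integrable lborel \<phi>"
proof (rule Bochner_Integration.integrable_bound)
  show "integrable lborel (\<lambda>x. 216 * (seminorm 0 \<phi> + seminorm 6 \<phi>) * lorentz x)"
    using integrable_lorentz by simp
  show "AE x in lborel. norm (\<phi> x) \<le> norm (216 * (seminorm 0 \<phi> + seminorm 6 \<phi>) * lorentz x)"
    using schwartz_lorentz_bound[OF assms] by (auto intro: order_trans[OF _ abs_ge_self])
qed (use schwartz_measurable[OF assms] in simp)

lemma schwartz_L1_bound:
  assumes "\<phi> \<in> schwartz"
  shows "(\<integral>x. norm (\<phi> x) \<partial>lborel) \<le> 216 * (seminorm 0 \<phi> + seminorm 6 \<phi>) * (\<integral>x. lorentz x \<partial>lborel)"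
proof -
  have "(\<integral>x. norm (\<phi> x) \<partial>lborel) \<le> (\<integral>x. 216 * (seminorm 0 \<phi> + seminorm 6 \<phi>) * lorentz x \<partial>lborel)"
    using integrable_lorentz schwartz_integrable[OF assms] schwartz_lorentz_bound[OF assms]
    by (intro integral_mono integrable_norm) auto
  then show ?thesis by simp
qed

lemma schwartz_norm_integrable:
  assumes "\<phi> \<in> schwartz"
  shows "integrable lborel (\<lambda>x. norm x * norm (\<phi> x))"
proof (rule Bochner_Integration.integrable_bound)
  show "integrable lborel (\<lambda>x. \<Sum>j\<in>UNIV. norm (of_real (x $ j) * \<phi> x))"
    by (intro Bochner_Integration.integrable_sum integrable_norm schwartz_integrable
        schwartz_coordinate assms)
  show "AE x in lborel. norm (norm x * norm (\<phi> x)) \<le> norm (\<Sum>j\<in>UNIV. norm (of_real (x $ j) * \<phi> x))"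
  proof (intro AE_I2)
    fix x :: "real^3"
    have "norm (norm x * norm (\<phi> x)) = norm x * norm (\<phi> x)" by simp
    also have "\<dots> \<le> (\<Sum>j\<in>UNIV. \<bar>x $ j\<bar>) * norm (\<phi> x)"
      by (intro mult_right_mono norm_le_l1_cart) auto
    also have "\<dots> = (\<Sum>j\<in>UNIV. norm (of_real (x $ j) * \<phi> x))"
      by (simp add: norm_mult sum_distrib_right)
    also have "\<dots> \<le> norm \<dots>" by simp
    finally show "norm (norm x * norm (\<phi> x)) \<le> norm (\<Sum>j\<in>UNIV. norm (of_real (x $ j) * \<phi> x))" .
  qed
qed (use schwartz_measurable[OF assms] in measurable)

text \<open>The moment that dominates the Taylor remainder in the derivative of the Fourier transform.\<close>

lemma schwartz_norm2_integrable:
  assumes "\<phi> \<in> schwartz"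
  shows "integrable lborel (\<lambda>x. (norm x)\<^sup>2 * norm (\<phi> x))"
proof -
  have "integrable lborel (\<lambda>x. \<Sum>j\<in>UNIV. (norm x * norm (of_real (x $ j) * \<phi> x)))"
    by (intro Bochner_Integration.integrable_sum schwartz_norm_integrable schwartz_coordinate assms)
  then show ?thesis
  proof (rule Bochner_Integration.integrable_bound)
    show "AE x in lborel. norm ((norm x)\<^sup>2 * norm (\<phi> x)) \<le>
       norm (\<Sum>j\<in>UNIV. (norm x * norm (of_real (x $ j) * \<phi> x)))"
    proof (intro AE_I2)
      fix x :: "real^3"
      have "norm ((norm x)\<^sup>2 * norm (\<phi> x)) = norm x * (norm x * norm (\<phi> x))"
        by (simp add: power2_eq_square norm_mult)
      also have "\<dots> \<le> norm x * ((\<Sum>j\<in>UNIV. \<bar>x $ j\<bar>) * norm (\<phi> x))"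
        by (intro mult_right_mono mult_left_mono norm_le_l1_cart) auto
      also have "\<dots> = (\<Sum>j\<in>UNIV. (norm x * norm (of_real (x $ j) * \<phi> x)))"
        by (simp add: norm_mult sum_distrib_right sum_distrib_left)
      also have "\<dots> \<le> norm \<dots>" by simp
      finally show "norm ((norm x)\<^sup>2 * norm (\<phi> x)) \<le>
         norm (\<Sum>j\<in>UNIV. (norm x * norm (of_real (x $ j) * \<phi> x)))" .
    qed
  qed (use schwartz_measurable[OF assms] in measurable)
qed

section \<open>The Fourier transform on Schwartz functions\<close>

lemma integrable_mult_bounded:
  fixes f g :: "'a \<Rightarrow> complex"
  assumes "integrable M f" "g \<in> borel_measurable M" "\<And>x. norm (g x) \<le> B"
  shows "integrable M (\<lambda>x. g x * f x)"
proof (rule Bochner_Integration.integrable_bound)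
  show "integrable M (\<lambda>x. B * norm (f x))" using assms(1) by simp
  show "AE x in M. norm (g x * f x) \<le> norm (B * norm (f x))"
  proof (intro AE_I2)
    fix x
    have "norm (g x * f x) \<le> B * norm (f x)"
      unfolding norm_mult using assms(3) by (intro mult_right_mono) auto
    then show "norm (g x * f x) \<le> norm (B * norm (f x))" by simp
  qed
qed (use assms in measurable)

lemma norm_exp_ii [simp]: "norm (exp (\<i> * of_real r)) = 1" "norm (exp (- (\<i> * of_real r))) = 1"
  by (simp_all add: norm_exp_eq_Re)

lemma fourier_integrable:
  fixes \<phi> :: test_fun
  assumes "integrable lborel \<phi>"
  shows "integrable lborel (\<lambda>x. exp (- \<i> * of_real (\<xi> \<bullet> x)) * \<phi> x)"
  by (rule integrable_mult_bounded[OF assms, where B = 1]) auto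

lemma fourier_norm_le:
  assumes "integrable lborel \<phi>"
  shows "norm (fourier \<phi> \<xi>) \<le> (\<integral>x. norm (\<phi> x) \<partial>lborel)"
proof -
  have "norm (fourier \<phi> \<xi>) \<le> (\<integral>x. norm (exp (- \<i> * of_real (\<xi> \<bullet> x)) * \<phi> x) \<partial>lborel)"
    unfolding fourier_def by (rule integral_norm_bound)
  then show ?thesis by (simp add: norm_mult)
qed

text \<open>Differentiation under the integral: the second-order Taylor remainder of the exponential is
  quadratic in the increment, uniformly up to the integrable factor \<open>|x|\<^sup>2 |\<phi> x|\<close>.\<close>

lemma fourier_has_derivative:
  assumes \<phi>: "\<phi> \<in> schwartz"
  shows "(fourier \<phi> has_derivative
    (\<lambda>h. \<integral>x. exp (- \<i> * of_real (\<xi> \<bullet> x)) * (- \<i> * of_real (h \<bullet> x) * \<phi> x) \<partial>lborel)) (at \<xi>)"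
proof (rule has_derivativeI_sandwich[where e = 1])
  define K where "K = (\<integral>x. (norm x)\<^sup>2 * norm (\<phi> x) \<partial>lborel)"
  let ?L = "\<lambda>h. \<integral>x. exp (- \<i> * of_real (\<xi> \<bullet> x)) * (- \<i> * of_real (h \<bullet> x) * \<phi> x) \<partial>lborel"
  note [measurable] = schwartz_measurable[OF \<phi>]
  have int1: "integrable lborel (\<lambda>x. exp (- \<i> * of_real (\<xi> \<bullet> x)) * (- \<i> * of_real (h \<bullet> x) * \<phi> x))" for h
  proof (rule Bochner_Integration.integrable_bound)
    show "integrable lborel (\<lambda>x. norm h * (norm x * norm (\<phi> x)))"
      using schwartz_norm_integrable[OF \<phi>] by simp
    show "AE x in lborel. norm (exp (- \<i> * of_real (\<xi> \<bullet> x)) * (- \<i> * of_real (h \<bullet> x) * \<phi> x)) \<le>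
        norm (norm h * (norm x * norm (\<phi> x)))"
      by (auto simp: norm_mult mult.assoc[symmetric] intro!: mult_right_mono Cauchy_Schwarz_ineq2)
  qed measurable
  note intE = fourier_integrable[OF schwartz_integrable[OF \<phi>]]
  have normL: "norm (?L h) \<le> norm h * (\<integral>x. norm x * norm (\<phi> x) \<partial>lborel)" for h
  proof -
    have "norm (?L h) \<le> (\<integral>x. norm h * (norm x * norm (\<phi> x)) \<partial>lborel)"
    proof (rule Bochner_Integration.integral_norm_bound_integral[OF int1])
      show "integrable lborel (\<lambda>x. norm h * (norm x * norm (\<phi> x)))"
        using schwartz_norm_integrable[OF \<phi>] by simp
    qed (auto simp: norm_mult mult.assoc[symmetric] intro!: mult_right_mono Cauchy_Schwarz_ineq2)
    then show ?thesis by simp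
  qed
  show "bounded_linear ?L"
  proof (rule bounded_linear_intro)
    fix h k :: "real^3" and r :: real
    have "?L (h + k) = (\<integral>x. exp (- \<i> * of_real (\<xi> \<bullet> x)) * (- \<i> * of_real (h \<bullet> x) * \<phi> x) +
        exp (- \<i> * of_real (\<xi> \<bullet> x)) * (- \<i> * of_real (k \<bullet> x) * \<phi> x) \<partial>lborel)"
      by (simp add: inner_add_left algebra_simps)
    also have "\<dots> = ?L h + ?L k" by (rule Bochner_Integration.integral_add[OF int1 int1])
    finally show "?L (h + k) = ?L h + ?L k" .
    have "?L (r *\<^sub>R h) = (\<integral>x. of_real r * (exp (- \<i> * of_real (\<xi> \<bullet> x)) * (- \<i> * of_real (h \<bullet> x) * \<phi> x)) \<partial>lborel)"
      by (simp add: algebra_simps)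
    also have "\<dots> = r *\<^sub>R ?L h" by (simp add: scaleR_conv_of_real)
    finally show "?L (r *\<^sub>R h) = r *\<^sub>R ?L h" .
  qed (rule normL)
  show "norm (fourier \<phi> y - fourier \<phi> \<xi> - ?L (y - \<xi>)) / norm (y - \<xi>) \<le> norm (y - \<xi>) * K"
    if "y \<noteq> \<xi>" for y
  proof -
    have "fourier \<phi> y - fourier \<phi> \<xi> - ?L (y - \<xi>) =
      (\<integral>x. exp (- \<i> * of_real (y \<bullet> x)) * \<phi> x - exp (- \<i> * of_real (\<xi> \<bullet> x)) * \<phi> x -
         exp (- \<i> * of_real (\<xi> \<bullet> x)) * (- \<i> * of_real ((y - \<xi>) \<bullet> x) * \<phi> x) \<partial>lborel)"
      unfolding fourier_def
      by (subst Bochner_Integration.integral_diff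
            [OF Bochner_Integration.integrable_diff[OF intE intE] int1],
          subst Bochner_Integration.integral_diff[OF intE intE], rule refl)
    also have "norm \<dots> \<le> (\<integral>x. (norm (y - \<xi>))\<^sup>2 * ((norm x)\<^sup>2 * norm (\<phi> x)) \<partial>lborel)"
    proof (rule Bochner_Integration.integral_norm_bound_integral)
      fix x :: "real^3"
      let ?r = "(y - \<xi>) \<bullet> x"
      have e: "exp (- \<i> * of_real (y \<bullet> x)) =
          exp (- \<i> * of_real (\<xi> \<bullet> x)) * exp (\<i> * of_real (- ?r))"
        by (simp only: exp_add[symmetric]) (simp add: inner_diff_left algebra_simps)
      have "exp (- \<i> * of_real (y \<bullet> x)) * \<phi> x - exp (- \<i> * of_real (\<xi> \<bullet> x)) * \<phi> x -
           exp (- \<i> * of_real (\<xi> \<bullet> x)) * (- \<i> * of_real ?r * \<phi> x) =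
          exp (- \<i> * of_real (\<xi> \<bullet> x)) *
           ((exp (\<i> * of_real (- ?r)) - (\<Sum>k\<le>1. (\<i> * of_real (- ?r)) ^ k / fact k)) * \<phi> x)"
        unfolding e by (simp add: algebra_simps)
      also have "norm \<dots> = norm (exp (\<i> * of_real (- ?r)) - (\<Sum>k\<le>1. (\<i> * of_real (- ?r)) ^ k / fact k)) * norm (\<phi> x)"
        by (simp add: norm_mult del: of_real_minus sum.atMost_Suc)
      also have "\<dots> \<le> \<bar>- ?r\<bar> ^ Suc 1 / fact (Suc 1) * norm (\<phi> x)"
        by (intro mult_right_mono iexp_approx1) auto
      also have "\<dots> \<le> (norm (y - \<xi>) * norm x)\<^sup>2 * norm (\<phi> x)"
      proof (rule mult_right_mono)
        have "\<bar>?r\<bar> ^ 2 \<le> (norm (y - \<xi>) * norm x)\<^sup>2"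
          by (intro power_mono Cauchy_Schwarz_ineq2) auto
        moreover have "\<bar>?r\<bar> ^ 2 / 2 \<le> \<bar>?r\<bar> ^ 2" by simp
        ultimately have "\<bar>?r\<bar> ^ 2 / 2 \<le> (norm (y - \<xi>) * norm x)\<^sup>2" by (rule order_trans[rotated])
        then show "\<bar>- ?r\<bar> ^ Suc 1 / fact (Suc 1) \<le> (norm (y - \<xi>) * norm x)\<^sup>2"
          by (simp add: numeral_2_eq_2[symmetric])
      qed auto
      finally show "norm (exp (- \<i> * of_real (y \<bullet> x)) * \<phi> x - exp (- \<i> * of_real (\<xi> \<bullet> x)) * \<phi> x -
           exp (- \<i> * of_real (\<xi> \<bullet> x)) * (- \<i> * of_real ?r * \<phi> x)) \<le>
           (norm (y - \<xi>))\<^sup>2 * ((norm x)\<^sup>2 * norm (\<phi> x))"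
        by (simp add: power_mult_distrib mult_ac)
    qed (use int1 fourier_integrable[OF schwartz_integrable[OF \<phi>]] schwartz_norm2_integrable[OF \<phi>] in
          \<open>auto intro!: Bochner_Integration.integrable_diff\<close>)
    finally have "norm (fourier \<phi> y - fourier \<phi> \<xi> - ?L (y - \<xi>)) \<le> (norm (y - \<xi>))\<^sup>2 * K"
      by (simp add: K_def)
    then show ?thesis
      using that by (simp only: power2_eq_square mult.assoc) (simp add: pos_divide_le_eq mult.commute)
  qed
  show "((\<lambda>y. norm (y - \<xi>) * K) \<longlongrightarrow> 0) (at \<xi>)"
    by (intro tendsto_eq_intros | simp)+
qed simp

lemma pd_fourier:
  assumes "\<phi> \<in> schwartz"
  shows "pd j (fourier \<phi>) = fourier (\<lambda>x. - \<i> * (of_real (x $ j) * \<phi> x))"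
  by (intro ext, subst pd_eqI[OF fourier_has_derivative[OF assms]])
     (simp add: fourier_def inner_axis' mult.assoc)

lemma pd_along_line:
  assumes "\<phi> \<in> schwartz"
  shows "((\<lambda>t. \<phi> (x + t *\<^sub>R axis j 1)) has_vector_derivative pd j \<phi> (x + t *\<^sub>R axis j 1)) (at t within S)"
proof -
  let ?D = "frechet_derivative \<phi> (at (x + t *\<^sub>R axis j 1))"
  have "((\<lambda>t. \<phi> (x + t *\<^sub>R axis j 1)) has_derivative (\<lambda>h. ?D (h *\<^sub>R axis j 1))) (at t within S)"
    by (rule has_derivative_compose[OF _ schwartz_has_derivative[OF assms]])
       (auto intro!: derivative_eq_intros)
  moreover have "?D (h *\<^sub>R axis j 1) = h *\<^sub>R ?D (axis j 1)" for h
    using schwartz_has_derivative[OF assms] by (metis has_derivative_linear linear_cmul)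
  ultimately show ?thesis
    by (simp add: has_vector_derivative_def pd_def)
qed

lemma lborel_integral_translate:
  fixes f :: "'a::euclidean_space \<Rightarrow> 'b::{banach, second_countable_topology}"
  assumes [measurable]: "f \<in> borel_measurable borel"
  shows "(\<integral>x. f (x + c) \<partial>lborel) = (\<integral>x. f x \<partial>lborel)"
proof -
  have "(\<integral>x. f x \<partial>lborel) = (\<integral>x. f x \<partial>distr lborel borel ((+) c))"
    by (simp add: lborel_distr_plus)
  also have "\<dots> = (\<integral>x. f (c + x) \<partial>lborel)" by (subst integral_distr) auto
  finally show ?thesis by (simp add: add.commute)
qed

text \<open>Integration by parts, obtained from translation invariance of Lebesgue measure: a translation
  by \<open>h e\<^sub>j\<close> multiplies the Fourier transform by a phase, and both sides are differentiated at
  \<open>h = 0\<close>.\<close>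

lemma fourier_pd:
  assumes \<phi>: "\<phi> \<in> schwartz"
  shows "fourier (pd j \<phi>) \<xi> = \<i> * of_real (\<xi> $ j) * fourier \<phi> \<xi>"
proof -
  define h where "h n = 1 / (real n + 1)" for n :: nat
  have h: "h n > 0" "h n \<le> 1" for n by (auto simp: h_def divide_simps)
  have hne: "h n \<noteq> 0" for n using h(1)[of n] by simp
  have h0: "h \<longlonglongrightarrow> 0" unfolding h_def by real_asymp
  let ?e = "axis j 1 :: real^3"
  let ?E = "\<lambda>x. exp (- \<i> * of_real (\<xi> \<bullet> x))"
  let ?D = "\<lambda>n x. (\<phi> (x + h n *\<^sub>R ?e) - \<phi> x) /\<^sub>R h n"
  let ?C = "216 * (seminorm 0 (pd j \<phi>) + seminorm 6 (pd j \<phi>))"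
  note [measurable] = schwartz_measurable[OF \<phi>] schwartz_measurable[OF schwartz_pd[OF \<phi>]]
  have bound: "norm (?D n x) \<le> ?C * lorentz x" for n x
  proof -
    have "norm (\<phi> (x + h n *\<^sub>R ?e) - \<phi> (x + 0 *\<^sub>R ?e)) \<le> ?C * lorentz x * norm (h n - 0)"
    proof (rule differentiable_bound[where S = "{0..h n}" and f = "\<lambda>t. \<phi> (x + t *\<^sub>R ?e)"])
      fix t assume t: "t \<in> {0..h n}"
      show "((\<lambda>t. \<phi> (x + t *\<^sub>R ?e)) has_derivative (\<lambda>k. k *\<^sub>R pd j \<phi> (x + t *\<^sub>R ?e))) (at t within {0..h n})"
        using pd_along_line[OF \<phi>] by (simp add: has_vector_derivative_def)
      have "norm (pd j \<phi> (x + t *\<^sub>R ?e)) \<le> ?C * lorentz x"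
        using t h(2)[of n] by (intro schwartz_shift_bound schwartz_pd \<phi>) auto
      then show "onorm (\<lambda>k. k *\<^sub>R pd j \<phi> (x + t *\<^sub>R ?e)) \<le> ?C * lorentz x"
        by (intro onorm_le) (simp add: mult.commute mult_left_mono)
    qed (use h in \<open>auto simp: less_imp_le\<close>)
    then show ?thesis using h[of n] by (simp add: divide_simps mult_ac)
  qed
  have lim1: "(\<lambda>n. \<integral>x. ?E x * ?D n x \<partial>lborel) \<longlonglongrightarrow> (\<integral>x. ?E x * pd j \<phi> x \<partial>lborel)"
  proof (rule integral_dominated_convergence[where w = "\<lambda>x. ?C * lorentz x"])
    show "integrable lborel (\<lambda>x. ?C * lorentz x)" using integrable_lorentz by simp
    show "AE x in lborel. (\<lambda>n. ?E x * ?D n x) \<longlonglongrightarrow> ?E x * pd j \<phi> x"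
    proof (intro AE_I2 tendsto_intros)
      fix x
      have "((\<lambda>t. norm (\<phi> (x + t *\<^sub>R ?e) - \<phi> x - t *\<^sub>R pd j \<phi> x) / norm t) \<longlongrightarrow> 0) (at 0)"
        using pd_along_line[OF \<phi>, of x j 0 UNIV]
        by (simp add: has_vector_derivative_def has_derivative_iff_norm)
      moreover have "filterlim h (at 0) sequentially"
        by (simp add: filterlim_at h0 hne)
      ultimately have "(\<lambda>n. norm (\<phi> (x + h n *\<^sub>R ?e) - \<phi> x - h n *\<^sub>R pd j \<phi> x) / norm (h n)) \<longlonglongrightarrow> 0"
        by (rule filterlim_compose)
      moreover have "norm (\<phi> (x + h n *\<^sub>R ?e) - \<phi> x - h n *\<^sub>R pd j \<phi> x) / norm (h n) =
          norm (?D n x - pd j \<phi> x)" for n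
      proof -
        have "?D n x - pd j \<phi> x = (\<phi> (x + h n *\<^sub>R ?e) - \<phi> x - h n *\<^sub>R pd j \<phi> x) /\<^sub>R h n"
          using h(1)[of n] by (simp add: scaleR_diff_right)
        then show ?thesis using h(1)[of n] by (simp only: norm_scaleR) (simp add: field_simps)
      qed
      ultimately show "(\<lambda>n. ?D n x) \<longlonglongrightarrow> pd j \<phi> x"
        by (simp add: tendsto_norm_zero_iff LIM_zero_iff)
    qed
    show "AE x in lborel. norm (?E x * ?D n x) \<le> ?C * lorentz x" for n
      using bound by (simp add: norm_mult)
  qed measurable
  have eq: "(\<integral>x. ?E x * ?D n x \<partial>lborel) =
      (exp (\<i> * of_real (h n * \<xi> $ j)) - 1) /\<^sub>R h n * fourier \<phi> \<xi>" for n
  proof -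
    let ?p = "exp (\<i> * of_real (h n * \<xi> $ j))"
    have sh: "?E x * \<phi> (x + h n *\<^sub>R ?e) = ?p * (?E (x + h n *\<^sub>R ?e) * \<phi> (x + h n *\<^sub>R ?e))" for x
    proof -
      have "?E x = ?p * ?E (x + h n *\<^sub>R ?e)"
        by (simp only: exp_add[symmetric]) (simp add: inner_add_right inner_axis algebra_simps)
      then show ?thesis by (simp only: mult.assoc)
    qed
    have i1: "integrable lborel (\<lambda>x. ?E x * \<phi> x)"
      by (intro fourier_integrable schwartz_integrable \<phi>)
    have i2: "integrable lborel (\<lambda>x. ?E (x + h n *\<^sub>R ?e) * \<phi> (x + h n *\<^sub>R ?e))"
    proof -
      have "integrable (distr lborel borel ((+) (h n *\<^sub>R ?e))) (\<lambda>x. ?E x * \<phi> x)"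
        using i1 by (simp add: lborel_distr_plus)
      then show ?thesis by (subst (asm) integrable_distr_eq) (auto simp: add.commute)
    qed
    have "(\<integral>x. ?E x * ?D n x \<partial>lborel) = (\<integral>x. (?p * (?E (x + h n *\<^sub>R ?e) * \<phi> (x + h n *\<^sub>R ?e))
         - ?E x * \<phi> x) /\<^sub>R h n \<partial>lborel)"
      by (intro Bochner_Integration.integral_cong refl) (simp only: sh[symmetric], simp add: algebra_simps scaleR_conv_of_real)
    also have "\<dots> = (?p * (\<integral>x. ?E (x + h n *\<^sub>R ?e) * \<phi> (x + h n *\<^sub>R ?e) \<partial>lborel) - (\<integral>x. ?E x * \<phi> x \<partial>lborel)) /\<^sub>R h n"
      using i1 i2 by (simp add: Bochner_Integration.integral_diff)
    also have "(\<integral>x. ?E (x + h n *\<^sub>R ?e) * \<phi> (x + h n *\<^sub>R ?e) \<partial>lborel) = fourier \<phi> \<xi>"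
      unfolding fourier_def by (rule lborel_integral_translate) measurable
    also have "(\<integral>x. ?E x * \<phi> x \<partial>lborel) = fourier \<phi> \<xi>" by (simp add: fourier_def)
    finally show ?thesis by (simp add: algebra_simps scaleR_conv_of_real)
  qed
  have lim2: "(\<lambda>n. (exp (\<i> * of_real (h n * \<xi> $ j)) - 1) /\<^sub>R h n * fourier \<phi> \<xi>) \<longlonglongrightarrow>
      \<i> * of_real (\<xi> $ j) * fourier \<phi> \<xi>"
  proof (intro tendsto_intros)
    have "((\<lambda>z. exp (\<i> * of_real (\<xi> $ j) * z)) has_field_derivative \<i> * of_real (\<xi> $ j)) (at 0)"
      by (auto intro!: derivative_eq_intros)
    then have "((\<lambda>z. (exp (\<i> * of_real (\<xi> $ j) * z) - 1) / z) \<longlongrightarrow> \<i> * of_real (\<xi> $ j)) (at 0)"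
      by (simp add: has_field_derivative_iff)
    moreover have "filterlim (\<lambda>n. of_real (h n) :: complex) (at 0) sequentially"
      using tendsto_of_real[OF h0, where 'a = complex] by (simp add: filterlim_at hne)
    ultimately have "(\<lambda>n. (exp (\<i> * of_real (\<xi> $ j) * of_real (h n)) - 1) / of_real (h n)) \<longlonglongrightarrow> \<i> * of_real (\<xi> $ j)"
      by (rule filterlim_compose)
    then show "(\<lambda>n. (exp (\<i> * of_real (h n * \<xi> $ j)) - 1) /\<^sub>R h n) \<longlonglongrightarrow> \<i> * of_real (\<xi> $ j)"
      by (simp add: scaleR_conv_of_real divide_inverse mult_ac)
  qed
  have "(\<integral>x. ?E x * pd j \<phi> x \<partial>lborel) = \<i> * of_real (\<xi> $ j) * fourier \<phi> \<xi>"
    using lim1[unfolded eq] lim2 by (rule LIMSEQ_unique)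
  then show ?thesis by (simp add: fourier_def)
qed

text \<open>Every derivative of \<open>\<phi>\<close> becomes a factor \<open>\<xi>\<^sub>j\<close>, so that the decay of the transform follows by
  induction from its boundedness.\<close>

lemma fourier_decay:
  assumes "\<phi> \<in> schwartz"
  shows "bounded (range (\<lambda>\<xi>. norm \<xi> ^ k *\<^sub>R fourier \<phi> \<xi>))"
  using assms
proof (induction k arbitrary: \<phi>)
  case 0
  then show ?case
    using fourier_norm_le[OF schwartz_integrable[OF 0]] by (auto simp: bounded_iff)
next
  case (Suc k)
  have "\<exists>M. \<forall>\<xi>. norm (norm \<xi> ^ k *\<^sub>R fourier (pd j \<phi>) \<xi>) \<le> M" for j
    using Suc.IH[OF schwartz_pd[OF Suc.prems]] by (auto simp: bounded_iff)
  then obtain M where M: "\<And>j \<xi>. norm (norm \<xi> ^ k *\<^sub>R fourier (pd j \<phi>) \<xi>) \<le> M j" by metis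
  have "norm (norm \<xi> ^ Suc k *\<^sub>R fourier \<phi> \<xi>) \<le> (\<Sum>j\<in>UNIV. M j)" for \<xi>
  proof -
    have "norm (norm \<xi> ^ Suc k *\<^sub>R fourier \<phi> \<xi>) = norm \<xi> * (norm \<xi> ^ k * norm (fourier \<phi> \<xi>))"
      by (simp add: mult_ac)
    also have "\<dots> \<le> (\<Sum>j\<in>UNIV. \<bar>\<xi> $ j\<bar>) * (norm \<xi> ^ k * norm (fourier \<phi> \<xi>))"
      by (intro mult_right_mono norm_le_l1_cart) auto
    also have "\<dots> = (\<Sum>j\<in>UNIV. norm (norm \<xi> ^ k *\<^sub>R fourier (pd j \<phi>) \<xi>))"
      by (simp add: fourier_pd[OF Suc.prems] norm_mult sum_distrib_left mult_ac)
    also have "\<dots> \<le> (\<Sum>j\<in>UNIV. M j)" by (intro sum_mono M)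
    finally show ?thesis .
  qed
  then show ?case by (auto simp: bounded_iff)
qed

lemma fourier_schwartz: "\<phi> \<in> schwartz \<Longrightarrow> fourier \<phi> \<in> schwartz"
proof (rule schwartz_coinduct[where S = "fourier ` schwartz"])
  fix \<psi> j assume "\<psi> \<in> fourier ` schwartz"
  then obtain \<phi> where \<phi>: "\<psi> = fourier \<phi>" "\<phi> \<in> schwartz" by auto
  then show "\<psi> differentiable (at x)" for x
    using fourier_has_derivative differentiable_def by blast
  show "bounded (range (\<lambda>x. norm x ^ k *\<^sub>R \<psi> x))" for k
    using \<phi> fourier_decay by auto
  show "pd j \<psi> \<in> fourier ` schwartz"
    unfolding \<phi>(1) pd_fourier[OF \<phi>(2)]
    by (rule imageI, rule schwartz_cmult[OF schwartz_coordinate[OF \<phi>(2)]])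
qed auto

section \<open>Gaussians and Fourier inversion\<close>

definition gauss :: "real \<Rightarrow> real^3 \<Rightarrow> test_fun" where
  "gauss A b = (\<lambda>x. of_real (exp (- A * (norm x)\<^sup>2 + b \<bullet> x)))"

text \<open>The functions polynomial times Gaussian, closed under partial derivatives; hence they are
  Schwartz functions by \<open>schwartz_coinduct\<close>.\<close>

inductive_set gauss_span :: "real \<Rightarrow> real^3 \<Rightarrow> test_fun set" for A b where
  gauss: "gauss A b \<in> gauss_span A b"
| coord: "\<phi> \<in> gauss_span A b \<Longrightarrow> (\<lambda>x. of_real (x $ j) * \<phi> x) \<in> gauss_span A b"
| lincomb: "\<phi> \<in> gauss_span A b \<Longrightarrow> \<psi> \<in> gauss_span A b \<Longrightarrow> (\<lambda>x. c * \<phi> x + d * \<psi> x) \<in> gauss_span A b"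

lemma gauss_has_derivative:
  "(gauss A b has_derivative (\<lambda>h. of_real (- 2 * A * (x \<bullet> h) + b \<bullet> h) * gauss A b x)) (at x)"
proof -
  have "((\<lambda>x. - A * (x \<bullet> x) + b \<bullet> x) has_derivative (\<lambda>h. - 2 * A * (x \<bullet> h) + b \<bullet> h)) (at x)"
    by (auto intro!: derivative_eq_intros simp: inner_commute)
  from has_derivative_exp[OF this]
  have "((\<lambda>x. exp (- A * (x \<bullet> x) + b \<bullet> x)) has_derivative
      (\<lambda>h. exp (- A * (x \<bullet> x) + b \<bullet> x) * (- 2 * A * (x \<bullet> h) + b \<bullet> h))) (at x)"
    by (subst mult.commute)
  from has_derivative_of_real[OF this, where 'a = complex] show ?thesis
    unfolding gauss_def power2_norm_eq_inner
    by (simp only: of_real_mult) (simp only: mult.commute)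
qed

lemma pd_gauss:
  "pd j (gauss A b) = (\<lambda>x. of_real (- 2 * A) * (of_real (x $ j) * gauss A b x) + of_real (b $ j) * gauss A b x)"
  by (intro ext, subst pd_eqI[OF gauss_has_derivative]) (simp add: inner_axis algebra_simps)

lemma gauss_span_differentiable: "\<phi> \<in> gauss_span A b \<Longrightarrow> \<phi> differentiable (at x)"
proof (induction rule: gauss_span.induct)
  case gauss
  then show ?case using gauss_has_derivative by (rule differentiableI)
next
  case (coord \<phi> j)
  have "((\<lambda>x. of_real (x $ j) :: complex) has_derivative (\<lambda>h. of_real (h $ j))) (at x)"
    by (intro derivative_intros)
      (simp_all add: bounded_linear_imp_has_derivative bounded_linear_vec_nth)
  then have "(\<lambda>x. of_real (x $ j) :: complex) differentiable (at x)" by (rule differentiableI)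
  then show ?case using coord.IH by (rule differentiable_mult)
next
  case (lincomb \<phi> \<psi> c d)
  then show ?case
    by (intro differentiable_add differentiable_mult differentiable_const)
qed

lemma power_le_fact_exp:
  fixes r :: real
  assumes "0 \<le> r"
  shows "r ^ k \<le> fact k * exp r"
proof -
  have "(\<Sum>n\<in>{k}. r ^ n /\<^sub>R fact n) \<le> (\<Sum>n. r ^ n /\<^sub>R fact n)"
    using assms summable_exp_generic[of r] by (intro sum_le_suminf) auto
  then show ?thesis by (simp add: exp_def field_simps)
qed

lemma gauss_span_bounded:
  assumes A: "A > 0"
  shows "\<phi> \<in> gauss_span A b \<Longrightarrow> bounded (range (\<lambda>x. norm x ^ k *\<^sub>R \<phi> x))"
proof (induction arbitrary: k rule: gauss_span.induct)
  case gauss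
  define B where "B = norm b + 1"
  have "norm (norm x ^ k *\<^sub>R gauss A b x) \<le> fact k * exp (B\<^sup>2 / (4 * A))" for x
  proof -
    let ?r = "norm x"
    have "norm (norm x ^ k *\<^sub>R gauss A b x) = ?r ^ k * exp (- A * ?r\<^sup>2 + b \<bullet> x)"
      by (simp add: gauss_def)
    also have "\<dots> \<le> (fact k * exp ?r) * exp (- A * ?r\<^sup>2 + norm b * ?r)"
      by (intro mult_mono power_le_fact_exp) (auto simp: norm_cauchy_schwarz)
    also have "\<dots> = fact k * exp (- A * ?r\<^sup>2 + B * ?r)"
      by (simp add: exp_add[symmetric] B_def algebra_simps)
    also have "\<dots> \<le> fact k * exp (B\<^sup>2 / (4 * A))"
    proof -
      have "0 \<le> A * (?r - B / (2 * A))\<^sup>2" using A by simp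
      also have "\<dots> = A * ?r\<^sup>2 - B * ?r + B\<^sup>2 / (4 * A)"
        using A by (simp add: power2_eq_square field_simps)
      finally show ?thesis by simp
    qed
    finally show ?thesis .
  qed
  then show ?case by (auto simp: bounded_iff)
next
  case (coord \<phi> j)
  show ?case by (rule bounded_coordinate[OF coord.IH])
next
  case (lincomb \<phi> \<psi> c d)
  then show ?case by (intro bounded_lincomb)
qed

lemma pd_gauss_span: "\<phi> \<in> gauss_span A b \<Longrightarrow> pd i \<phi> \<in> gauss_span A b"
proof (induction rule: gauss_span.induct)
  case gauss
  show ?case unfolding pd_gauss
    by (rule gauss_span.lincomb[OF gauss_span.coord[OF gauss_span.gauss] gauss_span.gauss])
next
  case (coord \<phi> j)
  have "pd i (\<lambda>x. of_real (x $ j) * \<phi> x) =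
      (\<lambda>x. (if i = j then 1 else 0) * \<phi> x + 1 * (of_real (x $ j) * pd i \<phi> x))"
    by (intro ext, subst pd_coordinate[OF gauss_span_differentiable[OF coord.hyps]]) simp
  then show ?case
    by (simp only: gauss_span.lincomb[OF coord.hyps gauss_span.coord[OF coord.IH]])
next
  case (lincomb \<phi> \<psi> c d)
  have "pd i (\<lambda>x. c * \<phi> x + d * \<psi> x) = (\<lambda>x. c * pd i \<phi> x + d * pd i \<psi> x)"
    by (intro ext pd_lincomb gauss_span_differentiable[OF lincomb.hyps(1)]
        gauss_span_differentiable[OF lincomb.hyps(2)])
  then show ?case using gauss_span.lincomb[OF lincomb.IH] by simp
qed

lemma gauss_schwartz: "A > 0 \<Longrightarrow> gauss A b \<in> schwartz"
  by (rule schwartz_coinduct[where S = "gauss_span A b"])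
     (auto simp: gauss_span.gauss gauss_span_differentiable gauss_span_bounded pd_gauss_span)

abbreviation "G0 \<equiv> gauss (1/2) 0"

definition "gauss_mass = (\<integral>x. exp (- (norm (x::real^3))\<^sup>2 / 2) \<partial>lborel)"

lemma G0_eq: "G0 x = of_real (exp (- (norm x)\<^sup>2 / 2))"
  by (simp add: gauss_def)

lemma G0_integrable: "integrable lborel (\<lambda>x::real^3. exp (- (norm x)\<^sup>2 / 2))"
  using schwartz_integrable[OF gauss_schwartz[of "1/2" 0], THEN integrable_norm]
  by (simp add: G0_eq)

lemma integral_G0: "(\<integral>x. G0 x \<partial>lborel) = of_real gauss_mass"
  by (simp add: G0_eq gauss_mass_def del: of_real_exp)

text \<open>The square of the total mass is the reciprocal of the constant in the inverse Fourier transform.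
  In the inversion formula one factor comes from the mass of the mollifier, the other from the
  transform of the Gaussian.\<close>

lemma gauss_mass_sq: "gauss_mass\<^sup>2 = (2 * pi) ^ 3"
proof -
  have "(\<integral>\<^sup>+(x::real). ennreal (exp (- x\<^sup>2 / 2)) \<partial>lborel) = ennreal (sqrt (2 * pi))"
  proof -
    have eq: "exp (- x\<^sup>2 / 2) = sqrt (2 * pi) * std_normal_density x" for x :: real
      by (simp add: std_normal_density_def)
    have "(\<integral>\<^sup>+(x::real). ennreal (exp (- x\<^sup>2 / 2)) \<partial>lborel) =
       ennreal (\<integral>x. sqrt (2 * pi) * std_normal_density x \<partial>lborel)"
      unfolding eq by (rule nn_integral_eq_integral) (auto intro!: integrable_mult_right)
    then show ?thesis by simp
  qed
  moreover have "ennreal gauss_mass = (\<integral>\<^sup>+(x::real^3). ennreal (exp (- (norm x)\<^sup>2 / 2)) \<partial>lborel)"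
    unfolding gauss_mass_def using G0_integrable by (intro nn_integral_eq_integral[symmetric]) auto
  moreover have "\<dots> = (\<integral>\<^sup>+(x::real^3). (\<Prod>b\<in>Basis. ennreal (exp (- (x \<bullet> b)\<^sup>2 / 2))) \<partial>lborel)"
  proof (intro nn_integral_cong)
    fix x :: "real^3"
    have "(norm x)\<^sup>2 = (\<Sum>b\<in>Basis. (x \<bullet> b)\<^sup>2)"
      by (subst power2_norm_eq_inner, subst euclidean_inner) (simp add: power2_eq_square)
    then have "exp (- (norm x)\<^sup>2 / 2) = (\<Prod>b\<in>Basis. exp (- (x \<bullet> b)\<^sup>2 / 2))"
      by (simp add: exp_sum[symmetric] sum_negf sum_divide_distrib)
    then show "ennreal (exp (- (norm x)\<^sup>2 / 2)) = (\<Prod>b\<in>Basis. ennreal (exp (- (x \<bullet> b)\<^sup>2 / 2)))"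
      by (simp add: prod_ennreal)
  qed
  moreover have "\<dots> = (\<Prod>b\<in>(Basis::(real^3) set). \<integral>\<^sup>+x. ennreal (exp (- x\<^sup>2 / 2)) \<partial>lborel)"
    by (rule nn_integral_lborel_prod) auto
  ultimately have "ennreal gauss_mass = ennreal (sqrt (2 * pi)) ^ 3" by simp
  also have "\<dots> = ennreal (sqrt (2 * pi) ^ 3)" by (simp add: ennreal_power)
  finally have "gauss_mass = sqrt (2 * pi) ^ 3"
    by (subst (asm) ennreal_inj) (auto simp: gauss_mass_def intro!: integral_nonneg_AE)
  then have "gauss_mass\<^sup>2 = ((sqrt (2 * pi))\<^sup>2) ^ 3"
  proof -
    have "(a ^ 3)\<^sup>2 = (a\<^sup>2) ^ 3" for a :: real by (simp add: power_mult[symmetric])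
    then show ?thesis by (simp only: \<open>gauss_mass = sqrt (2 * pi) ^ 3\<close>)
  qed
  also have "(sqrt (2 * pi))\<^sup>2 = 2 * pi" by (rule real_sqrt_pow2) simp
  finally show ?thesis .
qed

lemma gauss_mass_pos: "gauss_mass > 0"
proof -
  have "gauss_mass \<ge> 0" by (auto simp: gauss_mass_def intro!: integral_nonneg_AE)
  moreover have "gauss_mass \<noteq> 0" using gauss_mass_sq by auto
  ultimately show ?thesis by simp
qed

text \<open>The Gaussian satisfies \<open>\<partial>\<^sub>j G = -x\<^sub>j G\<close>, and the Fourier transform turns this equation into
  itself; hence the transform is a multiple of \<open>G\<close>.\<close>

lemma fourier_G0: "fourier G0 \<xi> = of_real gauss_mass * G0 \<xi>"
proof -
  have G: "G0 \<in> schwartz" by (simp add: gauss_schwartz)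
  have pdG: "pd j G0 = (\<lambda>x. (-1) * (of_real (x $ j) * G0 x))" for j
    unfolding pd_gauss by simp
  have pdF: "pd j (fourier G0) \<xi> = - of_real (\<xi> $ j) * fourier G0 \<xi>" for j \<xi>
  proof -
    have "pd j (fourier G0) \<xi> = fourier (\<lambda>x. \<i> * pd j G0 x) \<xi>"
      by (simp add: pd_fourier[OF G] pdG)
    also have "\<dots> = \<i> * fourier (pd j G0) \<xi>"
      by (simp add: fourier_def mult.left_commute[of _ \<i>])
    finally show ?thesis by (simp add: fourier_pd[OF G] mult.assoc)
  qed
  have D: "frechet_derivative (fourier G0) (at \<xi>) h = - of_real (\<xi> \<bullet> h) * fourier G0 \<xi>" for \<xi> h
  proof -
    let ?D = "frechet_derivative (fourier G0) (at \<xi>)"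
    have lin: "linear ?D"
      using schwartz_has_derivative[OF fourier_schwartz[OF G]] has_derivative_linear by blast
    have "h = (\<Sum>j\<in>UNIV. h $ j *\<^sub>R axis j 1)"
      using basis_expansion[of h] by (simp add: scalar_mult_eq_scaleR)
    then have "?D h = ?D (\<Sum>j\<in>UNIV. h $ j *\<^sub>R axis j 1)" by (rule arg_cong)
    also have "\<dots> = (\<Sum>j\<in>UNIV. h $ j *\<^sub>R pd j (fourier G0) \<xi>)"
      by (simp add: linear_sum[OF lin] linear_cmul[OF lin] pd_def)
    also have "\<dots> = - of_real (\<xi> \<bullet> h) * fourier G0 \<xi>"
      by (simp add: pdF inner_vec_def sum_distrib_left sum_negf[symmetric] scaleR_conv_of_real mult_ac)
    finally show ?thesis .
  qed
  define H where "H = (\<lambda>\<xi>. gauss (-1/2) 0 \<xi> * fourier G0 \<xi>)"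
  have "(H has_derivative (\<lambda>h. 0)) (at \<xi>)" for \<xi>
  proof -
    have "(H has_derivative (\<lambda>h. gauss (-1/2) 0 \<xi> * frechet_derivative (fourier G0) (at \<xi>) h +
        of_real (- 2 * (-1/2) * (\<xi> \<bullet> h) + 0 \<bullet> h) * gauss (-1/2) 0 \<xi> * fourier G0 \<xi>)) (at \<xi>)"
      unfolding H_def
      by (rule has_derivative_mult[OF gauss_has_derivative
            schwartz_has_derivative[OF fourier_schwartz[OF G]]])
    then show ?thesis by (simp add: D)
  qed
  then have "H \<xi> = H 0"
    using has_derivative_zero_unique[of UNIV H 0 \<xi>] by auto
  moreover have "H 0 = of_real gauss_mass"
    by (simp add: H_def gauss_def fourier_def gauss_mass_def del: of_real_exp)
  moreover have "G0 \<xi> * gauss (-1/2) 0 \<xi> = 1"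
    unfolding gauss_def of_real_mult[symmetric] exp_add[symmetric] by simp
  then have "fourier G0 \<xi> = G0 \<xi> * H \<xi>" by (simp add: H_def mult.assoc[symmetric])
  ultimately show ?thesis by (simp add: mult.commute)
qed

lemma lborel_integral_scale:
  fixes f :: "real^3 \<Rightarrow> 'b::{banach, second_countable_topology}"
  assumes [measurable]: "f \<in> borel_measurable borel" and "c > 0"
  shows "(\<integral>x. f x \<partial>lborel) = c ^ 3 *\<^sub>R (\<integral>x. f (t + c *\<^sub>R x) \<partial>lborel)"
proof -
  have "(\<integral>x. f x \<partial>lborel) =
     (\<integral>x. f x \<partial>density (distr lborel borel (\<lambda>x. t + c *\<^sub>R x)) (\<lambda>_. \<bar>c\<bar>^DIM(real^3)))"
    using assms by (subst lborel_affine[of c t]) auto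
  also have "\<dots> = (\<integral>x. c ^ 3 *\<^sub>R f x \<partial>distr lborel borel (\<lambda>x. t + c *\<^sub>R x))"
    using assms(2) by (subst integral_density) (auto simp: abs_of_pos)
  also have "\<dots> = (\<integral>x. c ^ 3 *\<^sub>R f (t + c *\<^sub>R x) \<partial>lborel)"
    by (subst integral_distr) auto
  finally show ?thesis by simp
qed

lemma (in pair_sigma_finite) integrable_pairI:
  fixes f :: "_ \<Rightarrow> _ \<Rightarrow> 'c::{banach, second_countable_topology}"
  assumes [measurable]: "case_prod f \<in> borel_measurable (M1 \<Otimes>\<^sub>M M2)"
    and "(\<integral>\<^sup>+x. \<integral>\<^sup>+y. ennreal (norm (f x y)) \<partial>M2 \<partial>M1) < \<infinity>"
  shows "integrable (M1 \<Otimes>\<^sub>M M2) (case_prod f)"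
proof (rule integrableI_bounded)
  have "(\<integral>\<^sup>+z. ennreal (norm (case_prod f z)) \<partial>(M1 \<Otimes>\<^sub>M M2)) =
      (\<integral>\<^sup>+x. \<integral>\<^sup>+y. ennreal (norm (f x y)) \<partial>M2 \<partial>M1)"
    by (subst M2.nn_integral_fst[symmetric]) auto
  with assms(2) show "(\<integral>\<^sup>+z. ennreal (norm (case_prod f z)) \<partial>(M1 \<Otimes>\<^sub>M M2)) < \<infinity>" by simp
qed fact

text \<open>Fubini's theorem for the kernel \<open>e\<^sup>-\<^sup>i\<^sup>x\<^sup>\<xi>\<close>.\<close>

lemma fourier_multiplication_formula:
  fixes f g :: test_fun
  assumes f: "integrable lborel f" and g: "integrable lborel g"
  shows "(\<integral>\<xi>. fourier f \<xi> * g \<xi> \<partial>lborel) = (\<integral>x. f x * fourier g x \<partial>lborel)"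
proof -
  note [measurable] = borel_measurable_integrable[OF f] borel_measurable_integrable[OF g]
  let ?F = "\<lambda>\<xi> x. exp (- \<i> * of_real (\<xi> \<bullet> x)) * f x * g \<xi>"
  have "(\<integral>\<^sup>+\<xi>. \<integral>\<^sup>+x. ennreal (norm (?F \<xi> x)) \<partial>lborel \<partial>lborel) =
      (\<integral>\<^sup>+\<xi>. ennreal (norm (g \<xi>)) * (\<integral>\<^sup>+x. ennreal (norm (f x)) \<partial>lborel) \<partial>lborel)"
    by (intro nn_integral_cong, subst nn_integral_cmult[symmetric])
       (auto simp: norm_mult ennreal_mult'[symmetric] mult_ac intro!: nn_integral_cong)
  also have "\<dots> < \<infinity>"
    using f g by (subst nn_integral_multc) (auto simp: integrable_iff_bounded ennreal_mult_less_top)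
  finally have "integrable (lborel \<Otimes>\<^sub>M lborel) (case_prod ?F)"
    by (intro lborel_pair.integrable_pairI) (auto simp: case_prod_beta)
  from lborel_pair.Fubini_integral[OF this]
  have "(\<integral>\<xi>. \<integral>x. ?F \<xi> x \<partial>lborel \<partial>lborel) = (\<integral>x. \<integral>\<xi>. ?F \<xi> x \<partial>lborel \<partial>lborel)" by simp
  moreover have "(\<integral>x. ?F \<xi> x \<partial>lborel) = fourier f \<xi> * g \<xi>" for \<xi>
    unfolding fourier_def by (rule integral_mult_left_zero)
  moreover have "(\<integral>\<xi>. ?F \<xi> x \<partial>lborel) = f x * fourier g x" for x
  proof -
    have "(\<integral>\<xi>. ?F \<xi> x \<partial>lborel) = (\<integral>\<xi>. f x * (exp (- \<i> * of_real (x \<bullet> \<xi>)) * g \<xi>) \<partial>lborel)"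
      by (intro Bochner_Integration.integral_cong refl) (simp add: inner_commute mult_ac)
    then show ?thesis by (simp add: fourier_def)
  qed
  ultimately show ?thesis by (simp only:)
qed


text \<open>Inversion: test \<open>\<integral> fourier \<phi> \<cdot> e\<^sup>i\<^sup>x\<^sup>\<xi>\<close> against the regulariser \<open>G (\<epsilon>\<xi>)\<close>, move the Fourier
  transform onto the regulariser, and let \<open>\<epsilon>\<close> tend to zero on both sides.\<close>

lemma fourier_regulariser:
  assumes "\<epsilon> > 0"
  shows "fourier (\<lambda>\<xi>. exp (\<i> * of_real (x \<bullet> \<xi>)) * G0 (\<epsilon> *\<^sub>R \<xi>)) y =
    of_real (gauss_mass / \<epsilon> ^ 3) * G0 ((y - x) /\<^sub>R \<epsilon>)"
proof -
  let ?z = "(y - x) /\<^sub>R \<epsilon>"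
  let ?f = "\<lambda>\<xi>. exp (- \<i> * of_real (?z \<bullet> \<xi>)) * G0 \<xi>"
  note [measurable] = schwartz_measurable[OF gauss_schwartz[of "1/2" 0], simplified]
  have "of_real gauss_mass * G0 ?z = (\<integral>\<xi>. ?f \<xi> \<partial>lborel)"
    by (simp only: fourier_G0[symmetric] fourier_def)
  also have "\<dots> = \<epsilon> ^ 3 *\<^sub>R (\<integral>\<xi>. ?f (0 + \<epsilon> *\<^sub>R \<xi>) \<partial>lborel)"
    by (rule lborel_integral_scale[OF _ assms]) measurable
  also have "(\<integral>\<xi>. ?f (0 + \<epsilon> *\<^sub>R \<xi>) \<partial>lborel) =
     fourier (\<lambda>\<xi>. exp (\<i> * of_real (x \<bullet> \<xi>)) * G0 (\<epsilon> *\<^sub>R \<xi>)) y"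
    unfolding fourier_def
  proof (intro Bochner_Integration.integral_cong refl)
    fix \<xi> :: "real^3"
    have "exp (- \<i> * of_real (?z \<bullet> (0 + \<epsilon> *\<^sub>R \<xi>))) = exp (- \<i> * of_real (y \<bullet> \<xi>)) * exp (\<i> * of_real (x \<bullet> \<xi>))"
    proof -
      have "?z \<bullet> (0 + \<epsilon> *\<^sub>R \<xi>) = y \<bullet> \<xi> - x \<bullet> \<xi>"
        using assms by (simp add: inner_diff_left)
      then show ?thesis by (simp only: exp_add[symmetric]) (simp add: algebra_simps)
    qed
    then show "?f (0 + \<epsilon> *\<^sub>R \<xi>) = exp (- \<i> * of_real (y \<bullet> \<xi>)) * (exp (\<i> * of_real (x \<bullet> \<xi>)) * G0 (\<epsilon> *\<^sub>R \<xi>))"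
      by (simp only: mult.assoc add_0_left)
  qed
  finally have "of_real gauss_mass * G0 ?z = \<epsilon> ^ 3 *\<^sub>R fourier (\<lambda>\<xi>. exp (\<i> * of_real (x \<bullet> \<xi>)) * G0 (\<epsilon> *\<^sub>R \<xi>)) y" .
  then show ?thesis
    using assms by (simp add: scaleR_conv_of_real field_simps)
qed

lemma seq_to_zero:
  defines "h \<equiv> \<lambda>n. 1 / (real n + 1)"
  shows "h n > 0" "h n \<le> 1" "h \<longlonglongrightarrow> 0"
  unfolding h_def using LIMSEQ_inverse_real_of_nat
  by (simp_all add: inverse_eq_divide add.commute)

text \<open>Rescaled Gaussians form an approximate identity at every point of continuity of a bounded
  function. Continuity at the single point \<open>x\<close> suffices, so that \<open>f\<close> may be the indicator of a box.\<close>

lemma gauss_mollify: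
  fixes f :: test_fun
  assumes meas [measurable]: "f \<in> borel_measurable borel" and bdd: "\<And>x. norm (f x) \<le> B"
    and cont: "(\<lambda>z. f (x + z)) \<midarrow>0\<rightarrow> f x"
  shows "(\<lambda>n. \<integral>z. f (x + (1 / (real n + 1)) *\<^sub>R z) * G0 z \<partial>lborel) \<longlonglongrightarrow> f x * of_real gauss_mass"
proof -
  define h where "h n = 1 / (real n + 1)" for n :: nat
  note h = seq_to_zero[folded h_def]
  note [measurable] = schwartz_measurable[OF gauss_schwartz[of "1/2" 0], simplified]
  have "(\<lambda>n. \<integral>z. f (x + h n *\<^sub>R z) * G0 z \<partial>lborel) \<longlonglongrightarrow> (\<integral>z. f x * G0 z \<partial>lborel)"
  proof (rule integral_dominated_convergence[where w = "\<lambda>z. B * norm (G0 z)"])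
    show "integrable lborel (\<lambda>z. B * norm (G0 z))"
      using schwartz_integrable[OF gauss_schwartz[of "1/2" 0]] by simp
    show "AE z in lborel. (\<lambda>n. f (x + h n *\<^sub>R z) * G0 z) \<longlonglongrightarrow> f x * G0 z"
    proof (intro AE_I2 tendsto_intros)
      fix z :: "real^3"
      show "(\<lambda>n. f (x + h n *\<^sub>R z)) \<longlonglongrightarrow> f x"
      proof (cases "z = 0")
        case False
        have "(\<lambda>n. h n *\<^sub>R z) \<longlonglongrightarrow> 0"
          using tendsto_scaleR[OF h(3) tendsto_const[of z]] by simp
        then have "filterlim (\<lambda>n. h n *\<^sub>R z) (at 0) sequentially"
          using False h(1) by (auto simp: filterlim_at less_imp_neq intro!: always_eventually)
             (metis less_irrefl)
        from filterlim_compose[OF cont this] show ?thesis .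
      qed simp
    qed
    show "AE z in lborel. norm (f (x + h n *\<^sub>R z) * G0 z) \<le> B * norm (G0 z)" for n
      using bdd by (auto simp: norm_mult intro!: mult_right_mono)
  qed measurable
  then show ?thesis by (simp add: h_def integral_G0 del: of_real_exp)
qed

lemma inv_fourier_eq: "inv_fourier \<phi> x = of_real (1 / (2 * pi) ^ 3) * fourier \<phi> (- x)"
  by (simp add: inv_fourier_def fourier_def inner_commute)

lemma fourier_inversion:
  assumes \<phi>: "\<phi> \<in> schwartz"
  shows "inv_fourier (fourier \<phi>) = \<phi>"
proof
  fix x :: "real^3"
  define h where "h n = 1 / (real n + 1)" for n :: nat
  note h = seq_to_zero[folded h_def]
  note [measurable] = schwartz_measurable[OF gauss_schwartz[of "1/2" 0], simplified]
    schwartz_measurable[OF \<phi>] schwartz_measurable[OF fourier_schwartz[OF \<phi>]]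
  let ?\<psi> = "\<lambda>n \<xi>. exp (\<i> * of_real (x \<bullet> \<xi>)) * G0 (h n *\<^sub>R \<xi>)"
  have "(\<lambda>n. \<integral>\<xi>. fourier \<phi> \<xi> * ?\<psi> n \<xi> \<partial>lborel) \<longlonglongrightarrow> (\<integral>\<xi>. fourier \<phi> \<xi> * exp (\<i> * of_real (x \<bullet> \<xi>)) \<partial>lborel)"
  proof (rule integral_dominated_convergence[where w = "\<lambda>\<xi>. norm (fourier \<phi> \<xi>)"])
    show "integrable lborel (\<lambda>\<xi>. norm (fourier \<phi> \<xi>))"
      by (intro integrable_norm schwartz_integrable fourier_schwartz \<phi>)
    show "AE \<xi> in lborel. (\<lambda>n. fourier \<phi> \<xi> * ?\<psi> n \<xi>) \<longlonglongrightarrow> fourier \<phi> \<xi> * exp (\<i> * of_real (x \<bullet> \<xi>))"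
    proof (intro AE_I2)
      fix \<xi> :: "real^3"
      have "(\<lambda>n. G0 (h n *\<^sub>R \<xi>)) \<longlonglongrightarrow> of_real (exp (- (norm (0 *\<^sub>R \<xi>))\<^sup>2 / 2))"
        unfolding G0_eq by (intro tendsto_intros h) simp
      then have "(\<lambda>n. fourier \<phi> \<xi> * ?\<psi> n \<xi>) \<longlonglongrightarrow> fourier \<phi> \<xi> * (exp (\<i> * of_real (x \<bullet> \<xi>)) * of_real (exp (- (norm (0 *\<^sub>R \<xi>))\<^sup>2 / 2)))"
        by (intro tendsto_mult tendsto_const)
      then show "(\<lambda>n. fourier \<phi> \<xi> * ?\<psi> n \<xi>) \<longlonglongrightarrow> fourier \<phi> \<xi> * exp (\<i> * of_real (x \<bullet> \<xi>))" by simp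
    qed
    show "AE \<xi> in lborel. norm (fourier \<phi> \<xi> * ?\<psi> n \<xi>) \<le> norm (fourier \<phi> \<xi>)" for n
      by (auto simp: norm_mult G0_eq intro!: mult_left_le simp del: of_real_exp)
  qed measurable
  moreover have "(\<integral>\<xi>. fourier \<phi> \<xi> * ?\<psi> n \<xi> \<partial>lborel) = of_real gauss_mass * (\<integral>z. \<phi> (x + h n *\<^sub>R z) * G0 z \<partial>lborel)" for n
  proof -
    have int: "integrable lborel (?\<psi> n)"
    proof (rule integrable_mult_bounded[where B = 1])
      have "(\<lambda>\<xi>. G0 (h n *\<^sub>R \<xi>)) = gauss ((h n)\<^sup>2 / 2) 0"
        by (simp add: gauss_def power_mult_distrib fun_eq_iff)
      then show "integrable lborel (\<lambda>\<xi>. G0 (h n *\<^sub>R \<xi>))"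
        using schwartz_integrable[OF gauss_schwartz[of "(h n)\<^sup>2 / 2" 0]] h(1)[of n] by simp
    qed auto
    have "(\<integral>\<xi>. fourier \<phi> \<xi> * ?\<psi> n \<xi> \<partial>lborel) = (\<integral>y. \<phi> y * fourier (?\<psi> n) y \<partial>lborel)"
      by (rule fourier_multiplication_formula[OF schwartz_integrable[OF \<phi>] int])
    also have "\<dots> = (\<integral>y. of_real (gauss_mass / h n ^ 3) * (\<phi> y * G0 ((y - x) /\<^sub>R h n)) \<partial>lborel)"
      by (simp only: fourier_regulariser[OF h(1)] mult.left_commute)
    also have "\<dots> = of_real (gauss_mass / h n ^ 3) * (\<integral>y. \<phi> y * G0 ((y - x) /\<^sub>R h n) \<partial>lborel)"
      by (rule integral_mult_right_zero)
    also have "(\<integral>y. \<phi> y * G0 ((y - x) /\<^sub>R h n) \<partial>lborel) =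
        h n ^ 3 *\<^sub>R (\<integral>z. \<phi> (x + h n *\<^sub>R z) * G0 ((x + h n *\<^sub>R z - x) /\<^sub>R h n) \<partial>lborel)"
      by (rule lborel_integral_scale[OF _ h(1)]) measurable
    also have "(\<lambda>z. \<phi> (x + h n *\<^sub>R z) * G0 ((x + h n *\<^sub>R z - x) /\<^sub>R h n)) = (\<lambda>z. \<phi> (x + h n *\<^sub>R z) * G0 z)"
      using h(1)[of n] by simp
    finally show ?thesis using h(1)[of n] by (simp add: scaleR_conv_of_real[where 'a = complex])
  qed
  moreover have "(\<lambda>n. of_real gauss_mass * (\<integral>z. \<phi> (x + h n *\<^sub>R z) * G0 z \<partial>lborel)) \<longlonglongrightarrow>
      of_real gauss_mass * (\<phi> x * of_real gauss_mass)"
    unfolding h_def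
  proof (intro tendsto_mult_left gauss_mollify)
    show "norm (\<phi> y) \<le> seminorm 0 \<phi>" for y using seminorm_ge[OF \<phi>, of y 0] by simp
    have "isCont \<phi> x"
      using schwartz_differentiable[OF \<phi>] differentiable_imp_continuous_within by blast
    then show "(\<lambda>z. \<phi> (x + z)) \<midarrow>0\<rightarrow> \<phi> x" by (simp add: isCont_iff)
  qed measurable
  ultimately have "(\<integral>\<xi>. fourier \<phi> \<xi> * exp (\<i> * of_real (x \<bullet> \<xi>)) \<partial>lborel) = of_real (gauss_mass\<^sup>2) * \<phi> x"
    using LIMSEQ_unique by (simp add: power2_eq_square mult_ac)
  then have "inv_fourier (fourier \<phi>) x = of_real (1 / (2 * pi) ^ 3) * (of_real (gauss_mass\<^sup>2) * \<phi> x)"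
    by (simp add: inv_fourier_def inner_commute mult.commute)
  then show "inv_fourier (fourier \<phi>) x = \<phi> x" by (simp add: gauss_mass_sq)
qed

lemma integral_reflect:
  fixes f :: "real^3 \<Rightarrow> 'b::{banach, second_countable_topology}"
  assumes [measurable]: "f \<in> borel_measurable borel"
  shows "(\<integral>x. f (- x) \<partial>lborel) = (\<integral>x. f x \<partial>lborel)"
proof -
  have "(\<integral>x. f x \<partial>lborel) = (\<integral>x. f x \<partial>distr lborel borel uminus)"
    using lborel_affine[of "-1" "0::real^3"] by (simp add: density_1)
  also have "\<dots> = (\<integral>x. f (- x) \<partial>lborel)"
    by (subst integral_distr) auto
  finally show ?thesis by simp
qed

text \<open>Reflecting the variable exchanges the transform and its inverse, up to the constant, so that
  this composition reduces to \<open>fourier_inversion\<close>.\<close>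

lemma fourier_inv_fourier:
  assumes \<phi>: "\<phi> \<in> schwartz"
  shows "fourier (inv_fourier \<phi>) = \<phi>"
proof
  fix \<xi>
  note [measurable] = schwartz_measurable[OF fourier_schwartz[OF \<phi>]]
  have "fourier (inv_fourier \<phi>) \<xi> = of_real (1 / (2 * pi) ^ 3) *
      (\<integral>x. exp (- \<i> * of_real (\<xi> \<bullet> x)) * fourier \<phi> (- x) \<partial>lborel)"
    unfolding fourier_def[of "inv_fourier \<phi>"] inv_fourier_eq mult.left_commute[of _ "of_real _"]
    by (rule integral_mult_right_zero)
  also have "(\<integral>x. exp (- \<i> * of_real (\<xi> \<bullet> x)) * fourier \<phi> (- x) \<partial>lborel) =
      (\<integral>x. exp (\<i> * of_real (\<xi> \<bullet> x)) * fourier \<phi> x \<partial>lborel)"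
    by (subst integral_reflect[symmetric]) auto
  also have "of_real (1 / (2 * pi) ^ 3) * \<dots> = inv_fourier (fourier \<phi>) \<xi>"
    by (simp add: inv_fourier_def inner_commute[of _ \<xi>])
  finally show "fourier (inv_fourier \<phi>) \<xi> = \<phi> \<xi>" by (simp add: fourier_inversion[OF \<phi>])
qed

lemma schwartz_reflect:
  assumes "\<phi> \<in> schwartz"
  shows "(\<lambda>x. \<phi> (- x)) \<in> schwartz"
proof (rule schwartz_coinduct)
  let ?S = "{(\<lambda>x. c * \<phi> (- x)) |c \<phi>. \<phi> \<in> schwartz}"
  show "(\<lambda>x. \<phi> (- x)) \<in> ?S" using assms by (intro CollectI exI[of _ 1] exI[of _ \<phi>]) simp
  have D: "((\<lambda>x. c * \<phi> (- x)) has_derivative (\<lambda>h. c * frechet_derivative \<phi> (at (- x)) (- h))) (at x)"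
    if "\<phi> \<in> schwartz" for c \<phi> x
    by (intro derivative_intros has_derivative_compose[OF _ schwartz_has_derivative[OF that]])
  fix \<rho> assume "\<rho> \<in> ?S"
  then obtain c \<phi> where \<rho>: "\<rho> = (\<lambda>x. c * \<phi> (- x))" and \<phi>: "\<phi> \<in> schwartz" by auto
  show "\<rho> differentiable (at x)" for x unfolding \<rho> using D[OF \<phi>] by (rule differentiableI)
  show "bounded (range (\<lambda>x. norm x ^ k *\<^sub>R \<rho> x))" for k
  proof -
    obtain M where M: "\<And>x. norm (norm x ^ k *\<^sub>R \<phi> x) \<le> M"
      using schwartz_bounded[OF \<phi>] unfolding bounded_iff by auto
    have "norm (norm x ^ k *\<^sub>R \<rho> x) \<le> norm c * M" for x
      using mult_left_mono[OF M[of "- x"], of "norm c"] by (simp add: \<rho> norm_mult mult_ac)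
    then show ?thesis by (auto simp: bounded_iff)
  qed
  show "pd j \<rho> \<in> ?S" for j
  proof -
    have "pd j \<rho> x = (- c) * pd j \<phi> (- x)" for x
    proof -
      have "linear (frechet_derivative \<phi> (at (- x)))"
        using schwartz_has_derivative[OF \<phi>] has_derivative_linear by blast
      then show ?thesis
        unfolding \<rho> by (subst pd_eqI[OF D[OF \<phi>]]) (simp add: pd_def linear_neg)
    qed
    then have "pd j \<rho> = (\<lambda>x. (- c) * pd j \<phi> (- x))" by (rule ext)
    with schwartz_pd[OF \<phi>] show ?thesis by (intro CollectI exI conjI)
  qed
qed

lemma inv_fourier_schwartz:
  assumes "\<phi> \<in> schwartz" shows "inv_fourier \<phi> \<in> schwartz"
proof -
  have "inv_fourier \<phi> = (\<lambda>x. of_real (1 / (2 * pi) ^ 3) * fourier \<phi> (- x))"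
    by (intro ext inv_fourier_eq)
  then show ?thesis
    by (simp only: schwartz_cmult[OF schwartz_reflect[OF fourier_schwartz[OF assms]]])
qed

section \<open>Functions determined by their Schwartz pairings\<close>

lemma locally_integrable_measurable:
  assumes "locally_integrable g"
  shows "g \<in> borel_measurable borel"
proof (rule borel_measurable_LIMSEQ_metric)
  fix n :: nat
  have "set_integrable lborel (cball 0 (real n)) g"
    using assms by (simp add: locally_integrable_def)
  then show "(\<lambda>x. indicator (cball 0 (real n)) x *\<^sub>R g x) \<in> borel_measurable borel"
    by (simp add: set_integrable_def borel_measurable_integrable)
next
  fix x :: "real^3"
  have "eventually (\<lambda>n. indicator (cball 0 (real n)) x *\<^sub>R g x = g x) sequentially"
    using eventually_ge_at_top[of "nat \<lceil>norm x\<rceil>"]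
  proof eventually_elim
    case (elim n)
    then have "norm x \<le> real n" by linarith
    then show ?case by simp
  qed
  then show "(\<lambda>n. indicator (cball 0 (real n)) x *\<^sub>R g x) \<longlonglongrightarrow> g x"
    by (rule tendsto_eventually)
qed

lemma G0_rescaled_times_gauss:
  "G0 ((x - y) /\<^sub>R \<epsilon>) * gauss 1 0 x =
    of_real (exp (- (norm y)\<^sup>2 / (2 * \<epsilon>\<^sup>2))) * gauss (1 + 1 / (2 * \<epsilon>\<^sup>2)) (y /\<^sub>R \<epsilon>\<^sup>2) x"
proof -
  have n: "(norm (x - y))\<^sup>2 = (norm x)\<^sup>2 - 2 * (y \<bullet> x) + (norm y)\<^sup>2"
    by (simp add: power2_norm_eq_inner algebra_simps inner_commute)
  have "- (norm ((x - y) /\<^sub>R \<epsilon>))\<^sup>2 / 2 + (- (norm x)\<^sup>2) =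
     - (norm y)\<^sup>2 / (2 * \<epsilon>\<^sup>2) + (- (1 + 1 / (2 * \<epsilon>\<^sup>2)) * (norm x)\<^sup>2 + (y /\<^sub>R \<epsilon>\<^sup>2) \<bullet> x)"
  proof -
    define k where "k = inverse (\<epsilon>\<^sup>2)"
    have k: "1 / (2 * \<epsilon>\<^sup>2) = k / 2" "- (norm y)\<^sup>2 / (2 * \<epsilon>\<^sup>2) = - (k * (norm y)\<^sup>2) / 2"
      by (simp_all add: k_def field_simps)
    have s: "(norm ((x - y) /\<^sub>R \<epsilon>))\<^sup>2 = k * (norm (x - y))\<^sup>2"
      by (simp add: k_def power_mult_distrib power_inverse)
    show ?thesis unfolding s k n k_def[symmetric] inner_scaleR_left
      by (simp add: algebra_simps add_divide_distrib diff_divide_distrib)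
  qed
  then have "exp (- (norm ((x - y) /\<^sub>R \<epsilon>))\<^sup>2 / 2 + (- (norm x)\<^sup>2)) =
     exp (- (norm y)\<^sup>2 / (2 * \<epsilon>\<^sup>2) + (- (1 + 1 / (2 * \<epsilon>\<^sup>2)) * (norm x)\<^sup>2 + (y /\<^sub>R \<epsilon>\<^sup>2) \<bullet> x))"
    by (rule arg_cong)
  then have "exp (- (norm ((x - y) /\<^sub>R \<epsilon>))\<^sup>2 / 2) * exp (- (norm x)\<^sup>2) =
     exp (- (norm y)\<^sup>2 / (2 * \<epsilon>\<^sup>2)) * exp (- (1 + 1 / (2 * \<epsilon>\<^sup>2)) * (norm x)\<^sup>2 + (y /\<^sub>R \<epsilon>\<^sup>2) \<bullet> x)"
    by (simp only: exp_add)
  then show ?thesis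
    unfolding gauss_def of_real_mult[symmetric] by simp
qed

text \<open>Pairing with Gaussians of shrinking width and averaging their centres over a box produces,
  in the limit, the integral over the box. The extra factor \<open>gauss 1 0\<close> makes \<open>g\<close> integrable
  while leaving all test functions Gaussian.\<close>

lemma box_integral_zero:
  assumes meas [measurable]: "g \<in> borel_measurable borel"
    and int: "\<And>\<phi>. \<phi> \<in> schwartz \<Longrightarrow> integrable lborel (\<lambda>x. g x * \<phi> x)"
    and zero: "\<And>\<phi>. \<phi> \<in> schwartz \<Longrightarrow> (\<integral>x. g x * \<phi> x \<partial>lborel) = 0"
  shows "(\<integral>x. indicator (box a b) x *\<^sub>R (g x * gauss 1 0 x) \<partial>lborel) = 0"
proof -
  define h where "h = (\<lambda>x. g x * gauss 1 0 x)"
  define f :: test_fun where "f = (\<lambda>y. indicator (box a b) y)"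
  define e where "e n = 1 / (real n + 1)" for n :: nat
  note e = seq_to_zero[folded e_def]
  note [measurable] = schwartz_measurable[OF gauss_schwartz[of "1/2" 0], simplified]
    schwartz_measurable[OF gauss_schwartz[of 1 0], simplified]
  have [measurable]: "h \<in> borel_measurable borel" "f \<in> borel_measurable borel"
    unfolding h_def f_def by measurable
  have h: "integrable lborel h" unfolding h_def by (intro int gauss_schwartz) simp
  have fint: "integrable lborel f"
    unfolding f_def by (rule integrable_real_indicator[THEN integrable_of_real, where 'a = complex, simplified of_real_indicator])
      (use emeasure_lborel_box_finite[of a b] in auto)
  have normf: "norm (f x) \<le> 1" for x by (auto simp: f_def indicator_def)
  define m where "m n x = (\<integral>z. f (x + e n *\<^sub>R z) * G0 z \<partial>lborel)" for n x
  have G0n: "norm (G0 z) \<le> 1" for z by (simp add: G0_eq del: of_real_exp)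
  have hm: "(\<integral>x. h x * m n x \<partial>lborel) = 0" for n
  proof -
    let ?F = "\<lambda>x y. h x * (f y * G0 ((x - y) /\<^sub>R e n))"
    have "(\<integral>\<^sup>+x. \<integral>\<^sup>+y. ennreal (norm (?F x y)) \<partial>lborel \<partial>lborel) \<le>
        (\<integral>\<^sup>+x. \<integral>\<^sup>+y. ennreal (norm (h x)) * ennreal (norm (f y)) \<partial>lborel \<partial>lborel)"
      by (intro nn_integral_mono)
        (auto simp: norm_mult ennreal_mult'[symmetric] intro!: ennreal_leI mult_left_mono mult_left_le G0n)
    also have "\<dots> = (\<integral>\<^sup>+x. ennreal (norm (h x)) \<partial>lborel) * (\<integral>\<^sup>+y. ennreal (norm (f y)) \<partial>lborel)"
      by (simp add: nn_integral_cmult nn_integral_multc)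
    also have "\<dots> < \<infinity>" using h fint by (auto simp: integrable_iff_bounded ennreal_mult_less_top)
    finally have "integrable (lborel \<Otimes>\<^sub>M lborel) (case_prod ?F)"
      by (intro lborel_pair.integrable_pairI) (auto simp: case_prod_beta)
    from lborel_pair.Fubini_integral[OF this]
    have "(\<integral>x. \<integral>y. ?F x y \<partial>lborel \<partial>lborel) = (\<integral>y. \<integral>x. ?F x y \<partial>lborel \<partial>lborel)" by simp
    also have "\<dots> = (\<integral>(y::real^3). 0 \<partial>lborel)"
    proof (intro Bochner_Integration.integral_cong refl)
      fix y :: "real^3"
      let ?\<phi> = "gauss (1 + 1 / (2 * (e n)\<^sup>2)) (y /\<^sub>R (e n)\<^sup>2)"
      let ?c = "f y * of_real (exp (- (norm y)\<^sup>2 / (2 * (e n)\<^sup>2)))"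
      have "?F x y = ?c * (g x * ?\<phi> x)" for x
      proof -
        have "?F x y = f y * g x * (G0 ((x - y) /\<^sub>R e n) * gauss 1 0 x)" by (simp add: h_def)
        also have "\<dots> = ?c * (g x * ?\<phi> x)" unfolding G0_rescaled_times_gauss by (simp only: mult_ac)
        finally show ?thesis .
      qed
      then have "(\<integral>x. ?F x y \<partial>lborel) = ?c * (\<integral>x. g x * ?\<phi> x \<partial>lborel)"
        by (simp only: integral_mult_right_zero)
      also have "\<dots> = 0"
        by (subst zero[OF gauss_schwartz]) (auto intro: add_pos_nonneg)
      finally show "(\<integral>x. ?F x y \<partial>lborel) = 0" .
    qed
    also have "(\<lambda>x. \<integral>y. ?F x y \<partial>lborel) = (\<lambda>x. of_real (e n ^ 3) * (h x * m n x))"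
    proof
      fix x
      have "(\<integral>y. ?F x y \<partial>lborel) = h x * (\<integral>y. f y * G0 ((x - y) /\<^sub>R e n) \<partial>lborel)"
        by (rule integral_mult_right_zero)
      also have "(\<integral>y. f y * G0 ((x - y) /\<^sub>R e n) \<partial>lborel) =
          e n ^ 3 *\<^sub>R (\<integral>z. f (x + e n *\<^sub>R z) * G0 ((x - (x + e n *\<^sub>R z)) /\<^sub>R e n) \<partial>lborel)"
        by (rule lborel_integral_scale[OF _ e(1)]) measurable
      also have "(\<lambda>z. f (x + e n *\<^sub>R z) * G0 ((x - (x + e n *\<^sub>R z)) /\<^sub>R e n)) = (\<lambda>z. f (x + e n *\<^sub>R z) * G0 z)"
        using e(1)[of n] by (simp add: G0_eq)
      finally show "(\<integral>y. ?F x y \<partial>lborel) = of_real (e n ^ 3) * (h x * m n x)"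
        by (simp add: m_def scaleR_conv_of_real[where 'a = complex])
    qed
    finally have "of_real (e n ^ 3) * (\<integral>x. h x * m n x \<partial>lborel) = 0"
      by (simp only: integral_mult_right_zero) simp
    then show ?thesis using e(1)[of n] by simp
  qed
  have "(\<lambda>n. \<integral>x. h x * m n x \<partial>lborel) \<longlonglongrightarrow> (\<integral>x. h x * (f x * of_real gauss_mass) \<partial>lborel)"
  proof (rule integral_dominated_convergence[where w = "\<lambda>x. norm (h x) * gauss_mass"])
    show "integrable lborel (\<lambda>x. norm (h x) * gauss_mass)" using h by simp
    have "cbox a b - box a b \<in> null_sets lborel"
      using negligible_frontier_interval[of a b]
      by (simp add: negligible_iff_null_sets null_sets_completion_iff)
    from AE_not_in[OF this] show "AE x in lborel. (\<lambda>n. h x * m n x) \<longlonglongrightarrow> h x * (f x * of_real gauss_mass)"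
    proof eventually_elim
      fix x assume x: "x \<notin> cbox a b - box a b"
      have "(\<lambda>z. f (x + z)) \<midarrow>0\<rightarrow> f x"
      proof (rule tendsto_eventually)
        have c: "((\<lambda>z. x + z) \<longlongrightarrow> x + 0) (at 0)" by (intro tendsto_intros)
        consider "x \<in> box a b" | "x \<in> - cbox a b" using x by auto
        then show "\<forall>\<^sub>F z in at 0. f (x + z) = f x"
        proof cases
          case 1
          then have "\<forall>\<^sub>F z in at 0. x + z \<in> box a b"
            using topological_tendstoD[OF c open_box] by simp
          then show ?thesis by eventually_elim (use 1 in \<open>simp add: f_def\<close>)
        next
          case 2
          then have "\<forall>\<^sub>F z in at 0. x + z \<in> - cbox a b"
            using topological_tendstoD[OF c, of "- cbox a b"] by (simp add: closed_cbox open_Compl)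
          then show ?thesis
            by eventually_elim (use 2 box_subset_cbox[of a b] in \<open>auto simp: f_def indicator_def\<close>)
        qed
      qed
      from gauss_mollify[OF \<open>f \<in> borel_measurable borel\<close> normf this]
      show "(\<lambda>n. h x * m n x) \<longlonglongrightarrow> h x * (f x * of_real gauss_mass)"
        unfolding m_def e_def by (intro tendsto_mult_left)
    qed
    show "AE x in lborel. norm (h x * m n x) \<le> norm (h x) * gauss_mass" for n
    proof (intro AE_I2)
      fix x
      have "norm (m n x) \<le> (\<integral>z. exp (- (norm z)\<^sup>2 / 2) \<partial>(lborel :: (real^3) measure))"
        unfolding m_def
      proof (rule Bochner_Integration.integral_norm_bound_integral)
        show "integrable lborel (\<lambda>z. f (x + e n *\<^sub>R z) * G0 z)"
          using schwartz_integrable[OF gauss_schwartz[of "1/2" 0]] normf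
          by (intro integrable_mult_bounded) auto
        show "norm (f (x + e n *\<^sub>R z) * G0 z) \<le> exp (- (norm z)\<^sup>2 / 2)" for z
          using normf mult_right_mono[OF normf, of "norm (G0 z)"]
          by (simp add: norm_mult G0_eq del: of_real_exp)
      qed (rule G0_integrable)
      then show "norm (h x * m n x) \<le> norm (h x) * gauss_mass"
        unfolding gauss_mass_def[symmetric] norm_mult by (intro mult_left_mono) auto
    qed
    show "(\<lambda>x. h x * m n x) \<in> borel_measurable lborel" for n
      unfolding m_def by measurable
  qed measurable
  then have "(\<integral>x. h x * (f x * of_real gauss_mass) \<partial>lborel) = 0"
    unfolding hm by (simp add: LIMSEQ_const_iff)
  moreover have "(\<lambda>x. h x * (f x * of_real gauss_mass)) =
     (\<lambda>x. of_real gauss_mass * (indicator (box a b) x *\<^sub>R (g x * gauss 1 0 x)))"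
    by (auto simp: h_def f_def indicator_def)
  ultimately have "of_real gauss_mass * (\<integral>x. indicator (box a b) x *\<^sub>R (g x * gauss 1 0 x) \<partial>lborel) = 0"
    by (simp only: integral_mult_right_zero)
  then show ?thesis using gauss_mass_pos by simp
qed

text \<open>Boxes are a generator of the Borel sets that is stable under intersections, so that the
  integral of \<open>h\<close> over every Borel set vanishes.\<close>

lemma AE_zero_if_box_integrals_zero:
  fixes h :: "'a::euclidean_space \<Rightarrow> complex"
  assumes h: "integrable lborel h"
    and box: "\<And>a b. (\<integral>x. indicator (box a b) x *\<^sub>R h x \<partial>lborel) = 0"
  shows "AE x in lborel. h x = 0"
proof -
  note [measurable] = borel_measurable_integrable[OF h]
  let ?I = "\<lambda>A. (\<integral>x. indicator A x *\<^sub>R h x \<partial>lborel)"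
  have int: "integrable lborel (\<lambda>x. indicator A x *\<^sub>R h x)" if "A \<in> sets borel" for A
    using that by (intro integrable_mult_indicator h) auto
  have dom: "norm (indicator A x *\<^sub>R h x) \<le> norm (h x)" for A x
    by (auto simp: indicator_def)
  have UNIV: "?I UNIV = 0"
  proof -
    have "(\<lambda>n. ?I (box (- (real n *\<^sub>R One)) (real n *\<^sub>R One))) \<longlonglongrightarrow> ?I UNIV"
    proof (rule integral_dominated_convergence[where w = "\<lambda>x. norm (h x)"])
      show "AE x in lborel. (\<lambda>n. indicator (box (- (real n *\<^sub>R One)) (real n *\<^sub>R One)) x *\<^sub>R h x)
          \<longlonglongrightarrow> indicator UNIV x *\<^sub>R h x"
      proof (intro AE_I2 tendsto_eventually)
        fix x :: 'a
        obtain i where i: "x \<in> box (- (real i *\<^sub>R One)) (real i *\<^sub>R One)"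
          using UN_box_eq_UNIV[where 'a = 'a] by blast
        show "\<forall>\<^sub>F n in sequentially. indicator (box (- (real n *\<^sub>R One)) (real n *\<^sub>R One)) x *\<^sub>R h x
            = indicator UNIV x *\<^sub>R h x"
          using eventually_ge_at_top[of i]
        proof eventually_elim
          fix n assume "i \<le> n"
          then have "x \<in> box (- (real n *\<^sub>R One)) (real n *\<^sub>R One)"
            using i by (force simp: mem_box inner_simps)
          then show "indicator (box (- (real n *\<^sub>R One)) (real n *\<^sub>R One)) x *\<^sub>R h x
            = indicator UNIV x *\<^sub>R h x" by simp
        qed
      qed
      show "integrable lborel (\<lambda>x. norm (h x))" using h by simp
    qed (use dom in auto)
    then show ?thesis unfolding box by (simp add: LIMSEQ_const_iff)
  qed
  have all: "?I A = 0" if "A \<in> sets borel" for A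
  proof -
    have st: "Int_stable (range (\<lambda>(a, b). box a b :: 'a set))"
    proof (rule Int_stableI)
      fix B C :: "'a set"
      assume "B \<in> range (\<lambda>(a, b). box a b)" "C \<in> range (\<lambda>(a, b). box a b)"
      then obtain a b c d where BC: "B = box a b" "C = box c d" by auto
      show "B \<inter> C \<in> range (\<lambda>(a, b). box a b)"
        unfolding BC box_Int_box by (rule range_eqI[where x = "(_, _)"]) simp
    qed
    have "A \<in> sigma_sets UNIV (range (\<lambda>(a, b). box a b))"
      using that by (simp add: borel_eq_box)
    then show ?thesis
    proof (induction rule: sigma_sets_induct_disjoint
        [OF st Pow_UNIV[THEN equalityD2, THEN subset_trans[OF subset_UNIV]],
          consumes 1, case_names basic empty compl union])
      case (compl A)
      then have [measurable]: "A \<in> sets borel" by (simp add: borel_eq_box)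
      have "?I (UNIV - A) = (\<integral>x. indicator UNIV x *\<^sub>R h x - indicator A x *\<^sub>R h x \<partial>lborel)"
        by (intro Bochner_Integration.integral_cong) (auto simp: indicator_def)
      also have "\<dots> = ?I UNIV - ?I A" by (intro Bochner_Integration.integral_diff int) auto
      finally show ?case using UNIV compl by simp
    next
      case (union A)
      then have [measurable]: "A i \<in> sets borel" for i by (auto simp: borel_eq_box)
      have "?I (\<Union>i. A i) = (\<Sum>i. ?I (A i))"
        using lebesgue_integral_countable_add[of A lborel h] union(1) int[of "\<Union>i. A i"]
        by (simp add: set_lebesgue_integral_def set_integrable_def disjoint_family_on_def)
      then show ?case using union by simp
    qed (auto simp: box)
  qed
  have set_eq: "set_lebesgue_integral lborel A h = 0" if "A \<in> sets lborel" for A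
    using all that by (simp add: set_lebesgue_integral_def)
  have "AE x in lborel. Re (h x) = 0"
  proof (rule density_unique_real)
    show "integrable lborel (\<lambda>x. Re (h x))" using h by (rule integrable_Re)
    fix A :: "'a set" assume A: "A \<in> sets lborel"
    have "(\<integral>x\<in>A. Re (h x) \<partial>lborel) = Re (set_lebesgue_integral lborel A h)"
      unfolding set_lebesgue_integral_def using int A by (subst integral_Re[symmetric]) auto
    then show "(\<integral>x\<in>A. Re (h x) \<partial>lborel) = (\<integral>x\<in>A. 0 \<partial>lborel)"
      using set_eq[OF A] by (simp add: set_lebesgue_integral_def)
  qed simp
  moreover have "AE x in lborel. Im (h x) = 0"
  proof (rule density_unique_real)
    show "integrable lborel (\<lambda>x. Im (h x))" using h by (rule integrable_Im)
    fix A :: "'a set" assume A: "A \<in> sets lborel"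
    have "(\<integral>x\<in>A. Im (h x) \<partial>lborel) = Im (set_lebesgue_integral lborel A h)"
      unfolding set_lebesgue_integral_def using int A by (subst integral_Im[symmetric]) auto
    then show "(\<integral>x\<in>A. Im (h x) \<partial>lborel) = (\<integral>x\<in>A. 0 \<partial>lborel)"
      using set_eq[OF A] by (simp add: set_lebesgue_integral_def)
  qed simp
  ultimately show ?thesis by eventually_elim (simp add: complex_eq_iff)
qed

text \<open>The reason why Fourier transforms of distributions are unique up to null sets, and why
  identities between distributions become identities at almost every frequency.\<close>

lemma AE_zero_if_schwartz_pairings_zero:
  assumes meas [measurable]: "g \<in> borel_measurable borel"
    and int: "\<And>\<phi>. \<phi> \<in> schwartz \<Longrightarrow> integrable lborel (\<lambda>x. g x * \<phi> x)"
    and zero: "\<And>\<phi>. \<phi> \<in> schwartz \<Longrightarrow> (\<integral>x. g x * \<phi> x \<partial>lborel) = 0"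
  shows "AE x in lborel. g x = 0"
proof -
  have "AE x in lborel. g x * gauss 1 0 x = 0"
    using box_integral_zero[OF assms] int[OF gauss_schwartz, of 1 0]
    by (intro AE_zero_if_box_integrals_zero) auto
  then show ?thesis by eventually_elim (simp add: gauss_def)
qed

section \<open>Distributions with a locally integrable Fourier transform\<close>

text \<open>A relation between functions and distributions instead of the choice \<open>hat f\<close>: the operations
  of the equation preserve it, and it leaves the freedom to replace \<open>G\<close> on a null set.\<close>

abbreviation frep :: "test_fun \<Rightarrow> distr \<Rightarrow> bool" where
  "frep G f \<equiv> represents G (fourier_distr f)"

lemma frep_measurable: "frep G f \<Longrightarrow> G \<in> borel_measurable borel"
  by (simp add: represents_def locally_integrable_measurable)

lemma frep_integrable: "frep G f \<Longrightarrow> \<phi> \<in> schwartz \<Longrightarrow> integrable lborel (\<lambda>\<xi>. G \<xi> * \<phi> \<xi>)"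
  by (simp add: represents_def)

lemma frep_fourier: "frep G f \<Longrightarrow> \<phi> \<in> schwartz \<Longrightarrow> f (fourier \<phi>) = (\<integral>\<xi>. G \<xi> * \<phi> \<xi> \<partial>lborel)"
  by (simp add: represents_def fourier_distr_def)

text \<open>Fourier inversion on the test function: a distribution is recovered from its transform.\<close>

lemma frep_eval: "frep G f \<Longrightarrow> \<phi> \<in> schwartz \<Longrightarrow> f \<phi> = (\<integral>\<xi>. G \<xi> * inv_fourier \<phi> \<xi> \<partial>lborel)"
  using frep_fourier[OF _ inv_fourier_schwartz] by (simp add: fourier_inv_fourier)

lemma frepI:
  assumes "locally_integrable G" "\<And>\<phi>. \<phi> \<in> schwartz \<Longrightarrow> integrable lborel (\<lambda>\<xi>. G \<xi> * \<phi> \<xi>)"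
    "\<And>\<phi>. \<phi> \<in> schwartz \<Longrightarrow> f (fourier \<phi>) = (\<integral>\<xi>. G \<xi> * \<phi> \<xi> \<partial>lborel)"
  shows "frep G f"
  using assms by (simp add: represents_def fourier_distr_def)

lemma represents_unique:
  assumes G: "represents G T" and H: "represents H T"
  shows "AE x in lborel. G x = H x"
proof -
  have [measurable]: "G \<in> borel_measurable borel" "H \<in> borel_measurable borel"
    using assms by (auto simp: represents_def locally_integrable_measurable)
  have "AE x in lborel. G x - H x = 0"
  proof (rule AE_zero_if_schwartz_pairings_zero)
    fix \<phi> assume \<phi>: "\<phi> \<in> schwartz"
    have i: "integrable lborel (\<lambda>x. G x * \<phi> x)" "integrable lborel (\<lambda>x. H x * \<phi> x)"
      "(\<integral>x. G x * \<phi> x \<partial>lborel) = (\<integral>x. H x * \<phi> x \<partial>lborel)"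
      using G H \<phi> by (auto simp: represents_def)
    then show "integrable lborel (\<lambda>x. (G x - H x) * \<phi> x)" "(\<integral>x. (G x - H x) * \<phi> x \<partial>lborel) = 0"
      by (simp_all add: left_diff_distrib Bochner_Integration.integral_diff)
  qed measurable
  then show ?thesis by eventually_elim simp
qed

lemma represents_fun_of:
  assumes "represents G T"
  shows "represents (fun_of T) T" "AE x in lborel. fun_of T x = G x"
proof -
  show *: "represents (fun_of T) T" 
    unfolding fun_of_def using assms by (rule someI[of "\<lambda>g. represents g T"])
  show "AE x in lborel. fun_of T x = G x" by (rule represents_unique[OF * assms])
qed

lemma frep_hat: "frep G f \<Longrightarrow> frep (hat f) f" "frep G f \<Longrightarrow> AE \<xi> in lborel. hat f \<xi> = G \<xi>"
  unfolding hat_def by (auto intro: represents_fun_of)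

lemma locally_integrable_cong_AE:
  assumes "locally_integrable G" "AE x in lborel. G x = H x" "H \<in> borel_measurable borel"
  shows "locally_integrable H"
  unfolding locally_integrable_def set_integrable_def
proof (intro allI impI)
  fix K :: "(real^3) set" assume K: "compact K"
  then have [measurable]: "K \<in> sets borel" by (simp add: borel_compact)
  have "integrable lborel (\<lambda>x. indicator K x *\<^sub>R G x)"
    using assms(1) K by (simp add: locally_integrable_def set_integrable_def)
  then show "integrable lborel (\<lambda>x. indicator K x *\<^sub>R H x)"
    by (rule integrable_cong_AE_imp) (use assms(2,3) in \<open>auto elim: AE_mp\<close>)
qed

lemma represents_cong_AE:
  assumes G: "represents G T" and ae: "AE x in lborel. G x = H x" and [measurable]: "H \<in> borel_measurable borel"
  shows "represents H T"
proof -
  have li: "locally_integrable G" and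
    p: "\<And>\<phi>. \<phi> \<in> schwartz \<Longrightarrow> integrable lborel (\<lambda>x. G x * \<phi> x) \<and> T \<phi> = (\<integral>x. G x * \<phi> x \<partial>lborel)"
    using G by (auto simp: represents_def)
  note [measurable] = locally_integrable_measurable[OF li]
  show ?thesis
    unfolding represents_def
  proof (intro conjI ballI)
    show "locally_integrable H" by (rule locally_integrable_cong_AE[OF li ae]) measurable
    fix \<phi> assume \<phi>: "\<phi> \<in> schwartz"
    note [measurable] = schwartz_measurable[OF \<phi>]
    have ae': "AE x in lborel. H x * \<phi> x = G x * \<phi> x" using ae by eventually_elim simp
    show "integrable lborel (\<lambda>x. H x * \<phi> x)"
      using p[OF \<phi>] ae' by (subst integrable_cong_AE[where g = "\<lambda>x. G x * \<phi> x"]) auto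
    show "T \<phi> = (\<integral>x. H x * \<phi> x \<partial>lborel)"
      using p[OF \<phi>] ae' by (subst integral_cong_AE[where g = "\<lambda>x. G x * \<phi> x"]) auto
  qed
qed

lemma frep_inv_fourier_distr:
  assumes "locally_integrable G" "\<And>\<phi>. \<phi> \<in> schwartz \<Longrightarrow> integrable lborel (\<lambda>\<xi>. G \<xi> * \<phi> \<xi>)"
  shows "frep G (inv_fourier_distr (regular G))"
  using assms
  by (intro frepI) (auto simp: inv_fourier_distr_def regular_def fourier_schwartz fourier_inversion)

lemma locally_integrable_bounded_mult:
  assumes G: "locally_integrable G" and [measurable]: "m \<in> borel_measurable borel"
    and bdd: "\<And>K. compact K \<Longrightarrow> \<exists>B. \<forall>x\<in>K. norm (m x) \<le> B"
  shows "locally_integrable (\<lambda>x. m x * G x)"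
  unfolding locally_integrable_def set_integrable_def
proof (intro allI impI)
  fix K :: "(real^3) set" assume K: "compact K"
  obtain B where B: "\<And>x. x \<in> K \<Longrightarrow> norm (m x) \<le> B" using bdd[OF K] by auto
  have [measurable]: "K \<in> sets borel" using K by (simp add: borel_compact)
  have "integrable lborel (\<lambda>x. (indicator K x *\<^sub>R m x) * (indicator K x *\<^sub>R G x))"
    by (rule integrable_mult_bounded[where B = "max B 0"])
       (use G K B in \<open>auto simp: locally_integrable_def set_integrable_def indicator_def le_max_iff_disj\<close>)
  also have "(\<lambda>x. (indicator K x *\<^sub>R m x) * (indicator K x *\<^sub>R G x)) = (\<lambda>x. indicator K x *\<^sub>R (m x * G x))"
    by (auto simp: indicator_def)
  finally show "integrable lborel (\<lambda>x. indicator K x *\<^sub>R (m x * G x))" .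
qed

lemma frep_multiplier:
  assumes G: "frep G f" and m [measurable]: "m \<in> borel_measurable borel" and B: "\<And>\<xi>. \<bar>m \<xi>\<bar> \<le> B"
  shows "frep (\<lambda>\<xi>. of_real (m \<xi>) * G \<xi>) (multiplier m f)"
proof (rule represents_cong_AE)
  note h = frep_hat[OF G]
  show "frep (\<lambda>\<xi>. of_real (m \<xi>) * hat f \<xi>) (multiplier m f)"
    unfolding multiplier_def
  proof (rule frep_inv_fourier_distr)
    show "locally_integrable (\<lambda>\<xi>. of_real (m \<xi>) * hat f \<xi>)"
      using h(1) B by (intro locally_integrable_bounded_mult) (auto simp: represents_def)
    fix \<phi> assume \<phi>: "\<phi> \<in> schwartz"
    show "integrable lborel (\<lambda>\<xi>. of_real (m \<xi>) * hat f \<xi> * \<phi> \<xi>)"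
      unfolding mult.assoc using B
      by (intro integrable_mult_bounded[where B = B] frep_integrable[OF h(1) \<phi>]) auto
  qed
  show "AE \<xi> in lborel. of_real (m \<xi>) * hat f \<xi> = of_real (m \<xi>) * G \<xi>"
    using h(2) by eventually_elim simp
  show "(\<lambda>\<xi>. of_real (m \<xi>) * G \<xi>) \<in> borel_measurable borel"
    using frep_measurable[OF G] by measurable
qed

lemma locally_integrable_sum:
  assumes "\<And>j. j \<in> J \<Longrightarrow> locally_integrable (G j)"
  shows "locally_integrable (\<lambda>x. \<Sum>j\<in>J. G j x)"
  using assms unfolding locally_integrable_def set_integrable_def
  by (auto simp: scaleR_sum_right intro!: Bochner_Integration.integrable_sum)

lemma frep_sum:
  assumes "\<And>j. j \<in> J \<Longrightarrow> frep (G j) (f j)"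
  shows "frep (\<lambda>\<xi>. \<Sum>j\<in>J. G j \<xi>) (\<lambda>\<phi>. \<Sum>j\<in>J. f j \<phi>)"
proof (rule frepI)
  show "locally_integrable (\<lambda>\<xi>. \<Sum>j\<in>J. G j \<xi>)"
    using assms by (intro locally_integrable_sum) (auto simp: represents_def)
  fix \<phi> assume \<phi>: "\<phi> \<in> schwartz"
  show "integrable lborel (\<lambda>\<xi>. (\<Sum>j\<in>J. G j \<xi>) * \<phi> \<xi>)"
    using frep_integrable[OF assms \<phi>] by (simp add: sum_distrib_right)
  show "(\<Sum>j\<in>J. f j (fourier \<phi>)) = (\<integral>\<xi>. (\<Sum>j\<in>J. G j \<xi>) * \<phi> \<xi> \<partial>lborel)"
    using frep_integrable[OF assms \<phi>] frep_fourier[OF assms \<phi>]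
    by (simp add: sum_distrib_right Bochner_Integration.integral_sum)
qed

lemma frep_diff:
  assumes "frep G f" "frep H g"
  shows "frep (\<lambda>\<xi>. G \<xi> - H \<xi>) (f - g)"
proof (rule frepI)
  show "locally_integrable (\<lambda>\<xi>. G \<xi> - H \<xi>)"
    using assms by (auto simp: represents_def locally_integrable_def intro!: set_integral_diff)
  fix \<phi> assume \<phi>: "\<phi> \<in> schwartz"
  note i = frep_integrable[OF assms(1) \<phi>] frep_integrable[OF assms(2) \<phi>]
  show "integrable lborel (\<lambda>\<xi>. (G \<xi> - H \<xi>) * \<phi> \<xi>)"
    using i by (simp add: left_diff_distrib)
  show "(f - g) (fourier \<phi>) = (\<integral>\<xi>. (G \<xi> - H \<xi>) * \<phi> \<xi> \<partial>lborel)"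
    using i frep_fourier[OF assms(1) \<phi>] frep_fourier[OF assms(2) \<phi>]
    by (simp add: left_diff_distrib Bochner_Integration.integral_diff)
qed

lemma frep_zero: "frep (\<lambda>_. 0) (\<lambda>_. 0)"
  by (rule frepI) (auto simp: locally_integrable_def set_integrable_def)

lemma continuous_bounded_on_compact:
  fixes m :: test_fun
  assumes "continuous_on UNIV m" "compact K"
  shows "\<exists>B. \<forall>x\<in>K. norm (m x) \<le> B"
proof -
  have "compact (m ` K)"
    using assms by (intro compact_continuous_image continuous_on_subset[OF assms(1)]) auto
  then show ?thesis by (auto dest!: compact_imp_bounded simp: bounded_iff)
qed

lemma frep_divergence:
  assumes "\<And>j. frep (G j) (f $ j)"
  shows "frep (\<lambda>\<xi>. \<Sum>j\<in>UNIV. \<i> * of_real (\<xi> $ j) * G j \<xi>) (divergence f)"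
proof -
  have "frep (\<lambda>\<xi>. \<i> * of_real (\<xi> $ j) * G j \<xi>) (\<lambda>\<phi>. distr_pd j (f $ j) \<phi>)" for j
  proof (rule frepI)
    show "locally_integrable (\<lambda>\<xi>. \<i> * of_real (\<xi> $ j) * G j \<xi>)"
    proof (rule locally_integrable_bounded_mult)
      show "locally_integrable (G j)" using assms by (simp add: represents_def)
      show "\<exists>B. \<forall>\<xi>\<in>K. norm (\<i> * of_real (\<xi> $ j)) \<le> B" if "compact K" for K :: "(real^3) set"
        by (rule continuous_bounded_on_compact[OF _ that]) (intro continuous_intros)
    qed measurable
    fix \<phi> assume \<phi>: "\<phi> \<in> schwartz"
    have s: "(\<lambda>x. - \<i> * (of_real (x $ j) * \<phi> x)) \<in> schwartz"
      by (intro schwartz_cmult schwartz_coordinate \<phi>)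
    have "integrable lborel (\<lambda>\<xi>. (-1) * (G j \<xi> * (- \<i> * (of_real (\<xi> $ j) * \<phi> \<xi>))))"
      using frep_integrable[OF assms s] by (rule integrable_mult_right)
    then show "integrable lborel (\<lambda>\<xi>. \<i> * of_real (\<xi> $ j) * G j \<xi> * \<phi> \<xi>)"
      by (simp add: mult_ac)
    have "distr_pd j (f $ j) (fourier \<phi>) = - (f $ j) (fourier (\<lambda>x. - \<i> * (of_real (x $ j) * \<phi> x)))"
      by (simp only: distr_pd_def fourier_schwartz[OF \<phi>] if_True pd_fourier[OF \<phi>])
    also have "\<dots> = (-1) * (\<integral>\<xi>. G j \<xi> * (- \<i> * (of_real (\<xi> $ j) * \<phi> \<xi>)) \<partial>lborel)"
      by (subst frep_fourier[OF assms s]) simp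
    also have "\<dots> = (\<integral>\<xi>. (-1) * (G j \<xi> * (- \<i> * (of_real (\<xi> $ j) * \<phi> \<xi>))) \<partial>lborel)"
      by (rule integral_mult_right_zero[symmetric])
    also have "\<dots> = (\<integral>\<xi>. \<i> * of_real (\<xi> $ j) * G j \<xi> * \<phi> \<xi> \<partial>lborel)"
      by (intro Bochner_Integration.integral_cong) (auto simp: mult_ac)
    finally show "distr_pd j (f $ j) (fourier \<phi>) = (\<integral>\<xi>. \<i> * of_real (\<xi> $ j) * G j \<xi> * \<phi> \<xi> \<partial>lborel)" .
  qed
  then have "frep (\<lambda>\<xi>. \<Sum>j\<in>UNIV. \<i> * of_real (\<xi> $ j) * G j \<xi>) (\<lambda>\<phi>. \<Sum>j\<in>UNIV. distr_pd j (f $ j) \<phi>)"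
    by (rule frep_sum)
  then show ?thesis by (simp add: divergence_def[abs_def])
qed

subsection \<open>Products and convolutions\<close>

definition conv :: "test_fun \<Rightarrow> test_fun \<Rightarrow> test_fun" where
  "conv F G = (\<lambda>\<zeta>. \<integral>\<eta>. F (\<zeta> - \<eta>) * G \<eta> \<partial>lborel)"

lemma nn_integral_translate:
  fixes f :: "'a::euclidean_space \<Rightarrow> ennreal"
  assumes [measurable]: "f \<in> borel_measurable borel"
  shows "(\<integral>\<^sup>+x. f (x - c) \<partial>lborel) = (\<integral>\<^sup>+x. f x \<partial>lborel)"
proof -
  have "(\<integral>\<^sup>+x. f x \<partial>lborel) = (\<integral>\<^sup>+x. f x \<partial>distr lborel borel ((+) (- c)))"
    by (simp only: lborel_distr_plus)
  also have "\<dots> = (\<integral>\<^sup>+x. f (- c + x) \<partial>lborel)" by (subst nn_integral_distr) auto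
  finally show ?thesis by simp
qed

lemma conv_kernel_integrable:
  fixes F G :: test_fun
  assumes F: "integrable lborel F" and G: "integrable lborel G"
  shows "integrable (lborel \<Otimes>\<^sub>M lborel) (\<lambda>(\<eta>, \<zeta>). F (\<zeta> - \<eta>) * G \<eta> :: complex)"
proof (rule lborel_pair.integrable_pairI)
  note [measurable] = borel_measurable_integrable[OF F] borel_measurable_integrable[OF G]
  have "(\<integral>\<^sup>+\<eta>. \<integral>\<^sup>+\<zeta>. ennreal (norm (F (\<zeta> - \<eta>) * G \<eta>)) \<partial>lborel \<partial>lborel) =
      (\<integral>\<^sup>+\<eta>. (\<integral>\<^sup>+\<zeta>. ennreal (norm (F \<zeta>)) \<partial>lborel) * ennreal (norm (G \<eta>)) \<partial>lborel)"
  proof (intro nn_integral_cong)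
    fix \<eta> :: "real^3"
    show "(\<integral>\<^sup>+\<zeta>. ennreal (norm (F (\<zeta> - \<eta>) * G \<eta>)) \<partial>lborel) =
        (\<integral>\<^sup>+\<zeta>. ennreal (norm (F \<zeta>)) \<partial>lborel) * ennreal (norm (G \<eta>))"
      by (subst nn_integral_translate[of "\<lambda>\<zeta>. ennreal (norm (F \<zeta>))" \<eta>, symmetric])
         (auto simp: norm_mult ennreal_mult' nn_integral_multc)
  qed
  also have "\<dots> = (\<integral>\<^sup>+\<zeta>. ennreal (norm (F \<zeta>)) \<partial>lborel) * (\<integral>\<^sup>+\<eta>. ennreal (norm (G \<eta>)) \<partial>lborel)"
    by (simp add: nn_integral_cmult)
  also have "\<dots> < \<infinity>" using F G by (auto simp: integrable_iff_bounded ennreal_mult_less_top)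
  finally show "(\<integral>\<^sup>+\<eta>. \<integral>\<^sup>+\<zeta>. ennreal (norm (F (\<zeta> - \<eta>) * G \<eta>)) \<partial>lborel \<partial>lborel) < \<infinity>" .
qed (use borel_measurable_integrable[OF F] borel_measurable_integrable[OF G] in measurable)

lemma conv_integrable:
  assumes "integrable lborel F" "integrable lborel G"
  shows "integrable lborel (conv F G)"
  unfolding conv_def using lborel_pair.integrable_snd[OF conv_kernel_integrable[OF assms]] .

lemma fourier_conv:
  assumes F: "integrable lborel F" and G: "integrable lborel G"
  shows "fourier (conv F G) x = fourier F x * fourier G x"
proof -
  note [measurable] = borel_measurable_integrable[OF F] borel_measurable_integrable[OF G]
  let ?E = "\<lambda>\<zeta>. exp (- \<i> * of_real (x \<bullet> \<zeta>))"
  have "integrable (lborel \<Otimes>\<^sub>M lborel) (\<lambda>z. ?E (snd z) * (case z of (\<eta>, \<zeta>) \<Rightarrow> F (\<zeta> - \<eta>) * G \<eta>))"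
    by (rule integrable_mult_bounded[OF conv_kernel_integrable[OF F G], where B = 1]) auto
  then have int: "integrable (lborel \<Otimes>\<^sub>M lborel) (\<lambda>(\<eta>, \<zeta>). ?E \<zeta> * (F (\<zeta> - \<eta>) * G \<eta>))"
    by (simp add: case_prod_beta')
  have "fourier (conv F G) x = (\<integral>\<zeta>. \<integral>\<eta>. ?E \<zeta> * (F (\<zeta> - \<eta>) * G \<eta>) \<partial>lborel \<partial>lborel)"
    unfolding fourier_def conv_def by (simp only: integral_mult_right_zero)
  also have "\<dots> = (\<integral>\<eta>. \<integral>\<zeta>. ?E \<zeta> * (F (\<zeta> - \<eta>) * G \<eta>) \<partial>lborel \<partial>lborel)"
    by (rule lborel_pair.Fubini_integral[OF int])
  also have "\<dots> = (\<integral>\<eta>. fourier F x * (?E \<eta> * G \<eta>) \<partial>lborel)"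
  proof (intro Bochner_Integration.integral_cong refl)
    fix \<eta> :: "real^3"
    have "(\<integral>\<zeta>. ?E \<zeta> * (F (\<zeta> - \<eta>) * G \<eta>) \<partial>lborel) =
       (\<integral>\<zeta>. ?E (\<zeta> + \<eta>) * (F (\<zeta> + \<eta> - \<eta>) * G \<eta>) \<partial>lborel)"
      by (rule lborel_integral_translate[symmetric]) measurable
    also have "(\<lambda>\<zeta>. ?E (\<zeta> + \<eta>) * (F (\<zeta> + \<eta> - \<eta>) * G \<eta>)) = (\<lambda>\<zeta>. (?E \<zeta> * F \<zeta>) * (?E \<eta> * G \<eta>))"
    proof
      fix \<zeta>
      have "?E (\<zeta> + \<eta>) = ?E \<zeta> * ?E \<eta>"
        by (simp only: exp_add[symmetric]) (simp add: inner_add_right algebra_simps)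
      then show "?E (\<zeta> + \<eta>) * (F (\<zeta> + \<eta> - \<eta>) * G \<eta>) = (?E \<zeta> * F \<zeta>) * (?E \<eta> * G \<eta>)"
        by (simp only: add_diff_cancel_right' mult_ac)
    qed
    also have "(\<integral>\<zeta>. (?E \<zeta> * F \<zeta>) * (?E \<eta> * G \<eta>) \<partial>lborel) = fourier F x * (?E \<eta> * G \<eta>)"
      unfolding fourier_def by (rule integral_mult_left_zero)
    finally show "(\<integral>\<zeta>. ?E \<zeta> * (F (\<zeta> - \<eta>) * G \<eta>) \<partial>lborel) = fourier F x * (?E \<eta> * G \<eta>)" .
  qed
  also have "\<dots> = fourier F x * fourier G x"
    unfolding fourier_def[of G] by (rule integral_mult_right_zero)
  finally show ?thesis .
qed

lemma locally_integrable_if_integrable: "integrable lborel F \<Longrightarrow> locally_integrable F"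
  unfolding locally_integrable_def set_integrable_def
  by (auto intro!: integrable_mult_indicator borel_compact)

lemma inv_fourier_measurable [measurable]:
  assumes [measurable]: "F \<in> borel_measurable borel"
  shows "inv_fourier F \<in> borel_measurable borel"
  unfolding inv_fourier_def by measurable

lemma inv_fourier_norm_le:
  assumes "integrable lborel F"
  shows "norm (inv_fourier F x) \<le> (\<integral>x. norm (F x) \<partial>lborel)"
proof -
  have "1 \<le> (2 * pi) ^ 3" using pi_gt3 by (intro one_le_power) simp
  then have "norm (of_real (1 / (2 * pi) ^ 3) :: complex) \<le> 1" by (simp add: divide_le_eq_1 norm_divide norm_power norm_mult)
  then have "norm (inv_fourier F x) \<le> 1 * norm (fourier F (- x))"
    unfolding inv_fourier_eq norm_mult by (intro mult_right_mono) auto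
  with fourier_norm_le[OF assms, of "- x"] show ?thesis by simp
qed

lemma integral_inv_fourier_swap:
  assumes F: "integrable lborel F" and \<phi>: "\<phi> \<in> schwartz"
  shows "(\<integral>\<xi>. F \<xi> * inv_fourier \<phi> \<xi> \<partial>lborel) = (\<integral>x. inv_fourier F x * \<phi> x \<partial>lborel)"
proof -
  let ?c = "of_real (1 / (2 * pi) ^ 3) :: complex"
  note [measurable] = borel_measurable_integrable[OF F] schwartz_measurable[OF \<phi>]
  have refl: "fourier \<phi> (- \<xi>) = fourier (\<lambda>x. \<phi> (- x)) \<xi>" for \<xi>
    unfolding fourier_def by (subst integral_reflect[symmetric]) auto
  have "(\<integral>\<xi>. F \<xi> * inv_fourier \<phi> \<xi> \<partial>lborel) = (\<integral>\<xi>. ?c * (F \<xi> * fourier (\<lambda>x. \<phi> (- x)) \<xi>) \<partial>lborel)"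
    unfolding inv_fourier_eq refl by (simp only: mult.left_commute)
  also have "\<dots> = ?c * (\<integral>\<xi>. F \<xi> * fourier (\<lambda>x. \<phi> (- x)) \<xi> \<partial>lborel)"
    by (rule integral_mult_right_zero)
  also have "(\<integral>\<xi>. F \<xi> * fourier (\<lambda>x. \<phi> (- x)) \<xi> \<partial>lborel) = (\<integral>x. fourier F x * \<phi> (- x) \<partial>lborel)"
    by (rule fourier_multiplication_formula[symmetric, OF F schwartz_integrable[OF schwartz_reflect[OF \<phi>]]])
  also have "\<dots> = (\<integral>x. fourier F (- x) * \<phi> x \<partial>lborel)"
  proof -
    have [measurable]: "fourier F \<in> borel_measurable borel" unfolding fourier_def by measurable
    show ?thesis by (subst integral_reflect[symmetric]) auto
  qed
  also have "?c * \<dots> = (\<integral>x. ?c * (fourier F (- x) * \<phi> x) \<partial>lborel)"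
    by (rule integral_mult_right_zero[symmetric])
  finally show ?thesis unfolding inv_fourier_eq by (simp only: mult.assoc)
qed

text \<open>A distribution with integrable transform is a bounded function, so that its pointwise
  products with others make sense.\<close>

lemma represents_inv_fourier:
  assumes f: "frep F f" and F: "integrable lborel F"
  shows "represents (inv_fourier F) f"
proof -
  note [measurable] = borel_measurable_integrable[OF F]
  show ?thesis
    unfolding represents_def
  proof (intro conjI ballI)
    have "locally_integrable (\<lambda>x. inv_fourier F x * 1)"
    proof (rule locally_integrable_bounded_mult)
      show "locally_integrable (\<lambda>x. 1)"
        unfolding locally_integrable_def set_integrable_def
        by (auto intro!: integrable_real_indicator[THEN integrable_of_real, where 'a = complex, simplified of_real_indicator]
            emeasure_compact_finite borel_compact simp: scaleR_conv_of_real of_real_indicator)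
      show "\<exists>B. \<forall>x\<in>K. norm (inv_fourier F x) \<le> B" for K
        using inv_fourier_norm_le[OF F] by blast
    qed measurable
    then show "locally_integrable (inv_fourier F)" by simp
    fix \<phi> assume \<phi>: "\<phi> \<in> schwartz"
    show "integrable lborel (\<lambda>x. inv_fourier F x * \<phi> x)"
      by (rule integrable_mult_bounded[OF schwartz_integrable[OF \<phi>] _ inv_fourier_norm_le[OF F]]) simp
    show "f \<phi> = (\<integral>x. inv_fourier F x * \<phi> x \<partial>lborel)"
      by (simp add: frep_eval[OF f \<phi>] integral_inv_fourier_swap[OF F \<phi>])
  qed
qed

lemma frep_distr_mult:
  assumes f: "frep F f" and F: "integrable lborel F" and g: "frep G g" and G: "integrable lborel G"
  shows "frep (\<lambda>\<xi>. of_real (1 / (2 * pi) ^ 3) * conv F G \<xi>) (distr_mult f g)"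
proof (rule frepI)
  let ?c = "of_real (1 / (2 * pi) ^ 3) :: complex"
  note FG = conv_integrable[OF F G]
  show "locally_integrable (\<lambda>\<xi>. ?c * conv F G \<xi>)"
    using FG by (intro locally_integrable_if_integrable integrable_mult_right)
  fix \<phi> assume \<phi>: "\<phi> \<in> schwartz"
  note [measurable] = borel_measurable_integrable[OF F] borel_measurable_integrable[OF G]
    schwartz_measurable[OF \<phi>] schwartz_measurable[OF fourier_schwartz[OF \<phi>]]
  have "integrable lborel (\<lambda>\<xi>. \<phi> \<xi> * (?c * conv F G \<xi>))"
    using FG seminorm_ge[OF \<phi>, of _ 0]
    by (intro integrable_mult_bounded[where B = "seminorm 0 \<phi>"] integrable_mult_right) auto
  then show "integrable lborel (\<lambda>\<xi>. ?c * conv F G \<xi> * \<phi> \<xi>)" by (simp only: mult.commute)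
  note rf = represents_fun_of[OF represents_inv_fourier[OF f F]]
    and rg = represents_fun_of[OF represents_inv_fourier[OF g G]]
  have [measurable]: "fun_of f \<in> borel_measurable borel" "fun_of g \<in> borel_measurable borel"
    using rf(1) rg(1) by (auto simp: represents_def locally_integrable_measurable)
  have pt: "inv_fourier F x * inv_fourier G x = ?c * inv_fourier (conv F G) x" for x
    unfolding inv_fourier_eq fourier_conv[OF F G] by (simp only: mult_ac)
  have "distr_mult f g (fourier \<phi>) = (\<integral>x. fun_of f x * fun_of g x * fourier \<phi> x \<partial>lborel)"
    by (simp add: distr_mult_def regular_def fourier_schwartz[OF \<phi>])
  also have "\<dots> = (\<integral>x. ?c * (inv_fourier (conv F G) x * fourier \<phi> x) \<partial>lborel)"
  proof (rule integral_cong_AE)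
    show "AE x in lborel. fun_of f x * fun_of g x * fourier \<phi> x = ?c * (inv_fourier (conv F G) x * fourier \<phi> x)"
      using rf(2) rg(2) by eventually_elim (simp only: pt mult.assoc)
  qed (use borel_measurable_integrable[OF FG] in measurable)
  also have "\<dots> = ?c * (\<integral>x. inv_fourier (conv F G) x * fourier \<phi> x \<partial>lborel)"
    by (rule integral_mult_right_zero)
  also have "(\<integral>x. inv_fourier (conv F G) x * fourier \<phi> x \<partial>lborel) = (\<integral>\<xi>. conv F G \<xi> * \<phi> \<xi> \<partial>lborel)"
    by (subst integral_inv_fourier_swap[OF FG fourier_schwartz[OF \<phi>], symmetric])
       (simp only: fourier_inversion[OF \<phi>])
  also have "?c * \<dots> = (\<integral>\<xi>. ?c * (conv F G \<xi> * \<phi> \<xi>) \<partial>lborel)"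
    by (rule integral_mult_right_zero[symmetric])
  finally show "distr_mult f g (fourier \<phi>) = (\<integral>\<xi>. ?c * conv F G \<xi> * \<phi> \<xi> \<partial>lborel)"
    by (simp only: mult.assoc)
qed

text \<open>The transport term in divergence form: a derivative of products, hence \<open>i\<xi>\<close> times
  convolutions.\<close>

lemma frep_advect:
  assumes "\<And>j. frep (V j) (v $ j)" "\<And>j. integrable lborel (V j)" "frep F f" "integrable lborel F"
  shows "frep (\<lambda>\<xi>. \<Sum>j\<in>UNIV. \<i> * of_real (\<xi> $ j) * (of_real (1 / (2 * pi) ^ 3) * conv (V j) F \<xi>)) (advect v f)"
  unfolding advect_def
  by (rule frep_divergence) (simp only: vec_lambda_beta frep_distr_mult[OF assms])

definition leray_symbol :: "3 \<Rightarrow> 3 \<Rightarrow> real^3 \<Rightarrow> real" where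
  "leray_symbol i j \<xi> = (if i = j then 1 else 0) - \<xi> $ i * \<xi> $ j / (norm \<xi>)\<^sup>2"

lemma leray_symbol_measurable [measurable]: "leray_symbol i j \<in> borel_measurable borel"
  unfolding leray_symbol_def by measurable

lemma leray_symbol_bound: "\<bar>leray_symbol i j \<xi>\<bar> \<le> 2"
proof -
  have b: "\<bar>\<xi> $ i * \<xi> $ j / (norm \<xi>)\<^sup>2\<bar> \<le> 1"
  proof (cases "\<xi> = 0")
    case False
    have "\<bar>\<xi> $ i\<bar> * \<bar>\<xi> $ j\<bar> \<le> norm \<xi> * norm \<xi>"
      by (intro mult_mono abs_component_le_norm) auto
    with False show ?thesis by (simp add: abs_mult power2_eq_square)
  qed simp
  have aux: "\<bar>(if i = j then 1 else 0) - q\<bar> \<le> 2" if "\<bar>q\<bar> \<le> 1" for q :: real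
    using that by auto
  show ?thesis
    unfolding leray_symbol_def
    using aux[OF b] .
qed

lemma frep_leray:
  assumes "\<And>j. frep (G j) (f $ j)"
  shows "frep (\<lambda>\<xi>. \<Sum>j\<in>UNIV. of_real (leray_symbol i j \<xi>) * G j \<xi>) (leray f $ i)"
proof -
  have "frep (\<lambda>\<xi>. of_real (leray_symbol i j \<xi>) * G j \<xi>) (multiplier (leray_symbol i j) (f $ j))" for j
    by (rule frep_multiplier[OF assms leray_symbol_measurable leray_symbol_bound])
  then show ?thesis
    unfolding leray_def by (simp add: leray_symbol_def[abs_def] frep_sum)
qed

lemma frep_heat:
  assumes "frep G f" "t \<ge> 0"
  shows "frep (\<lambda>\<xi>. of_real (exp (- t * norm \<xi> powr (2 * \<gamma>))) * G \<xi>) (heat \<gamma> t f)"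
  unfolding heat_def
  by (rule frep_multiplier[OF assms(1), where B = 1]) (use assms(2) in auto)

section \<open>Weighted norms, convolution and interpolation\<close>

definition wt :: "real \<Rightarrow> real \<Rightarrow> real \<Rightarrow> real^3 \<Rightarrow> real" where
  "wt a \<sigma> r \<xi> = rpow (norm \<xi>) r * exp (a * norm \<xi> powr (1 / \<sigma>))"

definition wnorm :: "real \<Rightarrow> real \<Rightarrow> real \<Rightarrow> (real^3 \<Rightarrow> ennreal) \<Rightarrow> ennreal" where
  "wnorm a \<sigma> r f = (\<integral>\<^sup>+\<xi>. ennreal (wt a \<sigma> r \<xi>) * f \<xi> \<partial>lborel)"

text \<open>The norm of the space with index \<open>r\<close>, as an extended nonnegative number and as a functional of
  the Fourier transform.\<close>

abbreviation wabs :: "real \<Rightarrow> real \<Rightarrow> real \<Rightarrow> (real^3 \<Rightarrow> 'b::real_normed_vector) \<Rightarrow> ennreal" where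
  "wabs a \<sigma> r F \<equiv> wnorm a \<sigma> r (\<lambda>\<xi>. ennreal (norm (F \<xi>)))"

lemma rpow_nonneg [simp]: "0 \<le> rpow x y"
  by (simp add: rpow_def)

lemma rpow_eq_powr: "x \<noteq> 0 \<Longrightarrow> rpow x y = x powr y"
  by (simp add: rpow_def)

lemma rpow_measurable [measurable (raw)]:
  "f \<in> borel_measurable M \<Longrightarrow> (\<lambda>x. rpow (f x) r) \<in> borel_measurable M"
  by (cases "r = 0") (simp_all add: rpow_def)

lemma wt_measurable [measurable]: "wt a \<sigma> r \<in> borel_measurable borel"
  unfolding wt_def by measurable

lemma wt_nonneg [simp]: "0 \<le> wt a \<sigma> r \<xi>"
  by (simp add: wt_def)

lemma wt_pos: "\<xi> \<noteq> 0 \<Longrightarrow> 0 < wt a \<sigma> r \<xi>"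
  by (simp add: wt_def rpow_eq_powr)

lemma AE_lborel_nonzero: "AE \<xi> in lborel. \<xi> \<noteq> (0 :: 'a::euclidean_space)"
  by (rule AE_lborel_singleton)

lemma weighted_L1_eq_wnorm: "weighted_L1 a \<sigma> r F = wabs a \<sigma> r F"
  by (simp add: weighted_L1_def wnorm_def wt_def ennreal_mult'[symmetric])

lemma wnorm_mono: "(\<And>\<xi>. f \<xi> \<le> g \<xi>) \<Longrightarrow> wnorm a \<sigma> r f \<le> wnorm a \<sigma> r g"
  unfolding wnorm_def by (intro nn_integral_mono mult_left_mono) auto

lemma wnorm_cong_AE: "AE \<xi> in lborel. f \<xi> = g \<xi> \<Longrightarrow> wnorm a \<sigma> r f = wnorm a \<sigma> r g"
  unfolding wnorm_def by (rule nn_integral_cong_AE) (auto elim!: AE_mp)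

lemma wnorm_add:
  "f \<in> borel_measurable borel \<Longrightarrow> g \<in> borel_measurable borel \<Longrightarrow>
    wnorm a \<sigma> r (\<lambda>\<xi>. f \<xi> + g \<xi>) = wnorm a \<sigma> r f + wnorm a \<sigma> r g"
  unfolding wnorm_def by (simp add: distrib_left nn_integral_add)

lemma wnorm_cmult:
  "f \<in> borel_measurable borel \<Longrightarrow> wnorm a \<sigma> r (\<lambda>\<xi>. c * f \<xi>) = c * wnorm a \<sigma> r f"
  unfolding wnorm_def by (simp add: mult.left_commute nn_integral_cmult)

lemma wnorm_sum:
  "(\<And>j. j \<in> J \<Longrightarrow> f j \<in> borel_measurable borel) \<Longrightarrow>
    wnorm a \<sigma> r (\<lambda>\<xi>. \<Sum>j\<in>J. f j \<xi>) = (\<Sum>j\<in>J. wnorm a \<sigma> r (f j))"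
  unfolding wnorm_def by (simp add: sum_distrib_left nn_integral_sum)

lemma wnorm_eq_0D:
  assumes [measurable]: "f \<in> borel_measurable borel" and "wnorm a \<sigma> r f = 0"
  shows "AE \<xi> in lborel. f \<xi> = 0"
proof -
  have "AE \<xi> in lborel. ennreal (wt a \<sigma> r \<xi>) * f \<xi> = 0"
    using assms(2) unfolding wnorm_def by (subst (asm) nn_integral_0_iff_AE) auto
  with AE_lborel_nonzero show ?thesis
  proof eventually_elim
    case (elim \<xi>)
    with wt_pos[of \<xi> a \<sigma> r] show ?case by (auto simp: ennreal_eq_0_iff)
  qed
qed

lemma wnorm_zero_AE: "AE \<xi> in lborel. f \<xi> = 0 \<Longrightarrow> wnorm a \<sigma> r f = 0"
  using wnorm_cong_AE[of f "\<lambda>_. 0"] by (simp add: wnorm_def)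

lemma powr_subadditive:
  fixes x y p :: real
  assumes "0 \<le> x" "0 \<le> y" "0 < p" "p \<le> 1"
  shows "(x + y) powr p \<le> x powr p + y powr p"
proof (cases "x + y = 0")
  case False
  then have S: "x + y > 0" using assms by linarith
  have le: "u / (x + y) \<le> (u / (x + y)) powr p" if "0 \<le> u" "u \<le> x + y" for u
  proof (cases "u = 0")
    case False
    then have "0 < u / (x + y)" "u / (x + y) \<le> 1" using that S by auto
    then show ?thesis using powr_mono'[of p 1 "u / (x + y)"] assms that by simp
  qed simp
  have "1 = x / (x + y) + y / (x + y)" using S by (simp add: add_divide_distrib[symmetric])
  also have "\<dots> \<le> (x / (x + y)) powr p + (y / (x + y)) powr p"
    using assms by (intro add_mono le) auto
  also have "\<dots> = (x powr p + y powr p) / (x + y) powr p"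
    using assms S by (simp add: powr_divide add_divide_distrib)
  finally show ?thesis using S by (simp add: pos_le_divide_eq)
qed (use assms in auto)

lemma rpow_mono: "0 \<le> x \<Longrightarrow> x \<le> y \<Longrightarrow> 0 \<le> p \<Longrightarrow> rpow x p \<le> rpow y p"
  by (simp add: rpow_def powr_mono2)

lemma rpow_subadditive:
  assumes "0 \<le> x" "0 \<le> y" "0 \<le> p" "p \<le> 1"
  shows "rpow (x + y) p \<le> rpow x p + rpow y p"
  using powr_subadditive[of x y p] assms by (auto simp: rpow_def)

text \<open>The exponential weight is submultiplicative because \<open>|\<xi>|\<^sup>1\<^sup>/\<^sup>\<sigma>\<close> is subadditive for
  \<open>\<sigma> \<ge> 1\<close>, and one derivative turns the weight \<open>|\<xi>|\<^sup>s\<close> into the subadditive weight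
  \<open>|\<xi>|\<^sup>s\<^sup>+\<^sup>1\<close> as \<open>0 \<le> s + 1 \<le> 1\<close>.\<close>

lemma wt_conv:
  assumes "a \<ge> 0" "\<sigma> \<ge> 1" "-1 \<le> s" "s \<le> 0"
  shows "wt a \<sigma> s \<zeta> * norm \<zeta> \<le>
    wt a \<sigma> (s + 1) (\<zeta> - \<eta>) * wt a \<sigma> 0 \<eta> + wt a \<sigma> 0 (\<zeta> - \<eta>) * wt a \<sigma> (s + 1) \<eta>"
proof -
  let ?x = "norm (\<zeta> - \<eta>)" and ?y = "norm \<eta>"
  have tri: "norm \<zeta> \<le> ?x + ?y" by norm
  have A: "rpow (norm \<zeta>) s * norm \<zeta> \<le> rpow ?x (s + 1) + rpow ?y (s + 1)"
  proof (cases "\<zeta> = 0")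
    case False
    then have "rpow (norm \<zeta>) s * norm \<zeta> = rpow (norm \<zeta>) (s + 1)"
      by (simp add: rpow_eq_powr powr_add)
    also have "\<dots> \<le> rpow (?x + ?y) (s + 1)"
      using tri assms by (intro rpow_mono) auto
    also have "\<dots> \<le> rpow ?x (s + 1) + rpow ?y (s + 1)"
      using assms by (intro rpow_subadditive) auto
    finally show ?thesis .
  qed (simp add: add_nonneg_nonneg)
  have "norm \<zeta> powr (1 / \<sigma>) \<le> (?x + ?y) powr (1 / \<sigma>)"
    using tri assms by (intro powr_mono2) auto
  also have "\<dots> \<le> ?x powr (1 / \<sigma>) + ?y powr (1 / \<sigma>)"
    using assms by (intro powr_subadditive) auto
  finally have "a * norm \<zeta> powr (1 / \<sigma>) \<le> a * ?x powr (1 / \<sigma>) + a * ?y powr (1 / \<sigma>)"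
    using assms(1) by (metis distrib_left mult_left_mono)
  then have B: "exp (a * norm \<zeta> powr (1 / \<sigma>)) \<le> exp (a * ?x powr (1 / \<sigma>)) * exp (a * ?y powr (1 / \<sigma>))"
    by (simp add: exp_add[symmetric])
  have "wt a \<sigma> s \<zeta> * norm \<zeta> = (rpow (norm \<zeta>) s * norm \<zeta>) * exp (a * norm \<zeta> powr (1 / \<sigma>))"
    by (simp add: wt_def)
  also have "\<dots> \<le> (rpow ?x (s + 1) + rpow ?y (s + 1)) * (exp (a * ?x powr (1 / \<sigma>)) * exp (a * ?y powr (1 / \<sigma>)))"
    using A B by (intro mult_mono) (auto simp: add_nonneg_nonneg)
  also have "\<dots> = wt a \<sigma> (s + 1) (\<zeta> - \<eta>) * wt a \<sigma> 0 \<eta> + wt a \<sigma> 0 (\<zeta> - \<eta>) * wt a \<sigma> (s + 1) \<eta>"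
    by (simp add: wt_def rpow_def[of _ 0] distrib_right)
  finally show ?thesis .
qed

definition nconv :: "(real^3 \<Rightarrow> ennreal) \<Rightarrow> (real^3 \<Rightarrow> ennreal) \<Rightarrow> real^3 \<Rightarrow> ennreal" where
  "nconv f g \<zeta> = (\<integral>\<^sup>+\<eta>. f (\<zeta> - \<eta>) * g \<eta> \<partial>lborel)"

lemma nconv_measurable [measurable]:
  assumes [measurable]: "f \<in> borel_measurable borel" "g \<in> borel_measurable borel"
  shows "nconv f g \<in> borel_measurable borel"
  unfolding nconv_def[abs_def] by measurable

lemma nconv_integral:
  assumes [measurable]: "f \<in> borel_measurable borel" "g \<in> borel_measurable borel"
  shows "(\<integral>\<^sup>+\<zeta>. nconv f g \<zeta> \<partial>lborel) = (\<integral>\<^sup>+\<zeta>. f \<zeta> \<partial>lborel) * (\<integral>\<^sup>+\<eta>. g \<eta> \<partial>lborel)"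
proof -
  have "(\<integral>\<^sup>+\<zeta>. nconv f g \<zeta> \<partial>lborel) = (\<integral>\<^sup>+\<eta>. \<integral>\<^sup>+\<zeta>. f (\<zeta> - \<eta>) * g \<eta> \<partial>lborel \<partial>lborel)"
    unfolding nconv_def by (rule lborel_pair.Fubini') measurable
  also have "\<dots> = (\<integral>\<^sup>+\<eta>. (\<integral>\<^sup>+\<zeta>. f \<zeta> \<partial>lborel) * g \<eta> \<partial>lborel)"
    by (intro nn_integral_cong, subst nn_integral_multc) (auto simp: nn_integral_translate)
  finally show ?thesis by (simp add: nn_integral_cmult)
qed

text \<open>The product estimate: by \<open>wt_conv\<close> the weight of one derivative of a product is shared between
  the two factors.\<close>

lemma wnorm_nconv:
  assumes par: "a \<ge> 0" "\<sigma> \<ge> 1" "-1 \<le> s" "s \<le> 0"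
    and [measurable]: "f \<in> borel_measurable borel" "g \<in> borel_measurable borel"
  shows "wnorm a \<sigma> s (\<lambda>\<zeta>. ennreal (norm \<zeta>) * nconv f g \<zeta>) \<le>
    wnorm a \<sigma> (s + 1) f * wnorm a \<sigma> 0 g + wnorm a \<sigma> 0 f * wnorm a \<sigma> (s + 1) g"
proof -
  let ?w1 = "\<lambda>\<xi>. ennreal (wt a \<sigma> (s + 1) \<xi>)" and ?w0 = "\<lambda>\<xi>. ennreal (wt a \<sigma> 0 \<xi>)"
  have "ennreal (wt a \<sigma> s \<zeta>) * (ennreal (norm \<zeta>) * nconv f g \<zeta>) \<le>
     nconv (\<lambda>\<xi>. ?w1 \<xi> * f \<xi>) (\<lambda>\<xi>. ?w0 \<xi> * g \<xi>) \<zeta> + nconv (\<lambda>\<xi>. ?w0 \<xi> * f \<xi>) (\<lambda>\<xi>. ?w1 \<xi> * g \<xi>) \<zeta>" for \<zeta>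
  proof -
    have "ennreal (wt a \<sigma> s \<zeta>) * (ennreal (norm \<zeta>) * nconv f g \<zeta>) =
       (\<integral>\<^sup>+\<eta>. ennreal (wt a \<sigma> s \<zeta> * norm \<zeta>) * (f (\<zeta> - \<eta>) * g \<eta>) \<partial>lborel)"
      unfolding nconv_def by (subst nn_integral_cmult) (auto simp: ennreal_mult' mult.assoc)
    also have "\<dots> \<le> (\<integral>\<^sup>+\<eta>. (?w1 (\<zeta> - \<eta>) * ?w0 \<eta> + ?w0 (\<zeta> - \<eta>) * ?w1 \<eta>) * (f (\<zeta> - \<eta>) * g \<eta>) \<partial>lborel)"
      by (intro nn_integral_mono mult_right_mono)
         (auto simp: ennreal_mult[symmetric] ennreal_plus[symmetric] simp del: ennreal_plus
           intro!: ennreal_leI wt_conv par)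
    also have "\<dots> = (\<integral>\<^sup>+\<eta>. (?w1 (\<zeta> - \<eta>) * f (\<zeta> - \<eta>)) * (?w0 \<eta> * g \<eta>) +
         (?w0 (\<zeta> - \<eta>) * f (\<zeta> - \<eta>)) * (?w1 \<eta> * g \<eta>) \<partial>lborel)"
      by (intro nn_integral_cong) (simp add: distrib_left distrib_right mult_ac)
    also have "\<dots> = nconv (\<lambda>\<xi>. ?w1 \<xi> * f \<xi>) (\<lambda>\<xi>. ?w0 \<xi> * g \<xi>) \<zeta> + nconv (\<lambda>\<xi>. ?w0 \<xi> * f \<xi>) (\<lambda>\<xi>. ?w1 \<xi> * g \<xi>) \<zeta>"
      unfolding nconv_def by (rule nn_integral_add) auto
    finally show ?thesis .
  qed
  then have "wnorm a \<sigma> s (\<lambda>\<zeta>. ennreal (norm \<zeta>) * nconv f g \<zeta>) \<le>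
     (\<integral>\<^sup>+\<zeta>. nconv (\<lambda>\<xi>. ?w1 \<xi> * f \<xi>) (\<lambda>\<xi>. ?w0 \<xi> * g \<xi>) \<zeta> +
        nconv (\<lambda>\<xi>. ?w0 \<xi> * f \<xi>) (\<lambda>\<xi>. ?w1 \<xi> * g \<xi>) \<zeta> \<partial>lborel)"
    unfolding wnorm_def by (rule nn_integral_mono)
  also have "\<dots> = wnorm a \<sigma> (s + 1) f * wnorm a \<sigma> 0 g + wnorm a \<sigma> 0 f * wnorm a \<sigma> (s + 1) g"
    unfolding wnorm_def by (subst nn_integral_add) (auto simp: nconv_integral)
  finally show ?thesis .
qed

text \<open>Interpolation of weights: split the frequencies at a radius \<open>R\<close>, compare the weight with the
  lower one inside and with the higher one outside, and choose \<open>R\<close> such that both contributions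
  agree; hence the factor 2.\<close>

lemma wnorm_split:
  assumes "q - s \<ge> 0" "r - q \<ge> 0" "R > 0" and [measurable]: "f \<in> borel_measurable borel"
  shows "wnorm a \<sigma> q f \<le> ennreal (R powr (q - s)) * wnorm a \<sigma> s f + ennreal (R powr (q - r)) * wnorm a \<sigma> r f"
proof -
  have pt: "wt a \<sigma> q \<xi> \<le> R powr (q - s) * wt a \<sigma> s \<xi> + R powr (q - r) * wt a \<sigma> r \<xi>" if "\<xi> \<noteq> 0" for \<xi>
  proof -
    let ?x = "norm \<xi>"
    have x: "?x > 0" using that by simp
    have "?x powr q \<le> R powr (q - s) * ?x powr s + R powr (q - r) * ?x powr r"
    proof (cases "?x \<le> R")
      case True
      have "?x powr q = ?x powr (q - s) * ?x powr s" using x by (simp add: powr_add[symmetric])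
      also have "\<dots> \<le> R powr (q - s) * ?x powr s"
        using True x assms by (intro mult_right_mono powr_mono2) auto
      finally show ?thesis by (simp add: add_increasing2)
    next
      case False
      have "?x powr q = ?x powr (q - r) * ?x powr r" using x by (simp add: powr_add[symmetric])
      also have "\<dots> \<le> R powr (q - r) * ?x powr r"
        using False x assms by (intro mult_right_mono powr_mono2') auto
      finally show ?thesis by (simp add: add_increasing)
    qed
    then have "?x powr q * exp (a * ?x powr (1 / \<sigma>)) \<le>
       (R powr (q - s) * ?x powr s + R powr (q - r) * ?x powr r) * exp (a * ?x powr (1 / \<sigma>))"
      by (rule mult_right_mono) simp
    then show ?thesis using that by (simp add: wt_def rpow_eq_powr distrib_right mult.assoc)
  qed
  have "wnorm a \<sigma> q f \<le> (\<integral>\<^sup>+\<xi>. ennreal (R powr (q - s)) * (ennreal (wt a \<sigma> s \<xi>) * f \<xi>) +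
      ennreal (R powr (q - r)) * (ennreal (wt a \<sigma> r \<xi>) * f \<xi>) \<partial>lborel)"
    unfolding wnorm_def
  proof (rule nn_integral_mono_AE)
    show "AE \<xi> in lborel. ennreal (wt a \<sigma> q \<xi>) * f \<xi> \<le>
      ennreal (R powr (q - s)) * (ennreal (wt a \<sigma> s \<xi>) * f \<xi>) +
      ennreal (R powr (q - r)) * (ennreal (wt a \<sigma> r \<xi>) * f \<xi>)"
      using AE_lborel_nonzero
    proof eventually_elim
      case (elim \<xi>)
      have "ennreal (wt a \<sigma> q \<xi>) \<le> ennreal (R powr (q - s)) * ennreal (wt a \<sigma> s \<xi>) +
          ennreal (R powr (q - r)) * ennreal (wt a \<sigma> r \<xi>)"
        using pt[OF elim] by (simp add: ennreal_mult[symmetric] ennreal_plus[symmetric] ennreal_leI del: ennreal_plus)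
      from mult_right_mono[OF this, of "f \<xi>"] show ?case by (simp add: distrib_right mult.assoc)
    qed
  qed
  also have "\<dots> = ennreal (R powr (q - s)) * wnorm a \<sigma> s f + ennreal (R powr (q - r)) * wnorm a \<sigma> r f"
    unfolding wnorm_def by (simp add: nn_integral_add nn_integral_cmult)
  finally show ?thesis .
qed

lemma wnorm_interpolate:
  assumes "s \<le> q" "q \<le> r" "s < r" and [measurable]: "f \<in> borel_measurable borel"
    and x: "wnorm a \<sigma> s f = ennreal x" "x > 0" and y: "wnorm a \<sigma> r f = ennreal y" "y > 0"
  shows "wnorm a \<sigma> q f \<le> ennreal (2 * x powr (1 - (q - s) / (r - s)) * y powr ((q - s) / (r - s)))"
proof -
  define k where "k = (q - s) / (r - s)"
  define R where "R = (y / x) powr (1 / (r - s))"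
  have R: "R > 0" using x y by (simp add: R_def)
  have k1: "(q - r) / (r - s) = k - 1" using assms by (simp add: k_def field_simps)
  have e1: "R powr (q - s) * x = x powr (1 - k) * y powr k"
  proof -
    have "R powr (q - s) = (y / x) powr k" by (simp add: R_def powr_powr k_def)
    also have "\<dots> = y powr k / x powr k" using x y by (simp add: powr_divide)
    finally show ?thesis using x by (simp add: powr_diff)
  qed
  have e2: "R powr (q - r) * y = x powr (1 - k) * y powr k"
  proof -
    have "R powr (q - r) = (y / x) powr (k - 1)" using k1 by (simp add: R_def powr_powr)
    also have "\<dots> = y powr (k - 1) / x powr (k - 1)" using x y by (simp add: powr_divide)
    finally show ?thesis using x y by (simp add: powr_diff)
  qed
  have "wnorm a \<sigma> q f \<le> ennreal (R powr (q - s)) * ennreal x + ennreal (R powr (q - r)) * ennreal y"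
    using wnorm_split[of q s r R f a \<sigma>] assms R by simp
  also have "\<dots> = ennreal (R powr (q - s) * x + R powr (q - r) * y)"
    using x y by (simp add: ennreal_mult[symmetric] ennreal_plus[symmetric] del: ennreal_plus)
  finally show ?thesis unfolding e1 e2 by (simp add: k_def mult_ac)
qed

text \<open>Young's inequality, distinguishing whether \<open>A Z\<^sup>\<kappa>\<close> is below \<open>\<epsilon> Z\<close>. It applies with the high norm as
  \<open>Z\<close>, whose coefficient has to be small.\<close>

lemma young_single:
  fixes \<kappa> \<epsilon> A Z :: real
  assumes k: "0 \<le> \<kappa>" "\<kappa> < 1" and e: "\<epsilon> > 0" and A: "A \<ge> 0" and Z: "Z > 0"
  shows "A * Z powr \<kappa> \<le> \<epsilon> * Z + \<epsilon> powr (- \<kappa> / (1 - \<kappa>)) * A powr (1 / (1 - \<kappa>))"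
proof (cases "A * Z powr \<kappa> \<le> \<epsilon> * Z")
  case False
  then have lt: "\<epsilon> * Z < A * Z powr \<kappa>" by simp
  have Ap: "A > 0"
    using A lt mult_pos_pos[OF e Z] by (cases "A = 0") auto
  have "Z powr (1 - \<kappa>) = Z / Z powr \<kappa>" using Z by (simp add: powr_diff)
  also have "\<dots> \<le> A / \<epsilon>" using lt Z e by (simp add: field_simps)
  finally have "Z powr (1 - \<kappa>) \<le> A / \<epsilon>" .
  then have "(Z powr (1 - \<kappa>)) powr (\<kappa> / (1 - \<kappa>)) \<le> (A / \<epsilon>) powr (\<kappa> / (1 - \<kappa>))"
    using k by (intro powr_mono2) auto
  moreover have "(Z powr (1 - \<kappa>)) powr (\<kappa> / (1 - \<kappa>)) = Z powr \<kappa>" using k by (simp add: powr_powr)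
  ultimately have "A * Z powr \<kappa> \<le> A * (A / \<epsilon>) powr (\<kappa> / (1 - \<kappa>))"
    using A by (simp add: mult_left_mono)
  also have "\<dots> = \<epsilon> powr (- \<kappa> / (1 - \<kappa>)) * (A powr 1 * A powr (\<kappa> / (1 - \<kappa>)))"
    using Ap e by (simp add: powr_divide powr_minus_divide)
  also have "A powr 1 * A powr (\<kappa> / (1 - \<kappa>)) = A powr (1 / (1 - \<kappa>))"
    using k by (subst powr_add[symmetric]) (simp add: field_simps)
  finally show ?thesis using e Z by (simp add: add_increasing)
qed (use e Z in \<open>simp add: add_increasing2\<close>)

lemma young_pair:
  fixes \<epsilon> A X Y :: real
  assumes k: "0 \<le> \<kappa>1" "0 \<le> \<kappa>2" "\<kappa>1 + \<kappa>2 < 1" and e: "\<epsilon> > 0" and A: "A \<ge> 0" and XY: "X > 0" "Y > 0"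
  shows "A * (X powr \<kappa>1 * Y powr \<kappa>2) \<le> \<epsilon> * (X + Y) +
    \<epsilon> powr (- (\<kappa>1 + \<kappa>2) / (1 - (\<kappa>1 + \<kappa>2))) * A powr (1 / (1 - (\<kappa>1 + \<kappa>2)))"
proof -
  have "X powr \<kappa>1 * Y powr \<kappa>2 \<le> (X + Y) powr \<kappa>1 * (X + Y) powr \<kappa>2"
    using k XY by (intro mult_mono powr_mono2) auto
  also have "\<dots> = (X + Y) powr (\<kappa>1 + \<kappa>2)" by (simp add: powr_add)
  finally have "A * (X powr \<kappa>1 * Y powr \<kappa>2) \<le> A * (X + Y) powr (\<kappa>1 + \<kappa>2)"
    using A by (rule mult_left_mono)
  also note young_single[of "\<kappa>1 + \<kappa>2" \<epsilon> A "X + Y"]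
  finally show ?thesis using assms by simp
qed

section \<open>The bilinear estimate\<close>

text \<open>All weights are positive off the origin, so that the norms vanish for the same functions. This
  disposes of the cases where a real power of a norm has base 0.\<close>

lemma wnorm_pos_transfer:
  assumes [measurable]: "f \<in> borel_measurable borel"
    and "wnorm a \<sigma> q f = ennreal x" "wnorm a \<sigma> r f = ennreal y" "0 < x" "0 \<le> y"
  shows "0 < y"
proof (rule ccontr)
  assume "\<not> 0 < y"
  then have "wnorm a \<sigma> r f = 0" using assms by simp
  then have "wnorm a \<sigma> q f = 0" by (rule wnorm_zero_AE[OF wnorm_eq_0D[OF assms(1)]])
  with assms show False by simp
qed

lemma wnorm_zero_transfer:
  "f \<in> borel_measurable borel \<Longrightarrow> wnorm a \<sigma> r f = 0 \<Longrightarrow> wnorm a \<sigma> q f = 0"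
  by (rule wnorm_zero_AE[OF wnorm_eq_0D])

text \<open>Both factors are interpolated between their low and high norms. The exponents of the high
  norms are \<open>k1\<close> and \<open>k2\<close>, and \<open>D > 0\<close> is equivalent to \<open>k1 + k2 < 1\<close>; then Young's inequality leaves the
  power \<open>1 / (1 - k1 - k2)\<close> of the low norms. With the roles of \<open>\<alpha>\<close> and \<open>\<beta>\<close> exchanged the lemma treats the
  other half of the product estimate.\<close>

lemma cross_term:
  fixes s \<alpha> \<beta> \<epsilon> :: real
  defines "D \<equiv> \<alpha> * (s + 2 * \<beta>) - \<beta>"
  assumes s: "-1 \<le> s" "s \<le> 0" and \<alpha>: "\<alpha> > 1/2" and \<beta>: "\<beta> > 1/2" and D: "D > 0" and \<epsilon>: "\<epsilon> > 0"
  obtains C where "C \<ge> 0" and "\<And>f g x X y Y. f \<in> borel_measurable borel \<Longrightarrow> g \<in> borel_measurable borel \<Longrightarrow>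
      wnorm a \<sigma> s f = ennreal x \<Longrightarrow> wnorm a \<sigma> (s + 2 * \<alpha>) f = ennreal X \<Longrightarrow>
      wnorm a \<sigma> s g = ennreal y \<Longrightarrow> wnorm a \<sigma> (s + 2 * \<beta>) g = ennreal Y \<Longrightarrow>
      0 \<le> x \<Longrightarrow> 0 \<le> X \<Longrightarrow> 0 \<le> y \<Longrightarrow> 0 \<le> Y \<Longrightarrow>
      wnorm a \<sigma> (s + 1) f * wnorm a \<sigma> 0 g \<le>
        ennreal (\<epsilon> * (X + Y) + C * (x * (rpow x (- s * \<alpha> / D) * rpow y (\<alpha> * (s + 2 * \<beta>) / D))))"
proof -
  define k1 where "k1 = 1 / (2 * \<alpha>)"
  define k2 where "k2 = - s / (2 * \<beta>)"
  define k where "k = k1 + k2"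
  have k_eq: "1 - k = D / (2 * \<alpha> * \<beta>)"
  proof -
    have nz: "\<alpha> \<noteq> 0" "\<beta> \<noteq> 0" using \<alpha> \<beta> by auto
    have "D / (2 * \<alpha> * \<beta>) = (\<alpha> * s) / (2 * \<alpha> * \<beta>) + (2 * \<alpha> * \<beta>) / (2 * \<alpha> * \<beta>) - \<beta> / (2 * \<alpha> * \<beta>)"
      unfolding add_divide_distrib[symmetric] diff_divide_distrib[symmetric]
      by (simp add: D_def distrib_left)
    also have "\<dots> = s / (2 * \<beta>) + 1 - 1 / (2 * \<alpha>)" using nz by simp
    finally show ?thesis by (simp add: k_def k1_def k2_def)
  qed
  have kp: "0 < D / (2 * \<alpha> * \<beta>)" using D \<alpha> \<beta> by (intro divide_pos_pos mult_pos_pos) auto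
  have k: "0 \<le> k1" "0 \<le> k2" "k < 1"
  proof -
    show "0 \<le> k1" using \<alpha> by (simp add: k1_def)
    show "0 \<le> k2" unfolding k2_def using s \<beta> by (intro divide_nonneg_pos) auto
    show "k < 1" using k_eq kp by linarith
  qed
  have e1: "(1 - k1) / (1 - k) = 1 + (- s * \<alpha> / D)" and e2: "(1 - k2) / (1 - k) = \<alpha> * (s + 2 * \<beta>) / D"
  proof -
    have nz: "D \<noteq> 0" "2 * \<alpha> * \<beta> \<noteq> 0" using D \<alpha> \<beta> by auto
    have q: "(P / E) / (D / E) = P / D" if "E \<noteq> 0" for P E :: real using that by simp
    have eqs: "1 - k1 = (D + (- s * \<alpha>)) / (2 * \<alpha> * \<beta>)" "1 - k2 = \<alpha> * (s + 2 * \<beta>) / (2 * \<alpha> * \<beta>)"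
    proof -
      have nz: "\<alpha> \<noteq> 0" "\<beta> \<noteq> 0" using \<alpha> \<beta> by auto
      have "(D + (- s * \<alpha>)) / (2 * \<alpha> * \<beta>) = ((2 * \<alpha>) * \<beta> - 1 * \<beta>) / (2 * \<alpha> * \<beta>)"
        by (simp add: D_def algebra_simps)
      also have "\<dots> = 1 - 1 / (2 * \<alpha>)" using nz unfolding diff_divide_distrib by simp
      finally show "1 - k1 = (D + (- s * \<alpha>)) / (2 * \<alpha> * \<beta>)" by (simp add: k1_def)
      have "\<alpha> * (s + 2 * \<beta>) / (2 * \<alpha> * \<beta>) = \<alpha> * s / (2 * \<alpha> * \<beta>) + 2 * \<alpha> * \<beta> / (2 * \<alpha> * \<beta>)"
        unfolding add_divide_distrib[symmetric] by (simp add: distrib_left)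
      also have "\<dots> = s / (2 * \<beta>) + 1" using nz by simp
      finally show "1 - k2 = \<alpha> * (s + 2 * \<beta>) / (2 * \<alpha> * \<beta>)" by (simp add: k2_def)
    qed
    have "(1 - k1) / (1 - k) = (D + (- s * \<alpha>)) / D"
      unfolding eqs(1) k_eq by (rule q[OF nz(2)])
    then show "(1 - k1) / (1 - k) = 1 + (- s * \<alpha> / D)"
      by (simp only: add_divide_distrib divide_self[OF nz(1)])
    show "(1 - k2) / (1 - k) = \<alpha> * (s + 2 * \<beta>) / D"
      unfolding eqs(2) k_eq by (rule q[OF nz(2)])
  qed
  define C where "C = \<epsilon> powr (- k / (1 - k)) * 4 powr (1 / (1 - k))"
  show thesis
  proof (rule that)
    show "C \<ge> 0" by (simp add: C_def)
    fix f g x X y Y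
    assume [measurable]: "f \<in> borel_measurable borel" "g \<in> borel_measurable borel"
      and n: "wnorm a \<sigma> s f = ennreal x" "wnorm a \<sigma> (s + 2 * \<alpha>) f = ennreal X"
        "wnorm a \<sigma> s g = ennreal y" "wnorm a \<sigma> (s + 2 * \<beta>) g = ennreal Y"
      and nn: "0 \<le> x" "0 \<le> X" "0 \<le> y" "0 \<le> (Y::real)"
    show "wnorm a \<sigma> (s + 1) f * wnorm a \<sigma> 0 g \<le>
        ennreal (\<epsilon> * (X + Y) + C * (x * (rpow x (- s * \<alpha> / D) * rpow y (\<alpha> * (s + 2 * \<beta>) / D))))"
    proof (cases "x = 0 \<or> y = 0")
      case True
      then have "wnorm a \<sigma> (s + 1) f * wnorm a \<sigma> 0 g = 0"
      proof
        assume "x = 0"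
        then have "wnorm a \<sigma> (s + 1) f = 0" using wnorm_zero_transfer[of f a \<sigma> s] n(1) by simp
        then show ?thesis by simp
      next
        assume "y = 0"
        then have "wnorm a \<sigma> 0 g = 0" using wnorm_zero_transfer[of g a \<sigma> s] n(3) by simp
        then show ?thesis by simp
      qed
      then show ?thesis by (simp only: zero_le)
    next
      case False
      then have xy: "x > 0" "y > 0" using nn by auto
      have XY: "X > 0" "Y > 0"
        using wnorm_pos_transfer[OF _ n(1) n(2)] wnorm_pos_transfer[OF _ n(3) n(4)] xy nn by auto
      have F: "wnorm a \<sigma> (s + 1) f \<le> ennreal (2 * x powr (1 - k1) * X powr k1)"
        using wnorm_interpolate[of s "s + 1" "s + 2 * \<alpha>" f a \<sigma> x X] n xy XY \<alpha> by (simp add: k1_def)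
      have G: "wnorm a \<sigma> 0 g \<le> ennreal (2 * y powr (1 - k2) * Y powr k2)"
        using wnorm_interpolate[of s 0 "s + 2 * \<beta>" g a \<sigma> y Y] n xy XY \<beta> s by (simp add: k2_def)
      define A where "A = 4 * (x powr (1 - k1) * y powr (1 - k2))"
      have "wnorm a \<sigma> (s + 1) f * wnorm a \<sigma> 0 g \<le>
          ennreal (2 * x powr (1 - k1) * X powr k1) * ennreal (2 * y powr (1 - k2) * Y powr k2)"
        by (rule mult_mono[OF F G]) auto
      also have "\<dots> = ennreal (A * (X powr k1 * Y powr k2))"
        by (subst ennreal_mult[symmetric]) (auto simp: A_def mult_ac)
      also have "\<dots> \<le> ennreal (\<epsilon> * (X + Y) + \<epsilon> powr (- k / (1 - k)) * A powr (1 / (1 - k)))"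
        using young_pair[of k1 k2 \<epsilon> A X Y] k \<epsilon> XY by (intro ennreal_leI) (simp add: k_def A_def)
      also have "\<epsilon> powr (- k / (1 - k)) * A powr (1 / (1 - k)) =
          C * (x * (rpow x (- s * \<alpha> / D) * rpow y (\<alpha> * (s + 2 * \<beta>) / D)))"
      proof -
        have "A powr (1 / (1 - k)) = 4 powr (1 / (1 - k)) *
            (x powr ((1 - k1) / (1 - k)) * y powr ((1 - k2) / (1 - k)))"
          using xy by (simp add: A_def powr_mult powr_powr)
        also have "\<dots> = 4 powr (1 / (1 - k)) * (x * x powr (- s * \<alpha> / D) * y powr (\<alpha> * (s + 2 * \<beta>) / D))"
        proof -
          have "x powr (1 + t) = x * x powr t" for t using xy by (simp add: powr_add)
          then show ?thesis unfolding e1 e2 by (simp only:)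
        qed
        finally show ?thesis using xy by (simp add: C_def rpow_eq_powr mult_ac)
      qed
      finally show ?thesis .
    qed
  qed
qed

text \<open>The case of two equal factors, where the exponents of the high norm are \<open>1 / (2\<alpha>)\<close> and
  \<open>-s / (2\<alpha>)\<close>.\<close>

lemma self_term:
  fixes s \<alpha> \<epsilon> :: real
  assumes s: "-1 \<le> s" "s \<le> 0" and \<alpha>: "\<alpha> > 1/2" and D: "2 * \<alpha> + s - 1 > 0" and \<epsilon>: "\<epsilon> > 0"
  obtains C where "C \<ge> 0" and "\<And>f x X. f \<in> borel_measurable borel \<Longrightarrow>
      wnorm a \<sigma> s f = ennreal x \<Longrightarrow> wnorm a \<sigma> (s + 2 * \<alpha>) f = ennreal X \<Longrightarrow>
      0 \<le> x \<Longrightarrow> 0 \<le> X \<Longrightarrow>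
      wnorm a \<sigma> (s + 1) f * wnorm a \<sigma> 0 f \<le>
        ennreal (\<epsilon> * X + C * (x * rpow x (2 * \<alpha> / (2 * \<alpha> + s - 1))))"
proof -
  define k1 where "k1 = 1 / (2 * \<alpha>)"
  define k2 where "k2 = - s / (2 * \<alpha>)"
  define k where "k = k1 + k2"
  have k_eq: "1 - k = (2 * \<alpha> + s - 1) / (2 * \<alpha>)"
    using \<alpha> by (simp add: k_def k1_def k2_def field_simps)
  have kp: "0 < (2 * \<alpha> + s - 1) / (2 * \<alpha>)" using D \<alpha> by (intro divide_pos_pos) auto
  have k: "0 \<le> k1" "0 \<le> k2" "k < 1"
  proof -
    show "0 \<le> k1" using \<alpha> by (simp add: k1_def)
    show "0 \<le> k2" unfolding k2_def using s \<alpha> by (intro divide_nonneg_pos) auto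
    show "k < 1" using k_eq kp by linarith
  qed
  have e: "(2 - k) / (1 - k) = 1 + 2 * \<alpha> / (2 * \<alpha> + s - 1)"
  proof -
    have "(2 - k) / (1 - k) = 1 + 1 / (1 - k)" using k by (simp add: field_simps)
    then show ?thesis unfolding k_eq by simp
  qed
  define C where "C = \<epsilon> powr (- k / (1 - k)) * 4 powr (1 / (1 - k))"
  show thesis
  proof (rule that)
    show "C \<ge> 0" by (simp add: C_def)
    fix f x X
    assume [measurable]: "f \<in> borel_measurable borel"
      and n: "wnorm a \<sigma> s f = ennreal x" "wnorm a \<sigma> (s + 2 * \<alpha>) f = ennreal X"
      and nn: "0 \<le> x" "0 \<le> (X::real)"
    show "wnorm a \<sigma> (s + 1) f * wnorm a \<sigma> 0 f \<le>
        ennreal (\<epsilon> * X + C * (x * rpow x (2 * \<alpha> / (2 * \<alpha> + s - 1))))"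
    proof (cases "x = 0")
      case True
      then have "wnorm a \<sigma> 0 f = 0" using wnorm_zero_transfer[of f a \<sigma> s] n(1) by simp
      then show ?thesis by simp
    next
      case False
      then have xy: "x > 0" using nn by auto
      have XY: "X > 0"
        using wnorm_pos_transfer[OF _ n(1) n(2)] xy nn by auto
      have F: "wnorm a \<sigma> (s + 1) f \<le> ennreal (2 * x powr (1 - k1) * X powr k1)"
        using wnorm_interpolate[of s "s + 1" "s + 2 * \<alpha>" f a \<sigma> x X] n xy XY \<alpha> by (simp add: k1_def)
      have G: "wnorm a \<sigma> 0 f \<le> ennreal (2 * x powr (1 - k2) * X powr k2)"
        using wnorm_interpolate[of s 0 "s + 2 * \<alpha>" f a \<sigma> x X] n xy XY \<alpha> s by (simp add: k2_def)
      define A where "A = 4 * x powr (2 - k)"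
      have "wnorm a \<sigma> (s + 1) f * wnorm a \<sigma> 0 f \<le>
          ennreal (2 * x powr (1 - k1) * X powr k1) * ennreal (2 * x powr (1 - k2) * X powr k2)"
        by (rule mult_mono[OF F G]) auto
      also have "\<dots> = ennreal (4 * (x powr (1 - k1) * x powr (1 - k2)) * (X powr k1 * X powr k2))"
        by (subst ennreal_mult[symmetric]) (auto simp: mult_ac)
      also have "\<dots> = ennreal (A * X powr k)"
        by (simp add: powr_add[symmetric] A_def k_def algebra_simps)
      also have "\<dots> \<le> ennreal (\<epsilon> * X + \<epsilon> powr (- k / (1 - k)) * A powr (1 / (1 - k)))"
        using young_single[of k \<epsilon> A X] k \<epsilon> XY by (intro ennreal_leI) (simp add: k_def A_def)
      also have "\<epsilon> powr (- k / (1 - k)) * A powr (1 / (1 - k)) =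
          C * (x * rpow x (2 * \<alpha> / (2 * \<alpha> + s - 1)))"
      proof -
        have "A powr (1 / (1 - k)) = 4 powr (1 / (1 - k)) * x powr ((2 - k) / (1 - k))"
          using xy by (simp add: A_def powr_mult powr_powr)
        also have "\<dots> = 4 powr (1 / (1 - k)) * (x * x powr (2 * \<alpha> / (2 * \<alpha> + s - 1)))"
          unfolding e using xy by (simp add: powr_add)
        finally show ?thesis using xy by (simp add: C_def rpow_eq_powr mult_ac)
      qed
      finally show ?thesis .
    qed
  qed
qed

locale boussinesq_exponents =
  fixes a \<sigma> \<alpha> \<beta> s :: real
  assumes a_nonneg: "a \<ge> 0" and sigma_ge: "\<sigma> \<ge> 1" and alpha_gt: "\<alpha> > 1/2" and beta_gt: "\<beta> > 1/2"
    and s_ge: "-1 \<le> s" and s_le: "s \<le> 0"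
    and D1: "2 * \<alpha> + s - 1 > 0" and D2: "\<beta> * (s + 2 * \<alpha>) - \<alpha> > 0" and D3: "\<alpha> * (s + 2 * \<beta>) - \<beta> > 0"
begin

text \<open>The quantity in the blow-up criterion, for \<open>x\<close> and \<open>y\<close> the norms of the velocity and of the
  temperature.\<close>

definition Phi :: "real \<Rightarrow> real \<Rightarrow> real" where
  "Phi x y = rpow x (2 * \<alpha> / (2 * \<alpha> + s - 1))
      + rpow x (\<beta> * (s + 2 * \<alpha>) / (\<beta> * (s + 2 * \<alpha>) - \<alpha>)) * rpow y (- s * \<beta> / (\<beta> * (s + 2 * \<alpha>) - \<alpha>))
      + rpow x (- s * \<alpha> / (\<alpha> * (s + 2 * \<beta>) - \<beta>)) * rpow y (\<alpha> * (s + 2 * \<beta>) / (\<alpha> * (s + 2 * \<beta>) - \<beta>))"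

lemma Phi_nonneg: "0 \<le> Phi x y"
  by (simp add: Phi_def add_nonneg_nonneg)

text \<open>The first term on the left is the self-interaction of the velocity, the second the transport
  of the temperature, which \<open>wnorm_nconv\<close> splits into two cross terms.\<close>

lemma bilinear_estimate:
  fixes \<epsilon> :: real
  assumes \<epsilon>: "\<epsilon> > 0"
  obtains C where "C \<ge> 0" and "\<And>f g x X y Y. f \<in> borel_measurable borel \<Longrightarrow> g \<in> borel_measurable borel \<Longrightarrow>
      wnorm a \<sigma> s f = ennreal x \<Longrightarrow> wnorm a \<sigma> (s + 2 * \<alpha>) f = ennreal X \<Longrightarrow>
      wnorm a \<sigma> s g = ennreal y \<Longrightarrow> wnorm a \<sigma> (s + 2 * \<beta>) g = ennreal Y \<Longrightarrow>
      0 \<le> x \<Longrightarrow> 0 \<le> X \<Longrightarrow> 0 \<le> y \<Longrightarrow> 0 \<le> Y \<Longrightarrow>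
      wnorm a \<sigma> s (\<lambda>\<zeta>. ennreal (norm \<zeta>) * nconv f f \<zeta>) + wnorm a \<sigma> s (\<lambda>\<zeta>. ennreal (norm \<zeta>) * nconv f g \<zeta>)
      \<le> ennreal (\<epsilon> * (X + Y) + C * (Phi x y * (x + y)))"
proof -
  have e: "\<epsilon> / 4 > 0" using \<epsilon> by simp
  obtain C1 where C1: "C1 \<ge> 0" "\<And>f x X. f \<in> borel_measurable borel \<Longrightarrow>
      wnorm a \<sigma> s f = ennreal x \<Longrightarrow> wnorm a \<sigma> (s + 2 * \<alpha>) f = ennreal X \<Longrightarrow> 0 \<le> x \<Longrightarrow> 0 \<le> X \<Longrightarrow>
      wnorm a \<sigma> (s + 1) f * wnorm a \<sigma> 0 f \<le>
        ennreal (\<epsilon> / 4 * X + C1 * (x * rpow x (2 * \<alpha> / (2 * \<alpha> + s - 1))))"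
    using self_term[OF s_ge s_le alpha_gt D1 e] by metis
  obtain C2 where C2: "C2 \<ge> 0" "\<And>f g x X y Y. f \<in> borel_measurable borel \<Longrightarrow> g \<in> borel_measurable borel \<Longrightarrow>
      wnorm a \<sigma> s f = ennreal x \<Longrightarrow> wnorm a \<sigma> (s + 2 * \<beta>) f = ennreal X \<Longrightarrow>
      wnorm a \<sigma> s g = ennreal y \<Longrightarrow> wnorm a \<sigma> (s + 2 * \<alpha>) g = ennreal Y \<Longrightarrow>
      0 \<le> x \<Longrightarrow> 0 \<le> X \<Longrightarrow> 0 \<le> y \<Longrightarrow> 0 \<le> Y \<Longrightarrow>
      wnorm a \<sigma> (s + 1) f * wnorm a \<sigma> 0 g \<le>
        ennreal (\<epsilon> / 4 * (X + Y) + C2 * (x * (rpow x (- s * \<beta> / (\<beta> * (s + 2 * \<alpha>) - \<alpha>)) * rpow y (\<beta> * (s + 2 * \<alpha>) / (\<beta> * (s + 2 * \<alpha>) - \<alpha>)))))"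
    using cross_term[OF s_ge s_le beta_gt alpha_gt D2 e] by metis
  obtain C3 where C3: "C3 \<ge> 0" "\<And>f g x X y Y. f \<in> borel_measurable borel \<Longrightarrow> g \<in> borel_measurable borel \<Longrightarrow>
      wnorm a \<sigma> s f = ennreal x \<Longrightarrow> wnorm a \<sigma> (s + 2 * \<alpha>) f = ennreal X \<Longrightarrow>
      wnorm a \<sigma> s g = ennreal y \<Longrightarrow> wnorm a \<sigma> (s + 2 * \<beta>) g = ennreal Y \<Longrightarrow>
      0 \<le> x \<Longrightarrow> 0 \<le> X \<Longrightarrow> 0 \<le> y \<Longrightarrow> 0 \<le> Y \<Longrightarrow>
      wnorm a \<sigma> (s + 1) f * wnorm a \<sigma> 0 g \<le>
        ennreal (\<epsilon> / 4 * (X + Y) + C3 * (x * (rpow x (- s * \<alpha> / (\<alpha> * (s + 2 * \<beta>) - \<beta>)) * rpow y (\<alpha> * (s + 2 * \<beta>) / (\<alpha> * (s + 2 * \<beta>) - \<beta>)))))"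
    using cross_term[OF s_ge s_le alpha_gt beta_gt D3 e] by metis
  define C where "C = 2 * C1 + C2 + C3"
  show thesis
  proof (rule that)
    show "C \<ge> 0" using C1(1) C2(1) C3(1) by (simp add: C_def)
    fix f g x X y Y
    assume [measurable]: "f \<in> borel_measurable borel" "g \<in> borel_measurable borel"
      and n: "wnorm a \<sigma> s f = ennreal x" "wnorm a \<sigma> (s + 2 * \<alpha>) f = ennreal X"
        "wnorm a \<sigma> s g = ennreal y" "wnorm a \<sigma> (s + 2 * \<beta>) g = ennreal Y"
      and nn: "0 \<le> x" "0 \<le> X" "0 \<le> y" "0 \<le> (Y::real)"
    define P1 where "P1 = rpow x (2 * \<alpha> / (2 * \<alpha> + s - 1))"
    define P2 where "P2 = rpow x (\<beta> * (s + 2 * \<alpha>) / (\<beta> * (s + 2 * \<alpha>) - \<alpha>)) * rpow y (- s * \<beta> / (\<beta> * (s + 2 * \<alpha>) - \<alpha>))"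
    define P3 where "P3 = rpow x (- s * \<alpha> / (\<alpha> * (s + 2 * \<beta>) - \<beta>)) * rpow y (\<alpha> * (s + 2 * \<beta>) / (\<alpha> * (s + 2 * \<beta>) - \<beta>))"
    have P: "P1 \<ge> 0" "P2 \<ge> 0" "P3 \<ge> 0" "Phi x y = P1 + P2 + P3"
      by (simp_all add: P1_def P2_def P3_def Phi_def)
    have b1: "wnorm a \<sigma> (s + 1) f * wnorm a \<sigma> 0 f \<le> ennreal (\<epsilon> / 4 * X + C1 * (x * P1))"
      using C1(2)[of f x X] n nn by (simp add: P1_def)
    have b2: "wnorm a \<sigma> 0 f * wnorm a \<sigma> (s + 1) g \<le> ennreal (\<epsilon> / 4 * (X + Y) + C2 * (y * P2))"
      using C2(2)[of g f y Y x X] n nn by (simp add: P2_def mult_ac add.commute)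
    have b3: "wnorm a \<sigma> (s + 1) f * wnorm a \<sigma> 0 g \<le> ennreal (\<epsilon> / 4 * (X + Y) + C3 * (x * P3))"
      using C3(2)[of f g x X y Y] n nn by (simp add: P3_def)
    have "wnorm a \<sigma> s (\<lambda>\<zeta>. ennreal (norm \<zeta>) * nconv f f \<zeta>) + wnorm a \<sigma> s (\<lambda>\<zeta>. ennreal (norm \<zeta>) * nconv f g \<zeta>) \<le>
      (wnorm a \<sigma> (s + 1) f * wnorm a \<sigma> 0 f + wnorm a \<sigma> (s + 1) f * wnorm a \<sigma> 0 f) +
      (wnorm a \<sigma> (s + 1) f * wnorm a \<sigma> 0 g + wnorm a \<sigma> 0 f * wnorm a \<sigma> (s + 1) g)"
      using wnorm_nconv[OF a_nonneg sigma_ge s_ge s_le, of f f] wnorm_nconv[OF a_nonneg sigma_ge s_ge s_le, of f g]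
      by (intro add_mono) (auto simp: mult.commute)
    also have "\<dots> \<le> (ennreal (\<epsilon> / 4 * X + C1 * (x * P1)) + ennreal (\<epsilon> / 4 * X + C1 * (x * P1))) +
        (ennreal (\<epsilon> / 4 * (X + Y) + C3 * (x * P3)) + ennreal (\<epsilon> / 4 * (X + Y) + C2 * (y * P2)))"
      by (intro add_mono b1 b2 b3)
    also have "\<dots> = ennreal ((\<epsilon> / 4 * X + C1 * (x * P1)) + (\<epsilon> / 4 * X + C1 * (x * P1)) +
        ((\<epsilon> / 4 * (X + Y) + C3 * (x * P3)) + (\<epsilon> / 4 * (X + Y) + C2 * (y * P2))))"
      using \<epsilon> nn P C1(1) C2(1) C3(1) by (subst ennreal_plus[symmetric], simp, simp)+
    also have "\<dots> \<le> ennreal (\<epsilon> * (X + Y) + C * (Phi x y * (x + y)))"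
    proof (rule ennreal_leI)
      have "2 * C1 * (x * P1) \<le> 2 * C1 * (Phi x y * (x + y))" "C2 * (y * P2) \<le> C2 * (Phi x y * (x + y))"
        "C3 * (x * P3) \<le> C3 * (Phi x y * (x + y))"
        using P nn C1(1) C2(1) C3(1)
        by (auto intro!: mult_left_mono simp: mult.commute[of x] mult.commute[of y] intro!: mult_mono)
      then have "2 * C1 * (x * P1) + C2 * (y * P2) + C3 * (x * P3) \<le> C * (Phi x y * (x + y))"
        unfolding C_def distrib_right by (intro add_mono)
      have "\<epsilon> * X \<ge> 0" "\<epsilon> * Y \<ge> 0" using \<epsilon> nn by auto
      show "(\<epsilon> / 4 * X + C1 * (x * P1)) + (\<epsilon> / 4 * X + C1 * (x * P1)) +
        ((\<epsilon> / 4 * (X + Y) + C3 * (x * P3)) + (\<epsilon> / 4 * (X + Y) + C2 * (y * P2)))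
        \<le> \<epsilon> * (X + Y) + C * (Phi x y * (x + y))"
      proof -
        have "\<epsilon> * (X + Y) = \<epsilon> * X + \<epsilon> * Y" "\<epsilon> / 4 * (X + Y) = \<epsilon> * X / 4 + \<epsilon> * Y / 4"
          "\<epsilon> / 4 * X = \<epsilon> * X / 4" "2 * C1 * (x * P1) = 2 * (C1 * (x * P1))"
          by (simp_all add: algebra_simps add_divide_distrib)
        with \<open>2 * C1 * (x * P1) + C2 * (y * P2) + C3 * (x * P3) \<le> C * (Phi x y * (x + y))\<close>
          \<open>\<epsilon> * X \<ge> 0\<close> \<open>\<epsilon> * Y \<ge> 0\<close>
        show ?thesis by linarith
      qed
    qed
    finally show "wnorm a \<sigma> s (\<lambda>\<zeta>. ennreal (norm \<zeta>) * nconv f f \<zeta>) + wnorm a \<sigma> s (\<lambda>\<zeta>. ennreal (norm \<zeta>) * nconv f g \<zeta>)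
      \<le> ennreal (\<epsilon> * (X + Y) + C * (Phi x y * (x + y)))" .
  qed
qed

end

section \<open>The weighted spaces on the Fourier side\<close>

lemma weighted_L1_hat: "frep G f \<Longrightarrow> weighted_L1 a \<sigma> r (hat f) = wabs a \<sigma> r G"
  unfolding weighted_L1_eq_wnorm using frep_hat(2)[of G f]
  by (intro wnorm_cong_AE) (auto elim!: AE_mp)

lemma X_norm_eq: "frep G f \<Longrightarrow> X_norm a \<sigma> r f = enn2real (wabs a \<sigma> r G)"
  by (simp add: X_norm_def weighted_L1_hat)

text \<open>Since \<open>hat f\<close> is determined up to a null set, norms may be computed from any representing
  function.\<close>

lemma X_space_iff: "frep G f \<Longrightarrow> f \<in> X_space a \<sigma> r \<longleftrightarrow> tempered f \<and> wabs a \<sigma> r G < \<infinity>"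
  by (auto simp: X_space_def weighted_L1_hat)

lemma X_space_frep: "f \<in> X_space a \<sigma> r \<Longrightarrow> frep (hat f) f"
  by (auto simp: X_space_def frep_hat)

abbreviation vnorm :: "(3 \<Rightarrow> complex) \<Rightarrow> ennreal" where
  "vnorm z \<equiv> ennreal (norm (\<chi> i. z i))"

abbreviation wvec :: "real \<Rightarrow> real \<Rightarrow> real \<Rightarrow> (3 \<Rightarrow> test_fun) \<Rightarrow> ennreal" where
  "wvec a \<sigma> r V \<equiv> wnorm a \<sigma> r (\<lambda>\<xi>. vnorm (\<lambda>k. V k \<xi>))"

lemma weighted_L1_hat_vec:
  assumes "\<And>i. frep (G i) (f $ i)"
  shows "weighted_L1 a \<sigma> r (hat_vec f) = wvec a \<sigma> r G"
proof -
  have "AE \<xi> in lborel. \<forall>i. hat (f $ i) \<xi> = G i \<xi>"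
    using frep_hat(2)[OF assms] by (simp add: AE_all_countable)
  then have "AE \<xi> in lborel. ennreal (norm (hat_vec f \<xi>)) = vnorm (\<lambda>i. G i \<xi>)"
    by eventually_elim (simp add: hat_vec_def)
  then show ?thesis unfolding weighted_L1_eq_wnorm by (rule wnorm_cong_AE)
qed

lemma X_norm_vec_eq:
  assumes "\<And>i. frep (G i) (f $ i)"
  shows "X_norm_vec a \<sigma> r f = enn2real (wvec a \<sigma> r G)"
  unfolding X_norm_vec_def weighted_L1_hat_vec[OF assms] ..

lemma X_space_vec_iff:
  assumes "\<And>i. frep (G i) (f $ i)"
  shows "f \<in> X_space_vec a \<sigma> r \<longleftrightarrow>
     (\<forall>i. tempered (f $ i)) \<and> wvec a \<sigma> r G < \<infinity>"
  unfolding X_space_vec_def weighted_L1_hat_vec[OF assms, symmetric] using assms by blast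

lemma X_space_vec_frep: "f \<in> X_space_vec a \<sigma> r \<Longrightarrow> frep (hat (f $ i)) (f $ i)"
  unfolding X_space_vec_def using frep_hat(1) by blast

lemma norm_component_vnorm: "ennreal (norm (z i)) \<le> vnorm z"
  by (intro ennreal_leI) (metis Finite_Cartesian_Product.norm_nth_le vec_lambda_beta)

lemma vnorm_le_sum: "vnorm z \<le> (\<Sum>i\<in>UNIV. ennreal (norm (z i)))"
proof -
  have "norm (\<chi> i. z i) \<le> (\<Sum>i\<in>UNIV. norm (z i))"
    unfolding norm_vec_def using L2_set_le_sum[of UNIV "\<lambda>i. norm (z i)"] by simp
  then show ?thesis by (simp add: ennreal_leI)
qed

lemma vnorm_measurable [measurable (raw)]:
  assumes "\<And>i. G i \<in> borel_measurable M"
  shows "(\<lambda>x. vnorm (\<lambda>i. G i x)) \<in> borel_measurable M"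
  unfolding norm_vec_def L2_set_def vec_lambda_beta using assms by measurable

lemma X_space_vec_component:
  assumes "f \<in> X_space_vec a \<sigma> r"
  shows "f $ i \<in> X_space a \<sigma> r"
proof -
  note fr = X_space_vec_frep[OF assms]
  have "tempered (f $ i)" "wvec a \<sigma> r (\<lambda>i. hat (f $ i)) < \<infinity>"
    using assms X_space_vec_iff[OF fr] by auto
  moreover have "wabs a \<sigma> r (hat (f $ i)) \<le> wvec a \<sigma> r (\<lambda>i. hat (f $ i))"
    by (intro wnorm_mono norm_component_vnorm)
  ultimately show ?thesis using X_space_iff[OF fr[of i]] by (auto simp: less_top[symmetric] top_unique)
qed

lemma X_space_vec_diff_frep:
  assumes "f \<in> X_space_vec a \<sigma> r" "g \<in> X_space_vec a \<sigma> r"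
  shows "frep (\<lambda>\<xi>. hat (f $ i) \<xi> - hat (g $ i) \<xi>) ((f - g) $ i)"
  unfolding vector_minus_component by (intro frep_diff X_space_vec_frep[OF assms(1)] X_space_vec_frep[OF assms(2)])

lemma wvec_le_sum:
  assumes "\<And>i. G i \<in> borel_measurable borel"
  shows "wvec a \<sigma> r G \<le> (\<Sum>i\<in>UNIV. wabs a \<sigma> r (G i))"
proof -
  have "wvec a \<sigma> r G \<le> wnorm a \<sigma> r (\<lambda>\<xi>. \<Sum>i\<in>UNIV. ennreal (norm (G i \<xi>)))"
    by (intro wnorm_mono vnorm_le_sum)
  also have "\<dots> = (\<Sum>i\<in>UNIV. wabs a \<sigma> r (G i))"
    using assms by (intro wnorm_sum) auto
  finally show ?thesis .
qed

lemma wnorm_vnorm_finite: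
  assumes "\<And>i. G i \<in> borel_measurable borel" "\<And>i. wabs a \<sigma> r (G i) < \<infinity>"
  shows "wvec a \<sigma> r G < \<infinity>"
  by (rule le_less_trans[OF wvec_le_sum[OF assms(1)]]) (use assms(2) in \<open>simp add: less_top[symmetric]\<close>)

lemma wnorm_diff_finite:
  fixes F G :: test_fun
  assumes [measurable]: "F \<in> borel_measurable borel" "G \<in> borel_measurable borel"
    and "wabs a \<sigma> r F < \<infinity>" "wabs a \<sigma> r G < \<infinity>"
  shows "wabs a \<sigma> r (\<lambda>\<xi>. F \<xi> - G \<xi>) < \<infinity>"
proof -
  have "wabs a \<sigma> r (\<lambda>\<xi>. F \<xi> - G \<xi>) \<le>
      wnorm a \<sigma> r (\<lambda>\<xi>. ennreal (norm (F \<xi>)) + ennreal (norm (G \<xi>)))"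
    by (intro wnorm_mono) (simp add: ennreal_plus[symmetric] ennreal_leI norm_triangle_ineq4 del: ennreal_plus)
  also have "\<dots> = wabs a \<sigma> r F + wabs a \<sigma> r G"
    by (rule wnorm_add) auto
  also have "\<dots> < \<infinity>" using assms by simp
  finally show ?thesis .
qed

lemma X_norm_component_le:
  assumes f: "f \<in> X_space_vec a \<sigma> r" and g: "g \<in> X_space_vec a \<sigma> r"
  shows "X_norm a \<sigma> r ((f - g) $ i) \<le> X_norm_vec a \<sigma> r (f - g)"
proof -
  note d = X_space_vec_diff_frep[OF f g]
  have [measurable]: "hat (f $ i) \<in> borel_measurable borel" "hat (g $ i) \<in> borel_measurable borel" for i
    using X_space_vec_frep[OF f] X_space_vec_frep[OF g] frep_measurable by blast+
  have fin: "wvec a \<sigma> r (\<lambda>i \<xi>. hat (f $ i) \<xi> - hat (g $ i) \<xi>) < \<infinity>"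
  proof (intro wnorm_vnorm_finite wnorm_diff_finite)
    show "wabs a \<sigma> r (hat (f $ i)) < \<infinity>" for i
      using X_space_vec_component[OF f, of i] X_space_iff[OF X_space_vec_frep[OF f, of i]] by auto
    show "wabs a \<sigma> r (hat (g $ i)) < \<infinity>" for i
      using X_space_vec_component[OF g, of i] X_space_iff[OF X_space_vec_frep[OF g, of i]] by auto
  qed measurable
  have "wabs a \<sigma> r (\<lambda>\<xi>. hat (f $ i) \<xi> - hat (g $ i) \<xi>) \<le>
      wvec a \<sigma> r (\<lambda>i \<xi>. hat (f $ i) \<xi> - hat (g $ i) \<xi>)"
    by (intro wnorm_mono norm_component_vnorm[of "\<lambda>i. hat (f $ i) _ - hat (g $ i) _"])
  then show ?thesis
    unfolding X_norm_eq[OF d] X_norm_vec_eq[OF d] using fin by (intro enn2real_mono) auto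
qed

lemma C_into_component:
  assumes "C_into (X_space_vec a \<sigma> r) (X_norm_vec a \<sigma> r) I u"
  shows "C_into (X_space a \<sigma> r) (X_norm a \<sigma> r) I (\<lambda>t. u t $ i)"
  unfolding C_into_def
proof (intro conjI ballI)
  have mem: "u t \<in> X_space_vec a \<sigma> r" if "t \<in> I" for t using assms that by (auto simp: C_into_def)
  show "u t $ i \<in> X_space a \<sigma> r" if "t \<in> I" for t
    using X_space_vec_component[OF mem[OF that]] .
  fix t assume t: "t \<in> I"
  have lim: "((\<lambda>r'. X_norm_vec a \<sigma> r (u r' - u t)) \<longlongrightarrow> 0) (at t within I)"
    using assms t by (auto simp: C_into_def)
  show "((\<lambda>r'. X_norm a \<sigma> r (u r' $ i - u t $ i)) \<longlongrightarrow> 0) (at t within I)"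
  proof (rule tendsto_sandwich[OF _ _ tendsto_const lim])
    show "\<forall>\<^sub>F r' in at t within I. 0 \<le> X_norm a \<sigma> r (u r' $ i - u t $ i)"
      by (simp add: X_norm_def)
    show "\<forall>\<^sub>F r' in at t within I. X_norm a \<sigma> r (u r' $ i - u t $ i) \<le> X_norm_vec a \<sigma> r (u r' - u t)"
      unfolding eventually_at_filter
      using X_norm_component_le[OF mem mem[OF t]] by (intro always_eventually) simp
  qed
qed

subsection \<open>Pairing and temperedness\<close>

text \<open>For \<open>s \<in> [-1, 0]\<close> the weight \<open>|\<xi>|\<^sup>s\<close> dominates \<open>1 / (1 + |\<xi>|)\<close>, so elements of the weighted
  space pair with every function of which two seminorms are finite.\<close>

lemma wt_lower:
  assumes "a \<ge> 0" "-1 \<le> s" "s \<le> 0" "\<xi> \<noteq> 0"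
  shows "1 \<le> (1 + norm \<xi>) * wt a \<sigma> s \<xi>"
proof -
  have x: "norm \<xi> > 0" using assms by simp
  have "norm \<xi> powr (- s) \<le> 1 + norm \<xi>"
  proof (cases "norm \<xi> \<le> 1")
    case True
    then have "norm \<xi> powr (- s) \<le> 1" using assms by (intro powr_le1) auto
    then show ?thesis using x by linarith
  next
    case False
    then have "norm \<xi> powr (- s) \<le> norm \<xi> powr 1" using assms by (intro powr_mono) auto
    then show ?thesis using x by simp
  qed
  then have "1 \<le> (1 + norm \<xi>) * norm \<xi> powr s"
    using x by (simp add: powr_minus field_simps)
  also have "\<dots> \<le> (1 + norm \<xi>) * wt a \<sigma> s \<xi>"
    unfolding wt_def using assms x
    by (intro mult_left_mono) (auto simp: rpow_eq_powr mult_le_cancel_left1)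
  finally show ?thesis .
qed

lemma pairing_nn_bound:
  fixes G :: test_fun
  assumes par: "a \<ge> 0" "-1 \<le> s" "s \<le> 0" and [measurable]: "G \<in> borel_measurable borel"
    and [measurable]: "\<phi> \<in> borel_measurable borel" and B: "\<And>\<xi>. (1 + norm \<xi>) * norm (\<phi> \<xi> :: complex) \<le> B"
  shows "(\<integral>\<^sup>+\<xi>. ennreal (norm (G \<xi> * \<phi> \<xi>)) \<partial>lborel) \<le> ennreal B * wabs a \<sigma> s G"
proof -
  have B0: "B \<ge> 0" using B[of 0] by (smt (verit) norm_ge_zero mult_nonneg_nonneg)
  have "(\<integral>\<^sup>+\<xi>. ennreal (norm (G \<xi> * \<phi> \<xi>)) \<partial>lborel) \<le>
      (\<integral>\<^sup>+\<xi>. ennreal B * (ennreal (wt a \<sigma> s \<xi>) * ennreal (norm (G \<xi>))) \<partial>lborel)"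
  proof (rule nn_integral_mono_AE)
    show "AE \<xi> in lborel. ennreal (norm (G \<xi> * \<phi> \<xi>)) \<le> ennreal B * (ennreal (wt a \<sigma> s \<xi>) * ennreal (norm (G \<xi>)))"
      using AE_lborel_nonzero
    proof eventually_elim
      case (elim \<xi>)
      have "norm (\<phi> \<xi>) * 1 \<le> norm (\<phi> \<xi>) * ((1 + norm \<xi>) * wt a \<sigma> s \<xi>)"
        by (intro mult_left_mono wt_lower par elim) auto
      also have "\<dots> = ((1 + norm \<xi>) * norm (\<phi> \<xi>)) * wt a \<sigma> s \<xi>" by simp
      also have "\<dots> \<le> B * wt a \<sigma> s \<xi>" by (intro mult_right_mono B) auto
      finally have "norm (G \<xi> * \<phi> \<xi>) \<le> norm (G \<xi>) * (B * wt a \<sigma> s \<xi>)"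
        by (simp add: norm_mult mult_left_mono)
      then have "ennreal (norm (G \<xi> * \<phi> \<xi>)) \<le> ennreal (B * (wt a \<sigma> s \<xi> * norm (G \<xi>)))"
        by (intro ennreal_leI) (simp add: mult_ac)
      then show ?case using B0 by (simp add: ennreal_mult)
    qed
  qed
  also have "\<dots> = ennreal B * wabs a \<sigma> s G"
    unfolding wnorm_def by (rule nn_integral_cmult) auto
  finally show "(\<integral>\<^sup>+\<xi>. ennreal (norm (G \<xi> * \<phi> \<xi>)) \<partial>lborel) \<le> ennreal B * wabs a \<sigma> s G" .
qed

text \<open>Convergence in the weighted norm implies convergence of every pairing.\<close>

lemma pairing_bound:
  fixes G :: test_fun
  assumes par: "a \<ge> 0" "-1 \<le> s" "s \<le> 0" and [measurable]: "G \<in> borel_measurable borel"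
    and fin: "wabs a \<sigma> s G < \<infinity>"
    and [measurable]: "\<phi> \<in> borel_measurable borel" and B: "\<And>\<xi>. (1 + norm \<xi>) * norm (\<phi> \<xi> :: complex) \<le> B"
  shows "integrable lborel (\<lambda>\<xi>. G \<xi> * \<phi> \<xi>)"
    and "norm (\<integral>\<xi>. G \<xi> * \<phi> \<xi> \<partial>lborel) \<le> B * enn2real (wabs a \<sigma> s G)"
proof -
  have B0: "B \<ge> 0" using B[of 0] by (smt (verit) norm_ge_zero mult_nonneg_nonneg)
  note nn = pairing_nn_bound[OF par assms(4,6) B, of \<sigma>]
  have "ennreal B * wabs a \<sigma> s G < \<infinity>"
    using fin by (simp add: ennreal_mult_less_top)
  from le_less_trans[OF nn this] show int: "integrable lborel (\<lambda>\<xi>. G \<xi> * \<phi> \<xi>)"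
    by (intro integrableI_bounded) auto
  have "ennreal (norm (\<integral>\<xi>. G \<xi> * \<phi> \<xi> \<partial>lborel)) \<le> (\<integral>\<^sup>+\<xi>. ennreal (norm (G \<xi> * \<phi> \<xi>)) \<partial>lborel)"
    by (rule integral_norm_bound_ennreal[OF int])
  also note nn
  also have "ennreal B * wabs a \<sigma> s G =
      ennreal (B * enn2real (wabs a \<sigma> s G))"
    using fin B0 by (simp add: ennreal_mult)
  finally show "norm (\<integral>\<xi>. G \<xi> * \<phi> \<xi> \<partial>lborel) \<le> B * enn2real (wabs a \<sigma> s G)"
    using B0 by (subst (asm) ennreal_le_iff) auto
qed

lemma schwartz_pairing_constant:
  "\<phi> \<in> schwartz \<Longrightarrow> (1 + norm \<xi>) * norm (\<phi> \<xi>) \<le> seminorm 0 \<phi> + seminorm 1 \<phi>"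
  using seminorm_ge[of \<phi> \<xi> 0] seminorm_ge[of \<phi> \<xi> 1] by (simp add: distrib_right)

lemma locally_integrable_weighted:
  fixes G :: test_fun
  assumes par: "a \<ge> 0" "-1 \<le> s" "s \<le> 0" and [measurable]: "G \<in> borel_measurable borel"
    and fin: "wabs a \<sigma> s G < \<infinity>"
  shows "locally_integrable G"
  unfolding locally_integrable_def set_integrable_def
proof (intro allI impI)
  fix K :: "(real^3) set" assume K: "compact K"
  then have [measurable]: "K \<in> sets borel" by (simp add: borel_compact)
  obtain R where R: "\<And>\<xi>. \<xi> \<in> K \<Longrightarrow> norm \<xi> \<le> R" using compact_imp_bounded[OF K] by (auto simp: bounded_iff)
  have "integrable lborel (\<lambda>\<xi>. G \<xi> * indicator K \<xi>)"
  proof (rule pairing_bound(1)[OF par _ fin])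
    show "(1 + norm \<xi>) * norm (indicator K \<xi> :: complex) \<le> max 0 (1 + R)" for \<xi>
      using R[of \<xi>] by (auto simp: indicator_def)
  qed measurable
  also have "(\<lambda>\<xi>. G \<xi> * indicator K \<xi>) = (\<lambda>\<xi>. indicator K \<xi> *\<^sub>R G \<xi>)"
    by (auto simp: indicator_def)
  finally show "integrable lborel (\<lambda>\<xi>. indicator K \<xi> *\<^sub>R G \<xi>)" .
qed

lemma seminorm_le_schwartz_norm:
  assumes "\<phi> \<in> schwartz" "k \<le> N" "length js \<le> N"
  shows "seminorm k (pds js \<phi>) \<le> schwartz_norm N \<phi>"
proof -
  have s: "pds js \<phi> \<in> schwartz" for js
    by (induction js) (auto simp: pds_Cons schwartz_pd assms, simp add: pds_def assms)
  have fin: "finite {js :: 3 list. length js \<le> N}"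
    using finite_lists_length_le[of "UNIV :: 3 set" N] by simp
  have "seminorm k (pds js \<phi>) \<le> (\<Sum>js\<in>{js. length js \<le> N}. seminorm k (pds js \<phi>))"
    using assms(3) fin seminorm_nonneg[OF s] by (intro member_le_sum) auto
  also have "\<dots> \<le> (\<Sum>k\<le>N. \<Sum>js\<in>{js. length js \<le> N}. seminorm k (pds js \<phi>))"
    using assms(2) seminorm_nonneg[OF s]
    by (intro member_le_sum[where f = "\<lambda>k. \<Sum>js\<in>{js. length js \<le> N}. seminorm k (pds js \<phi>)"] sum_nonneg) auto
  also have "\<dots> = schwartz_norm N \<phi>"
    by (simp add: schwartz_norm_def seminorm_def)
  finally show ?thesis .
qed

lemma inv_fourier_pairing_constant:
  assumes \<phi>: "\<phi> \<in> schwartz"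
  shows "(1 + norm \<xi>) * norm (inv_fourier \<phi> \<xi>) \<le> 1728 * (\<integral>x. lorentz x \<partial>lborel) * schwartz_norm 6 \<phi>"
proof -
  define L where "L = (\<integral>x. lorentz x \<partial>lborel)"
  define M where "M = 432 * L * schwartz_norm 6 \<phi>"
  have L: "L \<ge> 0" unfolding L_def using lorentz_pos by (intro integral_nonneg_AE) (auto intro: less_imp_le)
  have b: "norm (inv_fourier \<psi> \<xi>) \<le> norm (fourier \<psi> (- \<xi>))" for \<psi>
  proof -
    have "1 \<le> (2 * pi) ^ 3" using pi_gt3 by (intro one_le_power) simp
    then have "norm (of_real (1 / (2 * pi) ^ 3) :: complex) \<le> 1"
      by (simp add: divide_le_eq_1 norm_divide norm_power norm_mult)
    then have "norm (inv_fourier \<psi> \<xi>) \<le> 1 * norm (fourier \<psi> (- \<xi>))"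
      unfolding inv_fourier_eq norm_mult by (intro mult_right_mono) auto
    then show ?thesis by simp
  qed
  have f: "norm (fourier (pds js \<phi>) \<eta>) \<le> M" if "length js \<le> 1" for js \<eta>
  proof -
    have s: "pds js \<phi> \<in> schwartz"
      by (induction js) (auto simp: pds_Cons schwartz_pd \<phi>, simp add: pds_def \<phi>)
    have "norm (fourier (pds js \<phi>) \<eta>) \<le> 216 * (seminorm 0 (pds js \<phi>) + seminorm 6 (pds js \<phi>)) * L"
      using fourier_norm_le[OF schwartz_integrable[OF s]] schwartz_L1_bound[OF s]
      unfolding L_def by (rule order_trans)
    also have "\<dots> \<le> 216 * (schwartz_norm 6 \<phi> + schwartz_norm 6 \<phi>) * L"
      using L that by (intro mult_right_mono mult_left_mono add_mono seminorm_le_schwartz_norm \<phi>) auto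
    finally show ?thesis by (simp add: M_def mult_ac)
  qed
  have "norm \<xi> * norm (fourier \<phi> (- \<xi>)) \<le> (\<Sum>j\<in>UNIV. \<bar>\<xi> $ j\<bar>) * norm (fourier \<phi> (- \<xi>))"
    by (intro mult_right_mono norm_le_l1_cart) auto
  also have "\<dots> = (\<Sum>j\<in>UNIV. norm (fourier (pds [j] \<phi>) (- \<xi>)))"
    by (simp add: pds_def fourier_pd[OF \<phi>] norm_mult sum_distrib_right)
  also have "\<dots> \<le> (\<Sum>(j::3)\<in>UNIV. M)" by (intro sum_mono f) auto
  finally have 1: "norm \<xi> * norm (fourier \<phi> (- \<xi>)) \<le> 3 * M" by simp
  have "(1 + norm \<xi>) * norm (inv_fourier \<phi> \<xi>) \<le> (1 + norm \<xi>) * norm (fourier \<phi> (- \<xi>))"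
    by (intro mult_left_mono b) auto
  also have "\<dots> \<le> 4 * M" using 1 f[of "[]" "- \<xi>"] by (simp add: distrib_right pds_def)
  finally show ?thesis by (simp add: M_def L_def)
qed

lemma inv_fourier_lincomb:
  assumes "\<phi> \<in> schwartz" "\<psi> \<in> schwartz"
  shows "inv_fourier (\<lambda>x. b * \<phi> x + c * \<psi> x) \<xi> = b * inv_fourier \<phi> \<xi> + c * inv_fourier \<psi> \<xi>"
proof -
  have "fourier (\<lambda>x. b * \<phi> x + c * \<psi> x) \<eta> = b * fourier \<phi> \<eta> + c * fourier \<psi> \<eta>" for \<eta>
  proof -
    have i: "integrable lborel (\<lambda>x. exp (- \<i> * of_real (\<eta> \<bullet> x)) * \<phi> x)" "integrable lborel (\<lambda>x. exp (- \<i> * of_real (\<eta> \<bullet> x)) * \<psi> x)"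
      by (rule fourier_integrable[OF schwartz_integrable[OF assms(1)]],
          rule fourier_integrable[OF schwartz_integrable[OF assms(2)]])
    have "fourier (\<lambda>x. b * \<phi> x + c * \<psi> x) \<eta> = (\<integral>x. b * (exp (- \<i> * of_real (\<eta> \<bullet> x)) * \<phi> x) + c * (exp (- \<i> * of_real (\<eta> \<bullet> x)) * \<psi> x) \<partial>lborel)"
      unfolding fourier_def by (intro Bochner_Integration.integral_cong) (auto simp: algebra_simps)
    also have "\<dots> = b * fourier \<phi> \<eta> + c * fourier \<psi> \<eta>"
      unfolding fourier_def
      by (subst Bochner_Integration.integral_add[OF integrable_mult_right[OF i(1)] integrable_mult_right[OF i(2)]])
         (simp only: integral_mult_right_zero)
    finally show ?thesis .
  qed
  then show ?thesis unfolding inv_fourier_eq by (simp only: distrib_left mult.left_commute)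
qed

text \<open>Every measurable function of finite weighted norm is the transform of a tempered
  distribution. This is how time integrals and the final value of the extended solution are turned
  into elements of the space.\<close>

lemma weighted_distribution:
  fixes G :: test_fun
  assumes par: "a \<ge> 0" "-1 \<le> s" "s \<le> 0" and [measurable]: "G \<in> borel_measurable borel"
    and fin: "wabs a \<sigma> s G < \<infinity>"
  shows "tempered (inv_fourier_distr (regular G))" "frep G (inv_fourier_distr (regular G))"
proof -
  note int = pairing_bound(1)[OF par _ fin schwartz_measurable schwartz_pairing_constant]
  show fr: "frep G (inv_fourier_distr (regular G))"
    by (rule frep_inv_fourier_distr[OF locally_integrable_weighted[OF par _ fin] int]) auto
  have eval: "inv_fourier_distr (regular G) \<phi> = (\<integral>\<xi>. G \<xi> * inv_fourier \<phi> \<xi> \<partial>lborel)" if "\<phi> \<in> schwartz" for \<phi>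
    by (rule frep_eval[OF fr that])
  show "tempered (inv_fourier_distr (regular G))"
    unfolding tempered_def
  proof (intro conjI ballI allI impI exI)
    show "inv_fourier_distr (regular G) \<phi> = 0" if "\<phi> \<notin> schwartz" for \<phi>
      using that by (simp add: inv_fourier_distr_def)
    fix \<phi> \<psi> b c assume \<phi>: "\<phi> \<in> schwartz" and \<psi>: "\<psi> \<in> schwartz"
    have i: "integrable lborel (\<lambda>\<xi>. G \<xi> * inv_fourier \<phi> \<xi>)" "integrable lborel (\<lambda>\<xi>. G \<xi> * inv_fourier \<psi> \<xi>)"
      using int[OF _ inv_fourier_schwartz inv_fourier_schwartz] \<phi> \<psi> by auto
    have "inv_fourier_distr (regular G) (\<lambda>x. b * \<phi> x + c * \<psi> x) =
        (\<integral>\<xi>. b * (G \<xi> * inv_fourier \<phi> \<xi>) + c * (G \<xi> * inv_fourier \<psi> \<xi>) \<partial>lborel)"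
      unfolding eval[OF schwartz_lincomb[OF \<phi> \<psi>]] inv_fourier_lincomb[OF \<phi> \<psi>]
      by (simp only: distrib_left mult.left_commute)
    also have "\<dots> = b * (\<integral>\<xi>. G \<xi> * inv_fourier \<phi> \<xi> \<partial>lborel) + c * (\<integral>\<xi>. G \<xi> * inv_fourier \<psi> \<xi> \<partial>lborel)"
      by (subst Bochner_Integration.integral_add[OF integrable_mult_right[OF i(1)] integrable_mult_right[OF i(2)]])
         (simp only: integral_mult_right_zero)
    finally show "inv_fourier_distr (regular G) (\<lambda>x. b * \<phi> x + c * \<psi> x) =
        b * inv_fourier_distr (regular G) \<phi> + c * inv_fourier_distr (regular G) \<psi>"
      by (simp only: eval[OF \<phi>] eval[OF \<psi>])
  next
    fix \<phi> assume \<phi>: "\<phi> \<in> schwartz"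
    show "norm (inv_fourier_distr (regular G) \<phi>) \<le>
      (1728 * (\<integral>x. lorentz x \<partial>lborel) * enn2real (wabs a \<sigma> s G)) * schwartz_norm 6 \<phi>"
      unfolding eval[OF \<phi>]
      using pairing_bound(2)[OF par _ fin schwartz_measurable[OF inv_fourier_schwartz[OF \<phi>]] inv_fourier_pairing_constant[OF \<phi>]]
      by (simp add: mult_ac)
  qed
qed

section \<open>Jointly measurable versions\<close>

text \<open>Measurability in the pair of time and frequency, as Fubini's theorem requires it.\<close>

definition jmeas :: "(real \<Rightarrow> real^3 \<Rightarrow> 'b::topological_space) \<Rightarrow> bool" where
  "jmeas U \<longleftrightarrow> (\<lambda>z. U (fst z) (snd z)) \<in> borel_measurable (borel \<Otimes>\<^sub>M borel)"

lemma jmeas_comp: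
  assumes "jmeas U" "f \<in> borel_measurable M" "g \<in> borel_measurable M"
  shows "(\<lambda>x. U (f x) (g x)) \<in> borel_measurable M"
proof -
  have "(\<lambda>x. (f x, g x)) \<in> M \<rightarrow>\<^sub>M borel \<Otimes>\<^sub>M borel" using assms by (intro measurable_Pair)
  from measurable_compose[OF this assms(1)[unfolded jmeas_def]] show ?thesis by simp
qed

lemma jmeasI: "(\<lambda>z. U (fst z) (snd z)) \<in> borel_measurable (borel \<Otimes>\<^sub>M borel) \<Longrightarrow> jmeas U"
  by (simp add: jmeas_def)

text \<open>The Heine-Cantor theorem for \<open>d r t = \<parallel>w r - w t\<parallel>\<close>, stated for \<open>d\<close> because the weighted
  space is a set of distributions and not a metric type. The proof applies the Lebesgue number of a cover by balls on which
  \<open>d\<close> is small.\<close>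

lemma uniform_continuity_pseudometric:
  fixes d :: "real \<Rightarrow> real \<Rightarrow> real"
  assumes lim: "\<And>t. t \<in> {0..T} \<Longrightarrow> ((\<lambda>r. d r t) \<longlongrightarrow> 0) (at t within {0..T})"
    and refl: "\<And>t. t \<in> {0..T} \<Longrightarrow> d t t = 0"
    and sym: "\<And>r t. r \<in> {0..T} \<Longrightarrow> t \<in> {0..T} \<Longrightarrow> d r t = d t r"
    and tri: "\<And>r t q. r \<in> {0..T} \<Longrightarrow> t \<in> {0..T} \<Longrightarrow> q \<in> {0..T} \<Longrightarrow> d r t \<le> d r q + d q t"
    and e: "e > 0"
  obtains \<delta> where "\<delta> > 0" "\<And>r t. r \<in> {0..T} \<Longrightarrow> t \<in> {0..T} \<Longrightarrow> \<bar>r - t\<bar> < \<delta> \<Longrightarrow> d r t < e"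
proof -
  have "\<exists>\<delta>>0. \<forall>r\<in>{0..T}. dist r t < \<delta> \<longrightarrow> d r t < e / 2" if t: "t \<in> {0..T}" for t
  proof -
    have "\<forall>\<^sub>F r in at t within {0..T}. d r t < e / 2"
      using order_tendstoD(2)[OF lim[OF t], of "e / 2"] e by simp
    then obtain \<delta> where "\<delta> > 0" "\<forall>r\<in>{0..T}. r \<noteq> t \<and> dist r t < \<delta> \<longrightarrow> d r t < e / 2"
      unfolding eventually_at by auto
    with refl[OF t] e show ?thesis by (metis half_gt_zero)
  qed
  then obtain D where D: "\<And>t. t \<in> {0..T} \<Longrightarrow> D t > 0"
    "\<And>t r. t \<in> {0..T} \<Longrightarrow> r \<in> {0..T} \<Longrightarrow> dist r t < D t \<Longrightarrow> d r t < e / 2"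
    by metis
  show thesis
  proof (cases "{0..T} = {}")
    case False
    let ?C = "(\<lambda>t. ball t (D t)) ` {0..T}"
    have cover: "{0..T} \<subseteq> \<Union>?C" using D(1) by force
    from False have ne: "?C \<noteq> {}" by blast
    obtain \<delta> where \<delta>: "\<delta> > 0" "\<And>S. S \<subseteq> {0..T} \<Longrightarrow> diameter S < \<delta> \<Longrightarrow> \<exists>B\<in>?C. S \<subseteq> B"
      using Lebesgue_number_lemma[OF compact_Icc ne cover] by (metis (no_types, lifting) imageE open_ball)
    show thesis
    proof (rule that[OF \<delta>(1)])
      fix r t assume rt: "r \<in> {0..T}" "t \<in> {0..T}" "\<bar>r - t\<bar> < \<delta>"
      have "diameter {r, t} \<le> \<bar>r - t\<bar>"
        by (rule diameter_le) (auto simp: abs_minus_commute)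
      then obtain q where q: "q \<in> {0..T}" "{r, t} \<subseteq> ball q (D q)"
        using \<delta>(2)[of "{r, t}"] rt by force
      have "d r q < e / 2" by (rule D(2)[OF q(1) rt(1)]) (use q(2) in \<open>simp add: dist_commute\<close>)
      moreover have "d t q < e / 2" by (rule D(2)[OF q(1) rt(2)]) (use q(2) in \<open>simp add: dist_commute\<close>)
      ultimately show "d r t < e" using tri[OF rt(1,2) q(1)] sym[OF rt(2) q(1)] by linarith
    qed
  next
    case True
    show thesis by (rule that[of 1]) (use True in auto)
  qed
qed

lemma X_space_diff:
  assumes "f \<in> X_space a \<sigma> r" "g \<in> X_space a \<sigma> r"
  shows "frep (\<lambda>\<xi>. hat f \<xi> - hat g \<xi>) (f - g)"
    and "wabs a \<sigma> r (\<lambda>\<xi>. hat f \<xi> - hat g \<xi>) = ennreal (X_norm a \<sigma> r (f - g))"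
proof -
  note fr = X_space_frep[OF assms(1)] X_space_frep[OF assms(2)]
  show d: "frep (\<lambda>\<xi>. hat f \<xi> - hat g \<xi>) (f - g)" by (rule frep_diff[OF fr])
  have "wabs a \<sigma> r (\<lambda>\<xi>. hat f \<xi> - hat g \<xi>) < \<infinity>"
    using assms X_space_iff[OF fr(1)] X_space_iff[OF fr(2)] frep_measurable[OF fr(1)] frep_measurable[OF fr(2)]
    by (intro wnorm_diff_finite) auto
  then show "wabs a \<sigma> r (\<lambda>\<xi>. hat f \<xi> - hat g \<xi>) = ennreal (X_norm a \<sigma> r (f - g))"
    unfolding X_norm_eq[OF d] by simp
qed

text \<open>A curve that is continuous into the weighted space on a compact interval is approximated,
  uniformly in time, by curves constant on a grid; with the summable errors \<open>2\<^sup>-\<^sup>k\<close> the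
  approximations converge for every time and almost every frequency, and their limit inherits the
  joint measurability.\<close>

lemma jointly_measurable_version_compact:
  assumes C: "C_into (X_space a \<sigma> r) (X_norm a \<sigma> r) {0..T} w"
  obtains U where "jmeas U" "\<And>t. t \<in> {0..T} \<Longrightarrow> frep (U t) (w t)"
proof -
  have mem: "w t \<in> X_space a \<sigma> r" if "t \<in> {0..T}" for t using C that by (auto simp: C_into_def)
  note diff = X_space_diff[OF mem mem]
  define d where "d q t = X_norm a \<sigma> r (w q - w t)" for q t
  have [measurable]: "hat (w t) \<in> borel_measurable borel" if "t \<in> {0..T}" for t
    using frep_measurable[OF X_space_frep[OF mem[OF that]]] .
  have d_eq: "ennreal (d q t) = wabs a \<sigma> r (\<lambda>\<xi>. hat (w q) \<xi> - hat (w t) \<xi>)"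
    if "q \<in> {0..T}" "t \<in> {0..T}" for q t using diff(2)[OF that] by (simp add: d_def)
  have d0: "d q t \<ge> 0" for q t by (simp add: d_def X_norm_def)
  have uc: "\<exists>\<delta>>0. \<forall>q\<in>{0..T}. \<forall>t\<in>{0..T}. \<bar>q - t\<bar> < \<delta> \<longrightarrow> d q t < e" if e: "e > 0" for e
  proof -
    obtain \<delta> where "\<delta> > 0" "\<And>q t. q \<in> {0..T} \<Longrightarrow> t \<in> {0..T} \<Longrightarrow> \<bar>q - t\<bar> < \<delta> \<Longrightarrow> d q t < e"
    proof (rule uniform_continuity_pseudometric[where d = d and T = T and e = e])
      show "((\<lambda>q. d q t) \<longlongrightarrow> 0) (at t within {0..T})" if "t \<in> {0..T}" for t
        using C that by (auto simp: C_into_def d_def)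
      show "d t t = 0" if t: "t \<in> {0..T}" for t
      proof -
        have "ennreal (d t t) = 0" unfolding d_eq[OF t t] by (simp add: wnorm_def)
        then show ?thesis using d0[of t t] by (simp add: ennreal_eq_0_iff)
      qed
      show "d q t = d t q" if "q \<in> {0..T}" "t \<in> {0..T}" for q t
      proof -
        have "ennreal (d q t) = ennreal (d t q)"
          unfolding d_eq[OF that] d_eq[OF that(2,1)] by (simp add: norm_minus_commute)
        then show ?thesis using d0 by simp
      qed
      show "d q t \<le> d q p + d p t" if q: "q \<in> {0..T}" and t: "t \<in> {0..T}" and p: "p \<in> {0..T}" for q t p
      proof -
        have "ennreal (d q t) \<le> wnorm a \<sigma> r (\<lambda>\<xi>. ennreal (norm (hat (w q) \<xi> - hat (w p) \<xi>)) +
            ennreal (norm (hat (w p) \<xi> - hat (w t) \<xi>)))"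
          unfolding d_eq[OF q t]
          by (intro wnorm_mono) (auto simp: ennreal_plus[symmetric] simp del: ennreal_plus
              intro!: ennreal_leI norm_diff_triangle_ineq[THEN order_trans] norm_triangle_sub,
              metis norm_diff_triangle_le order_refl)
        also have "\<dots> = ennreal (d q p) + ennreal (d p t)"
          unfolding d_eq[OF q p] d_eq[OF p t] using q p t by (intro wnorm_add) auto
        also have "\<dots> = ennreal (d q p + d p t)" using d0 by simp
        finally show ?thesis using d0 by (subst (asm) ennreal_le_iff) (auto intro: add_nonneg_nonneg)
      qed
    qed (use e in auto)
    then show ?thesis by blast
  qed
  have "\<exists>\<delta>. \<forall>k::nat. \<delta> k > 0 \<and> (\<forall>q\<in>{0..T}. \<forall>t\<in>{0..T}. \<bar>q - t\<bar> < \<delta> k \<longrightarrow> d q t < (1/2) ^ k)"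
    by (intro choice allI) (use uc in simp)
  then obtain \<delta> where \<delta>: "\<And>k::nat. \<delta> k > 0"
    "\<And>k q t. q \<in> {0..T} \<Longrightarrow> t \<in> {0..T} \<Longrightarrow> \<bar>q - t\<bar> < \<delta> k \<Longrightarrow> d q t < (1/2) ^ k"
    by blast
  (* Grid points from below; mesh size delta k / 2 keeps node and t closer than delta k. *)
  define node where "node k t = \<delta> k / 2 * of_int \<lfloor>t / (\<delta> k / 2)\<rfloor>" for k t
  have node: "node k t \<in> {0..T}" "\<bar>node k t - t\<bar> < \<delta> k" if t: "t \<in> {0..T}" for k t
  proof -
    have p: "\<delta> k / 2 > 0" using \<delta>(1)[of k] by simp
    have 1: "node k t \<le> t"
      using mult_left_mono[OF of_int_floor_le[of "t / (\<delta> k / 2)"], of "\<delta> k / 2"] p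
      by (simp add: node_def)
    have "t / (\<delta> k / 2) < of_int \<lfloor>t / (\<delta> k / 2)\<rfloor> + 1" by linarith
    then have "\<delta> k / 2 * (t / (\<delta> k / 2)) < \<delta> k / 2 * (of_int \<lfloor>t / (\<delta> k / 2)\<rfloor> + 1)"
      using p by (intro mult_strict_left_mono)
    then have 2: "t < node k t + \<delta> k / 2" using p by (simp add: node_def distrib_left)
    have "0 \<le> t / (\<delta> k / 2)" using t p by simp
    then have 3: "0 \<le> node k t" unfolding node_def using p by (intro mult_nonneg_nonneg) auto
    show "node k t \<in> {0..T}" "\<bar>node k t - t\<bar> < \<delta> k" using 1 2 3 t p by auto
  qed
  (* The value off [0, T] is a placeholder that makes every grid function measurable. *)
  define grid where "grid k i = (if \<delta> k / 2 * of_int i \<in> {0..T} then hat (w (\<delta> k / 2 * of_int i)) else (\<lambda>_. 0))"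
    for k and i :: int
  define V where "V k t = grid k \<lfloor>t / (\<delta> k / 2)\<rfloor>" for k t
  have V_eq: "V k t = hat (w (node k t))" if "t \<in> {0..T}" for k t
    using node(1)[OF that] by (simp add: V_def grid_def node_def)
  have Vmeas: "jmeas (V k)" for k
  proof (rule jmeasI)
    have [measurable]: "grid k i \<in> borel_measurable borel" for i unfolding grid_def by auto
    show "(\<lambda>z. V k (fst z) (snd z)) \<in> borel_measurable (borel \<Otimes>\<^sub>M borel)"
      unfolding V_def
      by (rule measurable_compose_countable[where f = "\<lambda>i z. grid k i (snd z)" and g = "\<lambda>z. \<lfloor>fst z / (\<delta> k / 2)\<rfloor>"])
         measurable
  qed
  define U where "U t \<xi> = lim (\<lambda>k. V k t \<xi>)" for t \<xi>
  show thesis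
  proof (rule that)
    show U: "jmeas U"
      using Vmeas unfolding jmeas_def U_def by measurable
    fix t assume t: "t \<in> {0..T}"
    have [measurable]: "V k t \<in> borel_measurable borel" for k
      unfolding V_eq[OF t] using node(1)[OF t] by measurable
    have "(\<integral>\<^sup>+\<xi>. (\<Sum>k. ennreal (wt a \<sigma> r \<xi> * norm (V k t \<xi> - hat (w t) \<xi>))) \<partial>lborel) =
        (\<Sum>k. wabs a \<sigma> r (\<lambda>\<xi>. V k t \<xi> - hat (w t) \<xi>))"
      unfolding wnorm_def using t by (subst nn_integral_suminf) (auto simp: ennreal_mult)
    also have "\<dots> \<le> (\<Sum>k. ennreal ((1/2) ^ k))"
    proof (intro suminf_le allI)
      fix k
      have "wabs a \<sigma> r (\<lambda>\<xi>. V k t \<xi> - hat (w t) \<xi>) = ennreal (d (node k t) t)"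
        unfolding V_eq[OF t] d_eq[OF node(1)[OF t] t] ..
      also have "\<dots> \<le> ennreal ((1/2) ^ k)"
        using less_imp_le[OF \<delta>(2)[OF node(1)[OF t] t node(2)[OF t]]] by (rule ennreal_leI)
      finally show "wabs a \<sigma> r (\<lambda>\<xi>. V k t \<xi> - hat (w t) \<xi>) \<le> ennreal ((1/2) ^ k)" .
    qed auto
    also have "\<dots> = ennreal (\<Sum>k. (1/2) ^ k)"
      by (rule suminf_ennreal2) (auto simp: summable_geometric)
    also have "\<dots> < \<infinity>" by simp
    finally have "(\<integral>\<^sup>+\<xi>. (\<Sum>k. ennreal (wt a \<sigma> r \<xi> * norm (V k t \<xi> - hat (w t) \<xi>))) \<partial>lborel) \<noteq> \<infinity>"
      by simp
    then have "AE \<xi> in lborel. (\<Sum>k. ennreal (wt a \<sigma> r \<xi> * norm (V k t \<xi> - hat (w t) \<xi>))) \<noteq> \<infinity>"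
      using t by (intro nn_integral_noteq_infinite) auto
    then have "AE \<xi> in lborel. hat (w t) \<xi> = U t \<xi>"
      using AE_lborel_nonzero
    proof eventually_elim
      case (elim \<xi>)
      have "summable (\<lambda>k. wt a \<sigma> r \<xi> * norm (V k t \<xi> - hat (w t) \<xi>))"
        using elim(1) by (intro summable_suminf_not_top) auto
      then have "(\<lambda>k. wt a \<sigma> r \<xi> * norm (V k t \<xi> - hat (w t) \<xi>)) \<longlonglongrightarrow> 0"
        by (rule summable_LIMSEQ_zero)
      from tendsto_mult_left[OF this, of "inverse (wt a \<sigma> r \<xi>)"]
      have "(\<lambda>k. norm (V k t \<xi> - hat (w t) \<xi>)) \<longlonglongrightarrow> 0"
        using wt_pos[OF elim(2), of a \<sigma> r] by (simp add: mult.assoc[symmetric])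
      then have "(\<lambda>k. V k t \<xi>) \<longlonglongrightarrow> hat (w t) \<xi>"
        by (simp add: tendsto_norm_zero_iff LIM_zero_iff)
      then show ?case by (simp add: U_def limI)
    qed
    moreover have "U t \<in> borel_measurable borel"
      using jmeas_comp[OF U, of "\<lambda>_. t" borel "\<lambda>x. x"] by simp
    ultimately show "frep (U t) (w t)"
      by (rule represents_cong_AE[OF X_space_frep[OF mem[OF t]]])
  qed
qed

text \<open>The half-open interval is exhausted by compact ones, and at each time the version for the first
  suitable interval is taken; which one is suitable is a measurable function of time.\<close>

lemma jointly_measurable_version:
  assumes C: "\<And>T. 0 \<le> T \<Longrightarrow> T < Ts \<Longrightarrow> C_into (X_space a \<sigma> r) (X_norm a \<sigma> r) {0..T} w"
  obtains U where "jmeas U" "\<And>t. 0 \<le> t \<Longrightarrow> t < Ts \<Longrightarrow> frep (U t) (w t)"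
proof -
  define T where "T n = Ts - 1 / (real n + 1)" for n :: nat
  have "\<exists>U. jmeas U \<and> (\<forall>t\<in>{0..T n}. frep (U t) (w t))" for n
  proof (cases "0 \<le> T n")
    case True
    have "T n < Ts" by (simp add: T_def)
    from jointly_measurable_version_compact[OF C[OF True this]] show ?thesis by metis
  next
    case False
    then show ?thesis by (intro exI[of _ "\<lambda>_ _. 0"]) (auto simp: jmeas_def)
  qed
  then obtain V where V: "\<And>n. jmeas (V n)" "\<And>n t. t \<in> {0..T n} \<Longrightarrow> frep (V n t) (w t)" by metis
  define n where "n t = nat \<lceil>1 / (Ts - t)\<rceil>" for t
  define U where "U t = V (n t) t" for t
  show thesis
  proof (rule that)
    show "jmeas U"
    proof (rule jmeasI)
      show "(\<lambda>z. U (fst z) (snd z)) \<in> borel_measurable (borel \<Otimes>\<^sub>M borel)"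
        unfolding U_def
      proof (rule measurable_compose_countable[where f = "\<lambda>i z. V i (fst z) (snd z)" and g = "\<lambda>z. n (fst z)"])
        show "(\<lambda>z. V i (fst z) (snd z)) \<in> borel_measurable (borel \<Otimes>\<^sub>M borel)" for i
          using V(1)[of i] by (simp add: jmeas_def)
        show "(\<lambda>z. n (fst z)) \<in> borel \<Otimes>\<^sub>M borel \<rightarrow>\<^sub>M count_space UNIV"
          unfolding n_def by measurable
      qed
    qed
    fix t assume t: "0 \<le> t" "t < Ts"
    have "1 / (Ts - t) \<le> real (n t)" unfolding n_def by linarith
    also have "\<dots> < real (n t) + 1" by simp
    finally have "1 / (real (n t) + 1) < Ts - t" using t by (simp add: field_simps)
    then show "frep (U t) (w t)" unfolding U_def using t by (intro V(2)) (simp add: T_def)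
  qed
qed

section \<open>Duhamel integrals on the Fourier side\<close>

text \<open>\<open>\<integral>\<^sub>0\<^sup>t exp (-(t-\<tau>) |\<xi>|\<^sup>2\<^sup>\<gamma>) g(\<tau>, \<xi>) d\<tau>\<close> at a single frequency. The value 0 of a divergent integral is
  attained on a null set of frequencies only.\<close>

definition duh :: "real \<Rightarrow> (real \<Rightarrow> test_fun) \<Rightarrow> real \<Rightarrow> test_fun" where
  "duh \<gamma> g t \<xi> = (\<integral>\<tau>. indicator {0..t} \<tau> *\<^sub>R (of_real (exp (- (t - \<tau>) * norm \<xi> powr (2 * \<gamma>))) * g \<tau> \<xi>) \<partial>lborel)"

lemma duh_jmeas:
  assumes "jmeas g"
  shows "jmeas (duh \<gamma> g)"
proof (rule jmeasI)
  note [measurable (raw)] = jmeas_comp[OF assms]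
  show "(\<lambda>z. duh \<gamma> g (fst z) (snd z)) \<in> borel_measurable (borel \<Otimes>\<^sub>M borel)"
    unfolding duh_def indicator_def atLeastAtMost_iff by measurable
qed

lemma norm_integral_le_nn: "ennreal (norm (\<integral>x. f x \<partial>M)) \<le> (\<integral>\<^sup>+x. ennreal (norm (f x)) \<partial>M)"
  by (cases "integrable M f") (auto simp: integral_norm_bound_ennreal not_integrable_integral_eq)

lemma wnorm_duh_le:
  assumes g: "jmeas g"
  shows "wabs a \<sigma> r (duh \<gamma> g t) \<le>
    (\<integral>\<^sup>+\<tau>\<in>{0..t}. wabs a \<sigma> r (g \<tau>) \<partial>lborel)"
proof -
  note [measurable (raw)] = jmeas_comp[OF g]
  have "wabs a \<sigma> r (duh \<gamma> g t) \<le>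
      wnorm a \<sigma> r (\<lambda>\<xi>. \<integral>\<^sup>+\<tau>. ennreal (norm (g \<tau> \<xi>)) * indicator {0..t} \<tau> \<partial>lborel)"
  proof (rule wnorm_mono)
    fix \<xi>
    have "ennreal (norm (duh \<gamma> g t \<xi>)) \<le> (\<integral>\<^sup>+\<tau>. ennreal (norm (indicator {0..t} \<tau> *\<^sub>R
        (of_real (exp (- (t - \<tau>) * norm \<xi> powr (2 * \<gamma>))) * g \<tau> \<xi>))) \<partial>lborel)"
      unfolding duh_def by (rule norm_integral_le_nn)
    also have "\<dots> \<le> (\<integral>\<^sup>+\<tau>. ennreal (norm (g \<tau> \<xi>)) * indicator {0..t} \<tau> \<partial>lborel)"
      by (intro nn_integral_mono)
         (auto simp: indicator_def norm_mult intro!: ennreal_leI mult_left_le_one_le mult_nonpos_nonneg)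
    finally show "ennreal (norm (duh \<gamma> g t \<xi>)) \<le> (\<integral>\<^sup>+\<tau>. ennreal (norm (g \<tau> \<xi>)) * indicator {0..t} \<tau> \<partial>lborel)" .
  qed
  also have "\<dots> = (\<integral>\<^sup>+\<xi>. \<integral>\<^sup>+\<tau>. ennreal (wt a \<sigma> r \<xi>) * ennreal (norm (g \<tau> \<xi>)) * indicator {0..t} \<tau> \<partial>lborel \<partial>lborel)"
    unfolding wnorm_def by (intro nn_integral_cong, subst nn_integral_cmult[symmetric]) (auto simp: mult_ac)
  also have "\<dots> = (\<integral>\<^sup>+\<tau>. \<integral>\<^sup>+\<xi>. ennreal (wt a \<sigma> r \<xi>) * ennreal (norm (g \<tau> \<xi>)) * indicator {0..t} \<tau> \<partial>lborel \<partial>lborel)"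
    by (rule lborel_pair.Fubini'[symmetric]) measurable
  also have "\<dots> = (\<integral>\<^sup>+\<tau>\<in>{0..t}. wabs a \<sigma> r (g \<tau>) \<partial>lborel)"
    unfolding wnorm_def by (intro nn_integral_cong nn_integral_multc) measurable
  finally show ?thesis .
qed

text \<open>The weak time integral of the heat-propagated forcing is the distribution whose Fourier
  transform is the pointwise Duhamel integral; this is Fubini's theorem.\<close>

lemma time_integral_duh:
  assumes par: "a \<ge> 0" "-1 \<le> s" "s \<le> 0" and g: "jmeas g"
    and fin: "(\<integral>\<^sup>+\<tau>\<in>{0..t}. wabs a \<sigma> s (g \<tau>) \<partial>lborel) < \<infinity>"
    and F: "AE \<tau> in lborel. \<tau> \<in> {0..t} \<longrightarrow> (\<forall>\<phi>\<in>schwartz. F \<tau> \<phi> =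
      (\<integral>\<xi>. of_real (exp (- (t - \<tau>) * norm \<xi> powr (2 * \<gamma>))) * g \<tau> \<xi> * inv_fourier \<phi> \<xi> \<partial>lborel))"
  shows "has_time_integral F (inv_fourier_distr (regular (duh \<gamma> g t))) t"
    and "frep (duh \<gamma> g t) (inv_fourier_distr (regular (duh \<gamma> g t)))"
    and "tempered (inv_fourier_distr (regular (duh \<gamma> g t)))"
proof -
  note [measurable (raw)] = jmeas_comp[OF g]
  have Sm [measurable]: "duh \<gamma> g t \<in> borel_measurable borel"
    using jmeas_comp[OF duh_jmeas[OF g, of \<gamma>], of "\<lambda>_. t" borel "\<lambda>x. x"] by simp
  have Sfin: "wabs a \<sigma> s (duh \<gamma> g t) < \<infinity>"
    using le_less_trans[OF wnorm_duh_le[OF g] fin] .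
  show fr: "frep (duh \<gamma> g t) (inv_fourier_distr (regular (duh \<gamma> g t)))"
    and "tempered (inv_fourier_distr (regular (duh \<gamma> g t)))"
    using weighted_distribution[OF par Sm Sfin] by auto
  show "has_time_integral F (inv_fourier_distr (regular (duh \<gamma> g t))) t"
    unfolding has_time_integral_def
  proof
    fix \<phi> assume \<phi>: "\<phi> \<in> schwartz"
    let ?\<psi> = "inv_fourier \<phi>"
    have [measurable]: "?\<psi> \<in> borel_measurable borel"
      by (rule schwartz_measurable[OF inv_fourier_schwartz[OF \<phi>]])
    define B where "B = seminorm 0 ?\<psi> + seminorm 1 ?\<psi>"
    have B: "(1 + norm \<xi>) * norm (?\<psi> \<xi>) \<le> B" for \<xi>
      unfolding B_def by (rule schwartz_pairing_constant[OF inv_fourier_schwartz[OF \<phi>]])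
    let ?E = "\<lambda>\<tau> \<xi>. of_real (exp (- (t - \<tau>) * norm \<xi> powr (2 * \<gamma>))) :: complex"
    let ?K = "\<lambda>\<tau> \<xi>. indicator {0..t} \<tau> *\<^sub>R (?E \<tau> \<xi> * g \<tau> \<xi> * ?\<psi> \<xi>)"
    have "(\<integral>\<^sup>+\<tau>. \<integral>\<^sup>+\<xi>. ennreal (norm (?K \<tau> \<xi>)) \<partial>lborel \<partial>lborel) \<le>
        (\<integral>\<^sup>+\<tau>. ennreal B * (wabs a \<sigma> s (g \<tau>) * indicator {0..t} \<tau>) \<partial>lborel)"
    proof (rule nn_integral_mono)
      fix \<tau>
      show "(\<integral>\<^sup>+\<xi>. ennreal (norm (?K \<tau> \<xi>)) \<partial>lborel) \<le>
        ennreal B * (wabs a \<sigma> s (g \<tau>) * indicator {0..t} \<tau>)"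
      proof (cases "\<tau> \<in> {0..t}")
        case True
        have "(\<integral>\<^sup>+\<xi>. ennreal (norm (?K \<tau> \<xi>)) \<partial>lborel) \<le> (\<integral>\<^sup>+\<xi>. ennreal (norm (g \<tau> \<xi> * ?\<psi> \<xi>)) \<partial>lborel)"
          using True
          by (intro nn_integral_mono ennreal_leI)
             (auto simp: norm_mult mult.assoc intro!: mult_left_le_one_le mult_nonpos_nonneg)
        also have "\<dots> \<le> ennreal B * wabs a \<sigma> s (g \<tau>)"
          by (rule pairing_nn_bound[OF par _ _ B]) measurable
        finally show ?thesis using True by simp
      qed simp
    qed
    also have "\<dots> = ennreal B * (\<integral>\<^sup>+\<tau>\<in>{0..t}. wabs a \<sigma> s (g \<tau>) \<partial>lborel)"
      unfolding wnorm_def by (rule nn_integral_cmult) measurable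
    also have "\<dots> < \<infinity>" using fin by (simp add: ennreal_mult_less_top)
    finally have int: "integrable (lborel \<Otimes>\<^sub>M lborel) (case_prod ?K)"
      by (intro lborel_pair.integrable_pairI) (simp_all add: case_prod_beta)
    define H where "H \<tau> = (\<integral>\<xi>. ?K \<tau> \<xi> \<partial>lborel)" for \<tau>
    have Hm: "H \<in> borel_measurable lborel" unfolding H_def by measurable
    have Hint: "integrable lborel H"
      unfolding H_def by (rule lborel_pair.integrable_fst[OF int])
    have ae: "AE \<tau> in lebesgue. H \<tau> = indicator {0..t} \<tau> *\<^sub>R F \<tau> \<phi>"
      using AE_completion[OF F]
    proof eventually_elim
      case (elim \<tau>)
      then show ?case using \<phi> by (cases "\<tau> \<in> {0..t}") (auto simp: H_def)
    qed
    have HL: "integrable lebesgue H" "integral\<^sup>L lebesgue H = integral\<^sup>L lborel H"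
      using Hint Hm by (simp_all add: integrable_completion integral_completion)
    have Fm: "(\<lambda>\<tau>. indicator {0..t} \<tau> *\<^sub>R F \<tau> \<phi>) \<in> borel_measurable lebesgue"
      by (rule borel_measurable_AE[OF _ ae]) (use HL(1) in auto)
    have "inv_fourier_distr (regular (duh \<gamma> g t)) \<phi> = (\<integral>\<xi>. duh \<gamma> g t \<xi> * ?\<psi> \<xi> \<partial>lborel)"
      by (rule frep_eval[OF fr \<phi>])
    also have "\<dots> = (\<integral>\<xi>. \<integral>\<tau>. ?K \<tau> \<xi> \<partial>lborel \<partial>lborel)"
    proof (intro Bochner_Integration.integral_cong refl)
      fix \<xi>
      have "(\<lambda>\<tau>. ?K \<tau> \<xi>) = (\<lambda>\<tau>. (indicator {0..t} \<tau> *\<^sub>R (?E \<tau> \<xi> * g \<tau> \<xi>)) * ?\<psi> \<xi>)"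
        by (simp only: mult_scaleR_left)
      then show "duh \<gamma> g t \<xi> * ?\<psi> \<xi> = (\<integral>\<tau>. ?K \<tau> \<xi> \<partial>lborel)"
        unfolding duh_def by (simp only: integral_mult_left_zero)
    qed
    also have "\<dots> = integral\<^sup>L lborel H"
      unfolding H_def by (rule lborel_pair.Fubini_integral[OF int])
    also have "\<dots> = set_lebesgue_integral lebesgue {0..t} (\<lambda>\<tau>. F \<tau> \<phi>)"
      unfolding set_lebesgue_integral_def HL(2)[symmetric]
      by (rule integral_cong_AE[OF _ Fm ae]) (use HL(1) in auto)
    finally show "set_integrable lebesgue {0..t} (\<lambda>\<tau>. F \<tau> \<phi>) \<and>
       inv_fourier_distr (regular (duh \<gamma> g t)) \<phi> = set_lebesgue_integral lebesgue {0..t} (\<lambda>\<tau>. F \<tau> \<phi>)"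
      unfolding set_integrable_def using integrable_cong_AE_imp[OF HL(1) Fm ae] by simp
  qed
qed

section \<open>Smoothing estimate for the Duhamel formula\<close>

lemma heat_kernel_time_integral:
  fixes l r t :: real
  assumes "l \<ge> 0"
  shows "(\<integral>\<^sup>+\<tau>. ennreal (l * exp (- (\<tau> - r) * l)) * indicator {r..t} \<tau> \<partial>lborel) \<le> 1"
proof (cases "r \<le> t")
  case True
  have "(\<integral>\<^sup>+\<tau>. ennreal (l * exp (- (\<tau> - r) * l)) * indicator {r..t} \<tau> \<partial>lborel) =
      ennreal (- exp (- (t - r) * l) - (- exp (- (r - r) * l)))"
  proof (rule nn_integral_FTC_Icc[OF _ _ _ True])
    fix \<tau>
    show "((\<lambda>\<tau>. - exp (- (\<tau> - r) * l)) has_real_derivative l * exp (- (\<tau> - r) * l)) (at \<tau>)"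
      by (auto intro!: derivative_eq_intros)
  qed (use assms in auto)
  also have "\<dots> \<le> ennreal 1" by (intro ennreal_leI) simp
  finally show ?thesis by simp
qed simp

text \<open>The semigroup property \<open>E(t - r) = E(t - t\<^sub>0) E(t\<^sub>0 - r)\<close> turns the Duhamel formula with initial
  time 0 into one with initial time \<open>t\<^sub>0\<close>.\<close>

lemma duh_restart:
  assumes g: "jmeas g" and t0: "0 \<le> t0" "t0 \<le> t"
    and fin: "(\<integral>\<^sup>+r\<in>{0..t}. ennreal (norm (g r \<xi>)) \<partial>lborel) < \<infinity>"
  shows "ennreal (norm (of_real (exp (- t * norm \<xi> powr (2 * \<gamma>))) * z + duh \<gamma> g t \<xi>)) \<le>
     ennreal (exp (- (t - t0) * norm \<xi> powr (2 * \<gamma>)) *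
       norm (of_real (exp (- t0 * norm \<xi> powr (2 * \<gamma>))) * z + duh \<gamma> g t0 \<xi>)) +
     (\<integral>\<^sup>+r. ennreal (exp (- (t - r) * norm \<xi> powr (2 * \<gamma>)) * norm (g r \<xi>)) * indicator {t0..t} r \<partial>lborel)"
proof -
  note [measurable (raw)] = jmeas_comp[OF g]
  define l where "l = norm \<xi> powr (2 * \<gamma>)"
  have l: "l \<ge> 0" by (simp add: l_def)
  let ?E = "\<lambda>r. of_real (exp (- r * l)) :: complex"
  have split: "?E (p + q) = ?E p * ?E q" for p q
    by (simp only: of_real_mult[symmetric] exp_add[symmetric]) (simp add: algebra_simps)
  have int: "integrable lborel (\<lambda>r. indicator A r *\<^sub>R (?E (t' - r) * g r \<xi>))"
    if "A \<in> sets borel" "A \<subseteq> {0..t}" "A \<subseteq> {..t'}" for A t'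
  proof (rule integrableI_bounded)
    have "(\<integral>\<^sup>+r. ennreal (norm (indicator A r *\<^sub>R (?E (t' - r) * g r \<xi>))) \<partial>lborel) \<le>
       (\<integral>\<^sup>+r\<in>{0..t}. ennreal (norm (g r \<xi>)) \<partial>lborel)"
      using that l
      by (intro nn_integral_mono)
         (auto simp: indicator_def norm_mult subset_iff intro!: ennreal_leI mult_left_le_one_le mult_nonpos_nonneg)
    also note fin
    finally show "(\<integral>\<^sup>+r. ennreal (norm (indicator A r *\<^sub>R (?E (t' - r) * g r \<xi>))) \<partial>lborel) < \<infinity>" .
    have [measurable]: "A \<in> sets borel" by fact
    show "(\<lambda>r. indicator A r *\<^sub>R (?E (t' - r) * g r \<xi>)) \<in> borel_measurable lborel"
      by measurable
  qed
  define J where "J = (\<integral>r. indicator {t0..t} r *\<^sub>R (?E (t - r) * g r \<xi>) \<partial>lborel)"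
  have "duh \<gamma> g t \<xi> = (\<integral>r. indicator {0..t} r *\<^sub>R (?E (t - r) * g r \<xi>) \<partial>lborel)"
    by (simp add: duh_def l_def)
  also have "\<dots> = (\<integral>r. ?E (t - t0) * (indicator {0..t0} r *\<^sub>R (?E (t0 - r) * g r \<xi>)) +
      indicator {t0..t} r *\<^sub>R (?E (t - r) * g r \<xi>) \<partial>lborel)"
  proof (rule integral_cong_AE)
    show "AE r in lborel. indicator {0..t} r *\<^sub>R (?E (t - r) * g r \<xi>) =
      ?E (t - t0) * (indicator {0..t0} r *\<^sub>R (?E (t0 - r) * g r \<xi>)) + indicator {t0..t} r *\<^sub>R (?E (t - r) * g r \<xi>)"
      using AE_lborel_singleton[of t0]
    proof eventually_elim
      case (elim r)
      have "?E (t - r) = ?E (t - t0) * ?E (t0 - r)" using split[of "t - t0" "t0 - r"] by simp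
      then show ?case using elim t0 by (auto simp: indicator_def)
    qed
  qed measurable
  also have "\<dots> = ?E (t - t0) * duh \<gamma> g t0 \<xi> + J"
  proof -
    have i1: "integrable lborel (\<lambda>r. indicator {0..t0} r *\<^sub>R (?E (t0 - r) * g r \<xi>))"
      by (rule int) (use t0 in auto)
    have i2: "integrable lborel (\<lambda>r. indicator {t0..t} r *\<^sub>R (?E (t - r) * g r \<xi>))"
      by (rule int) (use t0 in auto)
    show ?thesis
      unfolding J_def duh_def l_def[symmetric]
        Bochner_Integration.integral_add[OF integrable_mult_right[OF i1] i2] integral_mult_right_zero ..
  qed
  finally have d: "duh \<gamma> g t \<xi> = ?E (t - t0) * duh \<gamma> g t0 \<xi> + J" .
  have "?E t = ?E (t - t0) * ?E t0" using split[of "t - t0" t0] by simp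
  then have "?E t * z + duh \<gamma> g t \<xi> = ?E (t - t0) * (?E t0 * z + duh \<gamma> g t0 \<xi>) + J"
    unfolding d by (simp only: distrib_left mult.assoc add.assoc)
  then have "norm (?E t * z + duh \<gamma> g t \<xi>) \<le> exp (- (t - t0) * l) * norm (?E t0 * z + duh \<gamma> g t0 \<xi>) + norm J"
    using norm_triangle_ineq[of "?E (t - t0) * (?E t0 * z + duh \<gamma> g t0 \<xi>)" J]
    by (simp only: norm_mult norm_of_real abs_exp_cancel)
  then have "ennreal (norm (?E t * z + duh \<gamma> g t \<xi>)) \<le>
     ennreal (exp (- (t - t0) * l) * norm (?E t0 * z + duh \<gamma> g t0 \<xi>)) + ennreal (norm J)"
    by (rule order_trans[OF ennreal_leI])
       (simp only: ennreal_plus[OF mult_nonneg_nonneg[OF exp_ge_zero norm_ge_zero] norm_ge_zero] order_refl)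
  also have "ennreal (norm J) \<le> (\<integral>\<^sup>+r. ennreal (norm (indicator {t0..t} r *\<^sub>R (?E (t - r) * g r \<xi>))) \<partial>lborel)"
    unfolding J_def by (rule norm_integral_le_nn)
  also have "\<dots> = (\<integral>\<^sup>+r. ennreal (exp (- (t - r) * l) * norm (g r \<xi>)) * indicator {t0..t} r \<partial>lborel)"
    by (intro nn_integral_cong) (simp add: indicator_def norm_mult)
  finally show ?thesis by (simp add: l_def add_left_mono)
qed

lemma wnorm_time_swap:
  assumes g: "jmeas (g :: real \<Rightarrow> real^3 \<Rightarrow> complex)" and [measurable]: "A \<in> sets borel"
  shows "(\<integral>\<^sup>+\<tau>\<in>A. wabs a \<sigma> r (g \<tau>) \<partial>lborel) =
    wnorm a \<sigma> r (\<lambda>\<xi>. \<integral>\<^sup>+\<tau>\<in>A. ennreal (norm (g \<tau> \<xi>)) \<partial>lborel)"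
proof -
  note [measurable (raw)] = jmeas_comp[OF g]
  have "(\<integral>\<^sup>+\<tau>\<in>A. wabs a \<sigma> r (g \<tau>) \<partial>lborel) =
     (\<integral>\<^sup>+\<tau>. \<integral>\<^sup>+\<xi>. ennreal (wt a \<sigma> r \<xi>) * ennreal (norm (g \<tau> \<xi>)) * indicator A \<tau> \<partial>lborel \<partial>lborel)"
    unfolding wnorm_def by (intro nn_integral_cong nn_integral_multc[symmetric]) measurable
  also have "\<dots> = (\<integral>\<^sup>+\<xi>. \<integral>\<^sup>+\<tau>. ennreal (wt a \<sigma> r \<xi>) * ennreal (norm (g \<tau> \<xi>)) * indicator A \<tau> \<partial>lborel \<partial>lborel)"
    by (rule lborel_pair.Fubini') measurable
  also have "\<dots> = wnorm a \<sigma> r (\<lambda>\<xi>. \<integral>\<^sup>+\<tau>\<in>A. ennreal (norm (g \<tau> \<xi>)) \<partial>lborel)"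
    unfolding wnorm_def by (intro nn_integral_cong, subst nn_integral_cmult[symmetric]) (auto simp: mult_ac)
  finally show ?thesis .
qed

lemma wnorm_finite_AE:
  assumes [measurable]: "f \<in> borel_measurable borel" and fin: "wnorm a \<sigma> r f < \<infinity>"
  shows "AE \<xi> in lborel. f \<xi> < \<infinity>"
proof -
  have "AE \<xi> in lborel. ennreal (wt a \<sigma> r \<xi>) * f \<xi> \<noteq> \<infinity>"
    using fin unfolding wnorm_def by (intro nn_integral_noteq_infinite) auto
  with AE_lborel_nonzero show ?thesis
  proof eventually_elim
    case (elim \<xi>)
    then show ?case using wt_pos[of \<xi> a \<sigma> r] by (auto simp: ennreal_mult_eq_top_iff less_top)
  qed
qed

lemma AE_time_integrable:
  assumes g: "jmeas (g :: real \<Rightarrow> real^3 \<Rightarrow> complex)"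
    and fin: "(\<integral>\<^sup>+\<tau>\<in>{0..t}. wabs a \<sigma> r (g \<tau>) \<partial>lborel) < \<infinity>"
  shows "AE \<xi> in lborel. (\<integral>\<^sup>+\<tau>\<in>{0..t}. ennreal (norm (g \<tau> \<xi>)) \<partial>lborel) < \<infinity>"
proof (rule wnorm_finite_AE)
  note [measurable (raw)] = jmeas_comp[OF g]
  show "(\<lambda>\<xi>. \<integral>\<^sup>+\<tau>\<in>{0..t}. ennreal (norm (g \<tau> \<xi>)) \<partial>lborel) \<in> borel_measurable borel" by measurable
  show "wnorm a \<sigma> r (\<lambda>\<xi>. \<integral>\<^sup>+\<tau>\<in>{0..t}. ennreal (norm (g \<tau> \<xi>)) \<partial>lborel) < \<infinity>"
    using fin by (subst (asm) wnorm_time_swap[OF g]) auto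
qed

lemma wt_add:
  "\<xi> \<noteq> 0 \<Longrightarrow> wt a \<sigma> (r + q) \<xi> = norm \<xi> powr q * wt a \<sigma> r \<xi>"
  by (simp add: wt_def rpow_eq_powr powr_add)

text \<open>The parabolic gain: the norm at time \<open>t\<close> and the time integral of the norm with \<open>2\<gamma>\<close> more
  derivatives are both controlled by the norm at time \<open>t\<^sub>0\<close> and the forcing, because
  \<open>|\<xi>|\<^sup>2\<^sup>\<gamma> exp (-\<tau> |\<xi>|\<^sup>2\<^sup>\<gamma>)\<close> has time integral at most one.\<close>

lemma parabolic_estimate:
  assumes W: "jmeas W" and g: "jmeas g" and t0: "0 \<le> t0" "t0 \<le> t"
    and eq: "\<And>\<tau>. 0 \<le> \<tau> \<Longrightarrow> \<tau> \<le> t \<Longrightarrow>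
      AE \<xi> in lborel. W \<tau> \<xi> = of_real (exp (- \<tau> * norm \<xi> powr (2 * \<gamma>))) * Z \<xi> + duh \<gamma> g \<tau> \<xi>"
    and fin: "(\<integral>\<^sup>+\<tau>\<in>{0..t}. wabs a \<sigma> r (g \<tau>) \<partial>lborel) < \<infinity>"
  shows "wabs a \<sigma> r (W t) \<le> wabs a \<sigma> r (W t0) +
      (\<integral>\<^sup>+\<tau>\<in>{t0..t}. wabs a \<sigma> r (g \<tau>) \<partial>lborel)" (is ?A)
    and "(\<integral>\<^sup>+\<tau>\<in>{t0..t}. wabs a \<sigma> (r + 2 * \<gamma>) (W \<tau>) \<partial>lborel) \<le>
      wabs a \<sigma> r (W t0) +
      (\<integral>\<^sup>+\<tau>\<in>{t0..t}. wabs a \<sigma> r (g \<tau>) \<partial>lborel)" (is ?B)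
proof -
  note [measurable (raw)] = jmeas_comp[OF g] jmeas_comp[OF W]
  let ?l = "\<lambda>\<xi>::real^3. norm \<xi> powr (2 * \<gamma>)"
  (* The pointwise majorant of W from the formula restarted at t0. *)
  define P where "P \<tau> \<xi> = ennreal (exp (- (\<tau> - t0) * ?l \<xi>)) * ennreal (norm (W t0 \<xi>)) +
     (\<integral>\<^sup>+r. ennreal (exp (- (\<tau> - r) * ?l \<xi>) * norm (g r \<xi>)) * indicator {t0..\<tau>} r \<partial>lborel)" for \<tau> \<xi>
  have Pm: "(\<lambda>z. P (fst z) (snd z)) \<in> borel_measurable (borel \<Otimes>\<^sub>M borel)"
    unfolding P_def indicator_def atLeastAtMost_iff by measurable
  note [measurable (raw)] = jmeas_comp[OF jmeasI[OF Pm]]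
  have bound: "AE \<xi> in lborel. ennreal (norm (W \<tau> \<xi>)) \<le> P \<tau> \<xi>" if \<tau>: "t0 \<le> \<tau>" "\<tau> \<le> t" for \<tau>
    using eq[OF order_trans[OF t0(1) \<tau>(1)] \<tau>(2)] eq[OF t0] AE_time_integrable[OF g fin]
  proof eventually_elim
    case (elim \<xi>)
    have "(\<integral>\<^sup>+r\<in>{0..\<tau>}. ennreal (norm (g r \<xi>)) \<partial>lborel) \<le> (\<integral>\<^sup>+r\<in>{0..t}. ennreal (norm (g r \<xi>)) \<partial>lborel)"
      using \<tau> by (intro nn_integral_mono) (auto simp: indicator_def)
    also have "\<dots> < \<infinity>" using elim by simp
    finally have "(\<integral>\<^sup>+r\<in>{0..\<tau>}. ennreal (norm (g r \<xi>)) \<partial>lborel) < \<infinity>" .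
    from duh_restart[OF g t0(1) \<tau>(1) this, of \<gamma> "Z \<xi>"] show ?case
      using elim by (simp add: P_def ennreal_mult)
  qed
  have "wabs a \<sigma> r (W t) \<le>
      (\<integral>\<^sup>+\<xi>. ennreal (wt a \<sigma> r \<xi>) * (ennreal (norm (W t0 \<xi>)) + (\<integral>\<^sup>+\<tau>\<in>{t0..t}. ennreal (norm (g \<tau> \<xi>)) \<partial>lborel)) \<partial>lborel)"
    unfolding wnorm_def
  proof (rule nn_integral_mono_AE)
    show "AE \<xi> in lborel. ennreal (wt a \<sigma> r \<xi>) * ennreal (norm (W t \<xi>)) \<le>
      ennreal (wt a \<sigma> r \<xi>) * (ennreal (norm (W t0 \<xi>)) + (\<integral>\<^sup>+\<tau>\<in>{t0..t}. ennreal (norm (g \<tau> \<xi>)) \<partial>lborel))"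
      using bound[OF t0(2) order_refl]
    proof eventually_elim
      case (elim \<xi>)
      have "P t \<xi> \<le> 1 * ennreal (norm (W t0 \<xi>)) + (\<integral>\<^sup>+\<tau>\<in>{t0..t}. ennreal (norm (g \<tau> \<xi>)) \<partial>lborel)"
        unfolding P_def
      proof (rule add_mono)
        show "ennreal (exp (- (t - t0) * ?l \<xi>)) * ennreal (norm (W t0 \<xi>)) \<le> 1 * ennreal (norm (W t0 \<xi>))"
          using t0 by (intro mult_right_mono) (auto simp: ennreal_le_1 intro!: mult_nonpos_nonneg)
        show "(\<integral>\<^sup>+r. ennreal (exp (- (t - r) * ?l \<xi>) * norm (g r \<xi>)) * indicator {t0..t} r \<partial>lborel) \<le>
            (\<integral>\<^sup>+\<tau>\<in>{t0..t}. ennreal (norm (g \<tau> \<xi>)) \<partial>lborel)"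
          by (intro nn_integral_mono)
             (auto simp: indicator_def intro!: ennreal_leI mult_left_le_one_le mult_nonpos_nonneg)
      qed
      with elim show ?case by (intro mult_left_mono) auto
    qed
  qed
  also have "\<dots> = wnorm a \<sigma> r (\<lambda>\<xi>. ennreal (norm (W t0 \<xi>)) + (\<integral>\<^sup>+\<tau>\<in>{t0..t}. ennreal (norm (g \<tau> \<xi>)) \<partial>lborel))"
    by (simp add: wnorm_def)
  also have "\<dots> = wabs a \<sigma> r (W t0) + wnorm a \<sigma> r (\<lambda>\<xi>. \<integral>\<^sup>+\<tau>\<in>{t0..t}. ennreal (norm (g \<tau> \<xi>)) \<partial>lborel)"
    by (rule wnorm_add) measurable
  finally show ?A by (subst wnorm_time_swap[OF g]) auto
  have "(\<integral>\<^sup>+\<tau>\<in>{t0..t}. wabs a \<sigma> (r + 2 * \<gamma>) (W \<tau>) \<partial>lborel) \<le>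
      (\<integral>\<^sup>+\<tau>. \<integral>\<^sup>+\<xi>. ennreal (wt a \<sigma> (r + 2 * \<gamma>) \<xi>) * P \<tau> \<xi> * indicator {t0..t} \<tau> \<partial>lborel \<partial>lborel)"
  proof (rule nn_integral_mono)
    fix \<tau>
    show "wabs a \<sigma> (r + 2 * \<gamma>) (W \<tau>) * indicator {t0..t} \<tau> \<le>
      (\<integral>\<^sup>+\<xi>. ennreal (wt a \<sigma> (r + 2 * \<gamma>) \<xi>) * P \<tau> \<xi> * indicator {t0..t} \<tau> \<partial>lborel)"
    proof (cases "\<tau> \<in> {t0..t}")
      case True
      then show ?thesis
        unfolding wnorm_def using bound[of \<tau>]
        by (auto intro!: nn_integral_mono_AE mult_left_mono elim!: AE_mp)
    qed simp
  qed
  also have "\<dots> = (\<integral>\<^sup>+\<xi>. \<integral>\<^sup>+\<tau>. ennreal (wt a \<sigma> (r + 2 * \<gamma>) \<xi>) * P \<tau> \<xi> * indicator {t0..t} \<tau> \<partial>lborel \<partial>lborel)"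
    by (rule lborel_pair.Fubini') measurable
  also have "\<dots> \<le> (\<integral>\<^sup>+\<xi>. ennreal (wt a \<sigma> r \<xi>) * (ennreal (norm (W t0 \<xi>)) + (\<integral>\<^sup>+\<tau>\<in>{t0..t}. ennreal (norm (g \<tau> \<xi>)) \<partial>lborel)) \<partial>lborel)"
  proof (rule nn_integral_mono_AE)
    show "AE \<xi> in lborel. (\<integral>\<^sup>+\<tau>. ennreal (wt a \<sigma> (r + 2 * \<gamma>) \<xi>) * P \<tau> \<xi> * indicator {t0..t} \<tau> \<partial>lborel) \<le>
      ennreal (wt a \<sigma> r \<xi>) * (ennreal (norm (W t0 \<xi>)) + (\<integral>\<^sup>+\<tau>\<in>{t0..t}. ennreal (norm (g \<tau> \<xi>)) \<partial>lborel))"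
      using AE_lborel_nonzero
    proof eventually_elim
      case (elim \<xi>)
      let ?k = "\<lambda>\<tau> r. ennreal (?l \<xi> * exp (- (\<tau> - r) * ?l \<xi>))"
      have lP: "ennreal (?l \<xi>) * P \<tau> \<xi> * indicator {t0..t} \<tau> = ennreal (norm (W t0 \<xi>)) * (?k \<tau> t0 * indicator {t0..t} \<tau>) +
          (\<integral>\<^sup>+r. ennreal (norm (g r \<xi>)) * indicator {t0..t} r * (?k \<tau> r * indicator {r..t} \<tau>) \<partial>lborel)" for \<tau>
      proof -
        have "ennreal (?l \<xi>) * P \<tau> \<xi> * indicator {t0..t} \<tau> = ennreal (norm (W t0 \<xi>)) * (?k \<tau> t0 * indicator {t0..t} \<tau>) +
          (\<integral>\<^sup>+r. ennreal (exp (- (\<tau> - r) * ?l \<xi>) * norm (g r \<xi>)) * indicator {t0..\<tau>} r \<partial>lborel) * (ennreal (?l \<xi>) * indicator {t0..t} \<tau>)"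
          unfolding P_def by (simp add: distrib_left distrib_right ennreal_mult mult_ac)
        also have "(\<integral>\<^sup>+r. ennreal (exp (- (\<tau> - r) * ?l \<xi>) * norm (g r \<xi>)) * indicator {t0..\<tau>} r \<partial>lborel) * (ennreal (?l \<xi>) * indicator {t0..t} \<tau>) =
          (\<integral>\<^sup>+r. ennreal (exp (- (\<tau> - r) * ?l \<xi>) * norm (g r \<xi>)) * indicator {t0..\<tau>} r * (ennreal (?l \<xi>) * indicator {t0..t} \<tau>) \<partial>lborel)"
          by (rule nn_integral_multc[symmetric]) measurable
        also have "\<dots> = (\<integral>\<^sup>+r. ennreal (norm (g r \<xi>)) * indicator {t0..t} r * (?k \<tau> r * indicator {r..t} \<tau>) \<partial>lborel)"
          by (intro nn_integral_cong) (auto simp: indicator_def ennreal_mult mult_ac)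
        finally show ?thesis .
      qed
      have outer: "(\<integral>\<^sup>+\<tau>. ennreal (wt a \<sigma> (r + 2 * \<gamma>) \<xi>) * P \<tau> \<xi> * indicator {t0..t} \<tau> \<partial>lborel) =
          ennreal (wt a \<sigma> r \<xi>) * (\<integral>\<^sup>+\<tau>. ennreal (?l \<xi>) * P \<tau> \<xi> * indicator {t0..t} \<tau> \<partial>lborel)"
        unfolding wt_add[OF elim]
        by (subst nn_integral_cmult[symmetric]) (auto simp: ennreal_mult mult_ac)
      have split: "(\<integral>\<^sup>+\<tau>. ennreal (?l \<xi>) * P \<tau> \<xi> * indicator {t0..t} \<tau> \<partial>lborel) =
          ennreal (norm (W t0 \<xi>)) * (\<integral>\<^sup>+\<tau>. ?k \<tau> t0 * indicator {t0..t} \<tau> \<partial>lborel) +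
          (\<integral>\<^sup>+\<tau>. \<integral>\<^sup>+r. ennreal (norm (g r \<xi>)) * indicator {t0..t} r * (?k \<tau> r * indicator {r..t} \<tau>) \<partial>lborel \<partial>lborel)"
        unfolding lP
        unfolding indicator_def atLeastAtMost_iff
        by (subst nn_integral_add) (simp_all add: nn_integral_cmult)
      have "(\<integral>\<^sup>+\<tau>. \<integral>\<^sup>+r. ennreal (norm (g r \<xi>)) * indicator {t0..t} r * (?k \<tau> r * indicator {r..t} \<tau>) \<partial>lborel \<partial>lborel) =
         (\<integral>\<^sup>+r. \<integral>\<^sup>+\<tau>. ennreal (norm (g r \<xi>)) * indicator {t0..t} r * (?k \<tau> r * indicator {r..t} \<tau>) \<partial>lborel \<partial>lborel)"
        unfolding indicator_def atLeastAtMost_iff by (rule lborel_pair.Fubini') measurable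
      also have "\<dots> = (\<integral>\<^sup>+r. ennreal (norm (g r \<xi>)) * indicator {t0..t} r * (\<integral>\<^sup>+\<tau>. ?k \<tau> r * indicator {r..t} \<tau> \<partial>lborel) \<partial>lborel)"
        by (intro nn_integral_cong nn_integral_cmult) measurable
      also have "\<dots> \<le> (\<integral>\<^sup>+r. ennreal (norm (g r \<xi>)) * indicator {t0..t} r * 1 \<partial>lborel)"
        by (intro mult_left_mono nn_integral_mono heat_kernel_time_integral) auto
      finally have inner: "(\<integral>\<^sup>+\<tau>. \<integral>\<^sup>+r. ennreal (norm (g r \<xi>)) * indicator {t0..t} r * (?k \<tau> r * indicator {r..t} \<tau>) \<partial>lborel \<partial>lborel)
         \<le> (\<integral>\<^sup>+\<tau>\<in>{t0..t}. ennreal (norm (g \<tau> \<xi>)) \<partial>lborel)" by simp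
      have first: "ennreal (norm (W t0 \<xi>)) * (\<integral>\<^sup>+\<tau>. ?k \<tau> t0 * indicator {t0..t} \<tau> \<partial>lborel) \<le> ennreal (norm (W t0 \<xi>))"
        using mult_left_mono[OF heat_kernel_time_integral[of "?l \<xi>" t0 t], of "ennreal (norm (W t0 \<xi>))"] by simp
      show ?case
        unfolding outer split by (intro mult_left_mono add_mono first inner) simp
    qed
  qed
  also have "\<dots> = wnorm a \<sigma> r (\<lambda>\<xi>. ennreal (norm (W t0 \<xi>)) + (\<integral>\<^sup>+\<tau>\<in>{t0..t}. ennreal (norm (g \<tau> \<xi>)) \<partial>lborel))"
    by (simp add: wnorm_def)
  also have "\<dots> = wabs a \<sigma> r (W t0) + wnorm a \<sigma> r (\<lambda>\<xi>. \<integral>\<^sup>+\<tau>\<in>{t0..t}. ennreal (norm (g \<tau> \<xi>)) \<partial>lborel)"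
    by (rule wnorm_add) measurable
  finally show ?B by (subst wnorm_time_swap[OF g]) auto
qed

section \<open>The forcing terms\<close>

text \<open>The transform of \<open>div (f v)\<close> in terms of the transforms \<open>V\<close> of \<open>v\<close> and \<open>F\<close> of \<open>f\<close>.\<close>

definition transport :: "(3 \<Rightarrow> test_fun) \<Rightarrow> test_fun \<Rightarrow> test_fun" where
  "transport V F \<xi> = (\<Sum>k\<in>UNIV. \<i> * of_real (\<xi> $ k) * (of_real (1 / (2 * pi) ^ 3) * conv (V k) F \<xi>))"

definition leray_hat :: "3 \<Rightarrow> (3 \<Rightarrow> test_fun) \<Rightarrow> test_fun" where
  "leray_hat i G \<xi> = (\<Sum>j\<in>UNIV. of_real (leray_symbol i j \<xi>) * G j \<xi>)"

lemma nconv_mono: "(\<And>\<xi>. f \<xi> \<le> f' \<xi>) \<Longrightarrow> (\<And>\<xi>. g \<xi> \<le> g' \<xi>) \<Longrightarrow> nconv f g \<xi> \<le> nconv f' g' \<xi>"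
  unfolding nconv_def by (intro nn_integral_mono mult_mono) auto

lemma norm_conv_le: "ennreal (norm (conv F G \<xi>)) \<le> nconv (\<lambda>\<xi>. ennreal (norm (F \<xi>))) (\<lambda>\<xi>. ennreal (norm (G \<xi>))) \<xi>"
  unfolding conv_def nconv_def
  by (rule order_trans[OF norm_integral_le_nn]) (simp add: norm_mult ennreal_mult)

lemma ennreal_norm_sum_le:
  fixes z :: "3 \<Rightarrow> complex"
  assumes "\<And>k. ennreal (norm (z k)) \<le> c"
  shows "ennreal (norm (\<Sum>k\<in>UNIV. z k)) \<le> 3 * c"
proof -
  have "ennreal (norm (\<Sum>k\<in>UNIV. z k)) \<le> ennreal (\<Sum>k\<in>UNIV. norm (z k))"
    by (intro ennreal_leI norm_sum)
  also have "\<dots> = (\<Sum>k\<in>UNIV. ennreal (norm (z k)))" by (simp add: sum_ennreal)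
  also have "\<dots> \<le> (\<Sum>(k::3)\<in>UNIV. c)" by (intro sum_mono assms)
  finally show ?thesis by simp
qed

lemma norm_transport_le:
  "ennreal (norm (transport V F \<xi>)) \<le>
    3 * (ennreal (norm \<xi>) * nconv (\<lambda>\<xi>. vnorm (\<lambda>k. V k \<xi>)) (\<lambda>\<xi>. ennreal (norm (F \<xi>))) \<xi>)"
  unfolding transport_def
proof (rule ennreal_norm_sum_le)
  fix k
  have "1 \<le> (2 * pi) ^ 3" using pi_gt3 by (intro one_le_power) simp
  then have c: "norm (of_real (1 / (2 * pi) ^ 3) :: complex) \<le> 1"
    by (simp add: divide_le_eq_1 norm_divide norm_power norm_mult)
  have "norm (\<i> * of_real (\<xi> $ k) * (of_real (1 / (2 * pi) ^ 3) * conv (V k) F \<xi>)) =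
      \<bar>\<xi> $ k\<bar> * (norm (of_real (1 / (2 * pi) ^ 3) :: complex) * norm (conv (V k) F \<xi>))"
    by (simp only: norm_mult norm_ii norm_of_real mult_1_left)
  also have "\<dots> \<le> norm \<xi> * (1 * norm (conv (V k) F \<xi>))"
    by (intro mult_mono abs_component_le_norm c) auto
  finally have "ennreal (norm (\<i> * of_real (\<xi> $ k) * (of_real (1 / (2 * pi) ^ 3) * conv (V k) F \<xi>))) \<le>
      ennreal (norm \<xi>) * ennreal (norm (conv (V k) F \<xi>))"
    by (simp add: ennreal_leI ennreal_mult[symmetric])
  also have "\<dots> \<le> ennreal (norm \<xi>) * nconv (\<lambda>\<xi>. ennreal (norm (V k \<xi>))) (\<lambda>\<xi>. ennreal (norm (F \<xi>))) \<xi>"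
    by (intro mult_left_mono norm_conv_le) simp
  also have "\<dots> \<le> ennreal (norm \<xi>) * nconv (\<lambda>\<xi>. vnorm (\<lambda>k. V k \<xi>)) (\<lambda>\<xi>. ennreal (norm (F \<xi>))) \<xi>"
    by (intro mult_left_mono nconv_mono norm_component_vnorm order_refl) simp
  finally show "ennreal (norm (\<i> * of_real (\<xi> $ k) * (of_real (1 / (2 * pi) ^ 3) * conv (V k) F \<xi>))) \<le>
    ennreal (norm \<xi>) * nconv (\<lambda>\<xi>. vnorm (\<lambda>k. V k \<xi>)) (\<lambda>\<xi>. ennreal (norm (F \<xi>))) \<xi>" .
qed

lemma norm_leray_hat_le:
  assumes "\<And>j. ennreal (norm (G j \<xi>)) \<le> c"
  shows "ennreal (norm (leray_hat i G \<xi>)) \<le> 6 * c"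
proof -
  have "ennreal (norm (leray_hat i G \<xi>)) \<le> 3 * (2 * c)"
    unfolding leray_hat_def
  proof (rule ennreal_norm_sum_le)
    fix j
    have "norm (of_real (leray_symbol i j \<xi>) * G j \<xi>) \<le> 2 * norm (G j \<xi>)"
      unfolding norm_mult norm_of_real by (intro mult_right_mono leray_symbol_bound) auto
    then have "ennreal (norm (of_real (leray_symbol i j \<xi>) * G j \<xi>)) \<le> ennreal 2 * ennreal (norm (G j \<xi>))"
      by (subst ennreal_mult[symmetric]) (auto intro: ennreal_leI)
    also have "\<dots> \<le> 2 * c" using assms[of j] by (simp add: mult_left_mono)
    finally show "ennreal (norm (of_real (leray_symbol i j \<xi>) * G j \<xi>)) \<le> 2 * c" .
  qed
  then show ?thesis by (simp add: mult.assoc[symmetric])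
qed

lemma conv_jmeas:
  assumes "jmeas F" "jmeas G"
  shows "jmeas (\<lambda>t. conv (F t) (G t))"
proof (rule jmeasI)
  note [measurable (raw)] = jmeas_comp[OF assms(1)] jmeas_comp[OF assms(2)]
  show "(\<lambda>z. conv (F (fst z)) (G (fst z)) (snd z)) \<in> borel_measurable (borel \<Otimes>\<^sub>M borel)"
    unfolding conv_def by measurable
qed

lemma transport_jmeas:
  assumes "\<And>k. jmeas (V k)" "jmeas F"
  shows "jmeas (\<lambda>t. transport (\<lambda>k. V k t) (F t))"
proof (rule jmeasI)
  have [measurable]: "(\<lambda>z. conv (V k (fst z)) (F (fst z)) (snd z)) \<in> borel_measurable (borel \<Otimes>\<^sub>M borel)" for k
    using conv_jmeas[OF assms(1)[of k] assms(2)] by (simp add: jmeas_def)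
  show "(\<lambda>z. transport (\<lambda>k. V k (fst z)) (F (fst z)) (snd z)) \<in> borel_measurable (borel \<Otimes>\<^sub>M borel)"
    unfolding transport_def by measurable (rule measurable_compose[OF measurable_snd], measurable)
qed

lemma leray_hat_jmeas:
  assumes "\<And>j. jmeas (G j)"
  shows "jmeas (\<lambda>t. leray_hat i (\<lambda>j. G j t))"
proof (rule jmeasI)
  have [measurable]: "(\<lambda>z. G j (fst z) (snd z)) \<in> borel_measurable (borel \<Otimes>\<^sub>M borel)" for j
    using assms[of j] by (simp add: jmeas_def)
  show "(\<lambda>z. leray_hat i (\<lambda>j. G j (fst z)) (snd z)) \<in> borel_measurable (borel \<Otimes>\<^sub>M borel)"
    unfolding leray_hat_def by measurable
qed

text \<open>The Fourier side of a curve with the regularity of a solution, before any equation is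
  imposed: jointly measurable transforms with finite, continuous low norms and integrable high
  norms.\<close>

locale fourier_curve = boussinesq_exponents +
  fixes Ts :: real and U :: "3 \<Rightarrow> real \<Rightarrow> test_fun" and \<Theta> :: "real \<Rightarrow> test_fun"
    and x y :: "real \<Rightarrow> real"
  assumes Ts_pos: "Ts > 0"
    and U_jmeas: "\<And>k. jmeas (U k)" and \<Theta>_jmeas: "jmeas \<Theta>"
    and U_low: "\<And>t. 0 \<le> t \<Longrightarrow> t < Ts \<Longrightarrow> wvec a \<sigma> s (\<lambda>k. U k t) = ennreal (x t)"
    and \<Theta>_low: "\<And>t. 0 \<le> t \<Longrightarrow> t < Ts \<Longrightarrow> wabs a \<sigma> s (\<Theta> t) = ennreal (y t)"
    and U_high: "\<And>t. 0 \<le> t \<Longrightarrow> t < Ts \<Longrightarrow>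
      (\<integral>\<^sup>+\<tau>\<in>{0..t}. wvec a \<sigma> (s + 2 * \<alpha>) (\<lambda>k. U k \<tau>) \<partial>lborel) < \<infinity>"
    and \<Theta>_high: "\<And>t. 0 \<le> t \<Longrightarrow> t < Ts \<Longrightarrow>
      (\<integral>\<^sup>+\<tau>\<in>{0..t}. wabs a \<sigma> (s + 2 * \<beta>) (\<Theta> \<tau>) \<partial>lborel) < \<infinity>"
    and x_nonneg: "\<And>t. 0 \<le> x t" and y_nonneg: "\<And>t. 0 \<le> y t"
    and x_cont: "continuous_on {0..<Ts} x" and y_cont: "continuous_on {0..<Ts} y"
begin

text \<open>\<open>high\<close> is the quantity that the heat flow controls after integration in time; \<open>N\<close> is the norm of
  the pair. The transforms of the three forcing terms are \<open>fA\<close> for \<open>P(u \<cdot> \<nabla>u)\<close>, \<open>fB\<close> for \<open>P(\<theta> e\<^sub>3)\<close> and \<open>fC\<close>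
  for \<open>u \<cdot> \<nabla>\<theta>\<close>.\<close>

definition "high \<tau> = wvec a \<sigma> (s + 2 * \<alpha>) (\<lambda>k. U k \<tau>) +
  wabs a \<sigma> (s + 2 * \<beta>) (\<Theta> \<tau>)"

definition "N t = x t + y t"

definition "fA i \<tau> = leray_hat i (\<lambda>j. transport (\<lambda>k. U k \<tau>) (U j \<tau>))"
definition "fB i \<tau> = leray_hat i (\<lambda>j. if j = 3 then \<Theta> \<tau> else (\<lambda>_. 0))"
definition "fC \<tau> = transport (\<lambda>k. U k \<tau>) (\<Theta> \<tau>)"

lemma fA_jmeas: "jmeas (fA i)"
  unfolding fA_def using U_jmeas by (intro leray_hat_jmeas[of "\<lambda>j \<tau>. transport (\<lambda>k. U k \<tau>) (U j \<tau>)"] transport_jmeas)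

lemma fB_jmeas: "jmeas (fB i)"
  unfolding fB_def using \<Theta>_jmeas
  by (intro leray_hat_jmeas[of "\<lambda>j \<tau>. if j = 3 then \<Theta> \<tau> else (\<lambda>_. 0)"])
     (simp add: jmeas_def if_distribR cong: if_cong)

lemma fC_jmeas: "jmeas fC"
  unfolding fC_def using U_jmeas \<Theta>_jmeas by (intro transport_jmeas)

lemma U_meas [measurable]: "U k t \<in> borel_measurable borel"
  using jmeas_comp[OF U_jmeas[of k], of "\<lambda>_. t" borel "\<lambda>x. x"] by simp

lemma \<Theta>_meas [measurable]: "\<Theta> t \<in> borel_measurable borel"
  using jmeas_comp[OF \<Theta>_jmeas, of "\<lambda>_. t" borel "\<lambda>x. x"] by simp

lemma wnorm_U_measurable [measurable]: "(\<lambda>\<tau>. wvec a \<sigma> r (\<lambda>k. U k \<tau>)) \<in> borel_measurable borel"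
proof -
  note [measurable (raw)] = jmeas_comp[OF U_jmeas]
  show ?thesis unfolding wnorm_def by measurable
qed

lemma wnorm_\<Theta>_measurable [measurable]: "(\<lambda>\<tau>. wabs a \<sigma> r (\<Theta> \<tau>)) \<in> borel_measurable borel"
proof -
  note [measurable (raw)] = jmeas_comp[OF \<Theta>_jmeas]
  show ?thesis unfolding wnorm_def by measurable
qed

lemma high_measurable [measurable]: "high \<in> borel_measurable borel"
  unfolding high_def[abs_def] by measurable

lemma high_integral_finite:
  assumes "0 \<le> t0" "t < Ts"
  shows "(\<integral>\<^sup>+\<tau>\<in>{t0..t}. high \<tau> \<partial>lborel) < \<infinity>"
proof (cases "0 \<le> t")
  case True
  have "(\<integral>\<^sup>+\<tau>\<in>{t0..t}. high \<tau> \<partial>lborel) \<le> (\<integral>\<^sup>+\<tau>\<in>{0..t}. high \<tau> \<partial>lborel)"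
    using assms by (intro nn_integral_mono) (auto simp: indicator_def)
  also have "\<dots> = (\<integral>\<^sup>+\<tau>\<in>{0..t}. wvec a \<sigma> (s + 2 * \<alpha>) (\<lambda>k. U k \<tau>) \<partial>lborel) +
     (\<integral>\<^sup>+\<tau>\<in>{0..t}. wabs a \<sigma> (s + 2 * \<beta>) (\<Theta> \<tau>) \<partial>lborel)"
    unfolding high_def distrib_right by (rule nn_integral_add) auto
  also have "\<dots> < \<infinity>" using U_high[OF True assms(2)] \<Theta>_high[OF True assms(2)] by simp
  finally show ?thesis .
next
  case False
  then have "{t0..t} = {}" using assms by auto
  then show ?thesis by simp
qed

lemma AE_high_finite: "AE \<tau> in lborel. 0 \<le> \<tau> \<and> \<tau> < Ts \<longrightarrow> high \<tau> < \<infinity>"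
proof -
  have "AE \<tau> in lborel. \<forall>n::nat. high \<tau> * indicator {0..Ts - 1 / (real n + 1)} \<tau> \<noteq> \<infinity>"
    unfolding AE_all_countable
    using high_integral_finite[of 0] by (intro allI nn_integral_noteq_infinite) (auto simp: less_top)
  then show ?thesis
  proof eventually_elim
    case (elim \<tau>)
    show ?case
    proof (intro impI)
      assume \<tau>: "0 \<le> \<tau> \<and> \<tau> < Ts"
      define n where "n = nat \<lceil>1 / (Ts - \<tau>)\<rceil>"
      have "1 / (Ts - \<tau>) \<le> real n" unfolding n_def by linarith
      also have "\<dots> < real n + 1" by simp
      finally have "1 / (real n + 1) < Ts - \<tau>" using \<tau> by (simp add: field_simps)
      then have "\<tau> \<in> {0..Ts - 1 / (real n + 1)}" using \<tau> by auto
      with elim[rule_format, of n] show "high \<tau> < \<infinity>" by (simp add: less_top)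
    qed
  qed
qed

text \<open>Both components are integrable in frequency at almost every time, as \<open>0\<close> lies between \<open>s\<close>
  and the high exponents.\<close>

lemma fields_integrable:
  assumes \<tau>: "0 \<le> \<tau>" "\<tau> < Ts" and hi: "high \<tau> < \<infinity>"
  shows "integrable lborel (U k \<tau>)" and "integrable lborel (\<Theta> \<tau>)"
proof -
  have key: "integrable lborel F" if [measurable]: "F \<in> borel_measurable borel"
    and lo: "wabs a \<sigma> s F < \<infinity>" and h: "wabs a \<sigma> (s + 2 * \<gamma>) F < \<infinity>"
    and \<gamma>: "\<gamma> > 1/2" for F :: test_fun and \<gamma>
  proof (rule integrableI_bounded)
    have "(\<integral>\<^sup>+\<xi>. ennreal (norm (F \<xi>)) \<partial>lborel) \<le> wabs a \<sigma> 0 F"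
      unfolding wnorm_def
    proof (intro nn_integral_mono)
      fix \<xi>
      have "1 \<le> wt a \<sigma> 0 \<xi>" using a_nonneg by (simp add: wt_def rpow_def)
      then show "ennreal (norm (F \<xi>)) \<le> ennreal (wt a \<sigma> 0 \<xi>) * ennreal (norm (F \<xi>))"
        using mult_right_mono[of 1 "ennreal (wt a \<sigma> 0 \<xi>)" "ennreal (norm (F \<xi>))"] by simp
    qed
    also have "\<dots> \<le> ennreal (1 powr (0 - s)) * wabs a \<sigma> s F +
        ennreal (1 powr (0 - (s + 2 * \<gamma>))) * wabs a \<sigma> (s + 2 * \<gamma>) F"
      using s_le s_ge \<gamma> by (intro wnorm_split) auto
    also have "\<dots> < \<infinity>" using lo h by simp
    finally show "(\<integral>\<^sup>+\<xi>. ennreal (norm (F \<xi>)) \<partial>lborel) < \<infinity>" .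
  qed measurable
  have hs: "wvec a \<sigma> (s + 2 * \<alpha>) (\<lambda>k. U k \<tau>) < \<infinity>"
    "wabs a \<sigma> (s + 2 * \<beta>) (\<Theta> \<tau>) < \<infinity>"
    using hi by (simp_all add: high_def)
  have le: "wabs a \<sigma> r (U k \<tau>) \<le> wvec a \<sigma> r (\<lambda>k. U k \<tau>)" for r
    by (intro wnorm_mono norm_component_vnorm[of "\<lambda>k. U k \<tau> _"])
  show "integrable lborel (U k \<tau>)"
    using le_less_trans[OF le] hs U_low[OF \<tau>] alpha_gt by (intro key[of _ \<alpha>]) auto
  show "integrable lborel (\<Theta> \<tau>)"
    using hs \<Theta>_low[OF \<tau>] beta_gt by (intro key[of _ \<beta>]) auto
qed

text \<open>\<open>force\<close> measures the right-hand sides of the equations, \<open>parts\<close> the single terms. The latter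
  matters because in the mild formulation each term has its own time integral.\<close>

definition "force \<tau> = (\<Sum>i\<in>UNIV. wabs a \<sigma> s (\<lambda>\<xi>. fB i \<tau> \<xi> - fA i \<tau> \<xi>)) +
  wabs a \<sigma> s (\<lambda>\<xi>. - fC \<tau> \<xi>)"

definition "parts \<tau> = (\<Sum>i\<in>UNIV. wabs a \<sigma> s (fA i \<tau>)) +
  (\<Sum>i\<in>UNIV. wabs a \<sigma> s (fB i \<tau>)) + wabs a \<sigma> s (fC \<tau>)"

lemma f_meas [measurable]: "fA i \<tau> \<in> borel_measurable borel" "fB i \<tau> \<in> borel_measurable borel" "fC \<tau> \<in> borel_measurable borel"
  using jmeas_comp[OF fA_jmeas[of i], of "\<lambda>_. \<tau>" borel "\<lambda>x. x"] jmeas_comp[OF fB_jmeas[of i], of "\<lambda>_. \<tau>" borel "\<lambda>x. x"]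
    jmeas_comp[OF fC_jmeas, of "\<lambda>_. \<tau>" borel "\<lambda>x. x"] by simp_all

lemma force_le_parts: "force \<tau> \<le> parts \<tau>"
proof -
  have "wabs a \<sigma> s (\<lambda>\<xi>. fB i \<tau> \<xi> - fA i \<tau> \<xi>) \<le>
     wabs a \<sigma> s (fA i \<tau>) + wabs a \<sigma> s (fB i \<tau>)" for i
  proof -
    have "wabs a \<sigma> s (\<lambda>\<xi>. fB i \<tau> \<xi> - fA i \<tau> \<xi>) \<le>
       wnorm a \<sigma> s (\<lambda>\<xi>. ennreal (norm (fA i \<tau> \<xi>)) + ennreal (norm (fB i \<tau> \<xi>)))"
    proof (intro wnorm_mono)
      fix \<xi>
      have "norm (fB i \<tau> \<xi> - fA i \<tau> \<xi>) \<le> norm (fA i \<tau> \<xi>) + norm (fB i \<tau> \<xi>)"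
        by (subst add.commute) (rule norm_triangle_ineq4)
      then show "ennreal (norm (fB i \<tau> \<xi> - fA i \<tau> \<xi>)) \<le> ennreal (norm (fA i \<tau> \<xi>)) + ennreal (norm (fB i \<tau> \<xi>))"
        by (simp add: ennreal_plus[symmetric] ennreal_leI del: ennreal_plus)
    qed
    also have "\<dots> = wabs a \<sigma> s (fA i \<tau>) + wabs a \<sigma> s (fB i \<tau>)"
      by (rule wnorm_add) auto
    finally show ?thesis .
  qed
  then have "(\<Sum>i\<in>UNIV. wabs a \<sigma> s (\<lambda>\<xi>. fB i \<tau> \<xi> - fA i \<tau> \<xi>)) \<le>
     (\<Sum>i\<in>UNIV. wabs a \<sigma> s (fA i \<tau>)) + (\<Sum>i\<in>UNIV. wabs a \<sigma> s (fB i \<tau>))"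
    unfolding sum.distrib[symmetric] by (rule sum_mono)
  then show ?thesis unfolding force_def parts_def by (simp add: add_right_mono)
qed

lemma forcing_le_parts:
  "wabs a \<sigma> s (fA i \<tau>) \<le> parts \<tau>"
  "wabs a \<sigma> s (fB i \<tau>) \<le> parts \<tau>"
  "wabs a \<sigma> s (fC \<tau>) \<le> parts \<tau>"
  "wabs a \<sigma> s (\<lambda>\<xi>. fB i \<tau> \<xi> - fA i \<tau> \<xi>) \<le> parts \<tau>"
  "wabs a \<sigma> s (\<lambda>\<xi>. - fC \<tau> \<xi>) \<le> parts \<tau>"
proof -
  have mem: "f i \<le> (\<Sum>i\<in>UNIV. f i)" for f :: "3 \<Rightarrow> ennreal" by (rule member_le_sum) auto
  show "wabs a \<sigma> s (fA i \<tau>) \<le> parts \<tau>"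
    unfolding parts_def add.assoc
    by (rule order_trans[OF mem[of "\<lambda>i. wabs a \<sigma> s (fA i \<tau>)"]]) (rule le_iff_add[THEN iffD2], blast)
  show "wabs a \<sigma> s (fB i \<tau>) \<le> parts \<tau>"
    unfolding parts_def
    by (rule order_trans[OF mem[of "\<lambda>i. wabs a \<sigma> s (fB i \<tau>)"]])
       (simp add: add_increasing add_increasing2)
  show "wabs a \<sigma> s (fC \<tau>) \<le> parts \<tau>" unfolding parts_def by (simp add: add_increasing)
  then show "wabs a \<sigma> s (\<lambda>\<xi>. - fC \<tau> \<xi>) \<le> parts \<tau>" by simp
  have "wabs a \<sigma> s (\<lambda>\<xi>. fB i \<tau> \<xi> - fA i \<tau> \<xi>) \<le> force \<tau>"
    unfolding force_def
    by (rule order_trans[OF mem[of "\<lambda>i. wabs a \<sigma> s (\<lambda>\<xi>. fB i \<tau> \<xi> - fA i \<tau> \<xi>)"]])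
       (simp add: add_increasing2)
  then show "wabs a \<sigma> s (\<lambda>\<xi>. fB i \<tau> \<xi> - fA i \<tau> \<xi>) \<le> parts \<tau>"
    using force_le_parts by (rule order_trans)
qed

lemma time_integral_finite:
  assumes "(\<integral>\<^sup>+\<tau>\<in>{0..t}. parts \<tau> \<partial>lborel) < \<infinity>" "\<And>\<tau>. h \<tau> \<le> parts \<tau>"
  shows "(\<integral>\<^sup>+\<tau>\<in>{0..t}. h \<tau> \<partial>lborel) < \<infinity>"
proof -
  have "(\<integral>\<^sup>+\<tau>\<in>{0..t}. h \<tau> \<partial>lborel) \<le> (\<integral>\<^sup>+\<tau>\<in>{0..t}. parts \<tau> \<partial>lborel)"
    by (intro nn_integral_mono mult_right_mono assms(2)) simp
  then show ?thesis using assms(1) by (rule le_less_trans)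
qed

lemma parts_le:
  "parts \<tau> \<le> 54 * (wnorm a \<sigma> s (\<lambda>\<zeta>. ennreal (norm \<zeta>) * nconv (\<lambda>\<xi>. vnorm (\<lambda>k. U k \<tau> \<xi>)) (\<lambda>\<xi>. vnorm (\<lambda>k. U k \<tau> \<xi>)) \<zeta>) +
      wnorm a \<sigma> s (\<lambda>\<zeta>. ennreal (norm \<zeta>) * nconv (\<lambda>\<xi>. vnorm (\<lambda>k. U k \<tau> \<xi>)) (\<lambda>\<xi>. ennreal (norm (\<Theta> \<tau> \<xi>))) \<zeta>)) +
    18 * wabs a \<sigma> s (\<Theta> \<tau>)"
proof -
  let ?V = "\<lambda>\<xi>. vnorm (\<lambda>k. U k \<tau> \<xi>)" and ?T = "\<lambda>\<xi>. ennreal (norm (\<Theta> \<tau> \<xi>))"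
  let ?VV = "\<lambda>\<zeta>. ennreal (norm \<zeta>) * nconv ?V ?V \<zeta>" and ?VT = "\<lambda>\<zeta>. ennreal (norm \<zeta>) * nconv ?V ?T \<zeta>"
  have A: "wabs a \<sigma> s (fA i \<tau>) \<le> 18 * wnorm a \<sigma> s ?VV" for i
  proof -
    have "ennreal (norm (fA i \<tau> \<xi>)) \<le> 18 * ?VV \<xi>" for \<xi>
    proof -
      have "ennreal (norm (fA i \<tau> \<xi>)) \<le> 6 * (3 * ?VV \<xi>)"
        unfolding fA_def
      proof (rule norm_leray_hat_le)
        fix j
        have "ennreal (norm (transport (\<lambda>k. U k \<tau>) (U j \<tau>) \<xi>)) \<le>
            3 * (ennreal (norm \<xi>) * nconv ?V (\<lambda>\<xi>. ennreal (norm (U j \<tau> \<xi>))) \<xi>)"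
          by (rule norm_transport_le)
        also have "\<dots> \<le> 3 * ?VV \<xi>"
          by (intro mult_left_mono nconv_mono norm_component_vnorm[of "\<lambda>k. U k \<tau> _"] order_refl) auto
        finally show "ennreal (norm (transport (\<lambda>k. U k \<tau>) (U j \<tau>) \<xi>)) \<le> 3 * ?VV \<xi>" .
      qed
      then show ?thesis by (simp add: mult.assoc[symmetric])
    qed
    then have "wabs a \<sigma> s (fA i \<tau>) \<le> wnorm a \<sigma> s (\<lambda>\<xi>. 18 * ?VV \<xi>)" by (rule wnorm_mono)
    also have "\<dots> = 18 * wnorm a \<sigma> s ?VV" by (rule wnorm_cmult) measurable
    finally show ?thesis .
  qed
  have B: "wabs a \<sigma> s (fB i \<tau>) \<le> 6 * wnorm a \<sigma> s ?T" for i
  proof -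
    have "ennreal (norm (fB i \<tau> \<xi>)) \<le> 6 * ?T \<xi>" for \<xi>
      unfolding fB_def by (rule norm_leray_hat_le) auto
    then have "wabs a \<sigma> s (fB i \<tau>) \<le> wnorm a \<sigma> s (\<lambda>\<xi>. 6 * ?T \<xi>)" by (rule wnorm_mono)
    also have "\<dots> = 6 * wnorm a \<sigma> s ?T" by (rule wnorm_cmult) measurable
    finally show ?thesis .
  qed
  have C: "wabs a \<sigma> s (fC \<tau>) \<le> 3 * wnorm a \<sigma> s ?VT"
  proof -
    have "wabs a \<sigma> s (fC \<tau>) \<le> wnorm a \<sigma> s (\<lambda>\<xi>. 3 * ?VT \<xi>)"
      unfolding fC_def by (intro wnorm_mono norm_transport_le)
    also have "\<dots> = 3 * wnorm a \<sigma> s ?VT" by (rule wnorm_cmult) measurable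
    finally show ?thesis .
  qed
  have "parts \<tau> \<le> (\<Sum>(i::3)\<in>UNIV. 18 * wnorm a \<sigma> s ?VV) + (\<Sum>(i::3)\<in>UNIV. 6 * wnorm a \<sigma> s ?T) + 3 * wnorm a \<sigma> s ?VT"
    unfolding parts_def by (intro add_mono sum_mono A B C)
  also have "\<dots> = 54 * wnorm a \<sigma> s ?VV + 18 * wnorm a \<sigma> s ?T + 3 * wnorm a \<sigma> s ?VT"
    by (simp add: mult.assoc[symmetric])
  also have "\<dots> \<le> 54 * wnorm a \<sigma> s ?VV + 18 * wnorm a \<sigma> s ?T + 54 * wnorm a \<sigma> s ?VT"
    by (intro add_left_mono mult_right_mono) auto
  finally show ?thesis by (simp add: distrib_left add_ac)
qed

text \<open>The bilinear estimate with \<open>\<epsilon> = 1/216\<close>: the constant 54 of \<open>parts_le\<close> and the factor 4, which leaves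
  room for absorption, turn this into the coefficient 1 of \<open>high\<close>. The buoyancy is linear and explains
  the \<open>1\<close> in \<open>1 + \<Phi>\<close>.\<close>

lemma parts_bound:
  obtains K where "K \<ge> 1" and "AE \<tau> in lborel. 0 \<le> \<tau> \<and> \<tau> < Ts \<longrightarrow>
    4 * parts \<tau> \<le> high \<tau> + ennreal (K * ((1 + Phi (x \<tau>) (y \<tau>)) * N \<tau>))"
proof -
  obtain C where C: "C \<ge> 0" "\<And>f g x X y Y. f \<in> borel_measurable borel \<Longrightarrow> g \<in> borel_measurable borel \<Longrightarrow>
      wnorm a \<sigma> s f = ennreal x \<Longrightarrow> wnorm a \<sigma> (s + 2 * \<alpha>) f = ennreal X \<Longrightarrow>
      wnorm a \<sigma> s g = ennreal y \<Longrightarrow> wnorm a \<sigma> (s + 2 * \<beta>) g = ennreal Y \<Longrightarrow>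
      0 \<le> x \<Longrightarrow> 0 \<le> X \<Longrightarrow> 0 \<le> y \<Longrightarrow> 0 \<le> Y \<Longrightarrow>
      wnorm a \<sigma> s (\<lambda>\<zeta>. ennreal (norm \<zeta>) * nconv f f \<zeta>) + wnorm a \<sigma> s (\<lambda>\<zeta>. ennreal (norm \<zeta>) * nconv f g \<zeta>)
      \<le> ennreal (1 / 216 * (X + Y) + C * (Phi x y * (x + y)))"
    using bilinear_estimate[of "1/216"] by auto
  show thesis
  proof (rule that)
    show "1 \<le> 216 * C + 72" using C(1) by simp
    show "AE \<tau> in lborel. 0 \<le> \<tau> \<and> \<tau> < Ts \<longrightarrow>
        4 * parts \<tau> \<le> high \<tau> + ennreal ((216 * C + 72) * ((1 + Phi (x \<tau>) (y \<tau>)) * N \<tau>))"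
      using AE_high_finite
    proof eventually_elim
      case (elim \<tau>)
      show ?case
      proof (intro impI)
        assume \<tau>: "0 \<le> \<tau> \<and> \<tau> < Ts"
        then have hi: "high \<tau> < \<infinity>" using elim by blast
        let ?V = "\<lambda>\<xi>. vnorm (\<lambda>k. U k \<tau> \<xi>)" and ?T = "\<lambda>\<xi>. ennreal (norm (\<Theta> \<tau> \<xi>))"
        define X where "X = enn2real (wnorm a \<sigma> (s + 2 * \<alpha>) ?V)"
        define Y where "Y = enn2real (wnorm a \<sigma> (s + 2 * \<beta>) ?T)"
        have XY: "wnorm a \<sigma> (s + 2 * \<alpha>) ?V = ennreal X" "wnorm a \<sigma> (s + 2 * \<beta>) ?T = ennreal Y" "X \<ge> 0" "Y \<ge> 0"
          using hi by (auto simp: X_def Y_def high_def less_top)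
        define P where "P = Phi (x \<tau>) (y \<tau>)"
        have P: "P \<ge> 0" by (simp add: P_def Phi_nonneg)
        have n: "x \<tau> \<ge> 0" "y \<tau> \<ge> 0" "N \<tau> \<ge> 0" using x_nonneg y_nonneg by (auto simp: N_def)
        have bil: "wnorm a \<sigma> s (\<lambda>\<zeta>. ennreal (norm \<zeta>) * nconv ?V ?V \<zeta>) + wnorm a \<sigma> s (\<lambda>\<zeta>. ennreal (norm \<zeta>) * nconv ?V ?T \<zeta>)
          \<le> ennreal (1 / 216 * (X + Y) + C * (P * N \<tau>))"
        proof -
          have m: "?V \<in> borel_measurable borel" "?T \<in> borel_measurable borel" by measurable
          have "0 \<le> \<tau>" "\<tau> < Ts" using \<tau> by auto
          from C(2)[OF m U_low[OF this] XY(1) \<Theta>_low[OF this] XY(2) n(1) XY(3) n(2) XY(4)] show ?thesis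
            by (simp only: P_def N_def)
        qed
        have "4 * parts \<tau> \<le> 4 * (54 * ennreal (1 / 216 * (X + Y) + C * (P * N \<tau>)) + 18 * ennreal (y \<tau>))"
        proof (intro mult_left_mono order_trans[OF parts_le])
          show "54 * (wnorm a \<sigma> s (\<lambda>\<zeta>. ennreal (norm \<zeta>) * nconv ?V ?V \<zeta>) + wnorm a \<sigma> s (\<lambda>\<zeta>. ennreal (norm \<zeta>) * nconv ?V ?T \<zeta>)) +
              18 * wnorm a \<sigma> s ?T \<le> 54 * ennreal (1 / 216 * (X + Y) + C * (P * N \<tau>)) + 18 * ennreal (y \<tau>)"
            using \<tau> \<Theta>_low[of \<tau>] by (intro add_mono mult_left_mono bil) auto
        qed simp
        also have "\<dots> = ennreal (4 * (54 * (1 / 216 * (X + Y) + C * (P * N \<tau>)) + 18 * y \<tau>))"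
        proof -
          have z: "0 \<le> 1 / 216 * (X + Y) + C * (P * N \<tau>)" using XY(3,4) C(1) P n by (intro add_nonneg_nonneg mult_nonneg_nonneg) auto
          have "ennreal (4 * (54 * z + 18 * w)) = 4 * (54 * ennreal z + 18 * ennreal w)" if "z \<ge> 0" "w \<ge> 0" for z w
            using that by (simp add: ennreal_mult ennreal_plus)
          from this[OF z n(2)] show ?thesis by simp
        qed
        also have "\<dots> \<le> ennreal ((X + Y) + (216 * C + 72) * ((1 + P) * N \<tau>))"
        proof (rule ennreal_leI)
          have "216 * (C * (P * N \<tau>)) \<le> 216 * (C * ((1 + P) * N \<tau>))"
            using C(1) P n by (intro mult_left_mono mult_right_mono) auto
          moreover have "y \<tau> \<le> N \<tau>" using n by (simp add: N_def)
          moreover have "N \<tau> \<le> (1 + P) * N \<tau>" using P n by (simp add: distrib_right)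
          moreover have "(216 * C + 72) * ((1 + P) * N \<tau>) = 216 * (C * ((1 + P) * N \<tau>)) + 72 * ((1 + P) * N \<tau>)"
            by (simp add: distrib_right)
          moreover have "4 * (54 * (1 / 216 * (X + Y) + C * (P * N \<tau>)) + 18 * y \<tau>) = (X + Y) + 216 * (C * (P * N \<tau>)) + 72 * y \<tau>"
            by (simp add: distrib_left)
          ultimately show "4 * (54 * (1 / 216 * (X + Y) + C * (P * N \<tau>)) + 18 * y \<tau>) \<le> (X + Y) + (216 * C + 72) * ((1 + P) * N \<tau>)"
            by linarith
        qed
        also have "\<dots> = high \<tau> + ennreal ((216 * C + 72) * ((1 + P) * N \<tau>))"
          using XY C(1) P n by (simp add: high_def ennreal_plus)
        finally show "4 * parts \<tau> \<le> high \<tau> + ennreal ((216 * C + 72) * ((1 + Phi (x \<tau>) (y \<tau>)) * N \<tau>))"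
          by (simp add: P_def)
      qed
    qed
  qed
qed

end

section \<open>Gronwall arguments\<close>

lemma nn_integral_continuous:
  fixes f :: "real \<Rightarrow> real"
  assumes c: "continuous_on {p..q} f" and nn: "\<And>\<tau>. \<tau> \<in> {p..q} \<Longrightarrow> 0 \<le> f \<tau>"
  shows "(\<integral>\<^sup>+\<tau>\<in>{p..q}. ennreal (f \<tau>) \<partial>lborel) = ennreal (integral {p..q} f)"
proof -
  have si: "set_integrable lborel {p..q} f" by (rule borel_integrable_atLeastAtMost'[OF c])
  have "(\<integral>\<^sup>+\<tau>\<in>{p..q}. ennreal (f \<tau>) \<partial>lborel) = (\<integral>\<^sup>+\<tau>. ennreal (indicator {p..q} \<tau> *\<^sub>R f \<tau>) \<partial>lborel)"
    by (intro nn_integral_cong) (simp add: indicator_def)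
  also have "\<dots> = ennreal (\<integral>\<tau>. indicator {p..q} \<tau> *\<^sub>R f \<tau> \<partial>lborel)"
    using si nn by (intro nn_integral_eq_integral) (auto simp: set_integrable_def indicator_def)
  also have "(\<integral>\<tau>. indicator {p..q} \<tau> *\<^sub>R f \<tau> \<partial>lborel) = integral {p..q} f"
    using set_borel_integral_eq_integral(2)[OF si] by (simp add: set_lebesgue_integral_def)
  finally show ?thesis .
qed

lemma integral_upper_DERIV:
  fixes f :: "real \<Rightarrow> real"
  assumes c: "continuous_on {p..q} f" and r: "p < r" "r < q"
  shows "((\<lambda>r. integral {p..r} f) has_real_derivative f r) (at r)"
proof -
  have "((\<lambda>r. integral {p..r} f) has_real_derivative f r) (at r within {p..q})"
    using integral_has_real_derivative[OF c, of r] r by simp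
  moreover have "at r within {p..q} = at r" using r by (intro at_within_Icc_at)
  ultimately show ?thesis by simp
qed

lemma integral_upper_continuous:
  fixes f :: "real \<Rightarrow> real"
  assumes "continuous_on {p..q} f"
  shows "continuous_on {p..q} (\<lambda>r. integral {p..r} f)"
  by (rule indefinite_integral_continuous_1[OF integrable_continuous_real[OF assms]])

lemma gronwall_linear:
  fixes f n :: "real \<Rightarrow> real"
  assumes pq: "p \<le> q" and f: "continuous_on {p..q} f" and n: "continuous_on {p..q} n"
    and f0: "\<And>r. r \<in> {p..q} \<Longrightarrow> 0 \<le> f r"
    and le: "\<And>r. r \<in> {p..q} \<Longrightarrow> n r \<le> A + integral {p..r} (\<lambda>\<tau>. f \<tau> * n \<tau>)"
  shows "n q \<le> A * exp (integral {p..q} f)"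
proof (cases "p = q")
  case True
  then show ?thesis using le[of q] by simp
next
  case False
  then have pq': "p < q" using pq by simp
  define Y where "Y r = A + integral {p..r} (\<lambda>\<tau>. f \<tau> * n \<tau>)" for r
  have fn: "continuous_on {p..q} (\<lambda>\<tau>. f \<tau> * n \<tau>)" by (intro continuous_intros f n)
  define E where "E r = Y r * exp (- integral {p..r} f)" for r
  have "E q \<le> E p"
  proof (rule DERIV_nonpos_imp_decreasing_open[OF pq])
    fix r assume r: "p < r" "r < q"
    have "(E has_real_derivative (f r * n r) * exp (- integral {p..r} f) +
        exp (- integral {p..r} f) * (- f r) * Y r) (at r)"
      unfolding E_def Y_def
      by (auto intro!: derivative_eq_intros integral_upper_DERIV[OF f r] integral_upper_DERIV[OF fn r])
    moreover have "(f r * n r) * exp (- integral {p..r} f) + exp (- integral {p..r} f) * (- f r) * Y r =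
        (exp (- integral {p..r} f) * f r) * (n r - Y r)" by (simp add: algebra_simps)
    moreover have "\<dots> \<le> 0"
      using f0[of r] le[of r] r by (intro mult_nonneg_nonpos mult_nonneg_nonneg) (auto simp: Y_def)
    ultimately show "\<exists>y. (E has_real_derivative y) (at r) \<and> y \<le> 0" by metis
  qed (unfold E_def Y_def, intro continuous_intros integral_upper_continuous f fn)
  then have "Y q * exp (- integral {p..q} f) \<le> A" by (simp add: E_def Y_def)
  then have "Y q \<le> A * exp (integral {p..q} f)"
    by (simp add: exp_minus field_simps)
  then show ?thesis using le[of q] pq by (simp add: Y_def)
qed

definition pow3 :: "real \<Rightarrow> real \<Rightarrow> real \<Rightarrow> real \<Rightarrow> real" where
  "pow3 p1 p2 p3 z = z powr p1 + z powr p2 + z powr p3"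

lemma pow3_pos: "z > 0 \<Longrightarrow> pow3 p1 p2 p3 z > 0"
  unfolding pow3_def by (intro add_pos_pos) auto

lemma pow3_mono: "0 \<le> z \<Longrightarrow> z \<le> w \<Longrightarrow> 0 \<le> p1 \<Longrightarrow> 0 \<le> p2 \<Longrightarrow> 0 \<le> p3 \<Longrightarrow> pow3 p1 p2 p3 z \<le> pow3 p1 p2 p3 w"
  unfolding pow3_def by (intro add_mono powr_mono2) auto

text \<open>Let \<open>Y\<close> be the right-hand side of the integral inequality. Then \<open>Y' \<le> K (1 + F(Y)) Y\<close> with the sum of
  powers \<open>F = pow3 p1 p2 p3\<close>, and \<open>z F'(z) \<le> q F(z)\<close>. Hence \<open>ln (F(Y) / (1 + F(Y)))\<close>, whose derivative is
  \<open>F'(Y) Y' / (F(Y) (1 + F(Y)))\<close>, has slope at most \<open>q K\<close>. The alternative \<open>n b = 0\<close> excludes the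
  logarithm of zero.\<close>

lemma gronwall_powers:
  fixes n :: "real \<Rightarrow> real"
  assumes ab: "a \<le> b" and A: "A > 0" and K: "K \<ge> 0"
    and p: "0 < p1" "0 < p2" "0 < p3" "p1 \<le> q" "p2 \<le> q" "p3 \<le> q"
    and g: "continuous_on {a..b} g" and gn: "\<And>r. r \<in> {a..b} \<Longrightarrow> 0 \<le> n r"
    and gle: "\<And>r. r \<in> {a..b} \<Longrightarrow> 0 \<le> g r \<and> g r \<le> K * ((1 + pow3 p1 p2 p3 (n r)) * n r)"
    and le: "\<And>r. r \<in> {a..b} \<Longrightarrow> n r \<le> A + integral {a..r} g"
  shows "ln (pow3 p1 p2 p3 (n b) / (1 + pow3 p1 p2 p3 (n b))) \<le>
    ln (pow3 p1 p2 p3 A / (1 + pow3 p1 p2 p3 A)) + q * K * (b - a) \<or> n b = 0"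
proof (cases "n b = 0")
  case False
  let ?F = "pow3 p1 p2 p3"
  define Y where "Y r = A + integral {a..r} g" for r
  have YA: "Y r \<ge> A" if "r \<in> {a..b}" for r
  proof -
    have "integral {a..r} g \<ge> 0" using gle that by (intro integral_nonneg integrable_continuous_real
        continuous_on_subset[OF g]) auto
    then show ?thesis by (simp add: Y_def)
  qed
  then have Y0: "Y r > 0" if "r \<in> {a..b}" for r using A that by force
  (* L is the quantity of bounded slope minus the linear bound, hence decreasing. *)
  define L where "L r = ln (?F (Y r)) - ln (1 + ?F (Y r)) - q * K * r" for r
  have "L b \<le> L a"
  proof (rule DERIV_nonpos_imp_decreasing_open[OF ab])
    fix r assume r: "a < r" "r < b"
    then have ri: "r \<in> {a..b}" by auto
    note Yp = Y0[OF ri]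
    note Fp = pow3_pos[OF Yp, of p1 p2 p3]
    have dY: "(Y has_real_derivative g r) (at r)"
      unfolding Y_def by (auto intro!: derivative_eq_intros integral_upper_DERIV[OF g r])
    define F' where "F' = p1 * Y r powr (p1 - 1) + p2 * Y r powr (p2 - 1) + p3 * Y r powr (p3 - 1)"
    have dF: "((\<lambda>r. ?F (Y r)) has_real_derivative F' * g r) (at r)"
      unfolding pow3_def F'_def
      by (rule derivative_eq_intros dY | use Yp in force)+ (simp add: algebra_simps)
    have dL: "(L has_real_derivative F' * g r / ?F (Y r) - F' * g r / (1 + ?F (Y r)) - q * K) (at r)"
      unfolding L_def
      by (rule derivative_eq_intros dF | use Fp in force)+
    have F'Y: "F' * Y r \<le> q * ?F (Y r)"
    proof -
      have "z powr (e - 1) * z = z powr e" if "z > 0" for z e :: real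
        using that by (simp add: powr_diff)
      then have "F' * Y r = p1 * Y r powr p1 + p2 * Y r powr p2 + p3 * Y r powr p3"
        using Yp by (simp add: F'_def distrib_right mult.assoc)
      also have "\<dots> \<le> q * Y r powr p1 + q * Y r powr p2 + q * Y r powr p3"
        using p by (intro add_mono mult_right_mono) auto
      finally show ?thesis by (simp add: pow3_def distrib_left)
    qed
    have nY: "n r \<le> Y r" using le[OF ri] by (simp add: Y_def)
    have "g r \<le> K * ((1 + ?F (n r)) * n r)" using gle[OF ri] by simp
    also have "\<dots> \<le> K * ((1 + ?F (Y r)) * Y r)"
      using K p nY gn[OF ri] Yp pow3_pos[OF Yp, of p1 p2 p3]
      by (intro mult_left_mono mult_mono add_left_mono pow3_mono) (auto simp: add_nonneg_nonneg less_imp_le)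
    finally have gY: "g r \<le> K * ((1 + ?F (Y r)) * Y r)" .
    have F'0: "F' \<ge> 0" using p by (simp add: F'_def)
    have "F' * g r \<le> F' * (K * ((1 + ?F (Y r)) * Y r))" using gY F'0 by (rule mult_left_mono)
    also have "\<dots> = (F' * Y r) * (K * (1 + ?F (Y r)))" by (simp only: mult_ac)
    also have "\<dots> \<le> (q * ?F (Y r)) * (K * (1 + ?F (Y r)))"
      using F'Y K Fp by (intro mult_right_mono) auto
    finally have "F' * g r \<le> (q * K) * (?F (Y r) * (1 + ?F (Y r)))" by (simp only: mult_ac)
    then have "F' * g r / (?F (Y r) * (1 + ?F (Y r))) \<le> q * K"
      using Fp by (simp add: pos_divide_le_eq)
    moreover have "F' * g r / ?F (Y r) - F' * g r / (1 + ?F (Y r)) = F' * g r / (?F (Y r) * (1 + ?F (Y r)))"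
      using Fp by (simp add: divide_simps) (simp add: algebra_simps)
    ultimately show "\<exists>y. (L has_real_derivative y) (at r) \<and> y \<le> 0"
      using dL by (intro exI[of _ "F' * g r / ?F (Y r) - F' * g r / (1 + ?F (Y r)) - q * K"]) simp
  next
    have cY: "continuous_on {a..b} Y"
      unfolding Y_def by (intro continuous_intros integral_upper_continuous g)
    have cF: "continuous_on {a..b} (\<lambda>r. ?F (Y r))"
      unfolding pow3_def using Y0 by (intro continuous_intros cY) force+
    show "continuous_on {a..b} L"
      unfolding L_def using pow3_pos[OF Y0, of _ p1 p2 p3]
      by (intro continuous_intros cF) (force simp: add_pos_pos)+
  qed
  moreover have Ya: "Y a = A" by (simp add: Y_def)
  moreover have lnq: "ln (?F z) - ln (1 + ?F z) = ln (?F z / (1 + ?F z))" if "z > 0" for z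
    using pow3_pos[OF that, of p1 p2 p3] by (simp add: ln_div)
  ultimately have main: "ln (?F (Y b) / (1 + ?F (Y b))) \<le> ln (?F A / (1 + ?F A)) + q * K * (b - a)"
    using lnq[OF A] lnq[OF Y0[of b]] ab by (simp add: L_def right_diff_distrib)
  have nb: "n b > 0" using gn[of b] False ab by force
  have "?F (n b) \<le> ?F (Y b)" using nb le[of b] ab p by (intro pow3_mono) (auto simp: Y_def)
  then have "?F (n b) / (1 + ?F (n b)) \<le> ?F (Y b) / (1 + ?F (Y b))"
    using pow3_pos[OF nb, of p1 p2 p3] by (simp add: field_simps)
  then have "ln (?F (n b) / (1 + ?F (n b))) \<le> ln (?F (Y b) / (1 + ?F (Y b)))"
    using pow3_pos[OF nb, of p1 p2 p3] by (intro ln_mono) auto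
  with main show ?thesis by linarith
qed simp

section \<open>Fourier-side solutions\<close>

context boussinesq_exponents
begin

text \<open>The degrees of homogeneity of the three terms of \<open>\<Phi>\<close>, which are the exponents of the lower
  bound (\<open>Phi_exponents\<close>).\<close>

definition "e1 = 2 * \<alpha> / (2 * \<alpha> + s - 1)"
definition "e2 = 2 * \<alpha> * \<beta> / (2 * \<alpha> * \<beta> + s * \<beta> - \<alpha>)"
definition "e3 = 2 * \<alpha> * \<beta> / (2 * \<alpha> * \<beta> + s * \<alpha> - \<beta>)"

lemma D2': "2 * \<alpha> * \<beta> + s * \<beta> - \<alpha> = \<beta> * (s + 2 * \<alpha>) - \<alpha>"
  and D3': "2 * \<alpha> * \<beta> + s * \<alpha> - \<beta> = \<alpha> * (s + 2 * \<beta>) - \<beta>"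
  by (simp_all add: algebra_simps)

lemma e_pos: "0 < e1" "0 < e2" "0 < e3"
  unfolding e1_def e2_def e3_def D2' D3'
  using D1 D2 D3 alpha_gt beta_gt by (auto intro!: divide_pos_pos mult_pos_pos)

lemma Phi_exponents:
  shows "0 \<le> \<beta> * (s + 2 * \<alpha>) / (\<beta> * (s + 2 * \<alpha>) - \<alpha>)" "0 \<le> - s * \<beta> / (\<beta> * (s + 2 * \<alpha>) - \<alpha>)"
    "0 \<le> - s * \<alpha> / (\<alpha> * (s + 2 * \<beta>) - \<beta>)" "0 \<le> \<alpha> * (s + 2 * \<beta>) / (\<alpha> * (s + 2 * \<beta>) - \<beta>)"
    "\<beta> * (s + 2 * \<alpha>) / (\<beta> * (s + 2 * \<alpha>) - \<alpha>) + - s * \<beta> / (\<beta> * (s + 2 * \<alpha>) - \<alpha>) = e2"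
    "- s * \<alpha> / (\<alpha> * (s + 2 * \<beta>) - \<beta>) + \<alpha> * (s + 2 * \<beta>) / (\<alpha> * (s + 2 * \<beta>) - \<beta>) = e3"
proof -
  show "0 \<le> \<beta> * (s + 2 * \<alpha>) / (\<beta> * (s + 2 * \<alpha>) - \<alpha>)" "0 \<le> \<alpha> * (s + 2 * \<beta>) / (\<alpha> * (s + 2 * \<beta>) - \<beta>)"
    using D2 D3 alpha_gt beta_gt s_ge by (auto intro!: divide_nonneg_pos mult_nonneg_nonneg)
  have "0 \<le> - s * \<beta>" "0 \<le> - s * \<alpha>" using s_le alpha_gt beta_gt by (auto intro!: mult_nonpos_nonneg)
  then show "0 \<le> - s * \<beta> / (\<beta> * (s + 2 * \<alpha>) - \<alpha>)" "0 \<le> - s * \<alpha> / (\<alpha> * (s + 2 * \<beta>) - \<beta>)"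
    using D2 D3 by (simp_all only: divide_nonneg_pos)
  show "\<beta> * (s + 2 * \<alpha>) / (\<beta> * (s + 2 * \<alpha>) - \<alpha>) + - s * \<beta> / (\<beta> * (s + 2 * \<alpha>) - \<alpha>) = e2"
    "- s * \<alpha> / (\<alpha> * (s + 2 * \<beta>) - \<beta>) + \<alpha> * (s + 2 * \<beta>) / (\<alpha> * (s + 2 * \<beta>) - \<beta>) = e3"
    unfolding e2_def e3_def D2' D3' add_divide_distrib[symmetric] by (simp_all add: algebra_simps)
qed

lemma rpow_pair_le:
  assumes "0 \<le> x" "0 \<le> y" "0 \<le> p" "0 \<le> q" "0 < p + q"
  shows "rpow x p * rpow y q \<le> (x + y) powr (p + q)"
proof (cases "x + y = 0")
  case True
  then have "x = 0" "y = 0" using assms by auto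
  then show ?thesis using assms by (auto simp: rpow_def)
next
  case False
  have "rpow x p * rpow y q \<le> rpow (x + y) p * rpow (x + y) q"
    using assms by (intro mult_mono rpow_mono) auto
  also have "\<dots> = (x + y) powr (p + q)" using False by (simp add: rpow_eq_powr powr_add)
  finally show ?thesis .
qed

lemma Phi_le_pow3:
  assumes "0 \<le> x" "0 \<le> y"
  shows "Phi x y \<le> pow3 e1 e2 e3 (x + y)"
  unfolding Phi_def pow3_def
proof (intro add_mono)
  show "rpow x (2 * \<alpha> / (2 * \<alpha> + s - 1)) \<le> (x + y) powr e1"
    using assms e_pos by (simp add: rpow_def e1_def[symmetric] powr_mono2)
  show "rpow x (\<beta> * (s + 2 * \<alpha>) / (\<beta> * (s + 2 * \<alpha>) - \<alpha>)) * rpow y (- s * \<beta> / (\<beta> * (s + 2 * \<alpha>) - \<alpha>)) \<le> (x + y) powr e2"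
    unfolding Phi_exponents(5)[symmetric]
    using e_pos by (intro rpow_pair_le assms Phi_exponents(1,2)) (simp only: Phi_exponents(5))
  show "rpow x (- s * \<alpha> / (\<alpha> * (s + 2 * \<beta>) - \<beta>)) * rpow y (\<alpha> * (s + 2 * \<beta>) / (\<alpha> * (s + 2 * \<beta>) - \<beta>)) \<le> (x + y) powr e3"
    unfolding Phi_exponents(6)[symmetric]
    using e_pos by (intro rpow_pair_le assms Phi_exponents(3,4)) (simp only: Phi_exponents(6))
qed

lemma continuous_on_rpow:
  fixes f :: "'a::topological_space \<Rightarrow> real"
  assumes "continuous_on S f" "\<And>t. 0 \<le> f t" "0 \<le> p"
  shows "continuous_on S (\<lambda>t. rpow (f t) p)"
proof (cases "p = 0")
  case True
  then show ?thesis by (simp add: rpow_def)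
next
  case False
  then show ?thesis
    unfolding rpow_def using assms by (auto intro!: continuous_on_powr')
qed

lemma Phi_continuous:
  assumes "continuous_on S f" "continuous_on S g" "\<And>t. 0 \<le> f t" "\<And>t. 0 \<le> g t"
  shows "continuous_on S (\<lambda>t. Phi (f t) (g t))"
  unfolding Phi_def using e_pos(1)
  by (intro continuous_on_add continuous_on_mult continuous_on_rpow assms Phi_exponents(1-4))
     (simp add: e1_def)

end

context fourier_curve
begin

text \<open>The bound for the forcing that remains after absorption.\<close>

definition "psi \<tau> = (1 + Phi (x \<tau>) (y \<tau>)) * N \<tau>"

lemma N_nonneg: "0 \<le> N t" using x_nonneg y_nonneg by (simp add: N_def add_nonneg_nonneg)

lemma N_cont: "continuous_on {0..<Ts} N" unfolding N_def by (intro continuous_intros x_cont y_cont)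

lemma Phi_cont: "continuous_on {0..<Ts} (\<lambda>\<tau>. Phi (x \<tau>) (y \<tau>))"
  by (intro Phi_continuous x_cont y_cont x_nonneg y_nonneg)

lemma psi_cont: "continuous_on {0..<Ts} psi"
  unfolding psi_def by (intro continuous_intros Phi_cont N_cont)

lemma psi_nonneg: "0 \<le> psi \<tau>"
  unfolding psi_def using Phi_nonneg N_nonneg by (intro mult_nonneg_nonneg) (auto simp: add_nonneg_nonneg)

lemma sub_cont: "continuous_on {0..<Ts} f \<Longrightarrow> 0 \<le> t0 \<Longrightarrow> t < Ts \<Longrightarrow> continuous_on {t0..t} f"
  by (erule continuous_on_subset) auto

lemma parts_measurable [measurable]: "parts \<in> borel_measurable borel"
proof -
  note [measurable (raw)] = jmeas_comp[OF fA_jmeas] jmeas_comp[OF fB_jmeas] jmeas_comp[OF fC_jmeas]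
  show ?thesis unfolding parts_def[abs_def] wnorm_def by measurable
qed

lemma parts_integral_finite:
  assumes t: "0 \<le> t" "t < Ts"
  shows "(\<integral>\<^sup>+\<tau>\<in>{0..t}. parts \<tau> \<partial>lborel) < \<infinity>"
proof -
  obtain K where K: "K \<ge> 1" "AE \<tau> in lborel. 0 \<le> \<tau> \<and> \<tau> < Ts \<longrightarrow>
    4 * parts \<tau> \<le> high \<tau> + ennreal (K * ((1 + Phi (x \<tau>) (y \<tau>)) * N \<tau>))" using parts_bound .
  have c: "continuous_on {0..t} (\<lambda>\<tau>. K * psi \<tau>)"
    using sub_cont[OF psi_cont order_refl t(2)] by (intro continuous_intros)
  have "(\<integral>\<^sup>+\<tau>\<in>{0..t}. parts \<tau> \<partial>lborel) \<le> (\<integral>\<^sup>+\<tau>\<in>{0..t}. 4 * parts \<tau> \<partial>lborel)"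
    by (intro nn_integral_mono mult_right_mono) (auto intro: order_trans[OF _ mult_right_mono[of 1 4]])
  also have "\<dots> \<le> (\<integral>\<^sup>+\<tau>. high \<tau> * indicator {0..t} \<tau> + ennreal (K * psi \<tau>) * indicator {0..t} \<tau> \<partial>lborel)"
    using K(2) t by (intro nn_integral_mono_AE) (auto simp: indicator_def psi_def elim!: AE_mp)
  also have "\<dots> = (\<integral>\<^sup>+\<tau>\<in>{0..t}. high \<tau> \<partial>lborel) + (\<integral>\<^sup>+\<tau>\<in>{0..t}. ennreal (K * psi \<tau>) \<partial>lborel)"
  proof (rule nn_integral_add)
    have "set_borel_measurable borel {0..t} (\<lambda>\<tau>. K * psi \<tau>)"
      using borel_measurable_integrable[OF borel_integrable_atLeastAtMost'[OF c, unfolded set_integrable_def]]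
      by (simp add: set_borel_measurable_def)
    then have "(\<lambda>\<tau>. ennreal (indicator {0..t} \<tau> *\<^sub>R (K * psi \<tau>))) \<in> borel_measurable borel"
      unfolding set_borel_measurable_def by measurable
    also have "(\<lambda>\<tau>. ennreal (indicator {0..t} \<tau> *\<^sub>R (K * psi \<tau>))) = (\<lambda>\<tau>. ennreal (K * psi \<tau>) * indicator {0..t} \<tau>)"
      by (auto simp: indicator_def)
    finally show "(\<lambda>\<tau>. ennreal (K * psi \<tau>) * indicator {0..t} \<tau>) \<in> borel_measurable lborel" by simp
  qed measurable
  also have "\<dots> < \<infinity>"
    using high_integral_finite[OF order_refl t(2)] nn_integral_continuous[OF c] K(1) psi_nonneg by simp
  finally show ?thesis .
qed

end

text \<open>The equation enters: the transforms satisfy the Duhamel formula, with \<open>Z\<close> and \<open>Z\<theta>\<close> the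
  transforms of the data.\<close>

locale fourier_solution = fourier_curve a \<sigma> \<alpha> \<beta> s Ts U \<Theta> x y
  for a \<sigma> \<alpha> \<beta> s Ts U \<Theta> x y +
  fixes Z :: "3 \<Rightarrow> test_fun" and Z\<theta> :: test_fun
  assumes U_eq: "\<And>i t. 0 \<le> t \<Longrightarrow> t < Ts \<Longrightarrow> AE \<xi> in lborel. U i t \<xi> =
      of_real (exp (- t * norm \<xi> powr (2 * \<alpha>))) * Z i \<xi> + duh \<alpha> (\<lambda>\<tau> \<xi>. fB i \<tau> \<xi> - fA i \<tau> \<xi>) t \<xi>"
    and \<Theta>_eq: "\<And>t. 0 \<le> t \<Longrightarrow> t < Ts \<Longrightarrow> AE \<xi> in lborel. \<Theta> t \<xi> =
      of_real (exp (- t * norm \<xi> powr (2 * \<beta>))) * Z\<theta> \<xi> + duh \<beta> (\<lambda>\<tau> \<xi>. - fC \<tau> \<xi>) t \<xi>"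
begin

lemma gU_jmeas: "jmeas (\<lambda>\<tau> \<xi>. fB i \<tau> \<xi> - fA i \<tau> \<xi>)"
  using fA_jmeas[of i] fB_jmeas[of i] by (auto simp: jmeas_def)

lemma g\<Theta>_jmeas: "jmeas (\<lambda>\<tau> \<xi>. - fC \<tau> \<xi>)"
  using fC_jmeas by (auto simp: jmeas_def)

lemma force_measurable [measurable]: "force \<in> borel_measurable borel"
proof -
  note [measurable (raw)] = jmeas_comp[OF fA_jmeas] jmeas_comp[OF fB_jmeas] jmeas_comp[OF fC_jmeas]
  show ?thesis unfolding force_def[abs_def] wnorm_def by measurable
qed

text \<open>The norm \<open>N\<close> up to a factor, but additive over the four scalar unknowns, to each of which the
  parabolic estimate applies separately.\<close>

definition "low_sum t = (\<Sum>i\<in>UNIV. wabs a \<sigma> s (U i t)) + wabs a \<sigma> s (\<Theta> t)"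

lemma low_sum_ge: "0 \<le> t \<Longrightarrow> t < Ts \<Longrightarrow> ennreal (N t) \<le> low_sum t"
  using wvec_le_sum[of "\<lambda>k. U k t" a \<sigma> s] U_low[of t] \<Theta>_low[of t] x_nonneg[of t] y_nonneg[of t]
  unfolding low_sum_def N_def by (simp add: ennreal_plus add_mono)

lemma low_sum_le: "0 \<le> t \<Longrightarrow> t < Ts \<Longrightarrow> low_sum t \<le> ennreal (3 * N t)"
proof -
  assume t: "0 \<le> t" "t < Ts"
  have "low_sum t \<le> (\<Sum>(i::3)\<in>UNIV. ennreal (x t)) + ennreal (y t)"
    unfolding low_sum_def \<Theta>_low[OF t] U_low[OF t, symmetric]
    by (intro add_mono sum_mono wnorm_mono norm_component_vnorm[of "\<lambda>k. U k t _"] order_refl)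
  also have "\<dots> = ennreal (3 * x t + y t)"
    using x_nonneg[of t] y_nonneg[of t] by (simp add: ennreal_plus ennreal_mult)
  also have "\<dots> \<le> ennreal (3 * N t)"
    using y_nonneg[of t] by (intro ennreal_leI) (simp add: N_def)
  finally show ?thesis .
qed

lemma energy_force:
  assumes t: "0 \<le> t0" "t0 \<le> t" "t < Ts"
  shows "low_sum t + (\<integral>\<^sup>+\<tau>\<in>{t0..t}. high \<tau> \<partial>lborel) \<le> 2 * low_sum t0 + 2 * (\<integral>\<^sup>+\<tau>\<in>{t0..t}. parts \<tau> \<partial>lborel)"
proof -
  have t': "0 \<le> t" using t by simp
  let ?gU = "\<lambda>i \<tau> \<xi>. fB i \<tau> \<xi> - fA i \<tau> \<xi>" and ?g\<Theta> = "\<lambda>\<tau> \<xi>. - fC \<tau> \<xi>"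
  have pf: "(\<integral>\<^sup>+\<tau>\<in>{0..t}. parts \<tau> \<partial>lborel) < \<infinity>" by (rule parts_integral_finite[OF t' t(3)])
  have eU: "AE \<xi> in lborel. U i \<tau> \<xi> = of_real (exp (- \<tau> * norm \<xi> powr (2 * \<alpha>))) * Z i \<xi> + duh \<alpha> (?gU i) \<tau> \<xi>"
    if "0 \<le> \<tau>" "\<tau> \<le> t" for i \<tau> using U_eq[of \<tau> i] that t by simp
  have eT: "AE \<xi> in lborel. \<Theta> \<tau> \<xi> = of_real (exp (- \<tau> * norm \<xi> powr (2 * \<beta>))) * Z\<theta> \<xi> + duh \<beta> ?g\<Theta> \<tau> \<xi>"
    if "0 \<le> \<tau>" "\<tau> \<le> t" for \<tau> using \<Theta>_eq[of \<tau>] that t by simp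
  note PU = parabolic_estimate[OF U_jmeas gU_jmeas t(1,2) eU time_integral_finite[OF pf forcing_le_parts(4)]]
  note PT = parabolic_estimate[OF \<Theta>_jmeas g\<Theta>_jmeas t(1,2) eT time_integral_finite[OF pf forcing_le_parts(5)]]
  define FU where "FU i = (\<integral>\<^sup>+\<tau>\<in>{t0..t}. wabs a \<sigma> s (?gU i \<tau>) \<partial>lborel)" for i
  define FT where "FT = (\<integral>\<^sup>+\<tau>\<in>{t0..t}. wabs a \<sigma> s (?g\<Theta> \<tau>) \<partial>lborel)"
  define wU where "wU i = wabs a \<sigma> s (U i t0)" for i
  define wT where "wT = wabs a \<sigma> s (\<Theta> t0)"
  note [measurable (raw)] = jmeas_comp[OF U_jmeas] jmeas_comp[OF fA_jmeas] jmeas_comp[OF fB_jmeas] jmeas_comp[OF fC_jmeas]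
  have F: "(\<Sum>i\<in>UNIV. FU i) + FT = (\<integral>\<^sup>+\<tau>\<in>{t0..t}. force \<tau> \<partial>lborel)"
  proof -
    have [measurable]: "(\<lambda>\<tau>. wabs a \<sigma> s (?gU i \<tau>)) \<in> borel_measurable borel"
      "(\<lambda>\<tau>. wabs a \<sigma> s (?g\<Theta> \<tau>)) \<in> borel_measurable borel" for i
      unfolding wnorm_def by measurable
    have "(\<integral>\<^sup>+\<tau>\<in>{t0..t}. force \<tau> \<partial>lborel) =
        (\<integral>\<^sup>+\<tau>. (\<Sum>i\<in>UNIV. wabs a \<sigma> s (?gU i \<tau>) * indicator {t0..t} \<tau>) +
          wabs a \<sigma> s (?g\<Theta> \<tau>) * indicator {t0..t} \<tau> \<partial>lborel)"
      by (simp only: force_def distrib_right sum_distrib_right)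
    also have "\<dots> = (\<integral>\<^sup>+\<tau>. (\<Sum>i\<in>UNIV. wabs a \<sigma> s (?gU i \<tau>) * indicator {t0..t} \<tau>) \<partial>lborel) + FT"
      unfolding FT_def by (rule nn_integral_add) measurable
    also have "(\<integral>\<^sup>+\<tau>. (\<Sum>i\<in>UNIV. wabs a \<sigma> s (?gU i \<tau>) * indicator {t0..t} \<tau>) \<partial>lborel) = (\<Sum>i\<in>UNIV. FU i)"
      unfolding FU_def by (rule nn_integral_sum) measurable
    finally show ?thesis by (rule sym)
  qed
  have T: "low_sum t0 = (\<Sum>i\<in>UNIV. wU i) + wT" by (simp add: low_sum_def wU_def wT_def)
  have "low_sum t \<le> (\<Sum>i\<in>UNIV. wU i + FU i) + (wT + FT)"
    unfolding low_sum_def wU_def FU_def wT_def FT_def by (intro add_mono sum_mono PU(1) PT(1))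
  also have "\<dots> = low_sum t0 + (\<integral>\<^sup>+\<tau>\<in>{t0..t}. force \<tau> \<partial>lborel)"
    by (simp add: T F[symmetric] sum.distrib add_ac)
  finally have A: "low_sum t \<le> low_sum t0 + (\<integral>\<^sup>+\<tau>\<in>{t0..t}. force \<tau> \<partial>lborel)" .
  have "(\<integral>\<^sup>+\<tau>\<in>{t0..t}. high \<tau> \<partial>lborel) \<le> (\<integral>\<^sup>+\<tau>\<in>{t0..t}. (\<Sum>i\<in>UNIV. wabs a \<sigma> (s + 2 * \<alpha>) (U i \<tau>)) +
      wabs a \<sigma> (s + 2 * \<beta>) (\<Theta> \<tau>) \<partial>lborel)"
    unfolding high_def by (intro nn_integral_mono mult_right_mono add_right_mono wvec_le_sum) auto
  also have "\<dots> = (\<Sum>i\<in>UNIV. (\<integral>\<^sup>+\<tau>\<in>{t0..t}. wabs a \<sigma> (s + 2 * \<alpha>) (U i \<tau>) \<partial>lborel)) +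
      (\<integral>\<^sup>+\<tau>\<in>{t0..t}. wabs a \<sigma> (s + 2 * \<beta>) (\<Theta> \<tau>) \<partial>lborel)"
  proof -
    have [measurable]: "(\<lambda>\<tau>. wabs a \<sigma> (s + 2 * \<alpha>) (U i \<tau>)) \<in> borel_measurable borel" for i
      unfolding wnorm_def by measurable
    have "(\<integral>\<^sup>+\<tau>. (\<Sum>i\<in>UNIV. wabs a \<sigma> (s + 2 * \<alpha>) (U i \<tau>) * indicator {t0..t} \<tau>) \<partial>lborel) =
        (\<Sum>i\<in>UNIV. (\<integral>\<^sup>+\<tau>\<in>{t0..t}. wabs a \<sigma> (s + 2 * \<alpha>) (U i \<tau>) \<partial>lborel))"
      by (rule nn_integral_sum) measurable
    then show ?thesis unfolding distrib_right sum_distrib_right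
      by (subst nn_integral_add) simp_all
  qed
  also have "\<dots> \<le> (\<Sum>i\<in>UNIV. wU i + FU i) + (wT + FT)"
    unfolding wU_def FU_def wT_def FT_def by (intro add_mono sum_mono PU(2) PT(2))
  also have "\<dots> = low_sum t0 + (\<integral>\<^sup>+\<tau>\<in>{t0..t}. force \<tau> \<partial>lborel)"
    by (simp add: T F[symmetric] sum.distrib add_ac)
  finally have B: "(\<integral>\<^sup>+\<tau>\<in>{t0..t}. high \<tau> \<partial>lborel) \<le> low_sum t0 + (\<integral>\<^sup>+\<tau>\<in>{t0..t}. force \<tau> \<partial>lborel)" .
  have C: "(\<integral>\<^sup>+\<tau>\<in>{t0..t}. force \<tau> \<partial>lborel) \<le> (\<integral>\<^sup>+\<tau>\<in>{t0..t}. parts \<tau> \<partial>lborel)"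
    by (intro nn_integral_mono mult_right_mono force_le_parts) auto
  have "low_sum t + (\<integral>\<^sup>+\<tau>\<in>{t0..t}. high \<tau> \<partial>lborel) \<le>
      (low_sum t0 + (\<integral>\<^sup>+\<tau>\<in>{t0..t}. parts \<tau> \<partial>lborel)) + (low_sum t0 + (\<integral>\<^sup>+\<tau>\<in>{t0..t}. parts \<tau> \<partial>lborel))"
    by (intro add_mono order_trans[OF A] order_trans[OF B] add_left_mono C)
  then show ?thesis by (simp add: mult_2 add_ac)
qed

text \<open>Twice \<open>energy_force\<close>, where \<open>4 parts \<le> high + K psi\<close> and one copy of the time integral of \<open>high\<close> moves to
  the left. That integral is finite, which the subtraction needs.\<close>

lemma energy:
  obtains K where "K \<ge> 1"
    and "AE \<tau> in lborel. 0 \<le> \<tau> \<and> \<tau> < Ts \<longrightarrow> 4 * parts \<tau> \<le> high \<tau> + ennreal (K * psi \<tau>)"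
    and "\<forall>t0 t. 0 \<le> t0 \<longrightarrow> t0 \<le> t \<longrightarrow> t < Ts \<longrightarrow>
      ennreal (2 * N t) + (\<integral>\<^sup>+\<tau>\<in>{t0..t}. high \<tau> \<partial>lborel) \<le> ennreal (12 * N t0 + integral {t0..t} (\<lambda>\<tau>. K * psi \<tau>))"
proof -
  obtain K where K: "K \<ge> 1" "AE \<tau> in lborel. 0 \<le> \<tau> \<and> \<tau> < Ts \<longrightarrow>
    4 * parts \<tau> \<le> high \<tau> + ennreal (K * ((1 + Phi (x \<tau>) (y \<tau>)) * N \<tau>))" using parts_bound .
  show thesis
  proof (rule that[OF K(1)])
    show "AE \<tau> in lborel. 0 \<le> \<tau> \<and> \<tau> < Ts \<longrightarrow> 4 * parts \<tau> \<le> high \<tau> + ennreal (K * psi \<tau>)"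
      using K(2) by (simp add: psi_def)
    show "\<forall>t0 t. 0 \<le> t0 \<longrightarrow> t0 \<le> t \<longrightarrow> t < Ts \<longrightarrow>
      ennreal (2 * N t) + (\<integral>\<^sup>+\<tau>\<in>{t0..t}. high \<tau> \<partial>lborel) \<le> ennreal (12 * N t0 + integral {t0..t} (\<lambda>\<tau>. K * psi \<tau>))"
    proof (intro allI impI)
    fix t0 t assume t: "0 \<le> t0" "t0 \<le> t" "t < Ts"
    let ?h = "\<integral>\<^sup>+\<tau>\<in>{t0..t}. high \<tau> \<partial>lborel"
    have hf: "?h < \<infinity>" by (rule high_integral_finite[OF t(1,3)])
    have c: "continuous_on {t0..t} (\<lambda>\<tau>. K * psi \<tau>)"
      using sub_cont[OF psi_cont t(1,3)] by (intro continuous_intros)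
    have m: "(\<lambda>\<tau>. ennreal (K * psi \<tau>) * indicator {t0..t} \<tau>) \<in> borel_measurable lborel"
    proof -
      have "set_borel_measurable borel {t0..t} (\<lambda>\<tau>. K * psi \<tau>)"
        using borel_measurable_integrable[OF borel_integrable_atLeastAtMost'[OF c, unfolded set_integrable_def]]
        by (simp add: set_borel_measurable_def)
      then have "(\<lambda>\<tau>. ennreal (indicator {t0..t} \<tau> *\<^sub>R (K * psi \<tau>))) \<in> borel_measurable borel"
        unfolding set_borel_measurable_def by measurable
      also have "(\<lambda>\<tau>. ennreal (indicator {t0..t} \<tau> *\<^sub>R (K * psi \<tau>))) = (\<lambda>\<tau>. ennreal (K * psi \<tau>) * indicator {t0..t} \<tau>)"
        by (auto simp: indicator_def)
      finally show ?thesis by simp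
    qed
    have "4 * (\<integral>\<^sup>+\<tau>\<in>{t0..t}. parts \<tau> \<partial>lborel) = (\<integral>\<^sup>+\<tau>\<in>{t0..t}. 4 * parts \<tau> \<partial>lborel)"
      by (simp add: nn_integral_cmult[symmetric] mult.assoc)
    also have "\<dots> \<le> (\<integral>\<^sup>+\<tau>. high \<tau> * indicator {t0..t} \<tau> + ennreal (K * psi \<tau>) * indicator {t0..t} \<tau> \<partial>lborel)"
      using K(2) t by (intro nn_integral_mono_AE) (auto simp: indicator_def psi_def elim!: AE_mp)
    also have "\<dots> = ?h + (\<integral>\<^sup>+\<tau>\<in>{t0..t}. ennreal (K * psi \<tau>) \<partial>lborel)"
      by (rule nn_integral_add[OF _ m]) measurable
    also have "(\<integral>\<^sup>+\<tau>\<in>{t0..t}. ennreal (K * psi \<tau>) \<partial>lborel) = ennreal (integral {t0..t} (\<lambda>\<tau>. K * psi \<tau>))"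
      using K(1) psi_nonneg by (intro nn_integral_continuous[OF c]) auto
    finally have p: "4 * (\<integral>\<^sup>+\<tau>\<in>{t0..t}. parts \<tau> \<partial>lborel) \<le> ?h + ennreal (integral {t0..t} (\<lambda>\<tau>. K * psi \<tau>))" .
    have "2 * (ennreal (N t) + ?h) \<le> 2 * (2 * low_sum t0 + 2 * (\<integral>\<^sup>+\<tau>\<in>{t0..t}. parts \<tau> \<partial>lborel))"
      using order_trans[OF add_right_mono[OF low_sum_ge] energy_force[OF t]] t by (intro mult_left_mono) auto
    also have "\<dots> = 4 * low_sum t0 + 4 * (\<integral>\<^sup>+\<tau>\<in>{t0..t}. parts \<tau> \<partial>lborel)"
      by (simp add: distrib_left mult.assoc[symmetric])
    also have "\<dots> \<le> 4 * ennreal (3 * N t0) + (?h + ennreal (integral {t0..t} (\<lambda>\<tau>. K * psi \<tau>)))"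
      using t by (intro add_mono p mult_left_mono low_sum_le) auto
    also have "\<dots> = ?h + ennreal (12 * N t0 + integral {t0..t} (\<lambda>\<tau>. K * psi \<tau>))"
    proof -
      have i0: "0 \<le> integral {t0..t} (\<lambda>\<tau>. K * psi \<tau>)"
        using K(1) psi_nonneg by (intro integral_nonneg integrable_continuous_real[OF c]) auto
      have "4 * ennreal (3 * N t0) = ennreal (12 * N t0)"
        using ennreal_mult[of 4 "3 * N t0"] N_nonneg[of t0] by simp
      then show ?thesis using i0 N_nonneg[of t0] by (simp add: ennreal_plus add_ac)
    qed
    finally have two: "2 * (ennreal (N t) + ?h) \<le> ?h + ennreal (12 * N t0 + integral {t0..t} (\<lambda>\<tau>. K * psi \<tau>))" .
    have "?h + (ennreal (2 * N t) + ?h) \<le> ?h + ennreal (12 * N t0 + integral {t0..t} (\<lambda>\<tau>. K * psi \<tau>))"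
    proof -
      have "ennreal (2 * N t) = 2 * ennreal (N t)" using N_nonneg[of t] by (simp add: ennreal_mult)
      then have "2 * (ennreal (N t) + ?h) = ?h + (ennreal (2 * N t) + ?h)" by (simp only: mult_2 add_ac)
      with two show ?thesis by (simp only:)
    qed
    then show "ennreal (2 * N t) + ?h \<le> ennreal (12 * N t0 + integral {t0..t} (\<lambda>\<tau>. K * psi \<tau>))"
      using hf by (subst (asm) ennreal_add_left_cancel_le) auto
    qed
  qed
qed

lemma N_bound_real:
  assumes "0 \<le> t0" "t0 \<le> t" "t < Ts" "K \<ge> 1"
    and e: "ennreal (2 * N t) + (\<integral>\<^sup>+\<tau>\<in>{t0..t}. high \<tau> \<partial>lborel) \<le> ennreal (12 * N t0 + integral {t0..t} (\<lambda>\<tau>. K * psi \<tau>))"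
  shows "N t \<le> 6 * N t0 + integral {t0..t} (\<lambda>\<tau>. K * psi \<tau>)"
proof -
  have i0: "0 \<le> integral {t0..t} (\<lambda>\<tau>. K * psi \<tau>)"
    using assms psi_nonneg sub_cont[OF psi_cont assms(1,3)]
    by (intro integral_nonneg integrable_continuous_real continuous_intros) auto
  have "ennreal (2 * N t) \<le> ennreal (12 * N t0 + integral {t0..t} (\<lambda>\<tau>. K * psi \<tau>))"
    using e by (rule order_trans[rotated]) simp
  then have "2 * N t \<le> 12 * N t0 + integral {t0..t} (\<lambda>\<tau>. K * psi \<tau>)"
    using i0 N_nonneg[of t0] by (subst (asm) ennreal_le_iff) auto
  with i0 show ?thesis by linarith
qed

text \<open>The energy inequality is linear in \<open>N\<close> with the coefficient \<open>K (1 + \<Phi>)\<close>. If \<open>\<Phi>\<close> is integrable,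
  Gronwall's inequality bounds \<open>N\<close> uniformly up to the final time; inserting this bound into the energy
  inequality controls \<open>high\<close>, and then \<open>parts_bound\<close> controls the forcing.\<close>

lemma bounds_if_Phi_integrable:
  assumes t0: "0 \<le> t0" "t0 < Ts" and fin: "(\<integral>\<^sup>+\<tau>\<in>{t0..<Ts}. ennreal (Phi (x \<tau>) (y \<tau>)) \<partial>lborel) < \<infinity>"
  shows "(\<integral>\<^sup>+\<tau>\<in>{0..<Ts}. high \<tau> \<partial>lborel) < \<infinity>" and "(\<integral>\<^sup>+\<tau>\<in>{0..<Ts}. parts \<tau> \<partial>lborel) < \<infinity>"
proof -
  obtain K where K: "K \<ge> 1" "AE \<tau> in lborel. 0 \<le> \<tau> \<and> \<tau> < Ts \<longrightarrow> 4 * parts \<tau> \<le> high \<tau> + ennreal (K * psi \<tau>)"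
    "\<forall>t0 t. 0 \<le> t0 \<longrightarrow> t0 \<le> t \<longrightarrow> t < Ts \<longrightarrow>
      ennreal (2 * N t) + (\<integral>\<^sup>+\<tau>\<in>{t0..t}. high \<tau> \<partial>lborel) \<le> ennreal (12 * N t0 + integral {t0..t} (\<lambda>\<tau>. K * psi \<tau>))"
    using energy .
  define P where "P = enn2real (\<integral>\<^sup>+\<tau>\<in>{t0..<Ts}. ennreal (Phi (x \<tau>) (y \<tau>)) \<partial>lborel)"
  have Pint: "integral {t0..t} (\<lambda>\<tau>. K * (1 + Phi (x \<tau>) (y \<tau>))) \<le> K * (Ts + P)" if t: "t0 \<le> t" "t < Ts" for t
  proof -
    have c: "continuous_on {t0..t} (\<lambda>\<tau>. Phi (x \<tau>) (y \<tau>))" by (rule sub_cont[OF Phi_cont t0(1) t(2)])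
    have "ennreal (integral {t0..t} (\<lambda>\<tau>. Phi (x \<tau>) (y \<tau>))) = (\<integral>\<^sup>+\<tau>\<in>{t0..t}. ennreal (Phi (x \<tau>) (y \<tau>)) \<partial>lborel)"
      by (rule nn_integral_continuous[OF c Phi_nonneg, symmetric])
    also have "\<dots> \<le> (\<integral>\<^sup>+\<tau>\<in>{t0..<Ts}. ennreal (Phi (x \<tau>) (y \<tau>)) \<partial>lborel)"
      using t by (intro nn_integral_mono mult_left_mono) (auto simp: indicator_def)
    also have "\<dots> = ennreal P" using fin by (simp add: P_def)
    finally have iP: "integral {t0..t} (\<lambda>\<tau>. Phi (x \<tau>) (y \<tau>)) \<le> P"
      by (subst (asm) ennreal_le_iff) (auto simp: P_def)
    have "integral {t0..t} (\<lambda>\<tau>. K * (1 + Phi (x \<tau>) (y \<tau>))) = K * (integral {t0..t} (\<lambda>\<tau>. 1) + integral {t0..t} (\<lambda>\<tau>. Phi (x \<tau>) (y \<tau>)))"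
    proof -
      have "integral {t0..t} (\<lambda>\<tau>. 1 + Phi (x \<tau>) (y \<tau>)) = integral {t0..t} (\<lambda>\<tau>. 1) + integral {t0..t} (\<lambda>\<tau>. Phi (x \<tau>) (y \<tau>))"
        by (rule Henstock_Kurzweil_Integration.integral_add[OF _ integrable_continuous_real[OF c]])
           (intro integrable_continuous_real continuous_intros)
      then show ?thesis by (simp only: integral_mult_right)
    qed
    also have "\<dots> \<le> K * (Ts + P)" using K(1) iP t t0 by (intro mult_left_mono add_mono) auto
    finally show ?thesis .
  qed
  define M where "M = 6 * N t0 * exp (K * (Ts + P))"
  have M0: "M \<ge> 0" using N_nonneg by (simp add: M_def)
  have NM: "N t \<le> M" if t: "t0 \<le> t" "t < Ts" for t
  proof -
    have "N t \<le> 6 * N t0 * exp (integral {t0..t} (\<lambda>\<tau>. K * (1 + Phi (x \<tau>) (y \<tau>))))"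
    proof (rule gronwall_linear[OF t(1)])
      show "continuous_on {t0..t} (\<lambda>\<tau>. K * (1 + Phi (x \<tau>) (y \<tau>)))"
        by (intro continuous_intros sub_cont[OF Phi_cont t0(1) t(2)])
      show "continuous_on {t0..t} N" by (rule sub_cont[OF N_cont t0(1) t(2)])
      show "0 \<le> K * (1 + Phi (x r) (y r))" for r
        using K(1) Phi_nonneg by (intro mult_nonneg_nonneg) (auto simp: add_nonneg_nonneg)
      show "N r \<le> 6 * N t0 + integral {t0..r} (\<lambda>\<tau>. K * (1 + Phi (x \<tau>) (y \<tau>)) * N \<tau>)" if "r \<in> {t0..t}" for r
        using N_bound_real[OF t0(1) _ _ K(1) K(3)[rule_format, OF t0(1)], of r] that t by (simp add: psi_def mult.assoc)
    qed
    also have "\<dots> \<le> M" unfolding M_def using Pint[OF t] N_nonneg[of t0] by (intro mult_left_mono) auto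
    finally show ?thesis .
  qed
  have psiM: "psi \<tau> \<le> (1 + Phi (x \<tau>) (y \<tau>)) * M" if "t0 \<le> \<tau>" "\<tau> < Ts" for \<tau>
    unfolding psi_def using NM[OF that] Phi_nonneg by (intro mult_left_mono) (auto simp: add_nonneg_nonneg)
  define B where "B = 12 * N t0 + K * (Ts + P) * M"
  have hB: "(\<integral>\<^sup>+\<tau>\<in>{t0..t}. high \<tau> \<partial>lborel) \<le> ennreal B" if t: "t0 \<le> t" "t < Ts" for t
  proof -
    have "(\<integral>\<^sup>+\<tau>\<in>{t0..t}. high \<tau> \<partial>lborel) \<le> ennreal (12 * N t0 + integral {t0..t} (\<lambda>\<tau>. K * psi \<tau>))"
      using K(3)[rule_format, OF t0(1) t] by (rule order_trans[rotated]) simp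
    also have "\<dots> \<le> ennreal B"
    proof (rule ennreal_leI)
      have "integral {t0..t} (\<lambda>\<tau>. K * psi \<tau>) \<le> integral {t0..t} (\<lambda>\<tau>. K * (1 + Phi (x \<tau>) (y \<tau>)) * M)"
        using K(1) psiM t
        by (intro integral_le integrable_continuous_real continuous_intros sub_cont[OF psi_cont t0(1)]
            sub_cont[OF Phi_cont t0(1)]) (auto simp: mult.assoc intro!: mult_left_mono)
      also have "\<dots> = integral {t0..t} (\<lambda>\<tau>. K * (1 + Phi (x \<tau>) (y \<tau>))) * M" by simp
      also have "\<dots> \<le> K * (Ts + P) * M" using Pint[OF t] M0 by (intro mult_right_mono)
      finally show "12 * N t0 + integral {t0..t} (\<lambda>\<tau>. K * psi \<tau>) \<le> B" by (simp add: B_def)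
    qed
    finally show ?thesis .
  qed
  have hT: "(\<integral>\<^sup>+\<tau>\<in>{t0..<Ts}. high \<tau> \<partial>lborel) \<le> ennreal B"
  proof -
    (* Exhaust [t0, Ts) by compact intervals and use monotone convergence. *)
    define T where "T n = Ts - (Ts - t0) / (real n + 1)" for n :: nat
    have T: "t0 \<le> T n" "T n < Ts" for n
      using t0 mult_right_mono[of t0 Ts "real n"] by (auto simp: T_def field_simps)
    have inc: "incseq (\<lambda>n \<tau>. high \<tau> * indicator {t0..T n} \<tau>)"
    proof (rule incseq_SucI, rule le_funI)
      fix n \<tau>
      have "T n \<le> T (Suc n)" using t0 by (auto simp: T_def intro!: divide_left_mono)
      then show "high \<tau> * indicator {t0..T n} \<tau> \<le> high \<tau> * indicator {t0..T (Suc n)} \<tau>"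
        by (auto simp: indicator_def)
    qed
    have "high \<tau> * indicator {t0..<Ts} \<tau> \<le> (SUP n. high \<tau> * indicator {t0..T n} \<tau>)" for \<tau>
    proof (cases "\<tau> \<in> {t0..<Ts}")
      case True
      define n where "n = nat \<lceil>(Ts - t0) / (Ts - \<tau>)\<rceil>"
      have "(Ts - t0) / (Ts - \<tau>) \<le> real n" unfolding n_def by linarith
      also have "\<dots> < real n + 1" by simp
      finally have "(Ts - t0) / (real n + 1) < Ts - \<tau>" using True by (simp add: field_simps)
      then have "\<tau> \<in> {t0..T n}" using True by (simp add: T_def)
      then have "high \<tau> * indicator {t0..<Ts} \<tau> \<le> high \<tau> * indicator {t0..T n} \<tau>" by (simp add: mult_left_mono indicator_def)
      also have "\<dots> \<le> (SUP n. high \<tau> * indicator {t0..T n} \<tau>)" by (rule SUP_upper) simp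
      finally show ?thesis .
    qed simp
    then have "(\<integral>\<^sup>+\<tau>\<in>{t0..<Ts}. high \<tau> \<partial>lborel) \<le> (\<integral>\<^sup>+\<tau>. (SUP n. high \<tau> * indicator {t0..T n} \<tau>) \<partial>lborel)"
      by (rule nn_integral_mono)
    also have "\<dots> = (SUP n. \<integral>\<^sup>+\<tau>\<in>{t0..T n}. high \<tau> \<partial>lborel)"
      by (rule nn_integral_monotone_convergence_SUP[OF inc]) measurable
    also have "\<dots> \<le> ennreal B" using T by (intro SUP_least hB)
    finally show ?thesis .
  qed
  have "(\<integral>\<^sup>+\<tau>\<in>{0..<Ts}. high \<tau> \<partial>lborel) \<le> (\<integral>\<^sup>+\<tau>. high \<tau> * indicator {0..t0} \<tau> + high \<tau> * indicator {t0..<Ts} \<tau> \<partial>lborel)"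
    by (intro nn_integral_mono) (auto simp: indicator_def)
  also have "\<dots> = (\<integral>\<^sup>+\<tau>\<in>{0..t0}. high \<tau> \<partial>lborel) + (\<integral>\<^sup>+\<tau>\<in>{t0..<Ts}. high \<tau> \<partial>lborel)"
    by (rule nn_integral_add) measurable
  also have "\<dots> < \<infinity>"
    using high_integral_finite[OF order_refl t0(2)] le_less_trans[OF hT ennreal_less_top] by simp
  finally show hf: "(\<integral>\<^sup>+\<tau>\<in>{0..<Ts}. high \<tau> \<partial>lborel) < \<infinity>" .
  have "(\<integral>\<^sup>+\<tau>\<in>{t0..<Ts}. parts \<tau> \<partial>lborel) \<le> (\<integral>\<^sup>+\<tau>\<in>{t0..<Ts}. 4 * parts \<tau> \<partial>lborel)"
    by (intro nn_integral_mono mult_right_mono) (auto intro: order_trans[OF _ mult_right_mono[of 1 4]])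
  also have "\<dots> \<le> (\<integral>\<^sup>+\<tau>. high \<tau> * indicator {t0..<Ts} \<tau> +
      ennreal (K * M) * (indicator {t0..Ts} \<tau> + ennreal (Phi (x \<tau>) (y \<tau>)) * indicator {t0..<Ts} \<tau>) \<partial>lborel)"
  proof (rule nn_integral_mono_AE)
    show "AE \<tau> in lborel. 4 * parts \<tau> * indicator {t0..<Ts} \<tau> \<le> high \<tau> * indicator {t0..<Ts} \<tau> +
      ennreal (K * M) * (indicator {t0..Ts} \<tau> + ennreal (Phi (x \<tau>) (y \<tau>)) * indicator {t0..<Ts} \<tau>)"
      using K(2)
    proof eventually_elim
      case (elim \<tau>)
      show ?case
      proof (cases "\<tau> \<in> {t0..<Ts}")
        case True
        have "ennreal (K * psi \<tau>) \<le> ennreal (K * M * (1 + Phi (x \<tau>) (y \<tau>)))"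
          using psiM[of \<tau>] True K(1) by (intro ennreal_leI) (simp add: mult.assoc mult.commute[of M] mult_left_mono)
        also have "\<dots> = ennreal (K * M) * (1 + ennreal (Phi (x \<tau>) (y \<tau>)))"
          using K(1) M0 Phi_nonneg by (simp add: ennreal_mult ennreal_plus add_nonneg_nonneg)
        finally have "high \<tau> + ennreal (K * psi \<tau>) \<le> high \<tau> + ennreal (K * M) * (1 + ennreal (Phi (x \<tau>) (y \<tau>)))"
          by (rule add_left_mono)
        moreover have "4 * parts \<tau> \<le> high \<tau> + ennreal (K * psi \<tau>)" using elim True t0 by auto
        ultimately show ?thesis using True by (simp add: order_trans)
      qed simp
    qed
  qed
  also have "\<dots> = (\<integral>\<^sup>+\<tau>\<in>{t0..<Ts}. high \<tau> \<partial>lborel) + ennreal (K * M) *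
      (emeasure lborel {t0..Ts} + (\<integral>\<^sup>+\<tau>\<in>{t0..<Ts}. ennreal (Phi (x \<tau>) (y \<tau>)) \<partial>lborel))"
  proof -
    have "continuous_on {t0..<Ts} (\<lambda>\<tau>. Phi (x \<tau>) (y \<tau>))"
      using Phi_cont by (rule continuous_on_subset) (use t0 in auto)
    then have "(\<lambda>\<tau>. ennreal (indicator {t0..<Ts} \<tau> *\<^sub>R Phi (x \<tau>) (y \<tau>))) \<in> borel_measurable borel"
      by (intro measurable_compose[OF _ measurable_ennreal] borel_measurable_continuous_on_indicator) auto
    also have "(\<lambda>\<tau>. ennreal (indicator {t0..<Ts} \<tau> *\<^sub>R Phi (x \<tau>) (y \<tau>))) = (\<lambda>\<tau>. ennreal (Phi (x \<tau>) (y \<tau>)) * indicator {t0..<Ts} \<tau>)"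
      by (auto simp: indicator_def)
    finally have [measurable]: "(\<lambda>\<tau>. ennreal (Phi (x \<tau>) (y \<tau>)) * indicator {t0..<Ts} \<tau>) \<in> borel_measurable lborel" by simp
    show ?thesis by (subst nn_integral_add) (auto simp: nn_integral_cmult nn_integral_add)
  qed
  also have "\<dots> < \<infinity>"
    using le_less_trans[OF hT ennreal_less_top] fin t0 by (simp add: ennreal_mult_less_top)
  finally have p2: "(\<integral>\<^sup>+\<tau>\<in>{t0..<Ts}. parts \<tau> \<partial>lborel) < \<infinity>" .
  have "(\<integral>\<^sup>+\<tau>\<in>{0..<Ts}. parts \<tau> \<partial>lborel) \<le> (\<integral>\<^sup>+\<tau>. parts \<tau> * indicator {0..t0} \<tau> + parts \<tau> * indicator {t0..<Ts} \<tau> \<partial>lborel)"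
    by (intro nn_integral_mono) (auto simp: indicator_def)
  also have "\<dots> = (\<integral>\<^sup>+\<tau>\<in>{0..t0}. parts \<tau> \<partial>lborel) + (\<integral>\<^sup>+\<tau>\<in>{t0..<Ts}. parts \<tau> \<partial>lborel)"
    by (rule nn_integral_add) measurable
  also have "\<dots> < \<infinity>" using parts_integral_finite[OF t0] p2 by simp
  finally show "(\<integral>\<^sup>+\<tau>\<in>{0..<Ts}. parts \<tau> \<partial>lborel) < \<infinity>" .
qed

end

section \<open>The blow-up rate\<close>

text \<open>Bernoulli's inequality for \<open>(e\<^sup>X)\<^sup>m\<close>: a multiplicative constant in the lower bound becomes a larger
  constant in the exponent.\<close>

lemma exp_minus_one_scale:
  fixes X :: real
  assumes "X \<ge> 0"
  shows "real m * (exp X - 1) \<le> exp (real m * X) - 1"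
proof -
  have "1 + real m * (exp X - 1) \<le> (1 + (exp X - 1)) ^ m"
    using assms by (intro Bernoulli_inequality) simp
  then show ?thesis by (simp add: exp_of_nat_mult)
qed

context fourier_solution
begin

text \<open>By \<open>gronwall_powers\<close>, \<open>F(N(t)) / (1 + F(N(t)))\<close> stays below \<open>v = F(A) / (1 + F(A)) e\<^sup>X\<close> with
  \<open>X = q K (Ts - t\<^sub>0)\<close> for \<open>t\<^sub>0 \<le> t < Ts\<close>, where \<open>A \<ge> 6 N(t\<^sub>0)\<close>. If \<open>v < 1\<close>, then \<open>N\<close> is bounded; so \<open>v \<ge> 1\<close>,
  which is the lower bound \<open>F(A) \<ge> 1 / (e\<^sup>X - 1)\<close>.\<close>

lemma blowup_rate:
  assumes unbounded: "\<And>M t0. 0 \<le> t0 \<Longrightarrow> t0 < Ts \<Longrightarrow> \<exists>t\<in>{t0..<Ts}. N t > M"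
  shows "\<exists>C>0. \<forall>t. 0 \<le> t \<and> t < Ts \<longrightarrow> rpow (N t) e1 + rpow (N t) e2 + rpow (N t) e3 \<ge> inverse (exp (C * (Ts - t)) - 1)"
proof -
  obtain K where K: "K \<ge> 1"
    "\<forall>t0 t. 0 \<le> t0 \<longrightarrow> t0 \<le> t \<longrightarrow> t < Ts \<longrightarrow>
      ennreal (2 * N t) + (\<integral>\<^sup>+\<tau>\<in>{t0..t}. high \<tau> \<partial>lborel) \<le> ennreal (12 * N t0 + integral {t0..t} (\<lambda>\<tau>. K * psi \<tau>))"
    using energy .
  define q where "q = e1 + e2 + e3"
  have q: "e1 \<le> q" "e2 \<le> q" "e3 \<le> q" "q > 0" using e_pos by (auto simp: q_def)
  let ?F = "pow3 e1 e2 e3"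
  define R where "R t = inverse (exp (q * K * (Ts - t)) - 1)" for t
  have FA: "R t0 \<le> ?F A" if t0: "0 \<le> t0" "t0 < Ts" and A: "A > 0" "6 * N t0 \<le> A" for t0 A
  proof (rule ccontr)
    assume "\<not> R t0 \<le> ?F A"
    then have lt: "?F A < R t0" by simp
    define X where "X = q * K * (Ts - t0)"
    have X: "X > 0" using q K(1) t0 by (simp add: X_def)
    have Fp: "?F A > 0" by (rule pow3_pos[OF A(1)])
    have "?F A < inverse (exp X - 1)" using lt by (simp only: R_def X_def)
    moreover have e: "exp X - 1 > 0" using X by simp
    ultimately have "?F A * (exp X - 1) < inverse (exp X - 1) * (exp X - 1)"
      by (intro mult_strict_right_mono)
    also have "\<dots> = 1" using e by simp
    finally have "?F A * (exp X - 1) < 1" .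
    then have v1: "?F A / (1 + ?F A) * exp X < 1" using Fp by (simp add: field_simps)
    define v where "v = ?F A / (1 + ?F A) * exp X"
    have v: "v > 0" "v < 1" using v1 Fp by (auto simp: v_def add_pos_pos)
    (* A value of N at which F exceeds v / (1 - v), already through its first power. *)
    define M where "M = (v / (1 - v)) powr (1 / e1)"
    obtain t where t: "t \<in> {t0..<Ts}" "N t > M" using unbounded[OF t0] by blast
    have Nt: "N t > 0" using t(2) by (rule le_less_trans[rotated]) (simp add: M_def)
    have "ln (?F (N t) / (1 + ?F (N t))) \<le> ln (?F A / (1 + ?F A)) + q * K * (t - t0) \<or> N t = 0"
    proof (rule gronwall_powers)
      show "t0 \<le> t" using t by simp
      show "continuous_on {t0..t} (\<lambda>\<tau>. K * psi \<tau>)"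
        using t by (intro continuous_intros sub_cont[OF psi_cont t0(1)]) auto
      show "0 \<le> K * psi r \<and> K * psi r \<le> K * ((1 + ?F (N r)) * N r)" for r
      proof
        show "0 \<le> K * psi r" using K(1) psi_nonneg by simp
        have "Phi (x r) (y r) \<le> ?F (N r)" unfolding N_def by (rule Phi_le_pow3[OF x_nonneg y_nonneg])
        then show "K * psi r \<le> K * ((1 + ?F (N r)) * N r)"
          unfolding psi_def using K(1) N_nonneg by (intro mult_left_mono mult_right_mono) auto
      qed
      show "N r \<le> A + integral {t0..r} (\<lambda>\<tau>. K * psi \<tau>)" if "r \<in> {t0..t}" for r
        using N_bound_real[OF t0(1) _ _ K(1) K(2)[rule_format, OF t0(1)], of r] that t A(2) by simp
    qed (use A K(1) e_pos q N_nonneg in auto)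
    then have "ln (?F (N t) / (1 + ?F (N t))) \<le> ln (?F A / (1 + ?F A)) + q * K * (t - t0)" using Nt by simp
    also have "\<dots> \<le> ln (?F A / (1 + ?F A)) + X"
      unfolding X_def using q K(1) t by (intro add_left_mono mult_left_mono) auto
    also have "\<dots> = ln v" unfolding v_def using Fp by (subst ln_mult) (auto simp: add_pos_pos)
    finally have "?F (N t) / (1 + ?F (N t)) \<le> v"
      using pow3_pos[OF Nt, of e1 e2 e3] v by (subst (asm) ln_le_cancel_iff) auto
    then have "?F (N t) \<le> v / (1 - v)" using pow3_pos[OF Nt, of e1 e2 e3] v by (simp add: field_simps)
    moreover have "v / (1 - v) < ?F (N t)"
    proof -
      have "v / (1 - v) = M powr e1" using v e_pos by (simp add: M_def powr_powr)
      also have "\<dots> < N t powr e1" using t(2) e_pos by (intro powr_less_mono2) (auto simp: M_def)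
      also have "\<dots> \<le> ?F (N t)" by (simp add: pow3_def)
      finally show ?thesis .
    qed
    ultimately show False by simp
  qed
  have Rpos: "R t > 0" if "t < Ts" for t using that q K(1) by (simp add: R_def)
  (* If N vanished at t0, every small A would be admissible in FA, but F(A) tends to 0. *)
  have Npos: "N t0 > 0" if t0: "0 \<le> t0" "t0 < Ts" for t0
  proof (rule ccontr)
    assume "\<not> 0 < N t0"
    then have z: "N t0 = 0" using N_nonneg[of t0] by simp
    have "((\<lambda>d. ?F d) \<longlongrightarrow> 0 + 0 + 0) (at_right 0)"
      unfolding pow3_def
      by (intro tendsto_add tendsto_zero_powrI[OF tendsto_ident_at tendsto_const])
         (use e_pos in \<open>auto simp: eventually_at_filter\<close>)
    moreover have "\<forall>\<^sub>F d in at_right 0. R t0 \<le> ?F d"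
      using FA[OF t0] z by (auto simp: eventually_at_filter)
    ultimately have "R t0 \<le> 0" using tendsto_lowerbound[of ?F 0 "at_right 0" "R t0"] by simp
    with Rpos[OF t0(2)] show False by simp
  qed
  (* Passing from A = 6 N t to N t costs at most the factor 6 powr q, which m bounds. *)
  define m where "m = nat \<lceil>6 powr q\<rceil>"
  have m: "6 powr q \<le> real m" by (simp add: m_def)
  have m0: "real m > 0" using m by (rule less_le_trans[rotated]) simp
  show ?thesis
  proof (intro exI conjI allI impI)
    show "real m * (q * K) > 0" using m0 q K(1) by simp
    fix t assume t: "0 \<le> t \<and> t < Ts"
    define X where "X = q * K * (Ts - t)"
    have X: "X > 0" using q K(1) t by (simp add: X_def)
    have n: "N t > 0" using Npos t by simp
    have "R t \<le> ?F (6 * N t)" using t n by (intro FA) auto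
    also have "\<dots> \<le> 6 powr q * ?F (N t)"
    proof -
      have "(6 * N t) powr e \<le> 6 powr q * N t powr e" if "e \<le> q" for e
        using that n by (simp add: powr_mult mult_right_mono)
      from this[OF q(1)] this[OF q(2)] this[OF q(3)] show ?thesis
        by (simp add: pow3_def distrib_left)
    qed
    also have "\<dots> \<le> real m * ?F (N t)" using m pow3_pos[OF n, of e1 e2 e3] by (intro mult_right_mono) auto
    finally have "inverse (exp X - 1) \<le> real m * ?F (N t)" by (simp add: R_def X_def)
    then have "1 \<le> real m * ?F (N t) * (exp X - 1)" using X by (simp add: field_simps)
    also have "\<dots> = ?F (N t) * (real m * (exp X - 1))" by simp
    also have "\<dots> \<le> ?F (N t) * (exp (real m * X) - 1)"
      using exp_minus_one_scale[of X m] X pow3_pos[OF n, of e1 e2 e3] by (intro mult_left_mono) auto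
    finally have "inverse (exp (real m * X) - 1) \<le> ?F (N t)"
      using X m0 by (simp add: field_simps)
    then show "inverse (exp (real m * (q * K) * (Ts - t)) - 1) \<le> rpow (N t) e1 + rpow (N t) e2 + rpow (N t) e3"
      using n by (simp add: X_def pow3_def rpow_eq_powr mult.assoc)
  qed
qed

end

section \<open>From mild solutions to the Fourier side\<close>

lemma X_norm_vec_nonneg: "0 \<le> X_norm_vec a \<sigma> r f" by (simp add: X_norm_vec_def)
lemma X_norm_nonneg: "0 \<le> X_norm a \<sigma> r f" by (simp add: X_norm_def)

text \<open>Makes the norm of a curve continuous in time when the curve is.\<close>

lemma X_norm_reverse_triangle:
  assumes f: "f \<in> X_space a \<sigma> r" and g: "g \<in> X_space a \<sigma> r"
  shows "\<bar>X_norm a \<sigma> r f - X_norm a \<sigma> r g\<bar> \<le> X_norm a \<sigma> r (f - g)"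
proof -
  note fr = X_space_frep[OF f] X_space_frep[OF g]
  have [measurable]: "hat f \<in> borel_measurable borel" "hat g \<in> borel_measurable borel"
    using fr frep_measurable by blast+
  have nf: "wabs a \<sigma> r (hat f) = ennreal (X_norm a \<sigma> r f)"
    and ng: "wabs a \<sigma> r (hat g) = ennreal (X_norm a \<sigma> r g)"
    using f g X_space_iff[OF fr(1)] X_space_iff[OF fr(2)] by (simp_all add: X_norm_eq[OF fr(1)] X_norm_eq[OF fr(2)])
  note nd = X_space_diff(2)[OF f g]
  have le: "wabs a \<sigma> r p \<le> wabs a \<sigma> r q + wabs a \<sigma> r (\<lambda>\<xi>. p \<xi> - q \<xi>)"
    if [measurable]: "p \<in> borel_measurable borel" "q \<in> borel_measurable borel" for p q :: test_fun
  proof -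
    have "wabs a \<sigma> r p \<le> wnorm a \<sigma> r (\<lambda>\<xi>. ennreal (norm (q \<xi>)) + ennreal (norm (p \<xi> - q \<xi>)))"
      by (intro wnorm_mono) (simp add: ennreal_plus[symmetric] ennreal_leI norm_triangle_sub del: ennreal_plus)
    also have "\<dots> = wabs a \<sigma> r q + wabs a \<sigma> r (\<lambda>\<xi>. p \<xi> - q \<xi>)"
      by (rule wnorm_add) measurable
    finally show ?thesis .
  qed
  have 1: "ennreal (X_norm a \<sigma> r f) \<le> ennreal (X_norm a \<sigma> r g + X_norm a \<sigma> r (f - g))"
    using le[of "hat f" "hat g"] by (simp add: nf ng nd X_norm_nonneg ennreal_plus)
  have 2: "ennreal (X_norm a \<sigma> r g) \<le> ennreal (X_norm a \<sigma> r f + X_norm a \<sigma> r (f - g))"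
    using le[of "hat g" "hat f"] by (simp add: nf ng nd X_norm_nonneg ennreal_plus norm_minus_commute[of "hat g _"])
  show ?thesis
    using 1 2 X_norm_nonneg by (subst (asm) (1 2) ennreal_le_iff) (auto simp: abs_le_iff intro: add_nonneg_nonneg)
qed

lemma X_norm_vec_reverse_triangle:
  assumes f: "f \<in> X_space_vec a \<sigma> r" and g: "g \<in> X_space_vec a \<sigma> r"
  shows "\<bar>X_norm_vec a \<sigma> r f - X_norm_vec a \<sigma> r g\<bar> \<le> X_norm_vec a \<sigma> r (f - g)"
proof -
  note fr = X_space_vec_frep[OF f] and gr = X_space_vec_frep[OF g]
  note dr = X_space_vec_diff_frep[OF f g]
  have [measurable]: "hat (f $ i) \<in> borel_measurable borel" "hat (g $ i) \<in> borel_measurable borel" for i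
    using fr gr frep_measurable by blast+
  have nf: "wvec a \<sigma> r (\<lambda>i. hat (f $ i)) = ennreal (X_norm_vec a \<sigma> r f)"
    and ng: "wvec a \<sigma> r (\<lambda>i. hat (g $ i)) = ennreal (X_norm_vec a \<sigma> r g)"
    using f g X_space_vec_iff[OF fr] X_space_vec_iff[OF gr] by (simp_all add: X_norm_vec_eq[OF fr] X_norm_vec_eq[OF gr])
  have nd: "wvec a \<sigma> r (\<lambda>i \<xi>. hat (f $ i) \<xi> - hat (g $ i) \<xi>) = ennreal (X_norm_vec a \<sigma> r (f - g))"
  proof -
    have "wvec a \<sigma> r (\<lambda>i \<xi>. hat (f $ i) \<xi> - hat (g $ i) \<xi>) < \<infinity>"
    proof (intro wnorm_vnorm_finite wnorm_diff_finite)
      show "wabs a \<sigma> r (hat (f $ i)) < \<infinity>" for i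
        using X_space_vec_component[OF f, of i] X_space_iff[OF fr[of i]] by auto
      show "wabs a \<sigma> r (hat (g $ i)) < \<infinity>" for i
        using X_space_vec_component[OF g, of i] X_space_iff[OF gr[of i]] by auto
    qed measurable
    then show ?thesis by (simp add: X_norm_vec_eq[OF dr])
  qed
  have le: "wvec a \<sigma> r p \<le> wvec a \<sigma> r q + wvec a \<sigma> r (\<lambda>i \<xi>. p i \<xi> - q i \<xi>)"
    if [measurable]: "\<And>i. p i \<in> borel_measurable borel" "\<And>i. q i \<in> borel_measurable borel" for p q :: "3 \<Rightarrow> test_fun"
  proof -
    have "wvec a \<sigma> r p \<le> wnorm a \<sigma> r (\<lambda>\<xi>. vnorm (\<lambda>i. q i \<xi>) + vnorm (\<lambda>i. p i \<xi> - q i \<xi>))"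
    proof (intro wnorm_mono)
      fix \<xi>
      have "(\<chi> i. p i \<xi> - q i \<xi>) = (\<chi> i. p i \<xi>) - (\<chi> i. q i \<xi>)" by (simp add: vec_eq_iff)
      then have "norm (\<chi> i. p i \<xi>) \<le> norm (\<chi> i. q i \<xi>) + norm (\<chi> i. p i \<xi> - q i \<xi>)"
        by (simp add: norm_triangle_sub)
      then show "vnorm (\<lambda>i. p i \<xi>) \<le> vnorm (\<lambda>i. q i \<xi>) + vnorm (\<lambda>i. p i \<xi> - q i \<xi>)"
        by (simp add: ennreal_plus[symmetric] ennreal_leI del: ennreal_plus)
    qed
    also have "\<dots> = wvec a \<sigma> r q + wvec a \<sigma> r (\<lambda>i \<xi>. p i \<xi> - q i \<xi>)"
      by (rule wnorm_add) measurable
    finally show ?thesis .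
  qed
  have comm: "vnorm (\<lambda>i. hat (g $ i) \<xi> - hat (f $ i) \<xi>) = vnorm (\<lambda>i. hat (f $ i) \<xi> - hat (g $ i) \<xi>)" for \<xi>
  proof -
    have "(\<chi> i. hat (g $ i) \<xi> - hat (f $ i) \<xi>) = - (\<chi> i. hat (f $ i) \<xi> - hat (g $ i) \<xi>)" by (simp add: vec_eq_iff)
    then show ?thesis by (simp only: norm_minus_cancel)
  qed
  have 1: "ennreal (X_norm_vec a \<sigma> r f) \<le> ennreal (X_norm_vec a \<sigma> r g + X_norm_vec a \<sigma> r (f - g))"
    using le[of "\<lambda>i. hat (f $ i)" "\<lambda>i. hat (g $ i)"] by (simp add: nf ng nd X_norm_vec_nonneg ennreal_plus)
  have 2: "ennreal (X_norm_vec a \<sigma> r g) \<le> ennreal (X_norm_vec a \<sigma> r f + X_norm_vec a \<sigma> r (f - g))"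
    using le[of "\<lambda>i. hat (g $ i)" "\<lambda>i. hat (f $ i)"] unfolding comm by (simp add: nf ng nd X_norm_vec_nonneg ennreal_plus)
  show ?thesis
    using 1 2 X_norm_vec_nonneg by (subst (asm) (1 2) ennreal_le_iff) (auto simp: abs_le_iff intro: add_nonneg_nonneg)
qed

lemma C_into_norm_continuous:
  assumes C: "\<And>T. 0 \<le> T \<Longrightarrow> T < Ts \<Longrightarrow> C_into V n {0..T} w"
    and rev: "\<And>f g. f \<in> V \<Longrightarrow> g \<in> V \<Longrightarrow> \<bar>n f - n g\<bar> \<le> n (f - g)"
  shows "continuous_on {0..<Ts} (\<lambda>t. n (w t))"
  unfolding continuous_on_def
proof
  fix t assume t: "t \<in> {0..<Ts}"
  define T where "T = (t + Ts) / 2"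
  have T: "t < T" "T < Ts" "0 \<le> T" using t by (auto simp: T_def)
  note CT = C[OF T(3,2)]
  have mem: "w r \<in> V" if "r \<in> {0..T}" for r using CT that by (auto simp: C_into_def)
  have tT: "t \<in> {0..T}" using t T by auto
  have eq: "at t within {0..<Ts} = at t within {0..T}"
    by (rule at_within_nhd[where S = "{..<T}"]) (use T t in auto)
  have lim: "((\<lambda>r. n (w r - w t)) \<longlongrightarrow> 0) (at t within {0..T})" using CT tT by (auto simp: C_into_def)
  have "((\<lambda>r. n (w r) - n (w t)) \<longlongrightarrow> 0) (at t within {0..T})"
  proof (rule Lim_null_comparison[OF _ lim])
    show "\<forall>\<^sub>F r in at t within {0..T}. norm (n (w r) - n (w t)) \<le> n (w r - w t)"
      unfolding eventually_at_filter using rev[OF mem mem[OF tT]] by (intro always_eventually) simp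
  qed
  then show "((\<lambda>t. n (w t)) \<longlongrightarrow> n (w t)) (at t within {0..<Ts})"
    unfolding eq by (simp add: LIM_zero_iff)
qed

text \<open>Integrability in time holds for the completed measure and refers to membership at almost every
  time; the conclusion is the corresponding Borel integral of a representing function.\<close>

lemma L1_into_high_finite:
  assumes L: "L1_into V n {0..T} w" and eq: "\<And>t. t \<in> {0..T} \<Longrightarrow> w t \<in> V \<Longrightarrow> h t = ennreal (n (w t))"
    and nn: "\<And>f. 0 \<le> n f"
  shows "(\<integral>\<^sup>+t\<in>{0..T}. h t \<partial>lborel) < \<infinity>"
proof -
  have ae: "AE t in lebesgue. t \<in> {0..T} \<longrightarrow> w t \<in> V" using L by (simp add: L1_into_def)
  have int: "integrable lebesgue (\<lambda>t. indicator {0..T} t *\<^sub>R n (w t))" using L by (simp add: L1_into_def set_integrable_def)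
  have "(\<integral>\<^sup>+t\<in>{0..T}. h t \<partial>lborel) = (\<integral>\<^sup>+t. h t * indicator {0..T} t \<partial>lebesgue)"
    by (rule nn_integral_completion[symmetric])
  also have "\<dots> \<le> (\<integral>\<^sup>+t. ennreal (norm (indicator {0..T} t *\<^sub>R n (w t))) \<partial>lebesgue)"
  proof (rule nn_integral_mono_AE)
    show "AE t in lebesgue. h t * indicator {0..T} t \<le> ennreal (norm (indicator {0..T} t *\<^sub>R n (w t)))"
      using ae by eventually_elim (auto simp: indicator_def eq nn)
  qed
  also have "\<dots> < \<infinity>" using int by (simp add: integrable_iff_bounded)
  finally show ?thesis .
qed

lemma mild_fourier_curve:
  assumes exps: "boussinesq_exponents a \<sigma> \<alpha> \<beta> s" and Ts: "Ts > 0"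
    and mild: "mild_solution a \<sigma> \<alpha> \<beta> s u0 \<theta>0 {0..<Ts} u \<theta>"
  obtains U \<Theta> where
    "fourier_curve a \<sigma> \<alpha> \<beta> s Ts U \<Theta> (\<lambda>t. X_norm_vec a \<sigma> s (u t)) (\<lambda>t. X_norm a \<sigma> s (\<theta> t))"
    "\<And>i t. 0 \<le> t \<Longrightarrow> t < Ts \<Longrightarrow> frep (U i t) (u t $ i)" "\<And>t. 0 \<le> t \<Longrightarrow> t < Ts \<Longrightarrow> frep (\<Theta> t) (\<theta> t)"
proof -
  interpret boussinesq_exponents a \<sigma> \<alpha> \<beta> s by fact
  have Cu: "C_into (X_space_vec a \<sigma> s) (X_norm_vec a \<sigma> s) {0..T} u"
    and Lu: "L1_into (X_space_vec a \<sigma> (s + 2 * \<alpha>)) (X_norm_vec a \<sigma> (s + 2 * \<alpha>)) {0..T} u"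
    and C\<theta>: "C_into (X_space a \<sigma> s) (X_norm a \<sigma> s) {0..T} \<theta>"
    and L\<theta>: "L1_into (X_space a \<sigma> (s + 2 * \<beta>)) (X_norm a \<sigma> (s + 2 * \<beta>)) {0..T} \<theta>"
    if "0 \<le> T" "T < Ts" for T
    using mild that by (auto simp: mild_solution_def)
  have "\<exists>V. jmeas V \<and> (\<forall>t. 0 \<le> t \<and> t < Ts \<longrightarrow> frep (V t) (u t $ i))" for i
    using jointly_measurable_version[OF C_into_component[OF Cu], of Ts i] by metis
  then obtain U where U: "\<And>i. jmeas (U i)" "\<And>i t. 0 \<le> t \<Longrightarrow> t < Ts \<Longrightarrow> frep (U i t) (u t $ i)" by metis
  obtain \<Theta> where \<Theta>: "jmeas \<Theta>" "\<And>t. 0 \<le> t \<Longrightarrow> t < Ts \<Longrightarrow> frep (\<Theta> t) (\<theta> t)"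
    using jointly_measurable_version[OF C\<theta>] by metis
  have umem: "u t \<in> X_space_vec a \<sigma> s" and \<theta>mem: "\<theta> t \<in> X_space a \<sigma> s" if "0 \<le> t" "t < Ts" for t
    using Cu[OF that] C\<theta>[OF that] that by (auto simp: C_into_def)
  have "fourier_curve a \<sigma> \<alpha> \<beta> s Ts U \<Theta> (\<lambda>t. X_norm_vec a \<sigma> s (u t)) (\<lambda>t. X_norm a \<sigma> s (\<theta> t))"
  proof (unfold_locales)
    show "Ts > 0" by fact
    show "jmeas (U k)" for k by (rule U)
    show "jmeas \<Theta>" by (rule \<Theta>)
    fix t assume t: "0 \<le> t" "t < Ts"
    show "wvec a \<sigma> s (\<lambda>k. U k t) = ennreal (X_norm_vec a \<sigma> s (u t))"
      using umem[OF t] X_space_vec_iff[OF U(2)[OF t]] by (simp add: X_norm_vec_eq[OF U(2)[OF t]])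
    show "wabs a \<sigma> s (\<Theta> t) = ennreal (X_norm a \<sigma> s (\<theta> t))"
      using \<theta>mem[OF t] X_space_iff[OF \<Theta>(2)[OF t]] by (simp add: X_norm_eq[OF \<Theta>(2)[OF t]])
    show "(\<integral>\<^sup>+\<tau>\<in>{0..t}. wvec a \<sigma> (s + 2 * \<alpha>) (\<lambda>k. U k \<tau>) \<partial>lborel) < \<infinity>"
    proof (rule L1_into_high_finite[OF Lu[OF t] _ X_norm_vec_nonneg])
      fix r assume r: "r \<in> {0..t}" "u r \<in> X_space_vec a \<sigma> (s + 2 * \<alpha>)"
      then have r': "0 \<le> r" "r < Ts" using t by auto
      show "wvec a \<sigma> (s + 2 * \<alpha>) (\<lambda>k. U k r) = ennreal (X_norm_vec a \<sigma> (s + 2 * \<alpha>) (u r))"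
        using r(2) X_space_vec_iff[OF U(2)[OF r']] by (simp add: X_norm_vec_eq[OF U(2)[OF r']])
    qed
    show "(\<integral>\<^sup>+\<tau>\<in>{0..t}. wabs a \<sigma> (s + 2 * \<beta>) (\<Theta> \<tau>) \<partial>lborel) < \<infinity>"
    proof (rule L1_into_high_finite[OF L\<theta>[OF t] _ X_norm_nonneg])
      fix r assume r: "r \<in> {0..t}" "\<theta> r \<in> X_space a \<sigma> (s + 2 * \<beta>)"
      then have r': "0 \<le> r" "r < Ts" using t by auto
      show "wabs a \<sigma> (s + 2 * \<beta>) (\<Theta> r) = ennreal (X_norm a \<sigma> (s + 2 * \<beta>) (\<theta> r))"
        using r(2) X_space_iff[OF \<Theta>(2)[OF r']] by (simp add: X_norm_eq[OF \<Theta>(2)[OF r']])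
    qed
  next
    show "continuous_on {0..<Ts} (\<lambda>t. X_norm_vec a \<sigma> s (u t))"
    proof (rule C_into_norm_continuous[where V = "X_space_vec a \<sigma> s" and n = "X_norm_vec a \<sigma> s" and w = u])
      show "C_into (X_space_vec a \<sigma> s) (X_norm_vec a \<sigma> s) {0..T} u" if "0 \<le> T" "T < Ts" for T by (rule Cu[OF that])
    qed (rule X_norm_vec_reverse_triangle)
    show "continuous_on {0..<Ts} (\<lambda>t. X_norm a \<sigma> s (\<theta> t))"
    proof (rule C_into_norm_continuous[where V = "X_space a \<sigma> s" and n = "X_norm a \<sigma> s" and w = \<theta>])
      show "C_into (X_space a \<sigma> s) (X_norm a \<sigma> s) {0..T} \<theta>" if "0 \<le> T" "T < Ts" for T by (rule C\<theta>[OF that])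
    qed (rule X_norm_reverse_triangle)
  qed (auto simp: X_norm_vec_nonneg X_norm_nonneg)
  with U(2) \<Theta>(2) show thesis using that by blast
qed

lemma time_integral_heat:
  assumes par: "a \<ge> 0" "-1 \<le> s" "s \<le> 0" and g: "jmeas g"
    and fin: "(\<integral>\<^sup>+\<tau>\<in>{0..t}. wabs a \<sigma> s (g \<tau>) \<partial>lborel) < \<infinity>"
    and L: "AE \<tau> in lborel. \<tau> \<in> {0..t} \<longrightarrow> frep (g \<tau>) (L \<tau>)"
  shows "has_time_integral (\<lambda>\<tau>. heat \<gamma> (t - \<tau>) (L \<tau>)) (inv_fourier_distr (regular (duh \<gamma> g t))) t"
proof (rule time_integral_duh(1)[OF par g fin])
  show "AE \<tau> in lborel. \<tau> \<in> {0..t} \<longrightarrow> (\<forall>\<phi>\<in>schwartz. heat \<gamma> (t - \<tau>) (L \<tau>) \<phi> =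
      (\<integral>\<xi>. of_real (exp (- (t - \<tau>) * norm \<xi> powr (2 * \<gamma>))) * g \<tau> \<xi> * inv_fourier \<phi> \<xi> \<partial>lborel))"
    using L
  proof eventually_elim
    case (elim \<tau>)
    show ?case
    proof (intro impI ballI)
      fix \<phi> assume "\<tau> \<in> {0..t}" and \<phi>: "\<phi> \<in> schwartz"
      with elim have "frep (g \<tau>) (L \<tau>)" "t - \<tau> \<ge> 0" by auto
      from frep_eval[OF frep_heat[OF this, of \<gamma>] \<phi>]
      show "heat \<gamma> (t - \<tau>) (L \<tau>) \<phi> = (\<integral>\<xi>. of_real (exp (- (t - \<tau>) * norm \<xi> powr (2 * \<gamma>))) * g \<tau> \<xi> * inv_fourier \<phi> \<xi> \<partial>lborel)" .
    qed
  qed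
qed

lemma frep_cong_schwartz:
  assumes "frep G f" "\<And>\<phi>. \<phi> \<in> schwartz \<Longrightarrow> g \<phi> = f \<phi>"
  shows "frep G g"
  using assms fourier_schwartz by (simp add: represents_def fourier_distr_def)

lemma has_time_integral_unique:
  "has_time_integral F S t \<Longrightarrow> has_time_integral F S' t \<Longrightarrow> \<phi> \<in> schwartz \<Longrightarrow> S \<phi> = S' \<phi>"
  by (simp add: has_time_integral_def)

lemma duh_diff_AE:
  assumes f: "jmeas f" and g: "jmeas g" and t: "0 \<le> t"
    and ff: "(\<integral>\<^sup>+\<tau>\<in>{0..t}. wabs a \<sigma> r (f \<tau>) \<partial>lborel) < \<infinity>"
    and gf: "(\<integral>\<^sup>+\<tau>\<in>{0..t}. wabs a \<sigma> r (g \<tau>) \<partial>lborel) < \<infinity>"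
  shows "AE \<xi> in lborel. duh \<gamma> (\<lambda>\<tau> \<xi>. f \<tau> \<xi> - g \<tau> \<xi>) t \<xi> = duh \<gamma> f t \<xi> - duh \<gamma> g t \<xi>"
  using AE_time_integrable[OF f ff] AE_time_integrable[OF g gf]
proof eventually_elim
  case (elim \<xi>)
  have int: "integrable lborel (\<lambda>\<tau>. indicator {0..t} \<tau> *\<^sub>R (of_real (exp (- (t - \<tau>) * norm \<xi> powr (2 * \<gamma>))) * h \<tau> \<xi>))"
    if h: "jmeas h" and hf: "(\<integral>\<^sup>+\<tau>\<in>{0..t}. ennreal (norm (h \<tau> \<xi>)) \<partial>lborel) < \<infinity>" for h :: "real \<Rightarrow> test_fun"
  proof (rule integrableI_bounded)
    note [measurable (raw)] = jmeas_comp[OF h]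
    show "(\<lambda>\<tau>. indicator {0..t} \<tau> *\<^sub>R (of_real (exp (- (t - \<tau>) * norm \<xi> powr (2 * \<gamma>))) * h \<tau> \<xi>)) \<in> borel_measurable lborel"
      by measurable
    have "(\<integral>\<^sup>+\<tau>. ennreal (norm (indicator {0..t} \<tau> *\<^sub>R (of_real (exp (- (t - \<tau>) * norm \<xi> powr (2 * \<gamma>))) * h \<tau> \<xi>))) \<partial>lborel)
       \<le> (\<integral>\<^sup>+\<tau>\<in>{0..t}. ennreal (norm (h \<tau> \<xi>)) \<partial>lborel)"
      by (intro nn_integral_mono)
         (auto simp: indicator_def norm_mult intro!: ennreal_leI mult_left_le_one_le mult_nonpos_nonneg)
    then show "(\<integral>\<^sup>+\<tau>. ennreal (norm (indicator {0..t} \<tau> *\<^sub>R (of_real (exp (- (t - \<tau>) * norm \<xi> powr (2 * \<gamma>))) * h \<tau> \<xi>))) \<partial>lborel) < \<infinity>"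
      using hf by (rule le_less_trans)
  qed
  show ?case
    unfolding duh_def Bochner_Integration.integral_diff[OF int[OF f elim(1)] int[OF g elim(2)], symmetric]
    by (intro Bochner_Integration.integral_cong) (auto simp: algebra_simps)
qed

section \<open>Closing the time interval\<close>

text \<open>The Duhamel formula at one frequency, with transformed data \<open>z\<close> and forcing \<open>g\<close>.\<close>

definition evo :: "real \<Rightarrow> test_fun \<Rightarrow> (real \<Rightarrow> test_fun) \<Rightarrow> real \<Rightarrow> test_fun" where
  "evo \<gamma> z g t \<xi> = of_real (exp (- t * norm \<xi> powr (2 * \<gamma>))) * z \<xi> + duh \<gamma> g t \<xi>"

lemma evo_measurable:
  assumes "jmeas g" and [measurable]: "z \<in> borel_measurable borel"
  shows "evo \<gamma> z g t \<in> borel_measurable borel"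
proof -
  note [measurable (raw)] = jmeas_comp[OF duh_jmeas[OF assms(1)]]
  show ?thesis unfolding evo_def[abs_def] by measurable
qed

lemma norm_evo_le:
  assumes "0 \<le> r" "r \<le> T"
  shows "ennreal (norm (evo \<gamma> z g r \<xi>)) \<le> ennreal (norm (z \<xi>)) + (\<integral>\<^sup>+\<tau>\<in>{0..T}. ennreal (norm (g \<tau> \<xi>)) \<partial>lborel)"
proof -
  have "ennreal (norm (duh \<gamma> g r \<xi>)) \<le> (\<integral>\<^sup>+\<tau>. ennreal (norm (indicator {0..r} \<tau> *\<^sub>R
      (of_real (exp (- (r - \<tau>) * norm \<xi> powr (2 * \<gamma>))) * g \<tau> \<xi>))) \<partial>lborel)"
    unfolding duh_def by (rule norm_integral_le_nn)
  also have "\<dots> \<le> (\<integral>\<^sup>+\<tau>\<in>{0..T}. ennreal (norm (g \<tau> \<xi>)) \<partial>lborel)"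
    using assms by (intro nn_integral_mono)
       (auto simp: indicator_def norm_mult intro!: ennreal_leI mult_left_le_one_le mult_nonpos_nonneg)
  finally have d: "ennreal (norm (duh \<gamma> g r \<xi>)) \<le> (\<integral>\<^sup>+\<tau>\<in>{0..T}. ennreal (norm (g \<tau> \<xi>)) \<partial>lborel)" .
  have "norm (of_real (exp (- r * norm \<xi> powr (2 * \<gamma>))) * z \<xi>) \<le> norm (z \<xi>)"
    using assms by (auto simp: norm_mult intro!: mult_left_le_one_le mult_nonpos_nonneg)
  then have "norm (evo \<gamma> z g r \<xi>) \<le> norm (z \<xi>) + norm (duh \<gamma> g r \<xi>)"
    unfolding evo_def by (intro order_trans[OF norm_triangle_ineq] add_right_mono)
  then have "ennreal (norm (evo \<gamma> z g r \<xi>)) \<le> ennreal (norm (z \<xi>)) + ennreal (norm (duh \<gamma> g r \<xi>))"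
    by (simp add: ennreal_plus[symmetric] ennreal_leI del: ennreal_plus)
  also have "\<dots> \<le> ennreal (norm (z \<xi>)) + (\<integral>\<^sup>+\<tau>\<in>{0..T}. ennreal (norm (g \<tau> \<xi>)) \<partial>lborel)"
    by (rule add_left_mono[OF d])
  finally show ?thesis .
qed

lemma evo_tendsto:
  assumes g: "jmeas g" and fin: "(\<integral>\<^sup>+\<tau>\<in>{0..T}. ennreal (norm (g \<tau> \<xi>)) \<partial>lborel) < \<infinity>"
    and R: "\<And>n. R n \<in> {0..T}" and lim: "R \<longlonglongrightarrow> T"
  shows "(\<lambda>n. evo \<gamma> z g (R n) \<xi>) \<longlonglongrightarrow> evo \<gamma> z g T \<xi>"
proof -
  note [measurable (raw)] = jmeas_comp[OF g]
  define l where "l = norm \<xi> powr (2 * \<gamma>)"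
  have l0: "0 \<le> l" by (simp add: l_def)
  have "(\<lambda>n. \<integral>\<tau>. indicator {0..R n} \<tau> *\<^sub>R (of_real (exp (- (R n - \<tau>) * l)) * g \<tau> \<xi>) \<partial>lborel) \<longlonglongrightarrow>
      (\<integral>\<tau>. indicator {0..T} \<tau> *\<^sub>R (of_real (exp (- (T - \<tau>) * l)) * g \<tau> \<xi>) \<partial>lborel)"
  proof (rule integral_dominated_convergence)
    show "(\<lambda>\<tau>. indicator {0..T} \<tau> *\<^sub>R (of_real (exp (- (T - \<tau>) * l)) * g \<tau> \<xi>)) \<in> borel_measurable lborel"
      by measurable
    show "(\<lambda>\<tau>. indicator {0..R n} \<tau> *\<^sub>R (of_real (exp (- (R n - \<tau>) * l)) * g \<tau> \<xi>)) \<in> borel_measurable lborel" for n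
      by measurable
    show "integrable lborel (\<lambda>\<tau>. indicator {0..T} \<tau> * norm (g \<tau> \<xi>))"
    proof (rule integrableI_bounded)
      have "(\<integral>\<^sup>+\<tau>. ennreal (norm (indicator {0..T} \<tau> * norm (g \<tau> \<xi>))) \<partial>lborel) = (\<integral>\<^sup>+\<tau>\<in>{0..T}. ennreal (norm (g \<tau> \<xi>)) \<partial>lborel)"
        by (intro nn_integral_cong) (auto simp: indicator_def)
      then show "(\<integral>\<^sup>+\<tau>. ennreal (norm (indicator {0..T} \<tau> * norm (g \<tau> \<xi>))) \<partial>lborel) < \<infinity>" using fin by simp
    qed measurable
    have "AE \<tau> in lborel. \<tau> \<noteq> T" by (rule AE_lborel_singleton)
    then show "AE \<tau> in lborel. (\<lambda>n. indicator {0..R n} \<tau> *\<^sub>R (of_real (exp (- (R n - \<tau>) * l)) * g \<tau> \<xi>))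
        \<longlonglongrightarrow> indicator {0..T} \<tau> *\<^sub>R (of_real (exp (- (T - \<tau>) * l)) * g \<tau> \<xi>)"
    proof eventually_elim
      case (elim \<tau>)
      show ?case
      proof (cases "0 \<le> \<tau> \<and> \<tau> < T")
        case True
        have "(\<lambda>n. of_real (exp (- (R n - \<tau>) * l)) * g \<tau> \<xi>) \<longlonglongrightarrow> of_real (exp (- (T - \<tau>) * l)) * g \<tau> \<xi>"
          by (intro tendsto_intros lim)
        moreover have "\<forall>\<^sub>F n in sequentially. \<tau> < R n" using order_tendstoD(1)[OF lim] True by blast
        then have "\<forall>\<^sub>F n in sequentially. of_real (exp (- (R n - \<tau>) * l)) * g \<tau> \<xi> =
            indicator {0..R n} \<tau> *\<^sub>R (of_real (exp (- (R n - \<tau>) * l)) * g \<tau> \<xi>)"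
          by eventually_elim (use True in simp)
        ultimately show ?thesis using True by (simp add: tendsto_cong)
      next
        case False
        then have "\<tau> \<notin> {0..R n}" "\<tau> \<notin> {0..T}" for n using elim R[of n] by auto
        then show ?thesis by simp
      qed
    qed
    show "AE \<tau> in lborel. norm (indicator {0..R n} \<tau> *\<^sub>R (of_real (exp (- (R n - \<tau>) * l)) * g \<tau> \<xi>))
        \<le> indicator {0..T} \<tau> * norm (g \<tau> \<xi>)" for n
      using R[of n] l0 by (intro always_eventually)
        (auto simp: indicator_def norm_mult intro!: mult_left_le_one_le mult_nonpos_nonneg)
  qed
  then have "(\<lambda>n. duh \<gamma> g (R n) \<xi>) \<longlonglongrightarrow> duh \<gamma> g T \<xi>" by (simp add: duh_def l_def)
  then show ?thesis unfolding evo_def by (intro tendsto_intros lim)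
qed

lemma wnorm_evo_finite:
  assumes g: "jmeas g" and [measurable]: "z \<in> borel_measurable borel"
    and zf: "wabs a \<sigma> s z < \<infinity>"
    and gf: "(\<integral>\<^sup>+\<tau>\<in>{0..T}. wabs a \<sigma> s (g \<tau>) \<partial>lborel) < \<infinity>"
    and r: "0 \<le> r" "r \<le> T"
  shows "wabs a \<sigma> s (evo \<gamma> z g r) < \<infinity>"
    and "wnorm a \<sigma> s (\<lambda>\<xi>. ennreal (norm (z \<xi>)) + (\<integral>\<^sup>+\<tau>\<in>{0..T}. ennreal (norm (g \<tau> \<xi>)) \<partial>lborel)) < \<infinity>"
proof -
  note [measurable (raw)] = jmeas_comp[OF g]
  have "wnorm a \<sigma> s (\<lambda>\<xi>. ennreal (norm (z \<xi>)) + (\<integral>\<^sup>+\<tau>\<in>{0..T}. ennreal (norm (g \<tau> \<xi>)) \<partial>lborel)) =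
    wabs a \<sigma> s z + (\<integral>\<^sup>+\<tau>\<in>{0..T}. wabs a \<sigma> s (g \<tau>) \<partial>lborel)"
    unfolding wnorm_time_swap[OF g, of "{0..T}", simplified] by (rule wnorm_add) measurable
  also have "\<dots> < \<infinity>" using zf gf by (simp add: ennreal_add_less_top)
  finally show 1: "wnorm a \<sigma> s (\<lambda>\<xi>. ennreal (norm (z \<xi>)) + (\<integral>\<^sup>+\<tau>\<in>{0..T}. ennreal (norm (g \<tau> \<xi>)) \<partial>lborel)) < \<infinity>" .
  show "wabs a \<sigma> s (evo \<gamma> z g r) < \<infinity>"
    by (rule le_less_trans[OF wnorm_mono 1]) (rule norm_evo_le[OF r])
qed

text \<open>Dominated convergence, first in time for fixed frequency, then in frequency with the majorant
  \<open>2 (|z| + \<integral>|g|)\<close>. This is the convergence of the solution to its final value.\<close>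

lemma evo_left_continuous:
  assumes g: "jmeas g" and z[measurable]: "z \<in> borel_measurable borel"
    and zf: "wabs a \<sigma> s z < \<infinity>"
    and gf: "(\<integral>\<^sup>+\<tau>\<in>{0..T}. wabs a \<sigma> s (g \<tau>) \<partial>lborel) < \<infinity>" and T: "0 \<le> T"
  shows "((\<lambda>r. wabs a \<sigma> s (\<lambda>\<xi>. evo \<gamma> z g r \<xi> - evo \<gamma> z g T \<xi>)) \<longlongrightarrow> 0) (at T within {0..T})"
  unfolding tendsto_at_iff_sequentially
proof (intro allI impI)
  fix R :: "nat \<Rightarrow> real" assume "\<forall>n. R n \<in> {0..T} - {T}" and lim: "R \<longlonglongrightarrow> T"
  then have R: "R n \<in> {0..T}" for n by auto
  note [measurable (raw)] = jmeas_comp[OF g]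
  note [measurable] = evo_measurable[OF g z]
  define D where "D \<xi> = ennreal (norm (z \<xi>)) + (\<integral>\<^sup>+\<tau>\<in>{0..T}. ennreal (norm (g \<tau> \<xi>)) \<partial>lborel)" for \<xi>
  have [measurable]: "D \<in> borel_measurable borel" unfolding D_def by measurable
  have Df: "wnorm a \<sigma> s D < \<infinity>" unfolding D_def by (rule wnorm_evo_finite(2)[OF g z zf gf T order_refl])
  have "(\<lambda>n. \<integral>\<^sup>+\<xi>. ennreal (wt a \<sigma> s \<xi>) * ennreal (norm (evo \<gamma> z g (R n) \<xi> - evo \<gamma> z g T \<xi>)) \<partial>lborel) \<longlonglongrightarrow> (\<integral>\<^sup>+(\<xi>::real^3). 0 \<partial>lborel)"
  proof (rule nn_integral_dominated_convergence[where w = "\<lambda>\<xi>. ennreal (wt a \<sigma> s \<xi>) * (2 * D \<xi>)"])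
    show "AE \<xi> in lborel. ennreal (wt a \<sigma> s \<xi>) * ennreal (norm (evo \<gamma> z g (R n) \<xi> - evo \<gamma> z g T \<xi>)) \<le> ennreal (wt a \<sigma> s \<xi>) * (2 * D \<xi>)" for n
    proof (intro always_eventually allI mult_left_mono)
      fix \<xi>
      have "norm (evo \<gamma> z g (R n) \<xi> - evo \<gamma> z g T \<xi>) \<le> norm (evo \<gamma> z g (R n) \<xi>) + norm (evo \<gamma> z g T \<xi>)"
        by (rule norm_triangle_ineq4)
      then have "ennreal (norm (evo \<gamma> z g (R n) \<xi> - evo \<gamma> z g T \<xi>)) \<le> ennreal (norm (evo \<gamma> z g (R n) \<xi>)) + ennreal (norm (evo \<gamma> z g T \<xi>))"
        by (simp add: ennreal_plus[symmetric] ennreal_leI del: ennreal_plus)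
      also have "\<dots> \<le> D \<xi> + D \<xi>"
        unfolding D_def using R[of n] T by (intro add_mono norm_evo_le) auto
      finally show "ennreal (norm (evo \<gamma> z g (R n) \<xi> - evo \<gamma> z g T \<xi>)) \<le> 2 * D \<xi>" by (simp only: mult_2)
    qed simp
    have "(\<integral>\<^sup>+\<xi>. ennreal (wt a \<sigma> s \<xi>) * (2 * D \<xi>) \<partial>lborel) = 2 * wnorm a \<sigma> s D"
      unfolding wnorm_def by (subst nn_integral_cmult[symmetric]) (auto simp: mult_ac)
    then show "(\<integral>\<^sup>+\<xi>. ennreal (wt a \<sigma> s \<xi>) * (2 * D \<xi>) \<partial>lborel) < \<infinity>"
      using Df by (simp add: ennreal_mult_less_top)
    have "AE \<xi> in lborel. (\<integral>\<^sup>+\<tau>\<in>{0..T}. ennreal (norm (g \<tau> \<xi>)) \<partial>lborel) < \<infinity>" by (rule AE_time_integrable[OF g gf])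
    then show "AE \<xi> in lborel. (\<lambda>n. ennreal (wt a \<sigma> s \<xi>) * ennreal (norm (evo \<gamma> z g (R n) \<xi> - evo \<gamma> z g T \<xi>))) \<longlonglongrightarrow> 0"
    proof eventually_elim
      case (elim \<xi>)
      have "(\<lambda>n. wt a \<sigma> s \<xi> * norm (evo \<gamma> z g (R n) \<xi> - evo \<gamma> z g T \<xi>)) \<longlonglongrightarrow> wt a \<sigma> s \<xi> * norm (evo \<gamma> z g T \<xi> - evo \<gamma> z g T \<xi>)"
        by (intro tendsto_intros evo_tendsto[OF g elim R lim])
      from tendsto_ennrealI[OF this] show ?case by (simp add: ennreal_mult')
    qed
  qed measurable
  then show "((\<lambda>r. wabs a \<sigma> s (\<lambda>\<xi>. evo \<gamma> z g r \<xi> - evo \<gamma> z g T \<xi>)) \<circ> R) \<longlonglongrightarrow> 0"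
    by (simp add: wnorm_def comp_def)
qed

text \<open>Continuity before the final time is local and is inherited from a larger interval.\<close>

lemma C_into_close:
  assumes C: "\<And>T. 0 \<le> T \<Longrightarrow> T < Ts \<Longrightarrow> C_into V n {0..T} w"
    and eq: "\<And>t. 0 \<le> t \<Longrightarrow> t < Ts \<Longrightarrow> w' t = w t" and mem: "w' Ts \<in> V"
    and lim: "((\<lambda>r. n (w' r - w' Ts)) \<longlongrightarrow> 0) (at Ts within {0..Ts})"
    and T: "T \<in> {0..Ts}"
  shows "C_into V n {0..T} w'"
proof -
  have w'V: "w' t \<in> V" if "t \<in> {0..Ts}" for t
  proof (cases "t = Ts")
    case False
    then show ?thesis using C[of t] eq[of t] that by (auto simp: C_into_def)
  qed (use mem in simp)
  have "((\<lambda>r. n (w' r - w' t)) \<longlongrightarrow> 0) (at t within {0..Ts})" if t: "t \<in> {0..Ts}" for t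
  proof (cases "t = Ts")
    case False
    define q where "q = (t + Ts) / 2"
    have q: "t < q" "q < Ts" "0 \<le> q" using t False by (auto simp: q_def)
    have at: "at t within {0..Ts} = at t within {0..q}"
      by (rule at_within_nhd[where S = "{..<q}"]) (use q t in auto)
    have "((\<lambda>r. n (w r - w t)) \<longlongrightarrow> 0) (at t within {0..q})" using C[OF q(3,2)] t q by (auto simp: C_into_def)
    then show ?thesis unfolding at
      by (rule tendsto_cong[THEN iffD1, rotated]) (use q t eq in \<open>auto simp: eventually_at_filter\<close>)
  qed (use lim in simp)
  then show ?thesis unfolding C_into_def using w'V T
    by (auto intro: tendsto_within_subset[where S = "{0..Ts}"])
qed

text \<open>On \<open>(T (k-1), T k]\<close> the glued function is \<open>g k\<close>. Taking \<open>glue T g n n\<close> combines simple approximations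
  on each of the intervals \<open>[0, T k]\<close> into one sequence of simple functions: at a given time the choice
  is constant for large \<open>n\<close>.\<close>

fun glue :: "(nat \<Rightarrow> real) \<Rightarrow> (nat \<Rightarrow> nat \<Rightarrow> real \<Rightarrow> 'v) \<Rightarrow> nat \<Rightarrow> nat \<Rightarrow> real \<Rightarrow> 'v" where
  "glue T g 0 n t = g 0 n t"
| "glue T g (Suc k) n t = (if t \<le> T k then glue T g k n t else g (Suc k) n t)"

lemma glue_simple:
  assumes "\<And>k. simple_function lebesgue (g k n)"
  shows "simple_function lebesgue (glue T g k n)"
proof (induction k)
  case 0
  have "glue T g 0 n = g 0 n" by (rule ext) simp
  then show ?case using assms by simp
next
  case (Suc k)
  have "glue T g (Suc k) n = (\<lambda>t. if t \<in> {..T k} then glue T g k n t else g (Suc k) n t)" by (rule ext) simp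
  moreover have "simple_function lebesgue (\<lambda>t. if t \<in> {..T k} then glue T g k n t else g (Suc k) n t)"
    by (rule simple_function_If_set[OF Suc assms]) (simp add: Int_absorb2)
  ultimately show ?case by simp
qed

lemma glue_eq:
  assumes "mono T" "t \<le> T k" "\<And>j. j < k \<Longrightarrow> T j < t" "k \<le> m"
  shows "glue T g m n t = g k n t"
  using assms(4)
proof (induction m)
  case (Suc m)
  show ?case
  proof (cases "k = Suc m")
    case True
    then show ?thesis using assms(3)[of m] by simp
  next
    case False
    then have "k \<le> m" using Suc.prems by simp
    then have "t \<le> T m" using assms(1,2) by (meson monoD order_trans)
    then show ?thesis using Suc.IH[OF \<open>k \<le> m\<close>] by simp
  qed
qed simp

text \<open>Strong measurability passes to the closed interval by gluing the approximations on an
  exhausting sequence of intervals; the single time \<open>Ts\<close> is a null set. The norm is dominated by \<open>h\<close>.\<close>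

lemma L1_into_close:
  fixes V :: "'v::minus set"
  assumes L: "\<And>T. 0 \<le> T \<Longrightarrow> T < Ts \<Longrightarrow> L1_into V n {0..T} w" and Ts: "Ts > 0"
    and eq: "\<And>t. 0 \<le> t \<Longrightarrow> t < Ts \<Longrightarrow> w' t = w t" and nn: "\<And>f. 0 \<le> n f"
    and h: "\<And>t. 0 \<le> t \<Longrightarrow> t < Ts \<Longrightarrow> ennreal (n (w t)) \<le> h t"
    and hf: "(\<integral>\<^sup>+t\<in>{0..<Ts}. h t \<partial>lborel) < \<infinity>"
    and T: "T \<in> {0..Ts}"
  shows "L1_into V n {0..T} w'"
proof -
  define q where "q k = Ts * (1 - 1 / (real k + 2))" for k :: nat
  have q: "0 \<le> q k" "q k < Ts" for k using Ts by (auto simp: q_def field_simps)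
  have mq: "mono q" unfolding q_def using Ts by (intro monoI mult_left_mono) (auto intro!: divide_left_mono)
  have ql: "q \<longlonglongrightarrow> Ts"
  proof -
    have "(\<lambda>k. Ts * (1 - 1 / (real k + 2))) \<longlonglongrightarrow> Ts * (1 - 0)"
      by (intro tendsto_intros tendsto_divide_0[OF tendsto_const] filterlim_at_top_imp_at_infinity) real_asymp
    then show ?thesis by (simp add: q_def[abs_def])
  qed
  have ne: "AE t in lebesgue. t \<noteq> Ts"
    by (rule AE_completion[OF AE_lborel_singleton])
  have ex: "\<exists>k. t \<le> q k \<and> (\<forall>j<k. q j < t)" if "t < Ts" for t
  proof -
    have "\<forall>\<^sub>F k in sequentially. t < q k" using order_tendstoD(1)[OF ql that] .
    then obtain k where "t \<le> q k" by (meson eventually_sequentially less_imp_le order_refl)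
    then have "t \<le> q (LEAST k. t \<le> q k)" by (rule LeastI)
    moreover have "\<forall>j<(LEAST k. t \<le> q k). q j < t" using not_less_Least by (force simp: not_le)
    ultimately show ?thesis by blast
  qed
  have "\<forall>k. \<exists>g. (\<forall>m. simple_function lebesgue (g m) \<and> (\<forall>t. g m t \<in> V)) \<and>
          (AE t in lebesgue. t \<in> {0..q k} \<longrightarrow> (\<lambda>m. n (g m t - w t)) \<longlonglongrightarrow> 0)"
    using L[OF q] by (simp add: L1_into_def)
  from choice[OF this] obtain g where "\<forall>k. (\<forall>m. simple_function lebesgue (g k m) \<and> (\<forall>t. g k m t \<in> V)) \<and>
          (AE t in lebesgue. t \<in> {0..q k} \<longrightarrow> (\<lambda>m. n (g k m t - w t)) \<longlonglongrightarrow> 0)" by (rule exE)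
  then have g: "simple_function lebesgue (g k m)" "g k m t \<in> V"
    "AE t in lebesgue. t \<in> {0..q k} \<longrightarrow> (\<lambda>m. n (g k m t - w t)) \<longlonglongrightarrow> 0" for k m t by simp_all
  have gV: "glue q g k m t \<in> V" for k m t
    by (induction k) (auto simp: g(2))
  have conv: "AE t in lebesgue. t \<in> {0..Ts} \<longrightarrow> (\<lambda>m. n (glue q g m m t - w' t)) \<longlonglongrightarrow> 0"
  proof -
    have "AE t in lebesgue. \<forall>k. t \<in> {0..q k} \<longrightarrow> (\<lambda>m. n (g k m t - w t)) \<longlonglongrightarrow> 0"
      using g(3) by (simp add: AE_all_countable)
    then show ?thesis using ne
    proof eventually_elim
      case (elim t)
      show ?case
      proof
        assume t: "t \<in> {0..Ts}"
        then have t': "0 \<le> t" "t < Ts" using elim by auto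
        obtain k where k: "t \<le> q k" "\<forall>j<k. q j < t" using ex[OF t'(2)] by blast
        have "(\<lambda>m. n (g k m t - w t)) \<longlonglongrightarrow> 0" using elim(1) k t' by auto
        moreover have "\<forall>\<^sub>F m in sequentially. n (g k m t - w t) = n (glue q g m m t - w' t)"
          unfolding eventually_sequentially
        proof (intro exI allI impI)
          fix m assume "k \<le> m"
          then show "n (g k m t - w t) = n (glue q g m m t - w' t)"
            using glue_eq[OF mq k(1) k(2)[rule_format], of m g m] eq[OF t'] by simp
        qed
        ultimately show "(\<lambda>m. n (glue q g m m t - w' t)) \<longlonglongrightarrow> 0" by (simp add: tendsto_cong)
      qed
    qed
  qed
  have mem: "AE t in lebesgue. t \<in> {0..Ts} \<longrightarrow> w' t \<in> V"
  proof -
    have "AE t in lebesgue. t \<in> {0..q k} \<longrightarrow> w t \<in> V" for k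
      using L[OF q] by (simp add: L1_into_def)
    then have "AE t in lebesgue. \<forall>k. t \<in> {0..q k} \<longrightarrow> w t \<in> V" unfolding AE_all_countable by (rule allI)
    then show ?thesis using ne
    proof eventually_elim
      case (elim t)
      then show ?case using ex[of t] eq[of t] by auto
    qed
  qed
  have int: "set_integrable lebesgue {0..Ts} (\<lambda>t. n (w' t))"
    unfolding set_integrable_def
  proof (rule integrableI_bounded)
    let ?f = "\<lambda>k t. indicator {0..q k} t *\<^sub>R n (w t)"
    have m: "?f k \<in> borel_measurable lebesgue" for k
      using L[OF q, of k] by (simp add: L1_into_def set_integrable_def borel_measurable_integrable)
    have lim: "(\<lambda>k. ?f k t) \<longlonglongrightarrow> indicator {0..<Ts} t *\<^sub>R n (w t)" for t
    proof (cases "t < Ts")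
      case True
      have "\<forall>\<^sub>F k in sequentially. t < q k" using order_tendstoD(1)[OF ql True] .
      then have "\<forall>\<^sub>F k in sequentially. ?f k t = indicator {0..<Ts} t *\<^sub>R n (w t)"
        by eventually_elim (use True in \<open>auto simp: indicator_def\<close>)
      then show ?thesis by (rule tendsto_eventually)
    next
      case False
      then have "t \<notin> {0..q k}" for k using q(2)[of k] by auto
      then show ?thesis using False by simp
    qed
    have m': "(\<lambda>t. indicator {0..<Ts} t *\<^sub>R n (w t)) \<in> borel_measurable lebesgue"
      by (rule borel_measurable_LIMSEQ_real[OF lim m])
    have e: "AE t in lebesgue. indicator {0..Ts} t *\<^sub>R n (w' t) = indicator {0..<Ts} t *\<^sub>R n (w t)"
      using ne by eventually_elim (auto simp: indicator_def eq)
    show "(\<lambda>t. indicator {0..Ts} t *\<^sub>R n (w' t)) \<in> borel_measurable lebesgue"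
    proof -
      have "(\<lambda>t. indicator {0..Ts} t *\<^sub>R n (w' t)) = (\<lambda>t. indicator {0..<Ts} t *\<^sub>R n (w t) + indicator {Ts} t *\<^sub>R n (w' Ts))"
        using Ts eq by (auto simp: indicator_def fun_eq_iff)
      moreover have "(\<lambda>t. indicator {Ts} t *\<^sub>R n (w' Ts)) \<in> borel_measurable lebesgue"
        by (intro measurable_completion) measurable
      ultimately show ?thesis using borel_measurable_add[OF m'] by simp
    qed
    have "(\<integral>\<^sup>+t. ennreal (norm (indicator {0..Ts} t *\<^sub>R n (w' t))) \<partial>lebesgue) \<le> (\<integral>\<^sup>+t. h t * indicator {0..<Ts} t \<partial>lebesgue)"
    proof (rule nn_integral_mono_AE)
      show "AE t in lebesgue. ennreal (norm (indicator {0..Ts} t *\<^sub>R n (w' t))) \<le> h t * indicator {0..<Ts} t"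
        using e by eventually_elim (auto simp: indicator_def nn h)
    qed
    also have "\<dots> = (\<integral>\<^sup>+t\<in>{0..<Ts}. h t \<partial>lborel)" by (rule nn_integral_completion)
    also note hf
    finally show "(\<integral>\<^sup>+t. ennreal (norm (indicator {0..Ts} t *\<^sub>R n (w' t))) \<partial>lebesgue) < \<infinity>" .
  qed
  have sub: "{0..T} \<subseteq> {0..Ts}" using T by auto
  show ?thesis unfolding L1_into_def
  proof (intro conjI exI allI)
    show "AE t in lebesgue. t \<in> {0..T} \<longrightarrow> w' t \<in> V" using mem by eventually_elim (use sub in auto)
    show "simple_function lebesgue (glue q g m m)" "glue q g m m t \<in> V" for m t
      by (rule glue_simple[OF g(1)]) (rule gV)
    show "AE t in lebesgue. t \<in> {0..T} \<longrightarrow> (\<lambda>m. n (glue q g m m t - w' t)) \<longlonglongrightarrow> 0"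
      using conv by eventually_elim (use sub in auto)
    show "set_integrable lebesgue {0..T} (\<lambda>t. n (w' t))"
      by (rule set_integrable_subset[OF int _ sub]) simp
  qed
qed

lemma X_space_pairing_bound:
  assumes par: "a \<ge> 0" "-1 \<le> s" "s \<le> 0" and f: "f \<in> X_space a \<sigma> s" "g \<in> X_space a \<sigma> s" and \<phi>: "\<phi> \<in> schwartz"
  shows "norm (f \<phi> - g \<phi>) \<le> 1728 * (\<integral>x. lorentz x \<partial>lborel) * schwartz_norm 6 \<phi> * X_norm a \<sigma> s (f - g)"
proof -
  note fr = X_space_diff(1)[OF f]
  have [measurable]: "inv_fourier \<phi> \<in> borel_measurable borel"
    using frep_measurable schwartz_measurable[OF \<phi>] by (intro inv_fourier_measurable)
  have m: "(\<lambda>\<xi>. hat f \<xi> - hat g \<xi>) \<in> borel_measurable borel" by (rule frep_measurable[OF fr])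
  have fin: "wabs a \<sigma> s (\<lambda>\<xi>. hat f \<xi> - hat g \<xi>) < \<infinity>" by (simp add: X_space_diff(2)[OF f])
  have "f \<phi> - g \<phi> = (f - g) \<phi>" by simp
  also have "\<dots> = (\<integral>\<xi>. (hat f \<xi> - hat g \<xi>) * inv_fourier \<phi> \<xi> \<partial>lborel)" by (rule frep_eval[OF fr \<phi>])
  finally show ?thesis
    using pairing_bound(2)[OF par m fin _ inv_fourier_pairing_constant[OF \<phi>]]
    by (simp add: X_space_diff(2)[OF f] X_norm_nonneg)
qed

text \<open>Pairings with a fixed test function pass to the limit at the final time, and with them every
  linear property such as being real or divergence free.\<close>

lemma C_into_pairing_continuous:
  assumes par: "a \<ge> 0" "-1 \<le> s" "s \<le> 0" and C: "C_into (X_space a \<sigma> s) (X_norm a \<sigma> s) I w"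
  shows "continuous_on I (\<lambda>t. w t \<phi>)"
proof (cases "\<phi> \<in> schwartz")
  case True
  define B where "B = 1728 * (\<integral>x. lorentz x \<partial>lborel) * schwartz_norm 6 \<phi>"
  show ?thesis unfolding continuous_on_def
  proof
    fix t assume t: "t \<in> I"
    have mem: "w r \<in> X_space a \<sigma> s" if "r \<in> I" for r using C that by (simp add: C_into_def)
    have "((\<lambda>r. B * X_norm a \<sigma> s (w r - w t)) \<longlongrightarrow> B * 0) (at t within I)"
      using C t by (intro tendsto_mult_left) (simp add: C_into_def)
    then have "((\<lambda>r. B * X_norm a \<sigma> s (w r - w t)) \<longlongrightarrow> 0) (at t within I)" by simp
    then have "((\<lambda>r. w r \<phi> - w t \<phi>) \<longlongrightarrow> 0) (at t within I)"
    proof (rule Lim_null_comparison[rotated])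
      show "\<forall>\<^sub>F r in at t within I. norm (w r \<phi> - w t \<phi>) \<le> B * X_norm a \<sigma> s (w r - w t)"
        unfolding eventually_at_filter B_def
        using X_space_pairing_bound[OF par mem mem[OF t] True] by (intro always_eventually) simp
    qed
    then show "((\<lambda>r. w r \<phi>) \<longlongrightarrow> w t \<phi>) (at t within I)" by (simp add: LIM_zero_iff)
  qed
next
  case False
  then have "w t \<phi> = 0" if "t \<in> I" for t using C that by (auto simp: C_into_def X_space_def tempered_def)
  then show ?thesis using continuous_on_cong[of I I "\<lambda>t. w t \<phi>" "\<lambda>_. 0"] by simp
qed

lemma continuous_eq_at_endpoint:
  fixes f g :: "real \<Rightarrow> complex"
  assumes "continuous_on {0..T} f" "continuous_on {0..T} g" "\<And>t. 0 \<le> t \<Longrightarrow> t < T \<Longrightarrow> f t = g t" "T > 0"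
  shows "f T = g T"
proof -
  have d: "continuous_on {0..T} (\<lambda>t. f t - g t)" using assms by (intro continuous_intros)
  have "((\<lambda>t. f t - g t) \<longlongrightarrow> f T - g T) (at T within {0..T})"
    using d assms(4) by (auto simp: continuous_on_def)
  then have "((\<lambda>t. f t - g t) \<longlongrightarrow> f T - g T) (at_left T)"
    using at_within_Icc_at_left[of 0 T] assms(4) by simp
  moreover have "\<forall>\<^sub>F t in at_left T. f t - g t = 0"
    using eventually_at_left_real[OF assms(4)] by eventually_elim (use assms(3) in auto)
  then have "((\<lambda>t. f t - g t) \<longlongrightarrow> 0) (at_left T)" by (rule tendsto_eventually)
  ultimately have "f T - g T = 0" by (rule tendsto_unique[OF trivial_limit_at_left_real])
  then show ?thesis by simp
qed

section \<open>Continuing the solution to the closed interval\<close>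

text \<open>A mild solution together with jointly measurable versions of its transforms.\<close>

locale mild_fields = fourier_curve a \<sigma> \<alpha> \<beta> s Ts U \<Theta> "\<lambda>t. X_norm_vec a \<sigma> s (u t)" "\<lambda>t. X_norm a \<sigma> s (\<theta> t)"
  for a \<sigma> \<alpha> \<beta> s Ts U \<Theta> u \<theta> +
  fixes u0 :: "distr^3" and \<theta>0 :: distr
  assumes mild: "mild_solution a \<sigma> \<alpha> \<beta> s u0 \<theta>0 {0..<Ts} u \<theta>"
    and U_frep: "\<And>i t. 0 \<le> t \<Longrightarrow> t < Ts \<Longrightarrow> frep (U i t) (u t $ i)"
    and \<Theta>_frep: "\<And>t. 0 \<le> t \<Longrightarrow> t < Ts \<Longrightarrow> frep (\<Theta> t) (\<theta> t)"
    and u0_mem: "u0 \<in> X_space_vec a \<sigma> s" and \<theta>0_mem: "\<theta>0 \<in> X_space a \<sigma> s"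
begin

text \<open>The forcing terms of the equation, as distributions, have the transforms \<open>fA\<close>, \<open>fB\<close> and \<open>fC\<close>. The
  products require integrable transforms, hence a time with finite high norms.\<close>

lemma forcing_frep:
  assumes \<tau>: "0 \<le> \<tau>" "\<tau> < Ts" and hi: "high \<tau> < \<infinity>"
  shows "frep (fA i \<tau>) (leray (advect_vec (u \<tau>) (u \<tau>)) $ i)"
    and "frep (fB i \<tau>) (leray (buoyancy (\<theta> \<tau>)) $ i)"
    and "frep (fC \<tau>) (advect (u \<tau>) (\<theta> \<tau>))"
proof -
  note ui = U_frep[OF \<tau>] and ti = \<Theta>_frep[OF \<tau>] and int = fields_integrable[OF \<tau> hi]
  have tr: "frep (transport (\<lambda>k. U k \<tau>) F) (advect (u \<tau>) f)" if "frep F f" "integrable lborel F" for F f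
    using frep_advect[OF ui int(1) that] by (simp add: transport_def[abs_def])
  have le: "frep (leray_hat i G) (leray f $ i)" if "\<And>j. frep (G j) (f $ j)" for G f
    using frep_leray[OF that] by (simp add: leray_hat_def[abs_def])
  show "frep (fC \<tau>) (advect (u \<tau>) (\<theta> \<tau>))" unfolding fC_def by (rule tr[OF ti int(2)])
  show "frep (fA i \<tau>) (leray (advect_vec (u \<tau>) (u \<tau>)) $ i)" unfolding fA_def
    by (rule le) (simp add: advect_vec_def tr[OF ui int(1)])
  show "frep (fB i \<tau>) (leray (buoyancy (\<theta> \<tau>)) $ i)" unfolding fB_def
    by (rule le) (auto simp: buoyancy_def ti frep_zero)
qed

definition "gU i = (\<lambda>\<tau> \<xi>. fB i \<tau> \<xi> - fA i \<tau> \<xi>)"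
definition "gT = (\<lambda>\<tau> \<xi>. - fC \<tau> \<xi>)"
abbreviation "EU i \<equiv> evo \<alpha> (hat (u0 $ i)) (gU i)"
abbreviation "ET \<equiv> evo \<beta> (hat \<theta>0) gT"
abbreviation "dist_of G \<equiv> inv_fourier_distr (regular G)"

lemma g_jmeas: "jmeas (gU i)" "jmeas gT"
  using fA_jmeas[of i] fB_jmeas[of i] fC_jmeas by (auto simp: jmeas_def gU_def gT_def)

lemma data_frep: "frep (hat (u0 $ i)) (u0 $ i)" "frep (hat \<theta>0) \<theta>0"
  using X_space_vec_frep[OF u0_mem] X_space_frep[OF \<theta>0_mem] by auto

lemma data_meas [measurable]: "hat (u0 $ i) \<in> borel_measurable borel" "hat \<theta>0 \<in> borel_measurable borel"
  using data_frep frep_measurable by blast+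

lemma data_finite: "wabs a \<sigma> s (hat (u0 $ i)) < \<infinity>"
    "wabs a \<sigma> s (hat \<theta>0) < \<infinity>"
  using X_space_vec_component[OF u0_mem, of i] X_space_iff[OF data_frep(1)] \<theta>0_mem X_space_iff[OF data_frep(2)] by auto

lemma E_meas [measurable]: "EU i t \<in> borel_measurable borel" "ET t \<in> borel_measurable borel"
  by (intro evo_measurable g_jmeas data_meas)+

lemmas par = a_nonneg s_ge s_le

text \<open>Stated for curves that agree with the solution before \<open>Ts\<close>, in order to cover the final time
  as well, at which only the continuation is defined.\<close>

lemma duhamel_integrals:
  assumes t: "0 \<le> t" "t \<le> Ts" and fin: "(\<integral>\<^sup>+\<tau>\<in>{0..t}. parts \<tau> \<partial>lborel) < \<infinity>"
    and v: "\<And>\<tau>. 0 \<le> \<tau> \<Longrightarrow> \<tau> < Ts \<Longrightarrow> v \<tau> = u \<tau>" "\<And>\<tau>. 0 \<le> \<tau> \<Longrightarrow> \<tau> < Ts \<Longrightarrow> \<eta> \<tau> = \<theta> \<tau>"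
  shows "has_time_integral (\<lambda>\<tau>. heat \<alpha> (t - \<tau>) (leray (advect_vec (v \<tau>) (v \<tau>)) $ i)) (dist_of (duh \<alpha> (fA i) t)) t"
    and "has_time_integral (\<lambda>\<tau>. heat \<alpha> (t - \<tau>) (leray (buoyancy (\<eta> \<tau>)) $ i)) (dist_of (duh \<alpha> (fB i) t)) t"
    and "has_time_integral (\<lambda>\<tau>. heat \<beta> (t - \<tau>) (advect (v \<tau>) (\<eta> \<tau>))) (dist_of (duh \<beta> fC t)) t"
proof -
  have "AE \<tau> in lborel. \<tau> \<noteq> Ts" by (rule AE_lborel_singleton)
  then have ae: "AE \<tau> in lborel. \<tau> \<in> {0..t} \<longrightarrow> 0 \<le> \<tau> \<and> \<tau> < Ts \<and> high \<tau> < \<infinity>"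
    using AE_high_finite by eventually_elim (use t in auto)
  show "has_time_integral (\<lambda>\<tau>. heat \<alpha> (t - \<tau>) (leray (advect_vec (v \<tau>) (v \<tau>)) $ i)) (dist_of (duh \<alpha> (fA i) t)) t"
  proof (rule time_integral_heat[OF par fA_jmeas time_integral_finite[OF fin forcing_le_parts(1)]])
    show "AE \<tau> in lborel. \<tau> \<in> {0..t} \<longrightarrow> frep (fA i \<tau>) (leray (advect_vec (v \<tau>) (v \<tau>)) $ i)"
      using ae by eventually_elim (use forcing_frep(1) v in auto)
  qed
  show "has_time_integral (\<lambda>\<tau>. heat \<alpha> (t - \<tau>) (leray (buoyancy (\<eta> \<tau>)) $ i)) (dist_of (duh \<alpha> (fB i) t)) t"
  proof (rule time_integral_heat[OF par fB_jmeas time_integral_finite[OF fin forcing_le_parts(2)]])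
    show "AE \<tau> in lborel. \<tau> \<in> {0..t} \<longrightarrow> frep (fB i \<tau>) (leray (buoyancy (\<eta> \<tau>)) $ i)"
      using ae by eventually_elim (use forcing_frep(2) v in auto)
  qed
  show "has_time_integral (\<lambda>\<tau>. heat \<beta> (t - \<tau>) (advect (v \<tau>) (\<eta> \<tau>))) (dist_of (duh \<beta> fC t)) t"
  proof (rule time_integral_heat[OF par fC_jmeas time_integral_finite[OF fin forcing_le_parts(3)]])
    show "AE \<tau> in lborel. \<tau> \<in> {0..t} \<longrightarrow> frep (fC \<tau>) (advect (v \<tau>) (\<eta> \<tau>))"
      using ae by eventually_elim (use forcing_frep(3) v in auto)
  qed
qed

lemma duhamel_frep:
  assumes t: "0 \<le> t" and fin: "(\<integral>\<^sup>+\<tau>\<in>{0..t}. parts \<tau> \<partial>lborel) < \<infinity>"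
  shows "frep (EU i t) (heat \<alpha> t (u0 $ i) - (dist_of (duh \<alpha> (fA i) t) - dist_of (duh \<alpha> (fB i) t)))"
    and "frep (ET t) (heat \<beta> t \<theta>0 - dist_of (duh \<beta> fC t))"
proof -
  note fA = time_integral_finite[OF fin forcing_le_parts(1)] and fB = time_integral_finite[OF fin forcing_le_parts(2)]
    and fC = time_integral_finite[OF fin forcing_le_parts(3)]
  have rep: "frep (duh \<gamma> g t) (dist_of (duh \<gamma> g t))"
    if g: "jmeas g" "(\<integral>\<^sup>+\<tau>\<in>{0..t}. wabs a \<sigma> s (g \<tau>) \<partial>lborel) < \<infinity>" for \<gamma> g
  proof (rule weighted_distribution(2)[OF par])
    note [measurable (raw)] = jmeas_comp[OF duh_jmeas[OF g(1)]]
    show "duh \<gamma> g t \<in> borel_measurable borel" by measurable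
    show "wabs a \<sigma> s (duh \<gamma> g t) < \<infinity>"
      by (rule le_less_trans[OF wnorm_duh_le[OF g(1)] g(2)])
  qed
  have "frep (\<lambda>\<xi>. of_real (exp (- t * norm \<xi> powr (2 * \<alpha>))) * hat (u0 $ i) \<xi> - (duh \<alpha> (fA i) t \<xi> - duh \<alpha> (fB i) t \<xi>))
      (heat \<alpha> t (u0 $ i) - (dist_of (duh \<alpha> (fA i) t) - dist_of (duh \<alpha> (fB i) t)))"
    by (intro frep_diff frep_heat data_frep t rep fA_jmeas fB_jmeas fA fB)
  then show "frep (EU i t) (heat \<alpha> t (u0 $ i) - (dist_of (duh \<alpha> (fA i) t) - dist_of (duh \<alpha> (fB i) t)))"
  proof (rule represents_cong_AE)
    show "AE \<xi> in lborel. of_real (exp (- t * norm \<xi> powr (2 * \<alpha>))) * hat (u0 $ i) \<xi> - (duh \<alpha> (fA i) t \<xi> - duh \<alpha> (fB i) t \<xi>) = EU i t \<xi>"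
      using duh_diff_AE[OF fB_jmeas fA_jmeas t fB fA, of \<alpha> i i] by eventually_elim (simp add: evo_def gU_def)
  qed measurable
  have "frep (\<lambda>\<xi>. of_real (exp (- t * norm \<xi> powr (2 * \<beta>))) * hat \<theta>0 \<xi> - duh \<beta> fC t \<xi>)
      (heat \<beta> t \<theta>0 - dist_of (duh \<beta> fC t))"
    by (intro frep_diff frep_heat data_frep t rep fC_jmeas fC)
  also have "(\<lambda>\<xi>. of_real (exp (- t * norm \<xi> powr (2 * \<beta>))) * hat \<theta>0 \<xi> - duh \<beta> fC t \<xi>) = ET t"
    by (simp add: evo_def gT_def duh_def fun_eq_iff)
  finally show "frep (ET t) (heat \<beta> t \<theta>0 - dist_of (duh \<beta> fC t))" .
qed

text \<open>The time integrals of the mild formulation are unique, so that they are those with the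
  transforms just computed.\<close>

lemma solution_frep:
  assumes t: "0 \<le> t" "t < Ts"
  shows "frep (EU i t) (u t $ i)" and "frep (ET t) (\<theta> t)"
proof -
  note fin = parts_integral_finite[OF t]
  have "duhamel_u \<alpha> u0 u \<theta> t" "duhamel_\<theta> \<beta> \<theta>0 u \<theta> t" using mild t by (auto simp: mild_solution_def)
  then obtain A B C where
    A: "has_time_integral (\<lambda>\<tau>. heat \<alpha> (t - \<tau>) (leray (advect_vec (u \<tau>) (u \<tau>)) $ i)) A t"
    and B: "has_time_integral (\<lambda>\<tau>. heat \<alpha> (t - \<tau>) (leray (buoyancy (\<theta> \<tau>)) $ i)) B t"
    and C: "has_time_integral (\<lambda>\<tau>. heat \<beta> (t - \<tau>) (advect (u \<tau>) (\<theta> \<tau>))) C t"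
    and eq: "\<forall>\<phi>\<in>schwartz. (u t $ i) \<phi> = heat \<alpha> t (u0 $ i) \<phi> - A \<phi> + B \<phi>"
      "\<forall>\<phi>\<in>schwartz. \<theta> t \<phi> = heat \<beta> t \<theta>0 \<phi> - C \<phi>"
    unfolding duhamel_u_def duhamel_\<theta>_def by blast
  note D = duhamel_integrals[OF t(1) less_imp_le[OF t(2)] fin, of u \<theta>, OF refl refl]
  show "frep (EU i t) (u t $ i)"
    using duhamel_frep(1)[OF t(1) fin]
    by (rule frep_cong_schwartz)
       (simp add: eq has_time_integral_unique[OF A D(1)] has_time_integral_unique[OF B D(2)])
  show "frep (ET t) (\<theta> t)"
    using duhamel_frep(2)[OF t(1) fin]
    by (rule frep_cong_schwartz) (simp add: eq has_time_integral_unique[OF C D(3)])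
qed

end

sublocale mild_fields \<subseteq> fourier_solution a \<sigma> \<alpha> \<beta> s Ts U \<Theta> "\<lambda>t. X_norm_vec a \<sigma> s (u t)" "\<lambda>t. X_norm a \<sigma> s (\<theta> t)"
  "\<lambda>i. hat (u0 $ i)" "hat \<theta>0"
proof unfold_locales
  fix i t assume t: "0 \<le> t" "t < Ts"
  show "AE \<xi> in lborel. U i t \<xi> = of_real (exp (- t * norm \<xi> powr (2 * \<alpha>))) * hat (u0 $ i) \<xi> + duh \<alpha> (\<lambda>\<tau> \<xi>. fB i \<tau> \<xi> - fA i \<tau> \<xi>) t \<xi>"
    using represents_unique[OF U_frep[OF t] solution_frep(1)[OF t]] by (simp add: evo_def gU_def)
  show "AE \<xi> in lborel. \<Theta> t \<xi> = of_real (exp (- t * norm \<xi> powr (2 * \<beta>))) * hat \<theta>0 \<xi> + duh \<beta> (\<lambda>\<tau> \<xi>. - fC \<tau> \<xi>) t \<xi>"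
    using represents_unique[OF \<Theta>_frep[OF t] solution_frep(2)[OF t]] by (simp add: evo_def gT_def)
qed

context mild_fields
begin

text \<open>The final value is the distribution whose transform is the Duhamel formula at \<open>Ts\<close>. It is a limit
  of the solution in norm, hence real and divergence free, and it satisfies the mild equation by its
  very definition.\<close>

lemma extension:
  assumes hf: "(\<integral>\<^sup>+\<tau>\<in>{0..<Ts}. high \<tau> \<partial>lborel) < \<infinity>" and pf: "(\<integral>\<^sup>+\<tau>\<in>{0..<Ts}. parts \<tau> \<partial>lborel) < \<infinity>"
  obtains v \<eta> where "mild_solution a \<sigma> \<alpha> \<beta> s u0 \<theta>0 {0..Ts} v \<eta>"
    "\<And>t. 0 \<le> t \<Longrightarrow> t < Ts \<Longrightarrow> v t = u t" "\<And>t. 0 \<le> t \<Longrightarrow> t < Ts \<Longrightarrow> \<eta> t = \<theta> t"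
proof -
  have fin: "(\<integral>\<^sup>+\<tau>\<in>{0..Ts}. parts \<tau> \<partial>lborel) < \<infinity>"
  proof -
    have "AE \<tau> in lborel. \<tau> \<noteq> Ts" by (rule AE_lborel_singleton)
    then have "AE \<tau> in lborel. parts \<tau> * indicator {0..Ts} \<tau> = parts \<tau> * indicator {0..<Ts} \<tau>"
      by eventually_elim (auto simp: indicator_def)
    from nn_integral_cong_AE[OF this] show ?thesis using pf by simp
  qed
  have Ts0: "0 \<le> Ts" using Ts_pos by simp
  define v :: "real \<Rightarrow> distr^3" where "v t = (if t = Ts then \<chi> i. dist_of (EU i Ts) else u t)" for t
  define \<eta> where "\<eta> t = (if t = Ts then dist_of (ET Ts) else \<theta> t)" for t
  have vu: "v t = u t" "\<eta> t = \<theta> t" if "0 \<le> t" "t < Ts" for t using that by (auto simp: v_def \<eta>_def)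
  have gfU: "(\<integral>\<^sup>+\<tau>\<in>{0..Ts}. wabs a \<sigma> s (gU i \<tau>) \<partial>lborel) < \<infinity>" for i
    unfolding gU_def by (rule time_integral_finite[OF fin forcing_le_parts(4)])
  have gfT: "(\<integral>\<^sup>+\<tau>\<in>{0..Ts}. wabs a \<sigma> s (gT \<tau>) \<partial>lborel) < \<infinity>"
    unfolding gT_def by (rule time_integral_finite[OF fin forcing_le_parts(5)])
  have EUf: "wabs a \<sigma> s (EU i Ts) < \<infinity>" for i
    by (rule wnorm_evo_finite(1)[OF g_jmeas(1) data_meas(1) data_finite(1) gfU Ts0 order_refl])
  have ETf: "wabs a \<sigma> s (ET Ts) < \<infinity>"
    by (rule wnorm_evo_finite(1)[OF g_jmeas(2) data_meas(2) data_finite(2) gfT Ts0 order_refl])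
  note wU = weighted_distribution[OF par E_meas(1) EUf] and wT = weighted_distribution[OF par E_meas(2) ETf]
  have vrep: "frep (EU i t) (v t $ i)" and \<eta>rep: "frep (ET t) (\<eta> t)" if "t \<in> {0..Ts}" for t i
  proof -
    show "frep (EU i t) (v t $ i)" using wU(2)[of i] solution_frep(1)[of t i] that by (cases "t = Ts") (auto simp: v_def)
    show "frep (ET t) (\<eta> t)" using wT(2) solution_frep(2)[of t] that by (cases "t = Ts") (auto simp: \<eta>_def)
  qed
  have TT: "Ts \<in> {0..Ts}" using Ts0 by simp
  have "wvec a \<sigma> s (\<lambda>i. EU i Ts) < \<infinity>" by (intro wnorm_vnorm_finite EUf E_meas)
  then have vmem: "v Ts \<in> X_space_vec a \<sigma> s"
    unfolding X_space_vec_iff[of "\<lambda>i. EU i Ts", OF vrep[OF TT]]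
    using wU(1) by (simp add: v_def)
  have \<eta>mem: "\<eta> Ts \<in> X_space a \<sigma> s"
    unfolding X_space_iff[OF \<eta>rep[OF TT]] using wT(1) ETf by (simp add: \<eta>_def)
  have atle: "\<forall>\<^sub>F r in at Ts within {0..Ts}. r \<in> {0..Ts}" by (simp add: eventually_at_filter)
  have \<eta>lim: "((\<lambda>r. X_norm a \<sigma> s (\<eta> r - \<eta> Ts)) \<longlongrightarrow> 0) (at Ts within {0..Ts})"
  proof -
    have "((\<lambda>r. enn2real (wabs a \<sigma> s (\<lambda>\<xi>. ET r \<xi> - ET Ts \<xi>))) \<longlongrightarrow> 0) (at Ts within {0..Ts})"
      using tendsto_enn2real[OF evo_left_continuous[OF g_jmeas(2) data_meas(2) data_finite(2) gfT Ts0, of \<beta>, folded ennreal_0]] by simp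
    then show ?thesis
    proof (rule tendsto_cong[THEN iffD1, rotated])
      show "\<forall>\<^sub>F r in at Ts within {0..Ts}. enn2real (wabs a \<sigma> s (\<lambda>\<xi>. ET r \<xi> - ET Ts \<xi>)) = X_norm a \<sigma> s (\<eta> r - \<eta> Ts)"
        using atle by eventually_elim (simp add: X_norm_eq[OF frep_diff[OF \<eta>rep \<eta>rep[OF TT]]])
    qed
  qed
  have vlim: "((\<lambda>r. X_norm_vec a \<sigma> s (v r - v Ts)) \<longlongrightarrow> 0) (at Ts within {0..Ts})"
  proof -
    have s0: "((\<lambda>r. \<Sum>i\<in>UNIV. wabs a \<sigma> s (\<lambda>\<xi>. EU i r \<xi> - EU i Ts \<xi>)) \<longlongrightarrow> (\<Sum>i\<in>(UNIV::3 set). 0)) (at Ts within {0..Ts})"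
      by (intro tendsto_sum evo_left_continuous[OF g_jmeas(1) data_meas(1) data_finite(1) gfU Ts0])
    have "((\<lambda>r. wvec a \<sigma> s (\<lambda>i \<xi>. EU i r \<xi> - EU i Ts \<xi>)) \<longlongrightarrow> 0) (at Ts within {0..Ts})"
    proof (rule tendsto_sandwich[OF _ _ tendsto_const s0[unfolded sum.neutral_const]])
      show "\<forall>\<^sub>F r in at Ts within {0..Ts}. 0 \<le> wvec a \<sigma> s (\<lambda>i \<xi>. EU i r \<xi> - EU i Ts \<xi>)" by simp
      show "\<forall>\<^sub>F r in at Ts within {0..Ts}. wvec a \<sigma> s (\<lambda>i \<xi>. EU i r \<xi> - EU i Ts \<xi>) \<le>
          (\<Sum>i\<in>UNIV. wabs a \<sigma> s (\<lambda>\<xi>. EU i r \<xi> - EU i Ts \<xi>))"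
        by (intro always_eventually allI wvec_le_sum) measurable
    qed
    from tendsto_enn2real[OF this[folded ennreal_0]]
    have "((\<lambda>r. enn2real (wvec a \<sigma> s (\<lambda>i \<xi>. EU i r \<xi> - EU i Ts \<xi>))) \<longlongrightarrow> 0) (at Ts within {0..Ts})" by simp
    then show ?thesis
    proof (rule tendsto_cong[THEN iffD1, rotated])
      show "\<forall>\<^sub>F r in at Ts within {0..Ts}. enn2real (wvec a \<sigma> s (\<lambda>i \<xi>. EU i r \<xi> - EU i Ts \<xi>)) = X_norm_vec a \<sigma> s (v r - v Ts)"
        using atle
      proof eventually_elim
        case (elim r)
        have "frep (\<lambda>\<xi>. EU i r \<xi> - EU i Ts \<xi>) ((v r - v Ts) $ i)" for i
          using frep_diff[OF vrep[OF elim] vrep[OF TT]] by simp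
        from X_norm_vec_eq[of "\<lambda>i \<xi>. EU i r \<xi> - EU i Ts \<xi>", OF this] show ?case by simp
      qed
    qed
  qed
  have M: "C_into (X_space_vec a \<sigma> s) (X_norm_vec a \<sigma> s) {0..T} u"
    "L1_into (X_space_vec a \<sigma> (s + 2 * \<alpha>)) (X_norm_vec a \<sigma> (s + 2 * \<alpha>)) {0..T} u"
    "C_into (X_space a \<sigma> s) (X_norm a \<sigma> s) {0..T} \<theta>"
    "L1_into (X_space a \<sigma> (s + 2 * \<beta>)) (X_norm a \<sigma> (s + 2 * \<beta>)) {0..T} \<theta>" if "0 \<le> T" "T < Ts" for T
    using mild that by (auto simp: mild_solution_def)
  have hfin: "(\<integral>\<^sup>+\<tau>\<in>{0..<Ts}. h \<tau> \<partial>lborel) < \<infinity>" if "\<And>\<tau>. h \<tau> \<le> high \<tau>" for h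
  proof -
    have "(\<integral>\<^sup>+\<tau>\<in>{0..<Ts}. h \<tau> \<partial>lborel) \<le> (\<integral>\<^sup>+\<tau>\<in>{0..<Ts}. high \<tau> \<partial>lborel)"
      by (intro nn_integral_mono mult_right_mono that) simp
    then show ?thesis using hf by (rule le_less_trans)
  qed
  have e2: "ennreal (enn2real x) \<le> x" for x by (cases x) auto
  have Cv: "C_into (X_space_vec a \<sigma> s) (X_norm_vec a \<sigma> s) {0..T} v"
    and C\<eta>: "C_into (X_space a \<sigma> s) (X_norm a \<sigma> s) {0..T} \<eta>" if "T \<in> {0..Ts}" for T
    by (rule C_into_close[where w = u, OF M(1) vu(1) vmem vlim that]; assumption)
       (rule C_into_close[where w = \<theta>, OF M(3) vu(2) \<eta>mem \<eta>lim that]; assumption)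
  have Lv: "L1_into (X_space_vec a \<sigma> (s + 2 * \<alpha>)) (X_norm_vec a \<sigma> (s + 2 * \<alpha>)) {0..T} v" if T: "T \<in> {0..Ts}" for T
  proof (rule L1_into_close[where w = u and h = "\<lambda>t. wvec a \<sigma> (s + 2 * \<alpha>) (\<lambda>k. U k t)", OF M(2) Ts_pos vu(1) X_norm_vec_nonneg _ _ T])
    show "ennreal (X_norm_vec a \<sigma> (s + 2 * \<alpha>) (u t)) \<le> wvec a \<sigma> (s + 2 * \<alpha>) (\<lambda>k. U k t)" if "0 \<le> t" "t < Ts" for t
      using X_norm_vec_eq[OF U_frep[OF that], of a \<sigma> "s + 2 * \<alpha>"] e2 by simp
    show "(\<integral>\<^sup>+t\<in>{0..<Ts}. wvec a \<sigma> (s + 2 * \<alpha>) (\<lambda>k. U k t) \<partial>lborel) < \<infinity>"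
      by (rule hfin) (simp add: high_def add_increasing2)
  qed assumption+
  have L\<eta>: "L1_into (X_space a \<sigma> (s + 2 * \<beta>)) (X_norm a \<sigma> (s + 2 * \<beta>)) {0..T} \<eta>" if T: "T \<in> {0..Ts}" for T
  proof (rule L1_into_close[where w = \<theta> and h = "\<lambda>t. wabs a \<sigma> (s + 2 * \<beta>) (\<Theta> t)", OF M(4) Ts_pos vu(2) X_norm_nonneg _ _ T])
    show "ennreal (X_norm a \<sigma> (s + 2 * \<beta>) (\<theta> t)) \<le> wabs a \<sigma> (s + 2 * \<beta>) (\<Theta> t)" if "0 \<le> t" "t < Ts" for t
      using X_norm_eq[OF \<Theta>_frep[OF that], of a \<sigma> "s + 2 * \<beta>"] e2 by simp
    show "(\<integral>\<^sup>+t\<in>{0..<Ts}. wabs a \<sigma> (s + 2 * \<beta>) (\<Theta> t) \<partial>lborel) < \<infinity>"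
      by (rule hfin) (simp add: high_def add_increasing)
  qed assumption+
  note cv = C_into_pairing_continuous[OF par C_into_component[OF Cv[OF TT]]]
  note c\<eta> = C_into_pairing_continuous[OF par C\<eta>[OF TT]]
  have old: "\<forall>i. real_distr (u t $ i)" "real_distr (\<theta> t)" "divergence (u t) = (\<lambda>_. 0)" if "0 \<le> t" "t < Ts" for t
    using mild that by (auto simp: mild_solution_def)
  have re: "real_distr (v Ts $ i)" for i unfolding real_distr_def
  proof
    fix \<phi> :: test_fun assume \<phi>: "\<phi> \<in> schwartz"
    show "(v Ts $ i) (\<lambda>x. cnj (\<phi> x)) = cnj ((v Ts $ i) \<phi>)"
      by (rule continuous_eq_at_endpoint[of Ts "\<lambda>t. (v t $ i) (\<lambda>x. cnj (\<phi> x))" "\<lambda>t. cnj ((v t $ i) \<phi>)"])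
         (use old(1) \<phi> vu Ts_pos in \<open>auto simp: real_distr_def intro!: continuous_intros cv\<close>)
  qed
  have re\<eta>: "real_distr (\<eta> Ts)" unfolding real_distr_def
  proof
    fix \<phi> :: test_fun assume \<phi>: "\<phi> \<in> schwartz"
    show "\<eta> Ts (\<lambda>x. cnj (\<phi> x)) = cnj (\<eta> Ts \<phi>)"
      by (rule continuous_eq_at_endpoint[of Ts "\<lambda>t. \<eta> t (\<lambda>x. cnj (\<phi> x))" "\<lambda>t. cnj (\<eta> t \<phi>)"])
         (use old(2) \<phi> vu Ts_pos in \<open>auto simp: real_distr_def intro!: continuous_intros c\<eta>\<close>)
  qed
  have div: "divergence (v Ts) = (\<lambda>_. 0)"
  proof (rule ext)
    fix \<phi>
    have c: "continuous_on {0..Ts} (\<lambda>t. divergence (v t) \<phi>)"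
      unfolding divergence_def distr_pd_def
      by (cases "\<phi> \<in> schwartz") (auto intro!: continuous_intros cv)
    show "divergence (v Ts) \<phi> = 0"
      by (rule continuous_eq_at_endpoint[OF c continuous_on_const]) (use old(3) vu Ts_pos in auto)
  qed
  have du: "duhamel_u \<alpha> u0 v \<eta> t" "duhamel_\<theta> \<beta> \<theta>0 v \<eta> t" if t: "t \<in> {0..Ts}" for t
  proof -
    have t': "0 \<le> t" "t \<le> Ts" using t by auto
    have fint: "(\<integral>\<^sup>+\<tau>\<in>{0..t}. parts \<tau> \<partial>lborel) < \<infinity>"
    proof -
      have "(\<integral>\<^sup>+\<tau>\<in>{0..t}. parts \<tau> \<partial>lborel) \<le> (\<integral>\<^sup>+\<tau>\<in>{0..Ts}. parts \<tau> \<partial>lborel)"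
        using t' by (intro nn_integral_mono) (auto simp: indicator_def)
      then show ?thesis using fin by (rule le_less_trans)
    qed
    note I = duhamel_integrals[where v = v and \<eta> = \<eta>, OF t' fint vu]
    note F = duhamel_frep[OF t'(1) fint]
    have "(v t $ i) \<phi> = heat \<alpha> t (u0 $ i) \<phi> - dist_of (duh \<alpha> (fA i) t) \<phi> + dist_of (duh \<alpha> (fB i) t) \<phi>" if \<phi>: "\<phi> \<in> schwartz" for i \<phi>
      using trans[OF frep_eval[OF vrep[OF t] \<phi>] sym[OF frep_eval[OF F(1) \<phi>, of i]]] by (simp add: diff_diff_eq2 diff_add_eq)
    then show "duhamel_u \<alpha> u0 v \<eta> t" unfolding duhamel_u_def using I(1,2) by blast
    have "\<eta> t \<phi> = heat \<beta> t \<theta>0 \<phi> - dist_of (duh \<beta> fC t) \<phi>" if \<phi>: "\<phi> \<in> schwartz" for \<phi>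
      using frep_eval[OF \<eta>rep[OF t] \<phi>] frep_eval[OF F(2) \<phi>] by simp
    then show "duhamel_\<theta> \<beta> \<theta>0 v \<eta> t" unfolding duhamel_\<theta>_def using I(3) by blast
  qed
  have alg: "(\<forall>i. real_distr (v t $ i)) \<and> real_distr (\<eta> t) \<and> divergence (v t) = (\<lambda>_. 0)" if t: "t \<in> {0..Ts}" for t
  proof (cases "t = Ts")
    case True
    then show ?thesis using re re\<eta> div by simp
  next
    case False
    then have "0 \<le> t" "t < Ts" using t by auto
    then show ?thesis using old[of t] vu[of t] by simp
  qed
  have "mild_solution a \<sigma> \<alpha> \<beta> s u0 \<theta>0 {0..Ts} v \<eta>"
    unfolding mild_solution_def using Cv C\<eta> Lv L\<eta> alg du by simp
  then show thesis using that vu by blast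
qed

text \<open>Otherwise \<open>extension\<close> would continue the solution to the closed interval.\<close>

lemma Phi_integral_infinite:
  assumes maximal: "\<nexists>J v \<eta>. is_interval J \<and> J \<subseteq> {0..} \<and> {0..<Ts} \<subset> J \<and>
      mild_solution a \<sigma> \<alpha> \<beta> s u0 \<theta>0 J v \<eta> \<and> (\<forall>t\<in>{0..<Ts}. v t = u t \<and> \<eta> t = \<theta> t)"
    and t0: "0 \<le> t0" "t0 < Ts"
  shows "(\<integral>\<^sup>+\<tau>\<in>{t0..<Ts}. ennreal (Phi (X_norm_vec a \<sigma> s (u \<tau>)) (X_norm a \<sigma> s (\<theta> \<tau>))) \<partial>lborel) = \<infinity>"
proof (rule ccontr)
  assume "\<not> ?thesis"
  then have "(\<integral>\<^sup>+\<tau>\<in>{t0..<Ts}. ennreal (Phi (X_norm_vec a \<sigma> s (u \<tau>)) (X_norm a \<sigma> s (\<theta> \<tau>))) \<partial>lborel) < \<infinity>"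
    by (simp add: less_top)
  from extension[OF bounds_if_Phi_integrable[OF t0 this]] obtain v \<eta> where
    m: "mild_solution a \<sigma> \<alpha> \<beta> s u0 \<theta>0 {0..Ts} v \<eta>" and
    e: "\<And>t. 0 \<le> t \<Longrightarrow> t < Ts \<Longrightarrow> v t = u t" "\<And>t. 0 \<le> t \<Longrightarrow> t < Ts \<Longrightarrow> \<eta> t = \<theta> t" by blast
  have "{0..<Ts} \<subset> {0..Ts}" using Ts_pos by auto
  moreover have "is_interval {0..Ts}" "{0..Ts} \<subseteq> {0..}" by (auto simp: is_interval_cc)
  ultimately show False using maximal m e by (metis atLeastLessThan_iff)
qed

text \<open>A bound for \<open>N\<close> bounds \<open>\<Phi>\<close>, which would then be integrable over a bounded interval.\<close>

lemma N_unbounded: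
  assumes inf: "(\<integral>\<^sup>+\<tau>\<in>{t0..<Ts}. ennreal (Phi (X_norm_vec a \<sigma> s (u \<tau>)) (X_norm a \<sigma> s (\<theta> \<tau>))) \<partial>lborel) = \<infinity>"
    and t0: "0 \<le> t0" "t0 < Ts"
  shows "\<exists>t\<in>{t0..<Ts}. N t > M"
proof (rule ccontr)
  assume "\<not> ?thesis"
  then have le: "N t \<le> max M 0" if "t \<in> {t0..<Ts}" for t using that by (auto simp: not_less intro: max.coboundedI1)
  have Phi: "Phi (X_norm_vec a \<sigma> s (u t)) (X_norm a \<sigma> s (\<theta> t)) \<le> pow3 e1 e2 e3 (max M 0)" if "t \<in> {t0..<Ts}" for t
  proof -
    have "Phi (X_norm_vec a \<sigma> s (u t)) (X_norm a \<sigma> s (\<theta> t)) \<le> pow3 e1 e2 e3 (N t)"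
      unfolding N_def by (rule Phi_le_pow3[OF X_norm_vec_nonneg X_norm_nonneg])
    also have "\<dots> \<le> pow3 e1 e2 e3 (max M 0)"
      using e_pos by (intro pow3_mono le[OF that] N_nonneg) auto
    finally show ?thesis .
  qed
  have "(\<integral>\<^sup>+\<tau>\<in>{t0..<Ts}. ennreal (Phi (X_norm_vec a \<sigma> s (u \<tau>)) (X_norm a \<sigma> s (\<theta> \<tau>))) \<partial>lborel)
      \<le> (\<integral>\<^sup>+\<tau>\<in>{t0..<Ts}. ennreal (pow3 e1 e2 e3 (max M 0)) \<partial>lborel)"
    using Phi by (intro nn_integral_mono) (auto simp: indicator_def intro!: ennreal_leI)
  also have "\<dots> = ennreal (pow3 e1 e2 e3 (max M 0)) * emeasure lborel {t0..<Ts}"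
    by (rule nn_integral_cmult_indicator) simp
  also have "\<dots> < \<infinity>" using t0 by (simp add: ennreal_mult_less_top)
  finally show False using inf by simp
qed

lemma Limsup_N:
  assumes unbounded: "\<And>M t0. 0 \<le> t0 \<Longrightarrow> t0 < Ts \<Longrightarrow> \<exists>t\<in>{t0..<Ts}. N t > M"
  shows "Limsup (at_left Ts) (\<lambda>r. ereal (N r)) = \<infinity>"
proof (rule ccontr)
  assume "\<not> ?thesis"
  then obtain M where "Limsup (at_left Ts) (\<lambda>r. ereal (N r)) < ereal M"
    unfolding less_PInf_Ex_of_nat by blast
  from Limsup_lessD[OF this] have "\<forall>\<^sub>F r in at_left Ts. N r < M" by simp
  then obtain b where b: "b < Ts" "\<And>y. b < y \<Longrightarrow> y < Ts \<Longrightarrow> N y < M" by (auto simp: eventually_at_left_field)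
  define t0 where "t0 = max 0 ((b + Ts) / 2)"
  have t0: "0 \<le> t0" "t0 < Ts" "b < t0" using b(1) Ts_pos by (auto simp: t0_def less_max_iff_disj)
  from unbounded[OF t0(1,2), of M] obtain t where "t \<in> {t0..<Ts}" "N t > M" by blast
  then show False using b(2)[of t] t0 by auto
qed

end

section \<open>Blow-up at the maximal time\<close>

theorem theorem1p5:
  fixes a \<sigma> \<alpha> \<beta> s :: real
    and u0 :: "distr^3" and \<theta>0 :: distr
    and u :: "real \<Rightarrow> distr^3" and \<theta> :: "real \<Rightarrow> distr"
    and Tstar :: ereal
  assumes "a \<ge> 0" and "\<sigma> \<ge> 1" and "\<alpha> > 1/2" and "\<beta> > 1/2"
    and "s \<in> {-1..0}"
    and "s > Max {1 - 2 * \<alpha>, \<alpha> * (1 - 2 * \<beta>) / \<beta>, \<beta> * (1 - 2 * \<alpha>) / \<alpha>}"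
    and "u0 \<in> X_space_vec a \<sigma> s" and "\<theta>0 \<in> X_space a \<sigma> s"
    and "\<forall>i. real_distr (u0 $ i)" and "real_distr \<theta>0"
    and "divergence u0 = (\<lambda>_. 0)"
    and "maximal_mild_solution a \<sigma> \<alpha> \<beta> s u0 \<theta>0 Tstar u \<theta>"
    and "Tstar < \<infinity>"
  shows "\<exists>C>0. \<forall>t. 0 \<le> t \<and> ereal t < Tstar \<longrightarrow>
    Limsup (at_left (real_of_ereal Tstar)) (\<lambda>r. ereal (pair_norm a \<sigma> s (u r) (\<theta> r))) = \<infinity>
    \<and>
    (\<integral>\<^sup>+\<tau>\<in>{t..<real_of_ereal Tstar}. ennreal (
        rpow (X_norm_vec a \<sigma> s (u \<tau>)) (2 * \<alpha> / (2 * \<alpha> + s - 1))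
      + rpow (X_norm_vec a \<sigma> s (u \<tau>)) (\<beta> * (s + 2 * \<alpha>) / (\<beta> * (s + 2 * \<alpha>) - \<alpha>))
        * rpow (X_norm a \<sigma> s (\<theta> \<tau>)) (- s * \<beta> / (\<beta> * (s + 2 * \<alpha>) - \<alpha>))
      + rpow (X_norm_vec a \<sigma> s (u \<tau>)) (- s * \<alpha> / (\<alpha> * (s + 2 * \<beta>) - \<beta>))
        * rpow (X_norm a \<sigma> s (\<theta> \<tau>)) (\<alpha> * (s + 2 * \<beta>) / (\<alpha> * (s + 2 * \<beta>) - \<beta>))) \<partial>lborel) = \<infinity>
    \<and>
    rpow (pair_norm a \<sigma> s (u t) (\<theta> t)) (2 * \<alpha> / (2 * \<alpha> + s - 1))
      + rpow (pair_norm a \<sigma> s (u t) (\<theta> t)) (2 * \<alpha> * \<beta> / (2 * \<alpha> * \<beta> + s * \<beta> - \<alpha>))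
      + rpow (pair_norm a \<sigma> s (u t) (\<theta> t)) (2 * \<alpha> * \<beta> / (2 * \<alpha> * \<beta> + s * \<alpha> - \<beta>))
    \<ge> inverse (exp (C * (real_of_ereal Tstar - t)) - 1)"
proof -
  have "s > 1 - 2 * \<alpha>" "s > \<alpha> * (1 - 2 * \<beta>) / \<beta>" "s > \<beta> * (1 - 2 * \<alpha>) / \<alpha>"
    using assms(6) by auto
  then have D: "2 * \<alpha> + s - 1 > 0" "\<beta> * (s + 2 * \<alpha>) - \<alpha> > 0" "\<alpha> * (s + 2 * \<beta>) - \<beta> > 0"
    using assms(3,4) by (simp_all add: field_simps)
  have exps: "boussinesq_exponents a \<sigma> \<alpha> \<beta> s"
    using assms(1-5) D by unfold_locales auto
  have "0 < Tstar" using assms(12) by (simp add: maximal_mild_solution_def)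
  then obtain Ts where Ts: "Tstar = ereal Ts" "Ts > 0" using assms(13) by (cases Tstar) auto
  have I: "{t. 0 \<le> t \<and> ereal t < Tstar} = {0..<Ts}" by (auto simp: Ts)
  have mild: "mild_solution a \<sigma> \<alpha> \<beta> s u0 \<theta>0 {0..<Ts} u \<theta>"
    and max: "\<nexists>J v \<eta>. is_interval J \<and> J \<subseteq> {0..} \<and> {0..<Ts} \<subset> J \<and>
      mild_solution a \<sigma> \<alpha> \<beta> s u0 \<theta>0 J v \<eta> \<and> (\<forall>t\<in>{0..<Ts}. v t = u t \<and> \<eta> t = \<theta> t)"
    using assms(12) unfolding maximal_mild_solution_def I Let_def by blast+
  obtain U \<Theta> where UT: "fourier_curve a \<sigma> \<alpha> \<beta> s Ts U \<Theta> (\<lambda>t. X_norm_vec a \<sigma> s (u t)) (\<lambda>t. X_norm a \<sigma> s (\<theta> t))"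
    "\<And>i t. 0 \<le> t \<Longrightarrow> t < Ts \<Longrightarrow> frep (U i t) (u t $ i)" "\<And>t. 0 \<le> t \<Longrightarrow> t < Ts \<Longrightarrow> frep (\<Theta> t) (\<theta> t)"
    using mild_fourier_curve[OF exps Ts(2) mild] by blast
  interpret mild_fields a \<sigma> \<alpha> \<beta> s Ts U \<Theta> u \<theta> u0 \<theta>0
    using UT mild assms(7,8) by (intro mild_fields.intro mild_fields_axioms.intro)
  have ii: "(\<integral>\<^sup>+\<tau>\<in>{t..<Ts}. ennreal (Phi (X_norm_vec a \<sigma> s (u \<tau>)) (X_norm a \<sigma> s (\<theta> \<tau>))) \<partial>lborel) = \<infinity>"
    if "0 \<le> t" "t < Ts" for t by (rule Phi_integral_infinite[OF max that])
  note unb = N_unbounded[OF ii]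
  have N: "pair_norm a \<sigma> s (u t) (\<theta> t) = N t" for t by (simp add: pair_norm_def N_def)
  obtain C where C: "C > 0" "\<And>t. 0 \<le> t \<Longrightarrow> t < Ts \<Longrightarrow>
      inverse (exp (C * (Ts - t)) - 1) \<le> rpow (N t) e1 + rpow (N t) e2 + rpow (N t) e3"
    using blowup_rate[OF unb] by blast
  have lim: "Limsup (at_left Ts) (\<lambda>r. ereal (N r)) = \<infinity>" by (rule Limsup_N[OF unb])
  show ?thesis
  proof (intro exI[of _ C] conjI allI impI C(1), goal_cases)
    case (1 t) show ?case using lim by (simp add: N Ts)
  next
    case (2 t) then show ?case using ii[of t] by (simp add: Ts Phi_def)
  next
    case (3 t) then show ?case using C(2)[of t] by (simp add: N Ts e1_def e2_def e3_def)
  qed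
qed

end
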